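(* Let $d\ge1$ and let $\mathcal{M}$ be a $d$-cluster tilting subcategory of an exact category $\mathcal{E}$ (not assumed weakly idempotent complete). Then $\mathcal{M}$ has the structure of a $d$-exact category, where a complex $$0\to M_{d+1}\to\cdots\to M_0\to0$$ in $\mathcal{M}$ is an admissible $d$-exact sequence if and only if it is homotopy equivalent to an acyclic complex in $\mathcal{E}$.
   Context: Conventions: all categories are additive; subcategories are full, closed under isomorphisms and finite direct sums. Exact categories are in the sense of Quillen. A complex $X_\bullet$ in an exact category is acyclic if there are conflations $0\to Z_i\to X_i\to Z_{i-1}\to0$ such that $X_i\to X_{i-1}$ is the composite $X_i\to Z_{i-1}\to X_{i-1}$. Homotopy equivalence is chain homotopy equivalence of complexes over $\mathcal{E}$. $\operatorname{Ext}$ denotes Yoneda Ext. $d$-cluster tilting: a subcategory $\mathcal{M}$ of an exact category $\mathcal{E}$ is $d$-cluster tilting if it is generating (every $E\in\mathcal{E}$ admits a deflation $M\to E$ with $M\in\mathcal{M}$), cogenerating (every $E$ admits an inflation $E\to M$ with $M\in\mathcal{M}$), functorially finite, and $\mathcal{M}=\{E\in\mathcal{E}\mid\operatorname{Ext}^i_{\mathcal{E}}(E,\mathcal{M})=0,\ 0<i<d\}=\{E\in\mathcal{E}\mid\operatorname{Ext}^i_{\mathcal{E}}(\mathcal{M},E)=0,\ 0<i<d\}$. $d$-exact categories: let $\mathcal{M}$ be an additive category. A complex $X_{d+1}\to\cdots\to X_0$ is left $d$-exact if $0\to\operatorname{Hom}(X,X_{d+1})\to\cdots\to\operatorname{Hom}(X,X_0)$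 is exact for all $X\in\mathcal{M}$, right $d$-exact if $0\to\operatorname{Hom}(X_0,X)\to\cdots\to\operatorname{Hom}(X_{d+1},X)$ is exact for all $X$, and $d$-exact if both. A morphism of complexes $h_\bullet$ between $d$-exact sequences is a weak isomorphism if for some $0\le i\le d+1$ both $h_i$ and $h_{i+1}$ are isomorphisms (with $h_{d+2}:=h_0$). A $d$-pushout of a complex $Y_d\to\cdots\to Y_0$ along $f\colon Y_d\to Z_d$ is a morphism of complexes $f_\bullet\colon Y_\bullet\to Z_\bullet=(Z_d\to\cdots\to Z_0)$ with $f_d=f$ whose mapping cone $Y_d\to Y_{d-1}\oplus Z_d\to\cdots\to Y_0\oplus Z_1\to Z_0$ is right $d$-exact; dually, a $d$-pullback of $Y_\bullet$ along $g\colon X_0\to Y_0$ is a morphism of complexes $g_\bullet\colon X_\bullet\to Y_\bullet$ with $g_0=g$ whose mapping cone is left $d$-exact. A $d$-exact structure on $\mathcal{M}$ is a class of $d$-exact sequences (called admissible; first morphisms $X_{d+1}\to X_d$ are admissible monomorphisms, last morphisms $X_1\to X_0$ are admissible epimorphisms), closed under weak isomorphisms, such that: (E0) $0\to\cdots\to0$ with $d+2$ terms is admissible; (E1), (E1)$^{\rm op}$ admissible monomorphisms, resp. admissible epimorphisms, are closed under composition; (E2) for admissible $Y_{d+1}\to\cdots\to Y_0$ and $Y_{d+1}\to Z_{d+1}$ there is a $d$-pushout $Z_{d+1}\to\cdots\to Z_1$ of $Y_{d+1}\to\cdots\to Y_1$ along it with $Z_{d+1}\to Z_d$ an admissible monomorphism;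 (E2)$^{\rm op}$ for admissible $Y_{d+1}\to\cdots\to Y_0$ and $X_0\to Y_0$ there is a $d$-pullback $X_d\to\cdots\to X_0$ of $Y_d\to\cdots\to Y_0$ along it with $X_1\to X_0$ an admissible epimorphism. A $d$-exact category is an additive category with a $d$-exact structure. *)

theory Defs
  imports "HOL-Algebra.Coset"
begin

section \<open>Additive categories\<close>

text \<open>Every arrow determines its domain and codomain, so hom-sets are disjoint. \<open>Zero A B\<close> is
  the zero morphism from \<open>A\<close> to \<open>B\<close>. The values of the operations outside the carriers \<open>Ob\<close>,
  \<open>Ar\<close> (or on non-composable, non-parallel arrows) are irrelevant.\<close>

record ('o, 'm) precat =
  Ob :: "'o set"
  Ar :: "'m set"
  Dom :: "'m \<Rightarrow> 'o"
  Cod :: "'m \<Rightarrow> 'o"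
  Id :: "'o \<Rightarrow> 'm"
  Comp :: "'m \<Rightarrow> 'm \<Rightarrow> 'm" (infixl "\<cdot>\<index>" 70)
  Add :: "'m \<Rightarrow> 'm \<Rightarrow> 'm" (infixl "\<oplus>\<index>" 65)
  Zero :: "'o \<Rightarrow> 'o \<Rightarrow> 'm"

definition Hom :: "('o, 'm) precat \<Rightarrow> 'o \<Rightarrow> 'o \<Rightarrow> 'm set" where
  "Hom C A B = {f \<in> Ar C. Dom C f = A \<and> Cod C f = B}"

definition hom_group :: "('o, 'm) precat \<Rightarrow> 'o \<Rightarrow> 'o \<Rightarrow> 'm monoid" where
  "hom_group C A B = \<lparr>carrier = Hom C A B, monoid.mult = Add C, one = Zero C A B\<rparr>"

definition Neg :: "('o, 'm) precat \<Rightarrow> 'm \<Rightarrow> 'm" where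
  "Neg C f = inv\<^bsub>hom_group C (Dom C f) (Cod C f)\<^esub> f"

definition is_iso :: "('o, 'm) precat \<Rightarrow> 'm \<Rightarrow> bool" where
  "is_iso C f \<longleftrightarrow> f \<in> Ar C \<and>
    (\<exists>g \<in> Hom C (Cod C f) (Dom C f). g \<cdot>\<^bsub>C\<^esub> f = Id C (Dom C f) \<and> f \<cdot>\<^bsub>C\<^esub> g = Id C (Cod C f))"

definition isomorphic :: "('o, 'm) precat \<Rightarrow> 'o \<Rightarrow> 'o \<Rightarrow> bool" where
  "isomorphic C A B \<longleftrightarrow> (\<exists>f \<in> Hom C A B. is_iso C f)"

definition zero_object :: "('o, 'm) precat \<Rightarrow> 'o \<Rightarrow> bool" where
  "zero_object C Z \<longleftrightarrow> Z \<in> Ob C \<and> (\<forall>A \<in> Ob C. (\<exists>!f. f \<in> Hom C A Z) \<and> (\<exists>!f. f \<in> Hom C Z A))"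

definition biproduct ::
  "('o, 'm) precat \<Rightarrow> 'o \<Rightarrow> 'o \<Rightarrow> 'o \<Rightarrow> 'm \<Rightarrow> 'm \<Rightarrow> 'm \<Rightarrow> 'm \<Rightarrow> bool" where
  "biproduct C A B P i j p q \<longleftrightarrow> P \<in> Ob C \<and>
    i \<in> Hom C A P \<and> j \<in> Hom C B P \<and> p \<in> Hom C P A \<and> q \<in> Hom C P B \<and>
    p \<cdot>\<^bsub>C\<^esub> i = Id C A \<and> q \<cdot>\<^bsub>C\<^esub> j = Id C B \<and>
    p \<cdot>\<^bsub>C\<^esub> j = Zero C B A \<and> q \<cdot>\<^bsub>C\<^esub> i = Zero C A B \<and>
    (i \<cdot>\<^bsub>C\<^esub> p) \<oplus>\<^bsub>C\<^esub> (j \<cdot>\<^bsub>C\<^esub> q) = Id C P"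

locale category =
  fixes C :: "('o, 'm) precat" (structure)
  assumes Dom_Ob: "f \<in> Ar C \<Longrightarrow> Dom C f \<in> Ob C"
    and Cod_Ob: "f \<in> Ar C \<Longrightarrow> Cod C f \<in> Ob C"
    and Id_Hom: "A \<in> Ob C \<Longrightarrow> Id C A \<in> Hom C A A"
    and Comp_Hom: "\<lbrakk>f \<in> Hom C A B; g \<in> Hom C B D\<rbrakk> \<Longrightarrow> g \<cdot> f \<in> Hom C A D"
    and Comp_Id: "f \<in> Hom C A B \<Longrightarrow> f \<cdot> Id C A = f"
    and Id_Comp: "f \<in> Hom C A B \<Longrightarrow> Id C B \<cdot> f = f"
    and Comp_assoc: "\<lbrakk>f \<in> Hom C A B; g \<in> Hom C B D; h \<in> Hom C D E\<rbrakk> \<Longrightarrow> h \<cdot> (g \<cdot> f) = h \<cdot> g \<cdot> f"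

locale additive_category = category +
  assumes hom_comm_group: "\<lbrakk>A \<in> Ob C; B \<in> Ob C\<rbrakk> \<Longrightarrow> comm_group (hom_group C A B)"
    and Comp_Add: "\<lbrakk>f \<in> Hom C A B; f' \<in> Hom C A B; g \<in> Hom C B D\<rbrakk>
      \<Longrightarrow> g \<cdot> (f \<oplus> f') = (g \<cdot> f) \<oplus> (g \<cdot> f')"
    and Add_Comp: "\<lbrakk>f \<in> Hom C A B; g \<in> Hom C B D; g' \<in> Hom C B D\<rbrakk>
      \<Longrightarrow> (g \<oplus> g') \<cdot> f = (g \<cdot> f) \<oplus> (g' \<cdot> f)"
    and ex_zero_object: "\<exists>Z. zero_object C Z"
    and ex_biproduct: "\<lbrakk>A \<in> Ob C; B \<in> Ob C\<rbrakk> \<Longrightarrow> \<exists>P i j p q. biproduct C A B P i j p q"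

definition full_sub :: "('o, 'm) precat \<Rightarrow> 'o set \<Rightarrow> ('o, 'm) precat" where
  "full_sub C M = C\<lparr>Ob := M, Ar := {f \<in> Ar C. Dom C f \<in> M \<and> Cod C f \<in> M}\<rparr>"

definition additive_subcategory :: "('o, 'm) precat \<Rightarrow> 'o set \<Rightarrow> bool" where
  "additive_subcategory C M \<longleftrightarrow> M \<subseteq> Ob C \<and>
    (\<forall>A B. A \<in> M \<longrightarrow> isomorphic C A B \<longrightarrow> B \<in> M) \<and>
    (\<forall>Z. zero_object C Z \<longrightarrow> Z \<in> M) \<and>
    (\<forall>A B P i j p q. A \<in> M \<longrightarrow> B \<in> M \<longrightarrow> biproduct C A B P i j p q \<longrightarrow> P \<in> M)"


section \<open>Complexes\<close>

text \<open>All complexes are indexed by the integers, with \<open>Diff X n : Obj X n \<rightarrow> Obj X (n - 1)\<close>. A finite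
  complex with terms in degrees \<open>a, \<dots>, b\<close> is a complex whose other terms are zero objects.\<close>

record ('o, 'm) cpx =
  Obj :: "int \<Rightarrow> 'o"
  Diff :: "int \<Rightarrow> 'm"

definition is_complex :: "('o, 'm) precat \<Rightarrow> ('o, 'm) cpx \<Rightarrow> bool" where
  "is_complex C X \<longleftrightarrow> (\<forall>n. Obj X n \<in> Ob C) \<and>
    (\<forall>n. Diff X n \<in> Hom C (Obj X n) (Obj X (n - 1))) \<and>
    (\<forall>n. Diff X (n - 1) \<cdot>\<^bsub>C\<^esub> Diff X n = Zero C (Obj X n) (Obj X (n - 2)))"

definition finite_complex :: "('o, 'm) precat \<Rightarrow> int \<Rightarrow> int \<Rightarrow> ('o, 'm) cpx \<Rightarrow> bool" where
  "finite_complex C a b X \<longleftrightarrow> is_complex C X \<and> (\<forall>n. n < a \<or> b < n \<longrightarrow> zero_object C (Obj X n))"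

text \<open>\<open>segment C Y a n\<close> is the brutal truncation \<open>Y\<^bsub>a+n\<^esub> \<rightarrow> \<dots> \<rightarrow> Y\<^bsub>a\<^esub>\<close>, re-indexed (without sign
  change) to have its terms in degrees \<open>n, \<dots>, 0\<close>.\<close>

definition segment :: "('o, 'm) precat \<Rightarrow> ('o, 'm) cpx \<Rightarrow> int \<Rightarrow> int \<Rightarrow> ('o, 'm) cpx" where
  "segment C Y a n =
    (let Z = (SOME Z. zero_object C Z);
         T = (\<lambda>k. if 0 \<le> k \<and> k \<le> n then Obj Y (a + k) else Z)
     in \<lparr>Obj = T,
         Diff = (\<lambda>k. if 0 < k \<and> k \<le> n then Diff Y (a + k) else Zero C (T k) (T (k - 1)))\<rparr>)"

definition chain_map ::
  "('o, 'm) precat \<Rightarrow> ('o, 'm) cpx \<Rightarrow> ('o, 'm) cpx \<Rightarrow> (int \<Rightarrow> 'm) \<Rightarrow> bool" where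
  "chain_map C X Y h \<longleftrightarrow> (\<forall>n. h n \<in> Hom C (Obj X n) (Obj Y n)) \<and>
    (\<forall>n. Diff Y n \<cdot>\<^bsub>C\<^esub> h n = h (n - 1) \<cdot>\<^bsub>C\<^esub> Diff X n)"

definition chain_homotopic ::
  "('o, 'm) precat \<Rightarrow> ('o, 'm) cpx \<Rightarrow> ('o, 'm) cpx \<Rightarrow> (int \<Rightarrow> 'm) \<Rightarrow> (int \<Rightarrow> 'm) \<Rightarrow> bool" where
  "chain_homotopic C X Y f g \<longleftrightarrow> (\<exists>s.
    (\<forall>n. s n \<in> Hom C (Obj X n) (Obj Y (n + 1))) \<and>
    (\<forall>n. f n = g n \<oplus>\<^bsub>C\<^esub> (Diff Y (n + 1) \<cdot>\<^bsub>C\<^esub> s n \<oplus>\<^bsub>C\<^esub> s (n - 1) \<cdot>\<^bsub>C\<^esub> Diff X n)))"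

definition homotopy_equivalent ::
  "('o, 'm) precat \<Rightarrow> ('o, 'm) cpx \<Rightarrow> ('o, 'm) cpx \<Rightarrow> bool" where
  "homotopy_equivalent C X Y \<longleftrightarrow> is_complex C X \<and> is_complex C Y \<and> (\<exists>f g.
    chain_map C X Y f \<and> chain_map C Y X g \<and>
    chain_homotopic C X X (\<lambda>n. g n \<cdot>\<^bsub>C\<^esub> f n) (\<lambda>n. Id C (Obj X n)) \<and>
    chain_homotopic C Y Y (\<lambda>n. f n \<cdot>\<^bsub>C\<^esub> g n) (\<lambda>n. Id C (Obj Y n)))"

text \<open>\<open>K\<close> is a mapping cone of \<open>h : X \<rightarrow> Y\<close>: its terms are biproducts \<open>K\<^sub>n = X\<^bsub>n-1\<^esub> \<oplus> Y\<^sub>n\<close> and its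
  differential has the matrix with rows \<open>(- Diff X (n - 1), 0)\<close> and \<open>(h (n - 1), Diff Y n)\<close>.\<close>

definition mapping_cone ::
  "('o, 'm) precat \<Rightarrow> ('o, 'm) cpx \<Rightarrow> ('o, 'm) cpx \<Rightarrow> (int \<Rightarrow> 'm) \<Rightarrow> ('o, 'm) cpx \<Rightarrow> bool" where
  "mapping_cone C X Y h K \<longleftrightarrow> is_complex C K \<and> (\<exists>i j p q. \<forall>n.
    biproduct C (Obj X (n - 1)) (Obj Y n) (Obj K n) (i n) (j n) (p n) (q n) \<and>
    p (n - 1) \<cdot>\<^bsub>C\<^esub> Diff K n \<cdot>\<^bsub>C\<^esub> i n = Neg C (Diff X (n - 1)) \<and>
    p (n - 1) \<cdot>\<^bsub>C\<^esub> Diff K n \<cdot>\<^bsub>C\<^esub> j n = Zero C (Obj Y n) (Obj X (n - 2)) \<and>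
    q (n - 1) \<cdot>\<^bsub>C\<^esub> Diff K n \<cdot>\<^bsub>C\<^esub> i n = h (n - 1) \<and>
    q (n - 1) \<cdot>\<^bsub>C\<^esub> Diff K n \<cdot>\<^bsub>C\<^esub> j n = Diff Y n)"


section \<open>Exact categories\<close>

definition is_kernel :: "('o, 'm) precat \<Rightarrow> 'm \<Rightarrow> 'm \<Rightarrow> bool" where
  "is_kernel C i p \<longleftrightarrow> i \<in> Ar C \<and> p \<in> Ar C \<and> Cod C i = Dom C p \<and>
    p \<cdot>\<^bsub>C\<^esub> i = Zero C (Dom C i) (Cod C p) \<and>
    (\<forall>X \<in> Ob C. \<forall>f \<in> Hom C X (Dom C p). p \<cdot>\<^bsub>C\<^esub> f = Zero C X (Cod C p) \<longrightarrow>
      (\<exists>!g. g \<in> Hom C X (Dom C i) \<and> i \<cdot>\<^bsub>C\<^esub> g = f))"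

definition is_cokernel :: "('o, 'm) precat \<Rightarrow> 'm \<Rightarrow> 'm \<Rightarrow> bool" where
  "is_cokernel C p i \<longleftrightarrow> i \<in> Ar C \<and> p \<in> Ar C \<and> Cod C i = Dom C p \<and>
    p \<cdot>\<^bsub>C\<^esub> i = Zero C (Dom C i) (Cod C p) \<and>
    (\<forall>X \<in> Ob C. \<forall>f \<in> Hom C (Cod C i) X. f \<cdot>\<^bsub>C\<^esub> i = Zero C (Dom C i) X \<longrightarrow>
      (\<exists>!g. g \<in> Hom C (Cod C p) X \<and> g \<cdot>\<^bsub>C\<^esub> p = f))"

text \<open>The square with sides \<open>i : A \<rightarrow> B\<close>, \<open>f : A \<rightarrow> A'\<close>, \<open>i' : A' \<rightarrow> B'\<close>, \<open>f' : B \<rightarrow> B'\<close>.\<close>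

definition is_pushout :: "('o, 'm) precat \<Rightarrow> 'm \<Rightarrow> 'm \<Rightarrow> 'm \<Rightarrow> 'm \<Rightarrow> bool" where
  "is_pushout C i f i' f' \<longleftrightarrow> {i, f, i', f'} \<subseteq> Ar C \<and>
    Dom C i = Dom C f \<and> Cod C i = Dom C f' \<and> Cod C f = Dom C i' \<and> Cod C i' = Cod C f' \<and>
    f' \<cdot>\<^bsub>C\<^esub> i = i' \<cdot>\<^bsub>C\<^esub> f \<and>
    (\<forall>X \<in> Ob C. \<forall>u \<in> Hom C (Cod C i) X. \<forall>v \<in> Hom C (Cod C f) X. u \<cdot>\<^bsub>C\<^esub> i = v \<cdot>\<^bsub>C\<^esub> f \<longrightarrow>
      (\<exists>!w. w \<in> Hom C (Cod C i') X \<and> w \<cdot>\<^bsub>C\<^esub> f' = u \<and> w \<cdot>\<^bsub>C\<^esub> i' = v))"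

text \<open>The square with sides \<open>p : B \<rightarrow> D\<close>, \<open>f : D' \<rightarrow> D\<close>, \<open>p' : B' \<rightarrow> D'\<close>, \<open>f' : B' \<rightarrow> B\<close>.\<close>

definition is_pullback :: "('o, 'm) precat \<Rightarrow> 'm \<Rightarrow> 'm \<Rightarrow> 'm \<Rightarrow> 'm \<Rightarrow> bool" where
  "is_pullback C p f p' f' \<longleftrightarrow> {p, f, p', f'} \<subseteq> Ar C \<and>
    Cod C p = Cod C f \<and> Dom C p = Cod C f' \<and> Dom C f = Cod C p' \<and> Dom C p' = Dom C f' \<and>
    p \<cdot>\<^bsub>C\<^esub> f' = f \<cdot>\<^bsub>C\<^esub> p' \<and>
    (\<forall>X \<in> Ob C. \<forall>u \<in> Hom C X (Dom C p). \<forall>v \<in> Hom C X (Dom C f). p \<cdot>\<^bsub>C\<^esub> u = f \<cdot>\<^bsub>C\<^esub> v \<longrightarrow>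
      (\<exists>!w. w \<in> Hom C X (Dom C p') \<and> f' \<cdot>\<^bsub>C\<^esub> w = u \<and> p' \<cdot>\<^bsub>C\<^esub> w = v))"

definition inflation :: "('m \<times> 'm) set \<Rightarrow> 'm \<Rightarrow> bool" where
  "inflation S i \<longleftrightarrow> (\<exists>p. (i, p) \<in> S)"

definition deflation :: "('m \<times> 'm) set \<Rightarrow> 'm \<Rightarrow> bool" where
  "deflation S p \<longleftrightarrow> (\<exists>i. (i, p) \<in> S)"

text \<open>Quillen's axioms in the standard minimal form, i.e. without Quillen's ``obscure axiom'', which
  Keller showed to be redundant. \<open>S\<close> is the class of conflations \<open>(i, p)\<close>.\<close>

locale exact_category = additive_category C
  for C :: "('o, 'm) precat" (structure) +
  fixes S :: "('m \<times> 'm) set"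
  assumes conflation_kernel: "(i, p) \<in> S \<Longrightarrow> is_kernel C i p"
    and conflation_cokernel: "(i, p) \<in> S \<Longrightarrow> is_cokernel C p i"
    and conflation_iso: "\<lbrakk>(i, p) \<in> S; is_iso C a; is_iso C b; is_iso C c;
        Dom C a = Dom C i; Dom C b = Cod C i; Dom C c = Cod C p;
        i' \<in> Hom C (Cod C a) (Cod C b); p' \<in> Hom C (Cod C b) (Cod C c);
        b \<cdot> i = i' \<cdot> a; c \<cdot> p = p' \<cdot> b\<rbrakk> \<Longrightarrow> (i', p') \<in> S"
    and inflation_Id: "A \<in> Ob C \<Longrightarrow> inflation S (Id C A)"
    and deflation_Id: "A \<in> Ob C \<Longrightarrow> deflation S (Id C A)"
    and inflation_Comp: "\<lbrakk>inflation S i; inflation S j; Cod C i = Dom C j\<rbrakk> \<Longrightarrow> inflation S (j \<cdot> i)"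
    and deflation_Comp: "\<lbrakk>deflation S p; deflation S q; Cod C p = Dom C q\<rbrakk> \<Longrightarrow> deflation S (q \<cdot> p)"
    and inflation_pushout: "\<lbrakk>inflation S i; f \<in> Ar C; Dom C f = Dom C i\<rbrakk>
      \<Longrightarrow> \<exists>i' f'. is_pushout C i f i' f' \<and> inflation S i'"
    and deflation_pullback: "\<lbrakk>deflation S p; f \<in> Ar C; Cod C f = Cod C p\<rbrakk>
      \<Longrightarrow> \<exists>p' f'. is_pullback C p f p' f' \<and> deflation S p'"

definition acyclic_complex ::
  "('o, 'm) precat \<Rightarrow> ('m \<times> 'm) set \<Rightarrow> ('o, 'm) cpx \<Rightarrow> bool" where
  "acyclic_complex C S X \<longleftrightarrow> is_complex C X \<and> (\<exists>Z i p. \<forall>n.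
    (i n, p n) \<in> S \<and> i n \<in> Hom C (Z n) (Obj X n) \<and> p n \<in> Hom C (Obj X n) (Z (n - 1)) \<and>
    Diff X n = i (n - 1) \<cdot>\<^bsub>C\<^esub> p n)"


section \<open>Yoneda Ext and cluster tilting\<close>

text \<open>An \<open>n\<close>-extension \<open>0 \<rightarrow> B \<rightarrow> X\<^sub>n \<rightarrow> \<dots> \<rightarrow> X\<^sub>1 \<rightarrow> A \<rightarrow> 0\<close> of \<open>A\<close> by \<open>B\<close>, for \<open>n \<ge> 1\<close>.\<close>

definition extensions ::
  "('o, 'm) precat \<Rightarrow> ('m \<times> 'm) set \<Rightarrow> nat \<Rightarrow> 'o \<Rightarrow> 'o \<Rightarrow> ('o, 'm) cpx set" where
  "extensions C S n A B = {X. finite_complex C 0 (int n + 1) X \<and> acyclic_complex C S X \<and>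
    Obj X 0 = A \<and> Obj X (int n + 1) = B}"

definition extension_morphism ::
  "('o, 'm) precat \<Rightarrow> ('m \<times> 'm) set \<Rightarrow> nat \<Rightarrow> 'o \<Rightarrow> 'o \<Rightarrow> ('o, 'm) cpx rel" where
  "extension_morphism C S n A B = {(X, Y) \<in> extensions C S n A B \<times> extensions C S n A B.
    \<exists>h. chain_map C X Y h \<and> h 0 = Id C A \<and> h (int n + 1) = Id C B}"

text \<open>\<open>Ext\<^sup>n(A, B)\<close> is the set of classes of \<open>n\<close>-extensions under the equivalence relation generated by
  the morphisms fixing both ends. The Baer sum makes it a group; this group is zero iff there is exactly
  one class.\<close>

definition yoneda_Ext ::
  "('o, 'm) precat \<Rightarrow> ('m \<times> 'm) set \<Rightarrow> nat \<Rightarrow> 'o \<Rightarrow> 'o \<Rightarrow> ('o, 'm) cpx set set" where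
  "yoneda_Ext C S n A B = extensions C S n A B //
    ((extension_morphism C S n A B \<union> (extension_morphism C S n A B)\<inverse>)\<^sup>*)"

definition Ext_vanishes ::
  "('o, 'm) precat \<Rightarrow> ('m \<times> 'm) set \<Rightarrow> nat \<Rightarrow> 'o \<Rightarrow> 'o \<Rightarrow> bool" where
  "Ext_vanishes C S n A B \<longleftrightarrow> is_singleton (yoneda_Ext C S n A B)"

definition generating :: "('o, 'm) precat \<Rightarrow> ('m \<times> 'm) set \<Rightarrow> 'o set \<Rightarrow> bool" where
  "generating C S M \<longleftrightarrow> (\<forall>A \<in> Ob C. \<exists>X \<in> M. \<exists>p \<in> Hom C X A. deflation S p)"

definition cogenerating :: "('o, 'm) precat \<Rightarrow> ('m \<times> 'm) set \<Rightarrow> 'o set \<Rightarrow> bool" where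
  "cogenerating C S M \<longleftrightarrow> (\<forall>A \<in> Ob C. \<exists>X \<in> M. \<exists>i \<in> Hom C A X. inflation S i)"

definition contravariantly_finite :: "('o, 'm) precat \<Rightarrow> 'o set \<Rightarrow> bool" where
  "contravariantly_finite C M \<longleftrightarrow> (\<forall>A \<in> Ob C. \<exists>X \<in> M. \<exists>f \<in> Hom C X A.
    \<forall>X' \<in> M. \<forall>g \<in> Hom C X' A. \<exists>h \<in> Hom C X' X. f \<cdot>\<^bsub>C\<^esub> h = g)"

definition covariantly_finite :: "('o, 'm) precat \<Rightarrow> 'o set \<Rightarrow> bool" where
  "covariantly_finite C M \<longleftrightarrow> (\<forall>A \<in> Ob C. \<exists>X \<in> M. \<exists>f \<in> Hom C A X.
    \<forall>X' \<in> M. \<forall>g \<in> Hom C A X'. \<exists>h \<in> Hom C X X'. h \<cdot>\<^bsub>C\<^esub> f = g)"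

definition functorially_finite :: "('o, 'm) precat \<Rightarrow> 'o set \<Rightarrow> bool" where
  "functorially_finite C M \<longleftrightarrow> contravariantly_finite C M \<and> covariantly_finite C M"

definition cluster_tilting ::
  "nat \<Rightarrow> ('o, 'm) precat \<Rightarrow> ('m \<times> 'm) set \<Rightarrow> 'o set \<Rightarrow> bool" where
  "cluster_tilting d C S M \<longleftrightarrow> additive_subcategory C M \<and>
    generating C S M \<and> cogenerating C S M \<and> functorially_finite C M \<and>
    M = {A \<in> Ob C. \<forall>n. 0 < n \<and> n < d \<longrightarrow> (\<forall>X \<in> M. Ext_vanishes C S n A X)} \<and>
    M = {A \<in> Ob C. \<forall>n. 0 < n \<and> n < d \<longrightarrow> (\<forall>X \<in> M. Ext_vanishes C S n X A)}"


section \<open>\<open>d\<close>-exact categories\<close>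

text \<open>Exactness of \<open>0 \<rightarrow> Hom(A, X\<^bsub>d+1\<^esub>) \<rightarrow> \<dots> \<rightarrow> Hom(A, X\<^sub>0)\<close>: at \<open>Hom(A, X\<^bsub>d+1\<^esub>)\<close> the image condition
  expresses injectivity, as \<open>X\<^bsub>d+2\<^esub>\<close> is a zero object.\<close>

definition left_d_exact :: "nat \<Rightarrow> ('o, 'm) precat \<Rightarrow> ('o, 'm) cpx \<Rightarrow> bool" where
  "left_d_exact d C X \<longleftrightarrow> finite_complex C 0 (int d + 1) X \<and>
    (\<forall>A \<in> Ob C. \<forall>n. 1 \<le> n \<and> n \<le> int d + 1 \<longrightarrow>
      (\<lambda>g. Diff X (n + 1) \<cdot>\<^bsub>C\<^esub> g) ` Hom C A (Obj X (n + 1)) =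
      kernel (hom_group C A (Obj X n)) (hom_group C A (Obj X (n - 1))) (\<lambda>f. Diff X n \<cdot>\<^bsub>C\<^esub> f))"

definition right_d_exact :: "nat \<Rightarrow> ('o, 'm) precat \<Rightarrow> ('o, 'm) cpx \<Rightarrow> bool" where
  "right_d_exact d C X \<longleftrightarrow> finite_complex C 0 (int d + 1) X \<and>
    (\<forall>A \<in> Ob C. \<forall>n. 0 \<le> n \<and> n \<le> int d \<longrightarrow>
      (\<lambda>g. g \<cdot>\<^bsub>C\<^esub> Diff X n) ` Hom C (Obj X (n - 1)) A =
      kernel (hom_group C (Obj X n) A) (hom_group C (Obj X (n + 1)) A) (\<lambda>f. f \<cdot>\<^bsub>C\<^esub> Diff X (n + 1)))"

definition d_exact :: "nat \<Rightarrow> ('o, 'm) precat \<Rightarrow> ('o, 'm) cpx \<Rightarrow> bool" where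
  "d_exact d C X \<longleftrightarrow> left_d_exact d C X \<and> right_d_exact d C X"

definition weak_isomorphism ::
  "nat \<Rightarrow> ('o, 'm) precat \<Rightarrow> ('o, 'm) cpx \<Rightarrow> ('o, 'm) cpx \<Rightarrow> (int \<Rightarrow> 'm) \<Rightarrow> bool" where
  "weak_isomorphism d C X Y h \<longleftrightarrow> d_exact d C X \<and> d_exact d C Y \<and> chain_map C X Y h \<and>
    ((\<exists>n. 0 \<le> n \<and> n \<le> int d \<and> is_iso C (h n) \<and> is_iso C (h (n + 1))) \<or>
     (is_iso C (h (int d + 1)) \<and> is_iso C (h 0)))"

definition d_pushout ::
  "nat \<Rightarrow> ('o, 'm) precat \<Rightarrow> ('o, 'm) cpx \<Rightarrow> 'm \<Rightarrow> ('o, 'm) cpx \<Rightarrow> (int \<Rightarrow> 'm) \<Rightarrow> bool" where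
  "d_pushout d C Y f Z h \<longleftrightarrow> finite_complex C 0 (int d) Y \<and> finite_complex C 0 (int d) Z \<and>
    chain_map C Y Z h \<and> h (int d) = f \<and> (\<exists>K. mapping_cone C Y Z h K \<and> right_d_exact d C K)"

definition d_pullback ::
  "nat \<Rightarrow> ('o, 'm) precat \<Rightarrow> ('o, 'm) cpx \<Rightarrow> 'm \<Rightarrow> ('o, 'm) cpx \<Rightarrow> (int \<Rightarrow> 'm) \<Rightarrow> bool" where
  "d_pullback d C Y g X h \<longleftrightarrow> finite_complex C 0 (int d) Y \<and> finite_complex C 0 (int d) X \<and>
    chain_map C X Y h \<and> h 0 = g \<and> (\<exists>K. mapping_cone C X Y h K \<and> left_d_exact d C K)"

definition admissible_mono :: "nat \<Rightarrow> ('o, 'm) cpx set \<Rightarrow> 'm \<Rightarrow> bool" where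
  "admissible_mono d D f \<longleftrightarrow> (\<exists>X \<in> D. f = Diff X (int d + 1))"

definition admissible_epi :: "('o, 'm) cpx set \<Rightarrow> 'm \<Rightarrow> bool" where
  "admissible_epi D f \<longleftrightarrow> (\<exists>X \<in> D. f = Diff X 1)"

text \<open>In \<open>d_pushout_admissible\<close>, \<open>segment C Y 1 d\<close> is \<open>Y\<^bsub>d+1\<^esub> \<rightarrow> \<dots> \<rightarrow> Y\<^sub>1\<close>; accordingly the degrees of
  \<open>Z\<close> are one lower than in the usual notation \<open>Z\<^bsub>d+1\<^esub> \<rightarrow> \<dots> \<rightarrow> Z\<^sub>1\<close>.\<close>

locale d_exact_category = additive_category C
  for d :: nat and C :: "('o, 'm) precat" (structure) +
  fixes D :: "('o, 'm) cpx set"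
  assumes admissible_d_exact: "X \<in> D \<Longrightarrow> d_exact d C X"
    and weak_isomorphism_closed: "weak_isomorphism d C X Y h \<Longrightarrow> X \<in> D \<longleftrightarrow> Y \<in> D"
    and zero_admissible: "\<lbrakk>is_complex C X; \<And>n. zero_object C (Obj X n)\<rbrakk> \<Longrightarrow> X \<in> D"
    and admissible_mono_Comp: "\<lbrakk>admissible_mono d D f; admissible_mono d D g; Cod C f = Dom C g\<rbrakk>
      \<Longrightarrow> admissible_mono d D (g \<cdot> f)"
    and admissible_epi_Comp: "\<lbrakk>admissible_epi D f; admissible_epi D g; Cod C f = Dom C g\<rbrakk>
      \<Longrightarrow> admissible_epi D (g \<cdot> f)"
    and d_pushout_admissible: "\<lbrakk>Y \<in> D; f \<in> Ar C; Dom C f = Obj Y (int d + 1)\<rbrakk>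
      \<Longrightarrow> \<exists>Z h. d_pushout d C (segment C Y 1 (int d)) f Z h \<and> admissible_mono d D (Diff Z (int d))"
    and d_pullback_admissible: "\<lbrakk>Y \<in> D; g \<in> Ar C; Cod C g = Obj Y 0\<rbrakk>
      \<Longrightarrow> \<exists>X h. d_pullback d C (segment C Y 0 (int d)) g X h \<and> admissible_epi D (Diff X 1)"

end

theory Submission
  imports Defs
begin

text \<open>A finite complex is homotopy equivalent to an acyclic one iff it is \<^emph>\<open>locally exact\<close>: every cycle
  becomes a boundary after composition with a deflation. This condition survives the failure of weak
  idempotent completeness, since the missing kernels are created by adding contractible complexes with
  terms in \<open>M\<close>. The vanishing of \<open>Ext\<close> between objects of \<open>M\<close> enters in two ways. First, cycles
  \<open>A \<rightarrow> X\<^sub>n\<close> with \<open>A\<close> in \<open>M\<close> lift through \<open>X\<^bsub>n+1\<^esub>\<close> if the terms above are in \<open>M\<close>; to see that an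
  extension splits, replace its middle terms functorially (up to choice) by left approximations, and compare
  two such replacements by their mapping cone, a shorter complex of the same kind. Second, if the
  upper terms of an acyclic complex are successively replaced by left approximations, then the last
  pushout again lies in \<open>M\<close>. The latter provides the resolutions and \<open>d\<close>-pushouts, and mapping cones of
  locally exact complexes, truncated where the chain map is invertible, remain locally exact, hence
  \<open>d\<close>-exact. The dual statements follow by passing to the opposite category.\<close>

section \<open>Additive categories\<close>

text \<open>Two obstacles shape the argument. \<open>Ext_vanishes\<close> only says that the Yoneda
  classes form a singleton, so no long exact sequences are at hand: each dimension shift becomes an
  explicit chain map between extensions, and splitting must be carried along zigzags of morphisms.
  Secondly, without weak idempotent completeness an arrow \<open>f\<close> for which some
  \<open>\<alpha> \<cdot> f\<close> is an inflation need not be an inflation. For \<open>d\<close>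
  at least 2 these arrows between objects of \<open>M\<close> are exactly the admissible
  monomorphisms, and this description (\<open>M_inflation\<close>) reduces closure under composition
  to a pushout. For \<open>d = 1\<close> one has \<open>M = Ob C\<close>, and the obscure axiom
  shows that such an \<open>f\<close> with a cokernel is an inflation. Closure under weak
  isomorphisms splits accordingly: two neighbouring isomorphisms give a homotopy equivalence,
  because a chain map between d-exact sequences that vanishes in one degree is null-homotopic, while
  isomorphisms at the two ends are treated through \<open>M_inflation\<close> and its dual.\<close>

definition Minus :: "('o, 'm) precat \<Rightarrow> 'm \<Rightarrow> 'm \<Rightarrow> 'm" (infixl "\<ominus>\<index>" 65) where
  "f \<ominus>\<^bsub>C\<^esub> g = f \<oplus>\<^bsub>C\<^esub> Neg C g"

context category
begin

declare Dom_Ob [simp] Cod_Ob [simp]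

lemma HomD:
  assumes "f \<in> Hom C A B"
  shows "f \<in> Ar C" "Dom C f = A" "Cod C f = B" "A \<in> Ob C" "B \<in> Ob C"
  using assms by (auto simp: Hom_def)

text \<open>Arrows are typed through \<open>Ar\<close>, \<open>Dom\<close> and \<open>Cod\<close>
  rather than \<open>Hom\<close>: composability then becomes a rewriting problem for the simplifier,
  with no intermediate object to guess.\<close>

lemma Comp_Ar [simp]:
  assumes "f \<in> Ar C" "g \<in> Ar C" "Cod C f = Dom C g"
  shows "g \<cdot> f \<in> Ar C" "Dom C (g \<cdot> f) = Dom C f" "Cod C (g \<cdot> f) = Cod C g"
  using Comp_Hom[of f "Dom C f" "Cod C f" g "Cod C g"] assms by (auto simp: Hom_def)

lemma Id_Ar [simp]:
  assumes "A \<in> Ob C"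
  shows "Id C A \<in> Ar C" "Dom C (Id C A) = A" "Cod C (Id C A) = A"
  using Id_Hom[OF assms] by (auto simp: Hom_def)

lemma Comp_assoc' [simp]:
  "\<lbrakk>f \<in> Ar C; g \<in> Ar C; h \<in> Ar C; Cod C f = Dom C g; Cod C g = Dom C h\<rbrakk> \<Longrightarrow> h \<cdot> g \<cdot> f = h \<cdot> (g \<cdot> f)"
  using Comp_assoc[of f "Dom C f" "Cod C f" g "Cod C g" h "Cod C h"] by (auto simp: Hom_def)

lemma Comp_Id' [simp]: "\<lbrakk>f \<in> Ar C; Dom C f = A\<rbrakk> \<Longrightarrow> f \<cdot> Id C A = f"
  using Comp_Id[of f A "Cod C f"] by (auto simp: Hom_def)

lemma Id_Comp' [simp]: "\<lbrakk>f \<in> Ar C; Cod C f = A\<rbrakk> \<Longrightarrow> Id C A \<cdot> f = f"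
  using Id_Comp[of f "Dom C f" A] by (auto simp: Hom_def)

text \<open>Composites are normalised to the right, so a known equation
  \<open>g \<cdot> f = k\<close> does not match inside \<open>g \<cdot> (f \<cdot> x)\<close>; this
  form applies it there.\<close>

lemma Comp_cong_left:
  "\<lbrakk>g \<cdot> f = k; f \<in> Ar C; g \<in> Ar C; x \<in> Ar C; Cod C x = Dom C f; Cod C f = Dom C g\<rbrakk> \<Longrightarrow> g \<cdot> (f \<cdot> x) = k \<cdot> x"
  using Comp_assoc' by metis

lemma is_iso_Id [simp]: "A \<in> Ob C \<Longrightarrow> is_iso C (Id C A)"
  unfolding is_iso_def by (auto simp: Hom_def intro!: bexI[of _ "Id C A"])

lemma is_isoE:
  assumes "is_iso C f"
  obtains g where "g \<in> Hom C (Cod C f) (Dom C f)" "g \<cdot> f = Id C (Dom C f)" "f \<cdot> g = Id C (Cod C f)"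
    "is_iso C g"
  using assms unfolding is_iso_def by (auto simp: Hom_def)

lemma is_isoI:
  "\<lbrakk>f \<in> Hom C A B; g \<in> Hom C B A; g \<cdot> f = Id C A; f \<cdot> g = Id C B\<rbrakk> \<Longrightarrow> is_iso C f"
  unfolding is_iso_def by (auto simp: Hom_def)

end

context additive_category
begin

lemma Hom_group:
  assumes A: "A \<in> Ob C" and B: "B \<in> Ob C"
  shows Zero_Hom: "Zero C A B \<in> Hom C A B"
    and Add_Hom: "\<lbrakk>f \<in> Hom C A B; g \<in> Hom C A B\<rbrakk> \<Longrightarrow> f \<oplus> g \<in> Hom C A B"
    and Neg_Hom: "f \<in> Hom C A B \<Longrightarrow> Neg C f \<in> Hom C A B"
    and "\<lbrakk>f \<in> Hom C A B; g \<in> Hom C A B; h \<in> Hom C A B\<rbrakk> \<Longrightarrow> f \<oplus> g \<oplus> h = f \<oplus> (g \<oplus> h)"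
    and "\<lbrakk>f \<in> Hom C A B; g \<in> Hom C A B\<rbrakk> \<Longrightarrow> f \<oplus> g = g \<oplus> f"
    and "f \<in> Hom C A B \<Longrightarrow> f \<oplus> Zero C A B = f"
    and "f \<in> Hom C A B \<Longrightarrow> Neg C f \<oplus> f = Zero C A B"
proof -
  interpret G: comm_group "hom_group C A B" by (rule hom_comm_group[OF A B])
  show "Zero C A B \<in> Hom C A B" "\<lbrakk>f \<in> Hom C A B; g \<in> Hom C A B\<rbrakk> \<Longrightarrow> f \<oplus> g \<in> Hom C A B"
    using G.one_closed G.m_closed[of f g] by (simp_all add: hom_group_def)
  have inv: "Neg C f = inv\<^bsub>hom_group C A B\<^esub> f" if "f \<in> Hom C A B"
    using that by (auto simp: Neg_def Hom_def)
  show "Neg C f \<in> Hom C A B" if "f \<in> Hom C A B"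
    unfolding inv[OF that] using G.inv_closed[of f] that by (simp add: hom_group_def)
  show "Neg C f \<oplus> f = Zero C A B" if "f \<in> Hom C A B"
    unfolding inv[OF that] using G.l_inv[of f] that by (simp add: hom_group_def)
  show "\<lbrakk>f \<in> Hom C A B; g \<in> Hom C A B; h \<in> Hom C A B\<rbrakk> \<Longrightarrow> f \<oplus> g \<oplus> h = f \<oplus> (g \<oplus> h)"
    "\<lbrakk>f \<in> Hom C A B; g \<in> Hom C A B\<rbrakk> \<Longrightarrow> f \<oplus> g = g \<oplus> f"
    "f \<in> Hom C A B \<Longrightarrow> f \<oplus> Zero C A B = f"
    using G.m_assoc[of f g h] G.m_comm[of f g] G.r_one[of f] by (simp_all add: hom_group_def)
qed

lemma Zero_Ar [simp]:
  assumes "A \<in> Ob C" "B \<in> Ob C"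
  shows "Zero C A B \<in> Ar C" "Dom C (Zero C A B) = A" "Cod C (Zero C A B) = B"
  using Zero_Hom[OF assms] by (auto simp: Hom_def)

lemma Add_Ar [simp]:
  assumes "f \<in> Ar C" "g \<in> Ar C" "Dom C f = Dom C g" "Cod C f = Cod C g"
  shows "f \<oplus> g \<in> Ar C" "Dom C (f \<oplus> g) = Dom C g" "Cod C (f \<oplus> g) = Cod C g"
  using Add_Hom[of "Dom C f" "Cod C f" f g] assms by (auto simp: Hom_def)

lemma Neg_Ar [simp]:
  assumes "f \<in> Ar C"
  shows "Neg C f \<in> Ar C" "Dom C (Neg C f) = Dom C f" "Cod C (Neg C f) = Cod C f"
  using Neg_Hom[of "Dom C f" "Cod C f" f] assms by (auto simp: Hom_def)

lemma Add_assoc [simp]: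
  "\<lbrakk>f \<in> Ar C; g \<in> Ar C; h \<in> Ar C; Dom C f = Dom C g; Dom C g = Dom C h; Cod C f = Cod C g; Cod C g = Cod
    C h\<rbrakk>
    \<Longrightarrow> f \<oplus> g \<oplus> h = f \<oplus> (g \<oplus> h)"
  using Hom_group(4)[of "Dom C f" "Cod C f" f g h] by (auto simp: Hom_def)

lemma Add_commute:
  "\<lbrakk>f \<in> Ar C; g \<in> Ar C; Dom C f = Dom C g; Cod C f = Cod C g\<rbrakk> \<Longrightarrow> f \<oplus> g = g \<oplus> f"
  using Hom_group(5)[of "Dom C f" "Cod C f" f g] by (auto simp: Hom_def)

lemma Add_left_commute:
  "\<lbrakk>f \<in> Ar C; g \<in> Ar C; h \<in> Ar C; Dom C f = Dom C g; Dom C g = Dom C h; Cod C f = Cod C g; Cod C g = Cod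
    C h\<rbrakk>
    \<Longrightarrow> f \<oplus> (g \<oplus> h) = g \<oplus> (f \<oplus> h)"
  using Add_assoc[of f g h] Add_assoc[of g f h] Add_commute[of f g] by simp

lemmas Add_ac = Add_commute Add_left_commute

lemma Add_Zero [simp]:
  "\<lbrakk>f \<in> Ar C; Dom C f = A; Cod C f = B\<rbrakk> \<Longrightarrow> f \<oplus> Zero C A B = f"
  "\<lbrakk>f \<in> Ar C; Dom C f = A; Cod C f = B\<rbrakk> \<Longrightarrow> Zero C A B \<oplus> f = f"
proof -
  show *: "f \<oplus> Zero C A B = f" if "f \<in> Ar C" "Dom C f = A" "Cod C f = B"
    using Hom_group(6)[of A B f] that by (auto simp: Hom_def)
  show "Zero C A B \<oplus> f = f" if "f \<in> Ar C" "Dom C f = A" "Cod C f = B"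
    using *[OF that] that Add_commute[of f "Zero C A B"] by auto
qed

lemma Neg_Add [simp]: "f \<in> Ar C \<Longrightarrow> Neg C f \<oplus> f = Zero C (Dom C f) (Cod C f)"
  using Hom_group(7)[of "Dom C f" "Cod C f" f] by (auto simp: Hom_def)

lemma Add_Neg [simp]: "f \<in> Ar C \<Longrightarrow> f \<oplus> Neg C f = Zero C (Dom C f) (Cod C f)"
  using Add_commute[of f "Neg C f"] by simp

lemma Add_right_cancel:
  assumes "f \<in> Ar C" "g \<in> Ar C" "h \<in> Ar C" "Dom C f = Dom C h" "Dom C g = Dom C h"
    "Cod C f = Cod C h" "Cod C g = Cod C h"
  shows "f \<oplus> h = g \<oplus> h \<longleftrightarrow> f = g"
proof
  assume "f \<oplus> h = g \<oplus> h"
  then have "(f \<oplus> h) \<oplus> Neg C h = (g \<oplus> h) \<oplus> Neg C h" by simp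
  then show "f = g" using assms by simp
qed simp

lemma Minus_Ar [simp]:
  assumes "f \<in> Ar C" "g \<in> Ar C" "Dom C f = Dom C g" "Cod C f = Cod C g"
  shows "f \<ominus> g \<in> Ar C" "Dom C (f \<ominus> g) = Dom C g" "Cod C (f \<ominus> g) = Cod C g"
  using assms by (simp_all add: Minus_def)

lemma Minus_eq_iff:
  assumes "f \<in> Ar C" "g \<in> Ar C" "h \<in> Ar C" "Dom C f = Dom C g" "Dom C h = Dom C g"
    "Cod C f = Cod C g" "Cod C h = Cod C g"
  shows "f \<ominus> g = h \<longleftrightarrow> f = h \<oplus> g" "h = f \<ominus> g \<longleftrightarrow> h \<oplus> g = f"
proof -
  have "(f \<ominus> g) \<oplus> g = f" using assms by (simp add: Minus_def)
  then show "f \<ominus> g = h \<longleftrightarrow> f = h \<oplus> g" "h = f \<ominus> g \<longleftrightarrow> h \<oplus> g = f"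
    using Add_right_cancel[of "f \<ominus> g" h g] assms by (auto simp del: Add_assoc)
qed

lemma Minus_self [simp]: "f \<in> Ar C \<Longrightarrow> f \<ominus> f = Zero C (Dom C f) (Cod C f)"
  by (simp add: Minus_def)

lemma Minus_eq_Zero_iff:
  "\<lbrakk>f \<in> Ar C; g \<in> Ar C; Dom C f = Dom C g; Cod C f = Cod C g; A = Dom C g; B = Cod C g\<rbrakk>
    \<Longrightarrow> f \<ominus> g = Zero C A B \<longleftrightarrow> f = g"
  by (simp add: Minus_eq_iff)

lemma Neg_eq: "f \<in> Ar C \<Longrightarrow> Neg C f = Zero C (Dom C f) (Cod C f) \<ominus> f"
  by (simp add: Minus_def)

lemma Add_Minus:
  assumes "f \<in> Ar C" "g \<in> Ar C" "h \<in> Ar C" "Dom C f = Dom C h" "Dom C g = Dom C h"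
    "Cod C f = Cod C h" "Cod C g = Cod C h"
  shows "f \<oplus> (g \<ominus> h) = (f \<oplus> g) \<ominus> h" "(g \<ominus> h) \<oplus> f = (f \<oplus> g) \<ominus> h"
    "(f \<ominus> g) \<ominus> h = f \<ominus> (g \<oplus> h)" "f \<ominus> (g \<ominus> h) = (f \<oplus> h) \<ominus> g"
proof -
  show 1: "f \<oplus> (g \<ominus> h) = (f \<oplus> g) \<ominus> h" using assms by (simp add: Minus_def)
  show "(g \<ominus> h) \<oplus> f = (f \<oplus> g) \<ominus> h" using 1 assms by (simp add: Add_commute)
  have "((f \<ominus> g) \<ominus> h) \<oplus> (g \<oplus> h) = f"
    using assms Minus_eq_iff(2)[of "f \<ominus> g" h "(f \<ominus> g) \<ominus> h"] Minus_eq_iff(2)[of f g "f \<ominus> g"]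
    by (simp add: Add_ac)
  then show "(f \<ominus> g) \<ominus> h = f \<ominus> (g \<oplus> h)" using assms by (simp add: Minus_eq_iff)
  have "(f \<ominus> (g \<ominus> h)) \<oplus> (g \<ominus> h) = f" using assms by (simp flip: Minus_eq_iff(2))
  then have "((f \<ominus> (g \<ominus> h)) \<oplus> (g \<ominus> h)) \<oplus> h = f \<oplus> h" by simp
  moreover have "(g \<ominus> h) \<oplus> h = g" using assms by (simp flip: Minus_eq_iff(2))
  ultimately have "(f \<ominus> (g \<ominus> h)) \<oplus> g = f \<oplus> h" using assms by simp
  then show "f \<ominus> (g \<ominus> h) = (f \<oplus> h) \<ominus> g" using assms by (simp add: Minus_eq_iff)
qed

lemma Comp_Add' [simp]:
  "\<lbrakk>f \<in> Ar C; f' \<in> Ar C; g \<in> Ar C; Dom C f = Dom C f'; Cod C f = Cod C f'; Cod C f' = Dom C g\<rbrakk>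
    \<Longrightarrow> g \<cdot> (f \<oplus> f') = (g \<cdot> f) \<oplus> (g \<cdot> f')"
  using Comp_Add[of f "Dom C f" "Dom C g" f' g "Cod C g"] by (auto simp: Hom_def)

lemma Add_Comp' [simp]:
  "\<lbrakk>f \<in> Ar C; g \<in> Ar C; g' \<in> Ar C; Dom C g = Dom C g'; Cod C g = Cod C g'; Cod C f = Dom C g'\<rbrakk>
    \<Longrightarrow> (g \<oplus> g') \<cdot> f = (g \<cdot> f) \<oplus> (g' \<cdot> f)"
  using Add_Comp[of f "Dom C f" "Dom C g" g "Cod C g" g'] by (auto simp: Hom_def)

lemma Comp_Zero [simp]:
  assumes "g \<in> Ar C" "A \<in> Ob C" "Dom C g = B"
  shows "g \<cdot> Zero C A B = Zero C A (Cod C g)"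
proof -
  let ?z = "Zero C A B"
  have B: "B \<in> Ob C" using assms by auto
  have "g \<cdot> ?z \<oplus> g \<cdot> ?z = g \<cdot> (?z \<oplus> ?z)" using assms B by (subst Comp_Add') auto
  also have "\<dots> = Zero C A (Cod C g) \<oplus> g \<cdot> ?z" using assms B by simp
  finally show ?thesis using assms B by (subst (asm) Add_right_cancel) auto
qed

lemma Zero_Comp [simp]:
  assumes "f \<in> Ar C" "B \<in> Ob C" "Cod C f = A"
  shows "Zero C A B \<cdot> f = Zero C (Dom C f) B"
proof -
  let ?z = "Zero C A B"
  have A: "A \<in> Ob C" using assms by auto
  have "?z \<cdot> f \<oplus> ?z \<cdot> f = (?z \<oplus> ?z) \<cdot> f" using assms A by (subst Add_Comp') auto
  also have "\<dots> = Zero C (Dom C f) B \<oplus> ?z \<cdot> f" using assms A by simp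
  finally show ?thesis using assms A by (subst (asm) Add_right_cancel) auto
qed

lemma Comp_Minus [simp]:
  assumes "f \<in> Ar C" "f' \<in> Ar C" "g \<in> Ar C" "Dom C f = Dom C f'" "Cod C f = Cod C f'" "Cod C f' = Dom C g"
  shows "g \<cdot> (f \<ominus> f') = (g \<cdot> f) \<ominus> (g \<cdot> f')"
proof -
  have "g \<cdot> (f \<ominus> f') \<oplus> g \<cdot> f' = g \<cdot> ((f \<ominus> f') \<oplus> f')" using assms by simp
  also have "(f \<ominus> f') \<oplus> f' = f" using assms by (simp flip: Minus_eq_iff(2))
  finally show ?thesis using assms by (simp add: Minus_eq_iff)
qed

lemma Minus_Comp [simp]:
  assumes "f \<in> Ar C" "g \<in> Ar C" "g' \<in> Ar C" "Dom C g = Dom C g'" "Cod C g = Cod C g'" "Cod C f = Dom C g'"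
  shows "(g \<ominus> g') \<cdot> f = (g \<cdot> f) \<ominus> (g' \<cdot> f)"
proof -
  have "(g \<ominus> g') \<cdot> f \<oplus> g' \<cdot> f = ((g \<ominus> g') \<oplus> g') \<cdot> f" using assms by (subst Add_Comp') auto
  also have "(g \<ominus> g') \<oplus> g' = g" using assms by (simp flip: Minus_eq_iff(2))
  finally show ?thesis using assms by (simp add: Minus_eq_iff)
qed

lemma Comp_Neg [simp]:
  "\<lbrakk>f \<in> Ar C; g \<in> Ar C; Cod C f = Dom C g\<rbrakk> \<Longrightarrow> g \<cdot> Neg C f = Neg C (g \<cdot> f)"
  "\<lbrakk>f \<in> Ar C; g \<in> Ar C; Cod C f = Dom C g\<rbrakk> \<Longrightarrow> Neg C g \<cdot> f = Neg C (g \<cdot> f)"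
  by (simp_all add: Neg_eq)

lemma Minus_Zero [simp]: "\<lbrakk>f \<in> Ar C; Dom C f = A; Cod C f = B\<rbrakk> \<Longrightarrow> f \<ominus> Zero C A B = f"
  by (subst Minus_eq_iff) auto

lemma Neg_Zero [simp]: "\<lbrakk>A \<in> Ob C; B \<in> Ob C\<rbrakk> \<Longrightarrow> Neg C (Zero C A B) = Zero C A B"
  by (simp add: Neg_eq)

text \<open>Rewriting with these rules moves all negative terms to the other side, so that an identity between
  parallel arrows is reduced to an identity between sums.\<close>

lemmas hom_algebra = Minus_eq_iff Add_Minus Neg_eq Add_ac

lemma Neg_Neg [simp]: "f \<in> Ar C \<Longrightarrow> Neg C (Neg C f) = f"
  by (simp add: hom_algebra)

text \<open>Reduces vanishing of an object to one equation between endomorphisms, which can be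
  tested after a deflation and does not change in a full subcategory.\<close>

lemma zero_object_iff: "zero_object C Z \<longleftrightarrow> Z \<in> Ob C \<and> Id C Z = Zero C Z Z"
proof
  assume "zero_object C Z"
  then show "Z \<in> Ob C \<and> Id C Z = Zero C Z Z"
    unfolding zero_object_def by (metis Id_Hom Zero_Hom)
next
  assume Z: "Z \<in> Ob C \<and> Id C Z = Zero C Z Z"
  show "zero_object C Z"
    unfolding zero_object_def
  proof (intro conjI ballI)
    show "Z \<in> Ob C" using Z by simp
    fix A assume A: "A \<in> Ob C"
    have "f = Zero C A Z" if "f \<in> Hom C A Z" for f
      using that Z A Id_Comp'[of f Z] by (auto simp: Hom_def simp del: Id_Comp')
    moreover have "f = Zero C Z A" if "f \<in> Hom C Z A" for f
      using that Z A Comp_Id'[of f Z] by (auto simp: Hom_def simp del: Comp_Id')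
    ultimately show "\<exists>!f. f \<in> Hom C A Z" "\<exists>!f. f \<in> Hom C Z A"
      using Zero_Hom Z A by metis+
  qed
qed

lemma zero_object_Ob [simp]: "zero_object C Z \<Longrightarrow> Z \<in> Ob C"
  by (simp add: zero_object_def)

lemma zero_object_eq:
  assumes "zero_object C Z"
  shows "\<lbrakk>f \<in> Ar C; Cod C f = Z\<rbrakk> \<Longrightarrow> f = Zero C (Dom C f) Z"
    "\<lbrakk>f \<in> Ar C; Dom C f = Z\<rbrakk> \<Longrightarrow> f = Zero C Z (Cod C f)"
  using assms Id_Comp'[of f Z] Comp_Id'[of f Z] unfolding zero_object_iff
  by (auto simp del: Id_Comp' Comp_Id')

lemma zero_object_parallel:
  assumes "zero_object C Z"
  shows "\<lbrakk>f \<in> Hom C A Z; g \<in> Hom C A Z\<rbrakk> \<Longrightarrow> f = g" "\<lbrakk>f \<in> Hom C Z A; g \<in> Hom C Z A\<rbrakk> \<Longrightarrow> f = g"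
  using zero_object_eq[OF assms] by (auto simp: Hom_def) (metis)+

lemma zero_object_iso:
  assumes "zero_object C A" "zero_object C B" "f \<in> Hom C A B"
  shows "is_iso C f"
  using assms by (intro is_isoI[of f A B "Zero C B A"])
    (auto simp: Hom_def intro: zero_object_parallel(1))

lemma biproductD:
  assumes "biproduct C A B P i j p q"
  shows "P \<in> Ob C" "A \<in> Ob C" "B \<in> Ob C"
    "i \<in> Ar C" "Dom C i = A" "Cod C i = P" "j \<in> Ar C" "Dom C j = B" "Cod C j = P"
    "p \<in> Ar C" "Dom C p = P" "Cod C p = A" "q \<in> Ar C" "Dom C q = P" "Cod C q = B"
    "p \<cdot> i = Id C A" "q \<cdot> j = Id C B" "p \<cdot> j = Zero C B A" "q \<cdot> i = Zero C A B"
    "(i \<cdot> p) \<oplus> (j \<cdot> q) = Id C P"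
  using assms by (auto simp: biproduct_def Hom_def)

lemma biproduct_Comp:
  assumes "biproduct C A B P i j p q" "f \<in> Ar C"
  shows "Cod C f = A \<Longrightarrow> p \<cdot> (i \<cdot> f) = f" "Cod C f = B \<Longrightarrow> q \<cdot> (j \<cdot> f) = f"
    "Cod C f = B \<Longrightarrow> p \<cdot> (j \<cdot> f) = Zero C (Dom C f) A" "Cod C f = A \<Longrightarrow> q \<cdot> (i \<cdot> f) = Zero C (Dom C f) B"
  using assms(2) biproductD[OF assms(1)] Comp_assoc'[of f i p] Comp_assoc'[of f j q]
    Comp_assoc'[of f j p] Comp_assoc'[of f i q] by auto

lemmas biproduct_simps = biproductD biproduct_Comp

lemma biproduct_decomp:
  assumes b: "biproduct C A B P i j p q"
  shows "\<lbrakk>f \<in> Ar C; Cod C f = P\<rbrakk> \<Longrightarrow> f = i \<cdot> (p \<cdot> f) \<oplus> j \<cdot> (q \<cdot> f)"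
    "\<lbrakk>f \<in> Ar C; Dom C f = P\<rbrakk> \<Longrightarrow> f = (f \<cdot> i) \<cdot> p \<oplus> (f \<cdot> j) \<cdot> q"
proof -
  note [simp] = biproductD[OF b]
  assume f: "f \<in> Ar C"
  { assume "Cod C f = P"
    then have "f = (i \<cdot> p \<oplus> j \<cdot> q) \<cdot> f" using f by (subst biproductD(20)[OF b]) simp
    also have "\<dots> = i \<cdot> (p \<cdot> f) \<oplus> j \<cdot> (q \<cdot> f)" using f \<open>Cod C f = P\<close> by (subst Add_Comp') auto
    finally show "f = i \<cdot> (p \<cdot> f) \<oplus> j \<cdot> (q \<cdot> f)" . }
  { assume "Dom C f = P"
    then have "f = f \<cdot> (i \<cdot> p \<oplus> j \<cdot> q)" using f by (subst biproductD(20)[OF b]) simp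
    also have "\<dots> = (f \<cdot> i) \<cdot> p \<oplus> (f \<cdot> j) \<cdot> q" using f \<open>Dom C f = P\<close> by (subst Comp_Add') auto
    finally show "f = (f \<cdot> i) \<cdot> p \<oplus> (f \<cdot> j) \<cdot> q" . }
qed

lemma biproduct_eqI:
  assumes "biproduct C A B P i j p q" "f \<in> Hom C X P" "g \<in> Hom C X P" "p \<cdot> f = p \<cdot> g" "q \<cdot> f = q \<cdot> g"
  shows "f = g"
  using biproduct_decomp(1)[OF assms(1), of f] biproduct_decomp(1)[OF assms(1), of g] assms(2-)
  by (auto simp: Hom_def)

lemma biproduct_eqI':
  assumes "biproduct C A B P i j p q" "f \<in> Hom C P X" "g \<in> Hom C P X" "f \<cdot> i = g \<cdot> i" "f \<cdot> j = g \<cdot> j"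
  shows "f = g"
  using biproduct_decomp(2)[OF assms(1), of f] biproduct_decomp(2)[OF assms(1), of g] assms(2-)
  by (auto simp: Hom_def)

lemma biproduct_commute:
  assumes b: "biproduct C A B P i j p q"
  shows "biproduct C B A P j i q p"
  using biproductD[OF b] unfolding biproduct_def by (auto simp: Hom_def Add_commute)

text \<open>The automorphism of \<open>P\<close> that adds \<open>f\<close> times the first
  coordinate to the second transports the structure maps. It makes the graph (1, f) a split
  monomorphism with cokernel \<open>q \<ominus> f \<cdot> p\<close>.\<close>

lemma biproduct_shear:
  assumes b: "biproduct C A B P i j p q" and f: "f \<in> Hom C A B"
  shows "biproduct C A B P (i \<oplus> j \<cdot> f) j p (q \<ominus> f \<cdot> p)"
proof -
  note [simp] = HomD[OF f] biproduct_simps[OF b]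
  have "i \<cdot> p \<oplus> (j \<cdot> q \<oplus> j \<cdot> (f \<cdot> p)) = Id C P \<oplus> j \<cdot> (f \<cdot> p)"
    by (subst Add_assoc[symmetric]) auto
  then show ?thesis
    unfolding biproduct_def by (simp add: Hom_def hom_algebra)
qed

lemma biproduct_zero:
  assumes "A \<in> Ob C" "zero_object C Z"
  shows "biproduct C A Z A (Id C A) (Zero C Z A) (Id C A) (Zero C A Z)"
  using assms unfolding biproduct_def by (auto simp: Hom_def zero_object_iff)

lemma biproduct_zero_object:
  assumes "biproduct C A B P i j p q" "zero_object C A" "zero_object C B"
  shows "zero_object C P"
proof -
  have "p = Zero C P A" "q = Zero C P B" using zero_object_eq(1) assms biproductD[OF assms(1)] by metis+
  then have "Id C P = Zero C P P" using biproductD[OF assms(1)]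
    by (metis Add_Zero(1) Comp_Zero Zero_Ar)
  then show ?thesis using biproductD[OF assms(1)] by (simp add: zero_object_iff)
qed

end

section \<open>Duality and exact categories\<close>

definition opc :: "('o, 'm) precat \<Rightarrow> ('o, 'm) precat" where
  "opc C = \<lparr>Ob = Ob C, Ar = Ar C, Dom = Cod C, Cod = Dom C, Id = Id C, Comp = \<lambda>g f. Comp C f g,
    Add = Add C, Zero = \<lambda>A B. Zero C B A\<rparr>"

lemma opc_sel [simp]:
  "Ob (opc C) = Ob C" "Ar (opc C) = Ar C" "Dom (opc C) = Cod C" "Cod (opc C) = Dom C" "Id (opc C) = Id C"
  "g \<cdot>\<^bsub>opc C\<^esub> f = f \<cdot>\<^bsub>C\<^esub> g" "Add (opc C) = Add C" "Zero (opc C) A B = Zero C B A"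
  by (simp_all add: opc_def)

text \<open>Only \<open>Dom\<close> and \<open>Cod\<close> are exchanged while the arrows stay the
  same, so duality is a strict involution: dualising twice returns the original category
  itself.\<close>

lemma opc_opc [simp]: "opc (opc C) = C"
  by (simp add: opc_def)

lemma Hom_opc [simp]: "Hom (opc C) A B = Hom C B A"
  by (auto simp: Hom_def)

lemma hom_group_opc [simp]: "hom_group (opc C) A B = hom_group C B A"
  by (simp add: hom_group_def)

lemma Neg_opc [simp]: "Neg (opc C) f = Neg C f"
  by (simp add: Neg_def)

lemma is_iso_opc [simp]: "is_iso (opc C) f = is_iso C f"
  by (auto simp: is_iso_def)

lemma zero_object_opc [simp]: "zero_object (opc C) Z = zero_object C Z"
  by (auto simp: zero_object_def)

lemma biproduct_opc: "biproduct (opc C) A B P i j p q \<longleftrightarrow> biproduct C A B P p q i j"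
  unfolding biproduct_def by auto

lemma is_kernel_opc [simp]: "is_kernel (opc C) p i = is_cokernel C p i"
  unfolding is_kernel_def is_cokernel_def by auto

lemma is_cokernel_opc [simp]: "is_cokernel (opc C) p i = is_kernel C p i"
  unfolding is_kernel_def is_cokernel_def by auto

lemma is_pushout_opc [simp]: "is_pushout (opc C) i f i' f' = is_pullback C i f i' f'"
  unfolding is_pushout_def is_pullback_def opc_sel Hom_opc by simp

lemma is_pullback_opc [simp]: "is_pullback (opc C) i f i' f' = is_pushout C i f i' f'"
  unfolding is_pushout_def is_pullback_def opc_sel Hom_opc by simp

lemma inflation_converse [simp]: "inflation (S\<inverse>) f = deflation S f"
  by (auto simp: inflation_def deflation_def)

lemma deflation_converse [simp]: "deflation (S\<inverse>) f = inflation S f"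
  by (auto simp: inflation_def deflation_def)

lemma isomorphic_opc:
  assumes "isomorphic (opc C) A B" shows "isomorphic C A B"
proof -
  obtain f where f: "f \<in> Hom C B A" "is_iso C f" using assms unfolding isomorphic_def by auto
  then obtain g where "g \<in> Hom C A B" "g \<cdot>\<^bsub>C\<^esub> f = Id C B" "f \<cdot>\<^bsub>C\<^esub> g = Id C A"
    unfolding is_iso_def by (auto simp: Hom_def)
  then show ?thesis using f unfolding isomorphic_def is_iso_def
    by (auto simp: Hom_def intro!: bexI[of _ g])
qed

lemma (in category) is_pushout_ex1:
  assumes P: "is_pushout C i f j g" and u: "u \<in> Hom C (Cod C i) X" and v: "v \<in> Hom C (Cod C f) X"
    and eq: "u \<cdot> i = v \<cdot> f"
  shows "\<exists>!w. w \<in> Hom C (Cod C j) X \<and> w \<cdot> g = u \<and> w \<cdot> j = v"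
proof -
  have "\<forall>X \<in> Ob C. \<forall>u \<in> Hom C (Cod C i) X. \<forall>v \<in> Hom C (Cod C f) X. u \<cdot> i = v \<cdot> f \<longrightarrow>
      (\<exists>!w. w \<in> Hom C (Cod C j) X \<and> w \<cdot> g = u \<and> w \<cdot> j = v)"
    using P unfolding is_pushout_def by (elim conjE)
  from this[THEN bspec, OF HomD(5)[OF u], THEN bspec, OF u, THEN bspec, OF v, THEN mp, OF eq] show
    ?thesis .
qed

lemma (in category) is_cokernel_ex1:
  assumes P: "is_cokernel C p i" and f: "f \<in> Hom C (Cod C i) X" and eq: "f \<cdot> i = Zero C (Dom C i) X"
  shows "\<exists>!g. g \<in> Hom C (Cod C p) X \<and> g \<cdot> p = f"
proof -
  have "\<forall>X \<in> Ob C. \<forall>f \<in> Hom C (Cod C i) X. f \<cdot> i = Zero C (Dom C i) X \<longrightarrow>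
      (\<exists>!g. g \<in> Hom C (Cod C p) X \<and> g \<cdot> p = f)"
    using P unfolding is_cokernel_def by (elim conjE)
  from this[THEN bspec, OF HomD(5)[OF f], THEN bspec, OF f, THEN mp, OF eq] show ?thesis .
qed

lemma (in category) is_kernel_ex1:
  assumes P: "is_kernel C i p" and f: "f \<in> Hom C X (Dom C p)" and eq: "p \<cdot> f = Zero C X (Cod C p)"
  shows "\<exists>!g. g \<in> Hom C X (Dom C i) \<and> i \<cdot> g = f"
proof -
  have "\<forall>X \<in> Ob C. \<forall>f \<in> Hom C X (Dom C p). p \<cdot> f = Zero C X (Cod C p) \<longrightarrow>
      (\<exists>!g. g \<in> Hom C X (Dom C i) \<and> i \<cdot> g = f)"
    using P unfolding is_kernel_def by (elim conjE)
  from this[THEN bspec, OF HomD(4)[OF f], THEN bspec, OF f, THEN mp, OF eq] show ?thesis .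
qed

lemma Ex1_unique: "\<lbrakk>\<exists>!x. P x; P a; P b\<rbrakk> \<Longrightarrow> a = b"
  by blast

lemma (in category) category_opc: "category (opc C)"
  by unfold_locales (auto simp: Hom_def)

lemma (in additive_category) additive_category_opc: "additive_category (opc C)"
proof -
  interpret O: category "opc C" by (rule category_opc)
  show ?thesis
  proof (intro additive_category.intro additive_category_axioms.intro O.category_axioms)
    show "\<exists>Z. zero_object (opc C) Z" using ex_zero_object by simp
    fix A B assume AB: "A \<in> Ob (opc C)" "B \<in> Ob (opc C)"
    show "\<exists>P i j p q. biproduct (opc C) A B P i j p q"
      using ex_biproduct[of A B] AB unfolding biproduct_opc by (simp) blast
    show "comm_group (hom_group (opc C) A B)" using hom_comm_group[of B A] AB by simp
  qed (auto simp: Hom_def)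
qed

lemma (in exact_category) exact_category_opc: "exact_category (opc C) (S\<inverse>)"
proof -
  interpret O: additive_category "opc C" by (rule additive_category_opc)
  show ?thesis
  proof (intro exact_category.intro exact_category_axioms.intro O.additive_category_axioms)
    show "\<exists>i' f'. is_pushout (opc C) i f i' f' \<and> inflation (S\<inverse>) i'"
      if "inflation (S\<inverse>) i" "f \<in> Ar (opc C)" "Dom (opc C) f = Dom (opc C) i" for i f
      using deflation_pullback[of i f] that by simp
    show "\<exists>i' f'. is_pullback (opc C) i f i' f' \<and> deflation (S\<inverse>) i'"
      if "deflation (S\<inverse>) i" "f \<in> Ar (opc C)" "Cod (opc C) f = Cod (opc C) i" for i f
      using inflation_pushout[of i f] that by simp
    fix i p a b c i' p'
    assume A: "(i, p) \<in> S\<inverse>" "is_iso (opc C) a" "is_iso (opc C) b" "is_iso (opc C) c"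
      "Dom (opc C) a = Dom (opc C) i" "Dom (opc C) b = Cod (opc C) i" "Dom (opc C) c = Cod (opc C) p"
      "i' \<in> Hom (opc C) (Cod (opc C) a) (Cod (opc C) b)"
        "p' \<in> Hom (opc C) (Cod (opc C) b) (Cod (opc C) c)"
      "b \<cdot>\<^bsub>opc C\<^esub> i = i' \<cdot>\<^bsub>opc C\<^esub> a" "c \<cdot>\<^bsub>opc C\<^esub> p = p' \<cdot>\<^bsub>opc C\<^esub> b"
    \<comment> \<open>Duality reverses the three vertical isomorphisms, so closure under isomorphism
      is applied to their inverses.\<close>
    obtain a1 where a1: "a1 \<in> Hom C (Cod C a) (Dom C a)" "a1 \<cdot> a = Id C (Dom C a)"
      "a \<cdot> a1 = Id C (Cod C a)" "is_iso C a1"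
      using A is_isoE[of a] by auto
    obtain b1 where b1: "b1 \<in> Hom C (Cod C b) (Dom C b)" "b1 \<cdot> b = Id C (Dom C b)"
      "b \<cdot> b1 = Id C (Cod C b)" "is_iso C b1"
      using A is_isoE[of b] by auto
    obtain c1 where c1: "c1 \<in> Hom C (Cod C c) (Dom C c)" "c1 \<cdot> c = Id C (Dom C c)"
      "c \<cdot> c1 = Id C (Cod C c)" "is_iso C c1"
      using A is_isoE[of c] by auto
    have pi: "(p, i) \<in> S" using A by simp
    note H = HomD[OF a1(1)] HomD[OF b1(1)] HomD[OF c1(1)]
    have P: "p \<in> Ar C" "i \<in> Ar C" "Cod C p = Dom C i" using conflation_kernel[OF pi]
      unfolding is_kernel_def by auto
    have Q: "i' \<in> Ar C" "p' \<in> Ar C" "Dom C i' = Dom C b" "Cod C i' = Dom C a" "Dom C p' = Dom C c"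
      "Cod C p' = Dom C b"
      using A by (auto simp: Hom_def)
    have T: "a \<in> Ar C" "b \<in> Ar C" "c \<in> Ar C" using A by (auto simp: is_iso_def)
    have E1: "i \<cdot> b = a \<cdot> i'" and E2: "p \<cdot> c = b \<cdot> p'" using A by auto
    have D: "Cod C a = Cod C i" "Cod C b = Dom C i" "Cod C c = Dom C p" using A by auto
    have "b1 \<cdot> p = b1 \<cdot> ((p \<cdot> c) \<cdot> c1)" using c1(3) H P T D by simp
    also have "\<dots> = (b1 \<cdot> b) \<cdot> (p' \<cdot> c1)" unfolding E2 using H P T D Q by simp
    finally have 1: "b1 \<cdot> p = p' \<cdot> c1" unfolding b1(2) using H P T D Q by simp
    have "a1 \<cdot> i = a1 \<cdot> ((i \<cdot> b) \<cdot> b1)" using b1(3) H P T D by simp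
    also have "\<dots> = (a1 \<cdot> a) \<cdot> (i' \<cdot> b1)" unfolding E1 using H P T D Q by simp
    finally have 2: "a1 \<cdot> i = i' \<cdot> b1" unfolding a1(2) using H P T D Q by simp
    have "(p', i') \<in> S"
      using conflation_iso[OF pi c1(4) b1(4) a1(4), of p' i'] A H P 1 2 by (auto simp: Hom_def)
    then show "(i', p') \<in> S\<inverse>" by simp
  qed (auto intro: conflation_kernel conflation_cokernel inflation_Id deflation_Id inflation_Comp
    deflation_Comp)
qed

section \<open>Consequences of Quillen's axioms\<close>

context exact_category
begin

lemma conflationD:
  assumes "(i, p) \<in> S"
  shows "i \<in> Ar C" "p \<in> Ar C" "Cod C i = Dom C p" "p \<cdot> i = Zero C (Dom C i) (Cod C p)"
    "f \<in> Ar C \<Longrightarrow> Cod C f = Dom C i \<Longrightarrow> p \<cdot> (i \<cdot> f) = Zero C (Dom C f) (Cod C p)"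
proof -
  show *: "i \<in> Ar C" "p \<in> Ar C" "Cod C i = Dom C p" "p \<cdot> i = Zero C (Dom C i) (Cod C p)"
    using conflation_kernel[OF assms] unfolding is_kernel_def by auto
  show "f \<in> Ar C \<Longrightarrow> Cod C f = Dom C i \<Longrightarrow> p \<cdot> (i \<cdot> f) = Zero C (Dom C f) (Cod C p)"
    using * Comp_cong_left[of p i _ f] by simp
qed

lemma conflation_lift:
  assumes "(i, p) \<in> S" "f \<in> Hom C X (Dom C p)" "p \<cdot> f = Zero C X (Cod C p)"
  obtains g where "g \<in> Hom C X (Dom C i)" "i \<cdot> g = f"
  using is_kernel_ex1[OF conflation_kernel[OF assms(1)] assms(2,3)] by blast

lemma conflation_colift:
  assumes "(i, p) \<in> S" "f \<in> Hom C (Cod C i) X" "f \<cdot> i = Zero C (Dom C i) X"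
  obtains g where "g \<in> Hom C (Cod C p) X" "g \<cdot> p = f"
  using is_cokernel_ex1[OF conflation_cokernel[OF assms(1)] assms(2,3)] by blast

lemma inflation_mono:
  assumes "inflation S i" "f \<in> Hom C X (Dom C i)" "g \<in> Hom C X (Dom C i)" "i \<cdot> f = i \<cdot> g"
  shows "f = g"
proof -
  obtain p where S: "(i, p) \<in> S" using assms unfolding inflation_def by auto
  have "i \<cdot> f \<in> Hom C X (Dom C p)" "p \<cdot> (i \<cdot> f) = Zero C X (Cod C p)"
    using conflationD[OF S] assms by (auto simp: Hom_def)
  then show ?thesis
    using is_kernel_ex1[OF conflation_kernel[OF S], of "i \<cdot> f" X] assms by metis
qed

lemma deflation_epi:
  assumes "deflation S p" "f \<in> Hom C (Cod C p) X" "g \<in> Hom C (Cod C p) X" "f \<cdot> p = g \<cdot> p"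
  shows "f = g"
proof -
  interpret O: exact_category "opc C" "S\<inverse>" by (rule exact_category_opc)
  show ?thesis using O.inflation_mono[of p f X g] assms by simp
qed

text \<open>Two cokernels of \<open>i\<close> differ by an isomorphism, and conflations are closed
  under isomorphism.\<close>

lemma conflation_cokernelI:
  assumes "inflation S i" "is_cokernel C p' i"
  shows "(i, p') \<in> S"
proof -
  obtain p where S: "(i, p) \<in> S" using assms unfolding inflation_def by auto
  note D = conflationD[OF S]
  have dp: "deflation S p" using S unfolding deflation_def by blast
  have p': "p' \<in> Ar C" "Dom C p' = Dom C p" "p' \<cdot> i = Zero C (Dom C i) (Cod C p')"
    using assms(2) D unfolding is_cokernel_def by auto
  obtain c where c: "c \<in> Hom C (Cod C p) (Cod C p')" "c \<cdot> p = p'"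
    using conflation_colift[OF S, of p' "Cod C p'"] p' D by (auto simp: Hom_def)
  obtain c' where c': "c' \<in> Hom C (Cod C p') (Cod C p)" "c' \<cdot> p' = p"
    using is_cokernel_ex1[OF assms(2), of p "Cod C p"] D by (auto simp: Hom_def)
  note H = HomD[OF c(1)] HomD[OF c'(1)]
  have "c' \<cdot> c \<cdot> p = p" using c c' H D p' by simp
  then have 1: "c' \<cdot> c = Id C (Cod C p)"
    using deflation_epi[OF dp, of "c' \<cdot> c" "Cod C p" "Id C (Cod C p)"] D H by (simp add: Hom_def)
  have "c \<cdot> c' \<cdot> p' = p'" using c c' H D p' by simp
  moreover have "Id C (Cod C p') \<cdot> p' = p'" using p' by simp
  moreover have "\<exists>!g. g \<in> Hom C (Cod C p') (Cod C p') \<and> g \<cdot> p' = p'"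
    using is_cokernel_ex1[OF assms(2), of p' "Cod C p'"] p' D by (auto simp: Hom_def)
  ultimately have 2: "c \<cdot> c' = Id C (Cod C p')" using H
    by (metis Comp_Hom Id_Hom c'(1) c(1))
  have "is_iso C c" using is_isoI[OF c(1) c'(1) 1 2] .
  moreover have "is_iso C (Id C (Dom C i))" "is_iso C (Id C (Cod C i))" using D by auto
  ultimately show ?thesis
    using conflation_iso[OF S, of "Id C (Dom C i)" "Id C (Cod C i)" c i p'] D H p' c
      by (auto simp: Hom_def)
qed

lemma conflation_Id_zero:
  assumes "zero_object C Z" "A \<in> Ob C"
  shows "(Id C A, Zero C A Z) \<in> S" 
proof (rule conflation_cokernelI)
  show "inflation S (Id C A)" using assms inflation_Id by simp
  show "is_cokernel C (Zero C A Z) (Id C A)"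
    unfolding is_cokernel_def
  proof (intro conjI ballI impI)
    fix X f assume X: "X \<in> Ob C" and f: "f \<in> Hom C (Cod C (Id C A)) X"
      "f \<cdot> Id C A = Zero C (Dom C (Id C A)) X"
    then have "f = Zero C A X" using assms by (auto simp: Hom_def)
    then show "\<exists>!g. g \<in> Hom C (Cod C (Zero C A Z)) X \<and> g \<cdot> Zero C A Z = f"
      using assms X zero_object_parallel(2)[OF assms(1)]
      by (intro ex1I[of _ "Zero C Z X"]) (auto simp: Hom_def)
  qed (use assms in auto)
qed

text \<open>The axiom provides one pushout square with this property; uniqueness of pushouts up to
  isomorphism extends it to every pushout square.\<close>

lemma inflation_of_pushout:
  assumes "inflation S i" "is_pushout C i f j g"
  shows "inflation S j"
proof -
  have f: "f \<in> Ar C" "Dom C f = Dom C i" "i \<in> Ar C" "j \<in> Ar C" "g \<in> Ar C" "Cod C i = Dom C g"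
    "Cod C f = Dom C j" "Cod C j = Cod C g" "g \<cdot> i = j \<cdot> f"
    using assms(2) unfolding is_pushout_def by auto
  obtain j' g' where P: "is_pushout C i f j' g'" "inflation S j'"
    using inflation_pushout[OF assms(1) f(1,2)] by auto
  have P': "j' \<in> Ar C" "g' \<in> Ar C" "Cod C i = Dom C g'" "Cod C f = Dom C j'" "Cod C j' = Cod C g'"
    "g' \<cdot> i = j' \<cdot> f"
    using P(1) unfolding is_pushout_def by auto
  have U: "\<exists>!w. w \<in> Hom C (Cod C j) (Cod C v) \<and> w \<cdot> g = u \<and> w \<cdot> j = v"
    if "u \<in> Ar C" "v \<in> Ar C" "Dom C u = Cod C i" "Dom C v = Cod C f" "Cod C u = Cod C v"
      "u \<cdot> i = v \<cdot> f" for u v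
    using is_pushout_ex1[OF assms(2) _ _ that(6), of "Cod C v"] that by (auto simp: Hom_def)
  have U': "\<exists>!w. w \<in> Hom C (Cod C j') (Cod C v) \<and> w \<cdot> g' = u \<and> w \<cdot> j' = v"
    if "u \<in> Ar C" "v \<in> Ar C" "Dom C u = Cod C i" "Dom C v = Cod C f" "Cod C u = Cod C v"
      "u \<cdot> i = v \<cdot> f" for u v
    using is_pushout_ex1[OF P(1) _ _ that(6), of "Cod C v"] that by (auto simp: Hom_def)
  obtain w where w: "w \<in> Hom C (Cod C j) (Cod C j')" "w \<cdot> g = g'" "w \<cdot> j = j'"
    using U[of g' j'] P' f by auto
  obtain w' where w': "w' \<in> Hom C (Cod C j') (Cod C j)" "w' \<cdot> g' = g" "w' \<cdot> j' = j"
    using U'[of g j] P' f by auto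
  note H = HomD[OF w(1)] HomD[OF w'(1)]
  have "w' \<cdot> w \<in> Hom C (Cod C j) (Cod C j) \<and> w' \<cdot> w \<cdot> g = g \<and> w' \<cdot> w \<cdot> j = j"
    "Id C (Cod C j) \<in> Hom C (Cod C j) (Cod C j) \<and> Id C (Cod C j) \<cdot> g = g \<and> Id C (Cod C j) \<cdot> j = j"
    using w w' H f by (simp_all add: Hom_def)
  moreover have "\<exists>!w. w \<in> Hom C (Cod C j) (Cod C j) \<and> w \<cdot> g = g \<and> w \<cdot> j = j" using U[of g j] f by simp
  ultimately have 1: "w' \<cdot> w = Id C (Cod C j)" by (elim Ex1_unique)
  have "w \<cdot> w' \<in> Hom C (Cod C j') (Cod C j') \<and> w \<cdot> w' \<cdot> g' = g' \<and> w \<cdot> w' \<cdot> j' = j'"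
    "Id C (Cod C j') \<in> Hom C (Cod C j') (Cod C j') \<and> Id C (Cod C j') \<cdot> g' = g' \<and>
      Id C (Cod C j') \<cdot> j' = j'"
    using w w' H f P' by (simp_all add: Hom_def)
  moreover have "\<exists>!w. w \<in> Hom C (Cod C j') (Cod C j') \<and> w \<cdot> g' = g' \<and> w \<cdot> j' = j'"
    using U'[of g' j'] P' f by simp
  ultimately have 2: "w \<cdot> w' = Id C (Cod C j')" by (elim Ex1_unique)
  have iso: "is_iso C w'" using is_isoI[OF w'(1) w(1) 2 1] .
  obtain p where S: "(j', p) \<in> S" using P unfolding inflation_def by auto
  note D = conflationD[OF S]
  have "(j, p \<cdot> w) \<in> S"
    using conflation_iso[OF S is_iso_Id[of "Dom C j'"] iso is_iso_Id[of "Cod C p"], of j "p \<cdot> w"] D H w'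
      f P' w 1 2
    by (auto simp: Hom_def)
  then show ?thesis unfolding inflation_def by auto
qed

text \<open>The inclusion \<open>i\<close> is a pushout of the inflation from a zero object to
  \<open>B\<close> along the arrow from the zero object to \<open>A\<close>.\<close>

lemma conflation_biproduct:
  assumes b: "biproduct C A B P i j p q"
  shows "(i, q) \<in> S"
proof (rule conflation_cokernelI)
  obtain Z where Z: "zero_object C Z" using ex_zero_object by auto
  interpret O: exact_category "opc C" "S\<inverse>" by (rule exact_category_opc)
  note [simp] = biproduct_simps[OF b]
  have "(Zero C Z B, Id C B) \<in> S" using O.conflation_Id_zero[of Z B] Z by simp
  then have infl: "inflation S (Zero C Z B)" unfolding inflation_def by blast
  have "is_pushout C (Zero C Z B) (Zero C Z A) i j"
    unfolding is_pushout_def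
  proof (intro conjI ballI impI)
    fix X u v assume X: "X \<in> Ob C" and u: "u \<in> Hom C (Cod C (Zero C Z B)) X"
      and v: "v \<in> Hom C (Cod C (Zero C Z A)) X"
    have H: "u \<in> Ar C" "Dom C u = B" "Cod C u = X" "v \<in> Ar C" "Dom C v = A" "Cod C v = X"
      using u v Z by (auto simp: Hom_def)
    let ?w = "v \<cdot> p \<oplus> u \<cdot> q"
    have w: "?w \<in> Hom C P X" "?w \<cdot> j = u" "?w \<cdot> i = v" using H by (auto simp: Hom_def)
    then show "\<exists>!w. w \<in> Hom C (Cod C i) X \<and> w \<cdot> j = u \<and> w \<cdot> i = v"
      by (intro ex1I[of _ ?w]) (auto intro: biproduct_eqI'[OF b])
  qed (use Z in auto)
  then show "inflation S i" using inflation_of_pushout infl by blast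
  show "is_cokernel C q i"
    unfolding is_cokernel_def
  proof (intro conjI ballI impI)
    fix X f assume X: "X \<in> Ob C" and f: "f \<in> Hom C (Cod C i) X" "f \<cdot> i = Zero C (Dom C i) X"
    note H = HomD[OF f(1)]
    have "f = f \<cdot> i \<cdot> p \<oplus> f \<cdot> j \<cdot> q" using biproduct_decomp(2)[OF b, of f] H by simp
    then have "f = f \<cdot> j \<cdot> q" unfolding f(2) using H X by simp
    then show "\<exists>!g. g \<in> Hom C (Cod C q) X \<and> g \<cdot> q = f"
    proof (intro ex1I[of _ "f \<cdot> j"])
      fix g assume g: "g \<in> Hom C (Cod C q) X \<and> g \<cdot> q = f"
      note HomD[OF conjunct1[OF g]]
      then show "g = f \<cdot> j" using g by auto
    qed (use H in \<open>auto simp: Hom_def\<close>)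
  qed auto
qed

text \<open>The arrow (f, \<iota>) is the composite of the graph (f, 1) from \<open>A\<close> to the
  sum of \<open>B\<close> and \<open>A\<close>, which is split, with the sum of the identity of
  \<open>B\<close> and \<open>\<iota>\<close>. The latter is a pushout of
  \<open>\<iota>\<close>.\<close>

lemma inflation_biproduct:
  assumes b: "biproduct C B A' P i j p q" and f: "f \<in> Hom C A B" and \<iota>: "\<iota> \<in> Hom C A A'" "inflation S \<iota>"
  shows "inflation S (i \<cdot> f \<oplus> j \<cdot> \<iota>)"
proof -
  note [simp] = biproduct_simps[OF b] HomD[OF f] HomD[OF \<iota>(1)]
  obtain Q i1 j1 p1 q1 where Q: "biproduct C B A Q i1 j1 p1 q1" using ex_biproduct[of B A] by auto
  note [simp] = biproduct_simps[OF Q]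
  have "(j1 \<oplus> i1 \<cdot> f, p1 \<ominus> f \<cdot> q1) \<in> S"
    by (rule conflation_biproduct[OF biproduct_shear[OF biproduct_commute[OF Q] f]])
  then have 1: "inflation S (j1 \<oplus> i1 \<cdot> f)" unfolding inflation_def by auto
  let ?m = "i \<cdot> p1 \<oplus> j \<cdot> (\<iota> \<cdot> q1)"
  have "is_pushout C \<iota> j1 ?m j"
    unfolding is_pushout_def
  proof (intro conjI ballI impI)
    fix X u v assume X: "X \<in> Ob C" and u: "u \<in> Hom C (Cod C \<iota>) X" and v: "v \<in> Hom C (Cod C j1) X"
      and eq: "u \<cdot> \<iota> = v \<cdot> j1"
    have H: "u \<in> Ar C" "Dom C u = A'" "Cod C u = X" "v \<in> Ar C" "Dom C v = Q" "Cod C v = X"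
      using u v by (auto simp: Hom_def)
    let ?w = "v \<cdot> (i1 \<cdot> p) \<oplus> u \<cdot> q"
    have "u \<cdot> (\<iota> \<cdot> q1) = v \<cdot> (j1 \<cdot> q1)"
      using H eq Comp_assoc'[of q1 \<iota> u] Comp_assoc'[of q1 j1 v] by simp
    then have w: "?w \<in> Hom C P X" "?w \<cdot> j = u" "?w \<cdot> ?m = v"
      using H biproduct_decomp(2)[OF Q, of v] by (auto simp: Hom_def)
    show "\<exists>!w. w \<in> Hom C (Cod C ?m) X \<and> w \<cdot> j = u \<and> w \<cdot> ?m = v"
    proof (intro ex1I[of _ ?w])
      fix w' assume w': "w' \<in> Hom C (Cod C ?m) X \<and> w' \<cdot> j = u \<and> w' \<cdot> ?m = v"
      have H': "w' \<in> Ar C" "Dom C w' = P" "Cod C w' = X" using w' by (auto simp: Hom_def)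
      have "w' \<cdot> i = w' \<cdot> ?m \<cdot> i1" using H' by simp
      also have "\<dots> = v \<cdot> i1" using w' by simp
      also have "\<dots> = ?w \<cdot> i" using H by simp
      finally have "w' \<cdot> i = ?w \<cdot> i" .
      moreover have "w' \<cdot> j = ?w \<cdot> j" using w w' by simp
      ultimately show "w' = ?w" using biproduct_eqI'[OF b _ w(1), of w'] H' by (auto simp: Hom_def)
    qed (use w in simp)
  qed auto
  then have "inflation S ?m" using inflation_of_pushout[OF \<iota>(2)] by blast
  then have "inflation S (?m \<cdot> (j1 \<oplus> i1 \<cdot> f))" by (intro inflation_Comp[OF 1]) auto
  moreover have "?m \<cdot> (j1 \<oplus> i1 \<cdot> f) = i \<cdot> f \<oplus> j \<cdot> \<iota>" by (simp add: Add_ac)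
  ultimately show ?thesis by simp
qed

text \<open>Subtracting \<open>\<alpha>\<close> times the first coordinate from the second turns (f,
  \<alpha> f) into (f, 0). An additional summand thus repairs what the lack of weak idempotent
  completeness breaks.\<close>

lemma inflation_biproduct_zero:
  assumes b: "biproduct C B A' P i j p q" and f: "f \<in> Hom C A B"
    and \<alpha>: "\<alpha> \<in> Hom C B A'" "inflation S (\<alpha> \<cdot> f)"
  shows "inflation S (i \<cdot> f)"
proof -
  note [simp] = biproduct_simps[OF b] HomD[OF f] HomD[OF \<alpha>(1)]
  have "Neg C \<alpha> \<in> Hom C B A'" by (simp add: Hom_def)
  from inflation_biproduct[OF biproduct_shear[OF b this] f _ \<alpha>(2)]
  have "inflation S ((i \<oplus> j \<cdot> Neg C \<alpha>) \<cdot> f \<oplus> j \<cdot> (\<alpha> \<cdot> f))" by (simp add: Hom_def)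
  moreover have "(i \<oplus> j \<cdot> Neg C \<alpha>) \<cdot> f \<oplus> j \<cdot> (\<alpha> \<cdot> f) = i \<cdot> f" by (simp add: hom_algebra)
  ultimately show ?thesis by simp
qed

text \<open>Arrows out of the pushout that kill \<open>i'\<close> correspond to arrows out of
  \<open>Cod C i\<close> that kill \<open>i\<close>, so both inflations have the same cokernel
  object.\<close>

lemma pushout_conflation:
  assumes S: "(i, p) \<in> S" and f: "f \<in> Ar C" "Dom C f = Dom C i"
  obtains i' f' p' where "is_pushout C i f i' f'" "(i', p') \<in> S" "p' \<cdot> f' = p" "Cod C p' = Cod C p"
proof -
  note D = conflationD[OF S]
  obtain i' f' where P: "is_pushout C i f i' f'" and I: "inflation S i'"
    using inflation_pushout[OF _ f] S unfolding inflation_def by blast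
  have T: "i' \<in> Ar C" "f' \<in> Ar C" "Dom C f' = Dom C p" "Dom C i' = Cod C f" "Cod C i' = Cod C f'"
    "f' \<cdot> i = i' \<cdot> f"
    using P D unfolding is_pushout_def by auto
  have U: "\<exists>!w. w \<in> Hom C (Cod C f') X \<and> w \<cdot> f' = u \<and> w \<cdot> i' = v"
    if "X \<in> Ob C" "u \<in> Hom C (Dom C p) X" "v \<in> Hom C (Cod C f) X" "u \<cdot> i = v \<cdot> f" for u v X
    using is_pushout_ex1[OF P _ that(3,4)] that(2) D T by simp
  obtain p' where p': "p' \<in> Hom C (Cod C f') (Cod C p)" "p' \<cdot> f' = p"
    "p' \<cdot> i' = Zero C (Cod C f) (Cod C p)"
    using U[of "Cod C p" p "Zero C (Cod C f) (Cod C p)"] D f by (auto simp: Hom_def)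
  note H = HomD[OF p'(1)]
  have "is_cokernel C p' i'"
    unfolding is_cokernel_def
  proof (intro conjI ballI impI)
    fix X g assume X: "X \<in> Ob C" and g: "g \<in> Hom C (Cod C i') X" "g \<cdot> i' = Zero C (Dom C i') X"
    note G = HomD[OF g(1)]
    have "g \<cdot> f' \<cdot> i = g \<cdot> i' \<cdot> f" using T G D f by simp
    then have "g \<cdot> f' \<cdot> i = Zero C (Dom C i) X" unfolding g(2) using f T X by simp
    then obtain k where k: "k \<in> Hom C (Cod C p) X" "k \<cdot> p = g \<cdot> f'"
      using conflation_colift[OF S, of "g \<cdot> f'" X] T G D by (auto simp: Hom_def)
    note K = HomD[OF k(1)]
    have "\<exists>!w. w \<in> Hom C (Cod C f') X \<and> w \<cdot> f' = k \<cdot> p \<and> w \<cdot> i' = Zero C (Cod C f) X"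
      using U[of X "k \<cdot> p" "Zero C (Cod C f) X"] K X f D by (auto simp: Hom_def)
    moreover have "g \<in> Hom C (Cod C f') X \<and> g \<cdot> f' = k \<cdot> p \<and> g \<cdot> i' = Zero C (Cod C f) X"
      using g k T G by (auto simp: Hom_def)
    moreover have "k \<cdot> p' \<in> Hom C (Cod C f') X \<and> k \<cdot> p' \<cdot> f' = k \<cdot> p \<and> k \<cdot> p' \<cdot> i' = Zero C (Cod C f) X"
      using K p' H T X f by (auto simp: Hom_def)
    ultimately have "k \<cdot> p' = g" by blast
    then show "\<exists>!k. k \<in> Hom C (Cod C p') X \<and> k \<cdot> p' = g"
    proof (intro ex1I[of _ k])
      fix k' assume k': "k' \<in> Hom C (Cod C p') X \<and> k' \<cdot> p' = g"
      have "k' \<in> Ar C" "Dom C k' = Cod C p" "Cod C k' = X" using k' H by (auto simp: Hom_def)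
      then have "k' \<cdot> p = k \<cdot> p" using k' p'(2)[symmetric] \<open>k \<cdot> p' = g\<close> K H T
        by (metis Comp_assoc')
      then show "k' = k" using deflation_epi[of p k' X k] S k k' H unfolding deflation_def by auto
    qed (use K k H in \<open>auto simp: Hom_def\<close>)
  qed (use H T D f p' in auto)
  then have "(i', p') \<in> S" using conflation_cokernelI[OF I] by blast
  then show thesis using that[OF P _ p'(2)] H by auto
qed

lemma conflation_zero_iso:
  assumes S: "(i, p) \<in> S" and Z: "zero_object C (Dom C i)"
  shows "is_iso C p"
proof -
  note D = conflationD[OF S]
  have "Id C (Dom C p) \<cdot> i = Zero C (Dom C i) (Dom C p)" using D zero_object_eq(2)[OF Z, of i] by simp
  then obtain g where g: "g \<in> Hom C (Cod C p) (Dom C p)" "g \<cdot> p = Id C (Dom C p)"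
    using conflation_colift[OF S, of "Id C (Dom C p)" "Dom C p"] D by (auto simp: Hom_def)
  note H = HomD[OF g(1)]
  have "p \<cdot> g \<cdot> p = p" using g H D by simp
  then have "p \<cdot> g = Id C (Cod C p)"
    using deflation_epi[of p "p \<cdot> g" "Cod C p" "Id C (Cod C p)"] S H D unfolding deflation_def
    by (auto simp: Hom_def)
  then show ?thesis using is_isoI[of p "Dom C p" "Cod C p" g] g D by (auto simp: Hom_def)
qed

text \<open>By the previous shear (f, 0) is an inflation, and its cokernel is the sum of
  \<open>p\<close> and the identity of \<open>A'\<close>. Pulling this deflation back along the
  inclusion of \<open>Cod C p\<close> gives \<open>p\<close>, so \<open>p\<close> is a deflation;
  its kernel is \<open>f\<close>.\<close>

lemma obscure_axiom:
  assumes f: "f \<in> Hom C A B" and \<alpha>: "\<alpha> \<in> Hom C B A'" "inflation S (\<alpha> \<cdot> f)" and p: "is_cokernel C p f"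
  shows "(f, p) \<in> S"
proof -
  obtain P i j pr q where b: "biproduct C B A' P i j pr q" using ex_biproduct[of B A'] HomD[OF \<alpha>(1)]
    by auto
  note [simp] = biproduct_simps[OF b] HomD[OF f] HomD[OF \<alpha>(1)]
  have T [simp]: "p \<in> Ar C" "Dom C p = B" "p \<cdot> f = Zero C A (Cod C p)" using p
    unfolding is_cokernel_def by auto
  have I: "inflation S (i \<cdot> f)" by (rule inflation_biproduct_zero[OF b f \<alpha>])
  obtain Q i1 j1 p1 q1 where Q: "biproduct C (Cod C p) A' Q i1 j1 p1 q1"
    using ex_biproduct[of "Cod C p" A'] by auto
  note [simp] = biproduct_simps[OF Q]
  let ?m = "i1 \<cdot> (p \<cdot> pr) \<oplus> j1 \<cdot> q"
  have "is_cokernel C ?m (i \<cdot> f)"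
    unfolding is_cokernel_def
  proof (intro conjI ballI impI)
    fix X g assume X: "X \<in> Ob C" and g: "g \<in> Hom C (Cod C (i \<cdot> f)) X"
      "g \<cdot> (i \<cdot> f) = Zero C (Dom C (i \<cdot> f)) X"
    have G: "g \<in> Ar C" "Dom C g = P" "Cod C g = X" using HomD[OF g(1)] by auto
    have "g \<cdot> i \<in> Hom C (Cod C f) X" "g \<cdot> i \<cdot> f = Zero C (Dom C f) X" using g(2) G by (auto simp: Hom_def)
    then obtain k where k: "k \<in> Hom C (Cod C p) X" "k \<cdot> p = g \<cdot> i"
      and ku: "\<And>k'. k' \<in> Hom C (Cod C p) X \<Longrightarrow> k' \<cdot> p = g \<cdot> i \<Longrightarrow> k' = k"
      using is_cokernel_ex1[OF p, of "g \<cdot> i" X] by metis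
    note K = HomD[OF k(1)]
    have "k \<cdot> (p \<cdot> pr) = g \<cdot> (i \<cdot> pr)" using k(2) K G Comp_assoc'[of pr p k] Comp_assoc'[of pr i g]
      by simp
    then have "(k \<cdot> p1 \<oplus> g \<cdot> (j \<cdot> q1)) \<cdot> ?m = g" using biproduct_decomp(2)[OF b, of g] K G by simp
    then show "\<exists>!k. k \<in> Hom C (Cod C ?m) X \<and> k \<cdot> ?m = g"
    proof (intro ex1I[of _ "k \<cdot> p1 \<oplus> g \<cdot> (j \<cdot> q1)"])
      fix w assume w: "w \<in> Hom C (Cod C ?m) X \<and> w \<cdot> ?m = g"
      have W: "w \<in> Ar C" "Dom C w = Q" "Cod C w = X" using HomD[OF conjunct1[OF w]] by auto
      have 1: "w \<cdot> ?m \<cdot> i = w \<cdot> i1 \<cdot> p" "w \<cdot> ?m \<cdot> j = w \<cdot> j1" using W by auto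
      have "w \<cdot> i1 = k" using 1(1) w W by (intro ku) (auto simp: Hom_def)
      moreover have "w \<cdot> j1 = g \<cdot> j" using 1(2) w by simp
      ultimately show "w = k \<cdot> p1 \<oplus> g \<cdot> (j \<cdot> q1)" using biproduct_decomp(2)[OF Q, of w] W G by simp
    qed (use K G in \<open>auto simp: Hom_def\<close>)
  qed auto
  then have S: "(i \<cdot> f, ?m) \<in> S" using conflation_cokernelI[OF I] by blast
  interpret O: exact_category "opc C" "S\<inverse>" by (rule exact_category_opc)
  have "is_pullback C ?m i1 p i"
    unfolding is_pullback_def
  proof (intro conjI ballI impI)
    fix X u v assume X: "X \<in> Ob C" and u: "u \<in> Hom C X (Dom C ?m)" and v: "v \<in> Hom C X (Dom C i1)"
      and eq: "?m \<cdot> u = i1 \<cdot> v"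
    have U: "u \<in> Ar C" "Dom C u = X" "Cod C u = P" "v \<in> Ar C" "Dom C v = X" "Cod C v = Cod C p"
      using HomD[OF u] HomD[OF v] by auto
    have "p1 \<cdot> (?m \<cdot> u) = p1 \<cdot> (i1 \<cdot> v)" "q1 \<cdot> (?m \<cdot> u) = q1 \<cdot> (i1 \<cdot> v)" using eq by auto
    then have 1: "p \<cdot> (pr \<cdot> u) = v" "q \<cdot> u = Zero C X A'" using U by auto
    have "i \<cdot> (pr \<cdot> u) \<oplus> j \<cdot> (q \<cdot> u) = i \<cdot> (pr \<cdot> u)" using U 1 X by simp
    then have "i \<cdot> (pr \<cdot> u) = u" using biproduct_decomp(1)[OF b, of u] U by metis
    then show "\<exists>!w. w \<in> Hom C X (Dom C p) \<and> i \<cdot> w = u \<and> p \<cdot> w = v"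
    proof (intro ex1I[of _ "pr \<cdot> u"])
      fix w assume w: "w \<in> Hom C X (Dom C p) \<and> i \<cdot> w = u \<and> p \<cdot> w = v"
      then show "w = pr \<cdot> u" using HomD[OF conjunct1[OF w]] by auto
    qed (use U 1 in \<open>auto simp: Hom_def\<close>)
  qed auto
  moreover have "deflation S ?m" using S unfolding deflation_def by blast
  ultimately have dp: "deflation S p" using O.inflation_of_pushout[of ?m i1 p i] by simp
  have "is_kernel C f p"
    unfolding is_kernel_def
  proof (intro conjI ballI impI)
    fix X u assume X: "X \<in> Ob C" and u: "u \<in> Hom C X (Dom C p)" "p \<cdot> u = Zero C X (Cod C p)"
    have U: "u \<in> Ar C" "Dom C u = X" "Cod C u = B" using HomD[OF u(1)] by auto
    have "?m \<cdot> (i \<cdot> u) = Zero C X Q" using U u X by simp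
    then obtain t where t: "t \<in> Hom C X A" "(i \<cdot> f) \<cdot> t = i \<cdot> u"
      using conflation_lift[OF S, of "i \<cdot> u" X] U by (auto simp: Hom_def)
    note TT = HomD[OF t(1)]
    have "pr \<cdot> ((i \<cdot> f) \<cdot> t) = pr \<cdot> (i \<cdot> u)" using t(2) by simp
    then have "f \<cdot> t = u" using TT U by simp
    then show "\<exists>!g. g \<in> Hom C X (Dom C f) \<and> f \<cdot> g = u"
    proof (intro ex1I[of _ t])
      fix t' assume t': "t' \<in> Hom C X (Dom C f) \<and> f \<cdot> t' = u"
      have "t' \<in> Hom C X A" using t' by simp
      moreover have "(i \<cdot> f) \<cdot> t' = (i \<cdot> f) \<cdot> t" using t' t HomD[OF conjunct1[OF t']] TT by simp
      ultimately show "t' = t" using inflation_mono[OF I, of t' X t] t by simp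
    qed (use t in auto)
  qed auto
  then show ?thesis using O.conflation_cokernelI[of p f] dp by simp
qed

text \<open>The universal property of the square, rewritten with a sign, says that (b, -e) is a
  cokernel of (D, a), and (D, a) is an inflation because \<open>a\<close> is one.\<close>

lemma pushout_biproduct_conflation:
  assumes a: "inflation S a" and P: "is_pushout C a D b e"
    and bi: "biproduct C (Cod C D) (Cod C a) Q i j p q"
  shows "(i \<cdot> D \<oplus> j \<cdot> a, b \<cdot> p \<ominus> e \<cdot> q) \<in> S"
proof (rule conflation_cokernelI)
  have T [simp]: "a \<in> Ar C" "D \<in> Ar C" "b \<in> Ar C" "e \<in> Ar C" "Dom C D = Dom C a" "Dom C b = Cod C D"
    "Dom C e = Cod C a" "Cod C b = Cod C e" and eq: "e \<cdot> a = b \<cdot> D"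
    using P unfolding is_pushout_def by auto
  note [simp] = biproduct_simps[OF bi]
  show "inflation S (i \<cdot> D \<oplus> j \<cdot> a)" by (rule inflation_biproduct[where A = "Dom C a", OF bi _ _ a])
    (auto simp: Hom_def)
  show "is_cokernel C (b \<cdot> p \<ominus> e \<cdot> q) (i \<cdot> D \<oplus> j \<cdot> a)"
    unfolding is_cokernel_def
  proof (intro conjI ballI impI)
    fix X g assume X: "X \<in> Ob C" and g: "g \<in> Hom C (Cod C (i \<cdot> D \<oplus> j \<cdot> a)) X"
      "g \<cdot> (i \<cdot> D \<oplus> j \<cdot> a) = Zero C (Dom C (i \<cdot> D \<oplus> j \<cdot> a)) X"
    have G: "g \<in> Ar C" "Dom C g = Q" "Cod C g = X" using HomD[OF g(1)] by auto
    have "g \<cdot> (i \<cdot> D) \<oplus> g \<cdot> (j \<cdot> a) = Zero C (Dom C a) X" using g(2) G by simp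
    then have "Neg C (g \<cdot> (j \<cdot> a)) = g \<cdot> (i \<cdot> D)" using G X by (simp add: hom_algebra)
    then have "Neg C (g \<cdot> j) \<cdot> a = (g \<cdot> i) \<cdot> D" using G by simp
    moreover have "Neg C (g \<cdot> j) \<in> Hom C (Cod C a) X" "g \<cdot> i \<in> Hom C (Cod C D) X" using G
      by (auto simp: Hom_def)
    ultimately obtain w where w: "w \<in> Hom C (Cod C b) X" "w \<cdot> e = Neg C (g \<cdot> j)" "w \<cdot> b = g \<cdot> i"
      and wu: "\<And>w'. w' \<in> Hom C (Cod C b) X \<Longrightarrow> w' \<cdot> e = Neg C (g \<cdot> j) \<Longrightarrow> w' \<cdot> b = g \<cdot> i \<Longrightarrow> w' = w"
      using is_pushout_ex1[OF P, of "Neg C (g \<cdot> j)" X "g \<cdot> i"] by metis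
    note W = HomD[OF w(1)]
    have 1: "w \<cdot> (b \<cdot> p) = g \<cdot> (i \<cdot> p)" "w \<cdot> (e \<cdot> q) = Neg C (g \<cdot> (j \<cdot> q))"
      using Comp_assoc'[of p b w] Comp_assoc'[of q e w] w W G by simp_all
    have "w \<cdot> (b \<cdot> p \<ominus> e \<cdot> q) = g \<cdot> (i \<cdot> p) \<ominus> Neg C (g \<cdot> (j \<cdot> q))" using 1 W G by simp
    also have "\<dots> = (g \<cdot> i) \<cdot> p \<oplus> (g \<cdot> j) \<cdot> q" using G X by (simp add: hom_algebra)
    also have "\<dots> = g" using biproduct_decomp(2)[OF bi, of g] G by simp
    finally have "w \<cdot> (b \<cdot> p \<ominus> e \<cdot> q) = g" .
    then show "\<exists>!k. k \<in> Hom C (Cod C (b \<cdot> p \<ominus> e \<cdot> q)) X \<and> k \<cdot> (b \<cdot> p \<ominus> e \<cdot> q) = g"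
    proof (intro ex1I[of _ w])
      fix k assume k: "k \<in> Hom C (Cod C (b \<cdot> p \<ominus> e \<cdot> q)) X \<and> k \<cdot> (b \<cdot> p \<ominus> e \<cdot> q) = g"
      have K: "k \<in> Ar C" "Dom C k = Cod C e" "Cod C k = X" using HomD[OF conjunct1[OF k]] by auto
      have "k \<cdot> (b \<cdot> p \<ominus> e \<cdot> q) \<cdot> i = g \<cdot> i" "k \<cdot> (b \<cdot> p \<ominus> e \<cdot> q) \<cdot> j = g \<cdot> j" using k by auto
      then show "k = w" using K G by (intro wu) (auto simp: Hom_def hom_algebra)
    qed (use W w in \<open>auto simp: Hom_def\<close>)
  qed (use eq in \<open>auto simp: hom_algebra\<close>)
qed

end

section \<open>Locally exact complexes\<close>

text \<open>Exactness of the represented complex as a complex of sheaves, for the topology whose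
  covers are the deflations. The formulation mentions no kernel object of a differential, so it
  makes sense where kernels are missing.\<close>

definition locally_exact :: "('o, 'm) precat \<Rightarrow> ('m \<times> 'm) set \<Rightarrow> ('o, 'm) cpx \<Rightarrow> bool" where
  "locally_exact C S X \<longleftrightarrow> is_complex C X \<and> (\<forall>n A f. f \<in> Hom C A (Obj X n) \<and>
    Diff X n \<cdot>\<^bsub>C\<^esub> f = Zero C A (Obj X (n - 1)) \<longrightarrow>
    (\<exists>Q q g. deflation S q \<and> q \<in> Hom C Q A \<and> g \<in> Hom C Q (Obj X (n + 1)) \<and>
      Diff X (n + 1) \<cdot>\<^bsub>C\<^esub> g = f \<cdot>\<^bsub>C\<^esub> q))"

text \<open>Together with a homotopy inverse \<open>G\<close>, the chain map \<open>F\<close> exhibits \<open>X\<close> as a direct summand of \<open>Y\<close> with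
  contractible complement.\<close>

definition deformation_retract ::
  "('o, 'm) precat \<Rightarrow> ('o, 'm) cpx \<Rightarrow> ('o, 'm) cpx \<Rightarrow> (int \<Rightarrow> 'm) \<Rightarrow> (int \<Rightarrow> 'm) \<Rightarrow> bool" where
  "deformation_retract C X Y F G \<longleftrightarrow> is_complex C X \<and> is_complex C Y \<and> chain_map C X Y F \<and>
    chain_map C Y X G \<and>
    (\<forall>n. G n \<cdot>\<^bsub>C\<^esub> F n = Id C (Obj X n)) \<and> chain_homotopic C Y Y (\<lambda>n. F n \<cdot>\<^bsub>C\<^esub> G n) (\<lambda>n. Id C (Obj Y n))"

text \<open>The set \<open>I\<close> of degrees allows partial data: kernels are built upwards, one
  degree at a time, over sets of the form \<open>{..<k}\<close>.\<close>

definition acyclic_data ::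
  "('o, 'm) precat \<Rightarrow> ('m \<times> 'm) set \<Rightarrow> ('o, 'm) cpx \<Rightarrow> (int \<Rightarrow> 'o) \<Rightarrow> (int \<Rightarrow> 'm) \<Rightarrow> (int \<Rightarrow> 'm) \<Rightarrow> int set \<Rightarrow>
    bool" where
  "acyclic_data C S X Z i p I \<longleftrightarrow> (\<forall>n \<in> I. (i n, p n) \<in> S \<and> i n \<in> Hom C (Z n) (Obj X n) \<and>
    p n \<in> Hom C (Obj X n) (Z (n - 1)) \<and> Diff X n = i (n - 1) \<cdot>\<^bsub>C\<^esub> p n)"

section \<open>Chain maps and deformation retracts\<close>

context additive_category
begin

lemma is_complexD:
  assumes "is_complex C X"
  shows "Obj X n \<in> Ob C" "Diff X n \<in> Ar C" "Dom C (Diff X n) = Obj X n" "Cod C (Diff X n) = Obj X (n - 1)"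
    "n = m + 1 \<Longrightarrow> Diff X m \<cdot> Diff X n = Zero C (Obj X n) (Obj X (m - 1))"
    "\<lbrakk>n = m + 1; f \<in> Ar C; Cod C f = Obj X n\<rbrakk> \<Longrightarrow> Diff X m \<cdot> (Diff X n \<cdot> f) = Zero C (Dom C f) (Obj X (m -
      1))"
proof -
  show *: "Obj X n \<in> Ob C" "Diff X n \<in> Ar C" "Dom C (Diff X n) = Obj X n"
    "Cod C (Diff X n) = Obj X (n - 1)" for n
    using assms by (auto simp: is_complex_def Hom_def)
  have DD: "Diff X (n - 1) \<cdot> Diff X n = Zero C (Obj X n) (Obj X (n - 2))"
    using assms by (simp add: is_complex_def)
  then show 1: "n = m + 1 \<Longrightarrow> Diff X m \<cdot> Diff X n = Zero C (Obj X n) (Obj X (m - 1))" by auto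
  assume "n = m + 1" "f \<in> Ar C" "Cod C f = Obj X n"
  then show "Diff X m \<cdot> (Diff X n \<cdot> f) = Zero C (Dom C f) (Obj X (m - 1))"
    using Comp_cong_left[OF 1, of f] * by simp
qed

lemma is_complexI:
  assumes "\<And>n. Obj X n \<in> Ob C" "\<And>n. Diff X n \<in> Hom C (Obj X n) (Obj X (n - 1))"
    "\<And>n. Diff X n \<cdot> Diff X (n + 1) = Zero C (Obj X (n + 1)) (Obj X (n - 1))"
  shows "is_complex C X"
  using assms(1,2) assms(3)[of "n - 1" for n] unfolding is_complex_def by simp

lemma chain_mapD:
  assumes "chain_map C X Y h"
  shows "h n \<in> Ar C" "Dom C (h n) = Obj X n" "Cod C (h n) = Obj Y n"
    "Diff Y n \<cdot> h n = h (n - 1) \<cdot> Diff X n"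
  using assms by (auto simp: chain_map_def Hom_def)

lemma chain_map_Comp:
  assumes "is_complex C Y" "chain_map C X Y h" "f \<in> Ar C" "Cod C f = Obj X n" "is_complex C X"
  shows "Diff Y n \<cdot> (h n \<cdot> f) = h (n - 1) \<cdot> (Diff X n \<cdot> f)"
proof -
  note [simp] = chain_mapD(1-3)[OF assms(2)] is_complexD(1-4)[OF assms(1)] is_complexD(1-4)[OF assms(5)]
    assms(3,4)
  have "(Diff Y n \<cdot> h n) \<cdot> f = (h (n - 1) \<cdot> Diff X n) \<cdot> f" using chain_mapD(4)[OF assms(2)] by simp
  then show ?thesis by simp
qed

lemma chain_map_compose:
  assumes "is_complex C X" "is_complex C Y" "is_complex C W" "chain_map C X Y f" "chain_map C Y W g"
  shows "chain_map C X W (\<lambda>n. g n \<cdot> f n)"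
proof -
  note [simp] = chain_mapD(1-3)[OF assms(4)] chain_mapD(1-3)[OF assms(5)] is_complexD(1-4)[OF assms(1)]
    is_complexD(1-4)[OF assms(2)] is_complexD(1-4)[OF assms(3)]
  have "Diff W n \<cdot> (g n \<cdot> f n) = (g (n - 1) \<cdot> f (n - 1)) \<cdot> Diff X n" for n
    using chain_map_Comp[OF assms(3,5), of "f n" n] assms(2) chain_mapD(4)[OF assms(4), of n] by simp
  then show ?thesis unfolding chain_map_def by (simp add: Hom_def)
qed

lemma chain_map_Id: "is_complex C X \<Longrightarrow> chain_map C X X (\<lambda>n. Id C (Obj X n))"
  by (simp add: chain_map_def is_complexD Hom_def)

lemma deformation_retract_refl:
  assumes "is_complex C X"
  shows "deformation_retract C X X (\<lambda>n. Id C (Obj X n)) (\<lambda>n. Id C (Obj X n))"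
  unfolding deformation_retract_def chain_homotopic_def
  using assms chain_map_Id[OF assms] is_complexD[OF assms]
  by (auto intro!: exI[of _ "\<lambda>n. Zero C (Obj X n) (Obj X (n + 1))"] simp: Hom_def)

lemma deformation_retract_trans:
  assumes "deformation_retract C X Y F G" "deformation_retract C Y W F' G'"
  shows "deformation_retract C X W (\<lambda>n. F' n \<cdot> F n) (\<lambda>n. G n \<cdot> G' n)"
proof -
  have X: "is_complex C X" and Y: "is_complex C Y" and W: "is_complex C W" and F: "chain_map C X Y F"
    and G: "chain_map C Y X G"
    and F': "chain_map C Y W F'" and G': "chain_map C W Y G'"
    and GF: "\<And>n. G n \<cdot> F n = Id C (Obj X n)" "\<And>n. G' n \<cdot> F' n = Id C (Obj Y n)"
    using assms unfolding deformation_retract_def by auto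
  obtain t where t: "\<And>n. t n \<in> Hom C (Obj Y n) (Obj Y (n + 1))"
    "\<And>n. F n \<cdot> G n = Id C (Obj Y n) \<oplus> (Diff Y (n + 1) \<cdot> t n \<oplus> t (n - 1) \<cdot> Diff Y n)"
    using assms(1) unfolding deformation_retract_def chain_homotopic_def by auto
  obtain u where u: "\<And>n. u n \<in> Hom C (Obj W n) (Obj W (n + 1))"
    "\<And>n. F' n \<cdot> G' n = Id C (Obj W n) \<oplus> (Diff W (n + 1) \<cdot> u n \<oplus> u (n - 1) \<cdot> Diff W n)"
    using assms(2) unfolding deformation_retract_def chain_homotopic_def by auto
  note [simp] = is_complexD(1-4)[OF X] is_complexD(1-4)[OF Y] is_complexD(1-4)[OF W] chain_mapD(1-3)[OF
    F] chain_mapD(1-3)[OF G]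
    chain_mapD(1-3)[OF F'] chain_mapD(1-3)[OF G'] HomD[OF t(1)] HomD[OF u(1)]
  have t' [simp]: "Dom C (t (n - 1)) = Obj Y (n - 1)" "Cod C (t (n - 1)) = Obj Y n"
     "Dom C (u (n - 1)) = Obj W (n - 1)" "Cod C (u (n - 1)) = Obj W n" for n
    using HomD[OF t(1), of "n - 1"] HomD[OF u(1), of "n - 1"] by auto
  have GF': "G n \<cdot> G' n \<cdot> (F' n \<cdot> F n) = Id C (Obj X n)" for n
    using GF(2)[of n] GF(1)[of n] Comp_cong_left[OF GF(2), of n "F n"] by simp
  \<comment> \<open>The homotopy \<open>u\<close> deforms \<open>W\<close> onto the image of
    \<open>Y\<close>; to it is added the homotopy \<open>t\<close> of \<open>Y\<close>, transported
    along \<open>F'\<close> and \<open>G'\<close>.\<close>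
  let ?s = "\<lambda>n. u n \<oplus> F' (n + 1) \<cdot> (t n \<cdot> G' n)"
  have "(F' n \<cdot> F n) \<cdot> (G n \<cdot> G' n) = Id C (Obj W n) \<oplus> (Diff W (n + 1) \<cdot> ?s n \<oplus> ?s (n - 1) \<cdot> Diff W n)"
    for n
  proof -
    have 1: "Diff W (n + 1) \<cdot> (F' (n + 1) \<cdot> (t n \<cdot> G' n)) = F' n \<cdot> (Diff Y (n + 1) \<cdot> (t n \<cdot> G' n))"
      using chain_map_Comp[OF W F', of "t n \<cdot> G' n" "n + 1"] Y by simp
    have 2: "Diff Y n \<cdot> G' n = G' (n - 1) \<cdot> Diff W n" using chain_mapD(4)[OF G'] .
    have "(F' n \<cdot> F n) \<cdot> (G n \<cdot> G' n) = F' n \<cdot> ((F n \<cdot> G n) \<cdot> G' n)" by simp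
    also have "\<dots> = F' n \<cdot> G' n \<oplus> (F' n \<cdot> (Diff Y (n + 1) \<cdot> (t n \<cdot> G' n)) \<oplus> F' n \<cdot> (t (n - 1) \<cdot> (Diff Y n
      \<cdot> G' n)))"
      unfolding t(2) by simp
    also have "\<dots> = Id C (Obj W n) \<oplus> (Diff W (n + 1) \<cdot> ?s n \<oplus> ?s (n - 1) \<cdot> Diff W n)"
      unfolding u(2) 2 using 1 by (simp add: Add_ac)
    finally show ?thesis .
  qed
  then have "chain_homotopic C W W (\<lambda>n. (F' n \<cdot> F n) \<cdot> (G n \<cdot> G' n)) (\<lambda>n. Id C (Obj W n))"
    unfolding chain_homotopic_def by (intro exI[of _ ?s]) (simp add: Hom_def)
  then show ?thesis
    unfolding deformation_retract_def
    using X W chain_map_compose[OF X Y W F F'] chain_map_compose[OF W Y X G' G] GF' by simp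
qed

lemma deformation_retract_homotopy_equivalent:
  assumes "deformation_retract C X Y F G"
  shows "homotopy_equivalent C X Y"
proof -
  have X: "is_complex C X" and GF: "\<And>n. G n \<cdot> F n = Id C (Obj X n)"
    using assms unfolding deformation_retract_def by auto
  have "chain_homotopic C X X (\<lambda>n. G n \<cdot> F n) (\<lambda>n. Id C (Obj X n))"
    unfolding chain_homotopic_def GF using is_complexD[OF X]
    by (auto intro!: exI[of _ "\<lambda>n. Zero C (Obj X n) (Obj X (n + 1))"] simp: Hom_def)
  then show ?thesis using assms unfolding homotopy_equivalent_def deformation_retract_def by blast
qed

end

section \<open>Local exactness and acyclicity\<close>

context exact_category
begin

lemma locally_exactE:
  assumes "locally_exact C S X" "f \<in> Hom C A (Obj X n)" "Diff X n \<cdot> f = Zero C A (Obj X (n - 1))"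
    "m = n + 1"
  obtains Q q g where "deflation S q" "q \<in> Hom C Q A" "g \<in> Hom C Q (Obj X m)" "Diff X m \<cdot> g = f \<cdot> q"
  using assms unfolding locally_exact_def by blast

lemma locally_exactI:
  assumes "is_complex C X"
    "\<And>n A f. \<lbrakk>f \<in> Hom C A (Obj X n); Diff X n \<cdot> f = Zero C A (Obj X (n - 1))\<rbrakk> \<Longrightarrow>
      \<exists>Q q g. deflation S q \<and> q \<in> Hom C Q A \<and> g \<in> Hom C Q (Obj X (n + 1)) \<and> Diff X (n + 1) \<cdot> g = f \<cdot> q"
  shows "locally_exact C S X"
  using assms unfolding locally_exact_def by blast

lemma locally_exact_is_complex: "locally_exact C S X \<Longrightarrow> is_complex C X"
  by (simp add: locally_exact_def)

text \<open>Move the cycle to \<open>Y\<close>, lift it there on a cover and move the lift back. The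
  result bounds \<open>G F f\<close>, and on a cycle this differs from \<open>f\<close> by the
  boundary of \<open>s n \<cdot> f\<close>, which is subtracted.\<close>

lemma locally_exact_homotopy:
  assumes Y: "locally_exact C S Y" and X: "is_complex C X" and F: "chain_map C X Y F"
    and G: "chain_map C Y X G"
    and h: "chain_homotopic C X X (\<lambda>n. G n \<cdot> F n) (\<lambda>n. Id C (Obj X n))"
  shows "locally_exact C S X"
proof (rule locally_exactI[OF X])
  note Yc = locally_exact_is_complex[OF Y]
  fix n A f assume f: "f \<in> Hom C A (Obj X n)" and z: "Diff X n \<cdot> f = Zero C A (Obj X (n - 1))"
  obtain s where s: "\<And>n. s n \<in> Hom C (Obj X n) (Obj X (n + 1))"
    "\<And>n. G n \<cdot> F n = Id C (Obj X n) \<oplus> (Diff X (n + 1) \<cdot> s n \<oplus> s (n - 1) \<cdot> Diff X n)"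
    using h unfolding chain_homotopic_def by auto
  note [simp] = is_complexD(1-4)[OF X] is_complexD(1-4)[OF Yc] chain_mapD(1-3)[OF F] chain_mapD(1-3)[OF G]
    HomD[OF f] HomD[OF s(1)]
  have s' [simp]: "Dom C (s (n - 1)) = Obj X (n - 1)" "Cod C (s (n - 1)) = Obj X n"
    using HomD[OF s(1), of "n - 1"] by auto
  have "Diff Y n \<cdot> (F n \<cdot> f) = Zero C A (Obj Y (n - 1))"
    using chain_map_Comp[OF Yc F, of f n] X z by simp
  then obtain Q q g where q: "deflation S q" "q \<in> Hom C Q A" and g: "g \<in> Hom C Q (Obj Y (n + 1))"
    "Diff Y (n + 1) \<cdot> g = (F n \<cdot> f) \<cdot> q"
    using locally_exactE[OF Y, of "F n \<cdot> f" A n "n + 1"] by (auto simp: Hom_def)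
  note [simp] = HomD[OF q(2)] HomD[OF g(1)]
  have e1: "Diff X n \<cdot> (f \<cdot> q) = Zero C Q (Obj X (n - 1))"
    using Comp_cong_left[OF z, of q] by simp
  have "Diff X (n + 1) \<cdot> (G (n + 1) \<cdot> g) = G n \<cdot> (F n \<cdot> (f \<cdot> q))"
    using chain_map_Comp[OF X G, of g "n + 1"] Yc g(2) by simp
  also have "\<dots> = (G n \<cdot> F n) \<cdot> (f \<cdot> q)" by simp
  also have "\<dots> = f \<cdot> q \<oplus> Diff X (n + 1) \<cdot> (s n \<cdot> (f \<cdot> q))"
    unfolding s(2) using e1 by simp
  finally have "Diff X (n + 1) \<cdot> (G (n + 1) \<cdot> g \<ominus> s n \<cdot> (f \<cdot> q)) = f \<cdot> q"
    by (simp add: hom_algebra)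
  then show "\<exists>Q q g. deflation S q \<and> q \<in> Hom C Q A \<and> g \<in> Hom C Q (Obj X (n + 1)) \<and>
    Diff X (n + 1) \<cdot> g = f \<cdot> q"
    using q by (intro exI[of _ Q] exI[of _ q] exI[of _ "G (n + 1) \<cdot> g \<ominus> s n \<cdot> (f \<cdot> q)"]) (simp add:
      Hom_def)
qed

lemma acyclic_data_is_complex:
  assumes "acyclic_data C S X Z i p UNIV"
  shows "is_complex C X"
proof (rule is_complexI)
  have S: "(i n, p n) \<in> S" and i: "i n \<in> Hom C (Z n) (Obj X n)" and p: "p n \<in> Hom C (Obj X n) (Z (n - 1))"
    and D: "Diff X n = i (n - 1) \<cdot> p n" for n
    using assms unfolding acyclic_data_def by auto
  note [simp] = HomD[OF i] HomD[OF p]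
  fix n
  have [simp]: "Cod C (p (n + 1)) = Z n" "Dom C (i (n - 1)) = Z (n - 1)"
    "Cod C (i (n - 1)) = Obj X (n - 1)"
    using HomD[OF p, of "n + 1"] HomD[OF i, of "n - 1"] by auto
  show "Obj X n \<in> Ob C" by simp
  show "Diff X n \<in> Hom C (Obj X n) (Obj X (n - 1))" unfolding D by (simp add: Hom_def)
  show "Diff X n \<cdot> Diff X (n + 1) = Zero C (Obj X (n + 1)) (Obj X (n - 1))"
    unfolding D using conflationD(5)[OF S, of "p (n + 1)" n] by simp
qed

lemma acyclic_complex_iff: "acyclic_complex C S X \<longleftrightarrow> (\<exists>Z i p. acyclic_data C S X Z i p UNIV)"
  unfolding acyclic_complex_def using acyclic_data_is_complex unfolding acyclic_data_def by blast

lemma acyclic_dataD: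
  assumes "acyclic_data C S X Z i p I" "n \<in> I"
  shows "(i n, p n) \<in> S" "Diff X n = i (n - 1) \<cdot> p n"
    "i n \<in> Ar C" "Dom C (i n) = Z n" "Cod C (i n) = Obj X n"
    "p n \<in> Ar C" "Dom C (p n) = Obj X n" "Cod C (p n) = Z (n - 1)"
    "Z n \<in> Ob C" "Z (n - 1) \<in> Ob C" "Obj X n \<in> Ob C" "inflation S (i n)" "deflation S (p n)"
    "p n \<cdot> i n = Zero C (Z n) (Z (n - 1))"
    "f \<in> Ar C \<Longrightarrow> Cod C f = Z n \<Longrightarrow> p n \<cdot> (i n \<cdot> f) = Zero C (Dom C f) (Z (n - 1))"
proof -
  have S: "(i n, p n) \<in> S" and i: "i n \<in> Hom C (Z n) (Obj X n)" and p: "p n \<in> Hom C (Obj X n) (Z (n - 1))"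
    and D: "Diff X n = i (n - 1) \<cdot> p n"
    using assms unfolding acyclic_data_def by auto
  show "(i n, p n) \<in> S" "Diff X n = i (n - 1) \<cdot> p n"
    "i n \<in> Ar C" "Dom C (i n) = Z n" "Cod C (i n) = Obj X n"
    "p n \<in> Ar C" "Dom C (p n) = Obj X n" "Cod C (p n) = Z (n - 1)"
    "Z n \<in> Ob C" "Z (n - 1) \<in> Ob C" "Obj X n \<in> Ob C" "inflation S (i n)" "deflation S (p n)"
    "p n \<cdot> i n = Zero C (Z n) (Z (n - 1))"
    "f \<in> Ar C \<Longrightarrow> Cod C f = Z n \<Longrightarrow> p n \<cdot> (i n \<cdot> f) = Zero C (Dom C f) (Z (n - 1))"
    using S D HomD[OF i] HomD[OF p] conflationD[OF S] by (auto simp: inflation_def deflation_def)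
qed

lemma acyclic_cycle_lift:
  assumes a: "acyclic_data C S X Z i p I" and n: "n \<in> I" "n - 1 \<in> I" and f: "f \<in> Hom C A (Obj X n)"
    and z: "Diff X n \<cdot> f = Zero C A (Obj X (n - 1))"
  obtains g where "g \<in> Hom C A (Z n)" "i n \<cdot> g = f"
proof -
  note [simp] = acyclic_dataD(3-)[OF a n(1)] acyclic_dataD(3-)[OF a n(2)] HomD[OF f]
  have "i (n - 1) \<cdot> (p n \<cdot> f) = i (n - 1) \<cdot> Zero C A (Z (n - 1))"
    using z unfolding acyclic_dataD(2)[OF a n(1)] by simp
  then have "p n \<cdot> f = Zero C A (Z (n - 1))"
    by (rule inflation_mono[of "i (n - 1)" _ A, rotated 3]) (auto simp: Hom_def)
  then show thesis using conflation_lift[OF acyclic_dataD(1)[OF a n(1)], of f A] that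
    by (auto simp: Hom_def)
qed

text \<open>A cycle factors through the kernel \<open>Z n\<close>; its pullback along the deflation
  from degree \<open>n + 1\<close> onto \<open>Z n\<close> supplies both the cover and the
  lift.\<close>

lemma acyclic_locally_exact:
  assumes "acyclic_complex C S X"
  shows "locally_exact C S X"
proof -
  obtain Z i p where a: "acyclic_data C S X Z i p UNIV" using assms acyclic_complex_iff by auto
  note [simp] = acyclic_dataD(3-)[OF a UNIV_I]
  show ?thesis
  proof (rule locally_exactI[OF acyclic_data_is_complex[OF a]])
    fix n A f assume f: "f \<in> Hom C A (Obj X n)" and z: "Diff X n \<cdot> f = Zero C A (Obj X (n - 1))"
    obtain g where g: "g \<in> Hom C A (Z n)" "i n \<cdot> g = f"
      using acyclic_cycle_lift[OF a _ _ f z] by auto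
    note [simp] = HomD[OF g(1)] HomD[OF f]
    have [simp]: "Cod C (p (n + 1)) = Z n" using acyclic_dataD(8)[OF a UNIV_I, of "n + 1"] by simp
    obtain q k where q: "is_pullback C (p (n + 1)) g q k" "deflation S q"
      using deflation_pullback[of "p (n + 1)" g] by auto
    have T: "q \<in> Ar C" "Cod C q = A" "k \<in> Ar C" "Dom C k = Dom C q" "Cod C k = Obj X (n + 1)"
      "p (n + 1) \<cdot> k = g \<cdot> q"
      using q(1) unfolding is_pullback_def by auto
    have "Diff X (n + 1) \<cdot> k = f \<cdot> q"
      unfolding acyclic_dataD(2)[OF a UNIV_I] using T g(2)[symmetric] by simp
    then show "\<exists>Q q g. deflation S q \<and> q \<in> Hom C Q A \<and> g \<in> Hom C Q (Obj X (n + 1)) \<and>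
      Diff X (n + 1) \<cdot> g = f \<cdot> q"
      using q(2) T by (intro exI[of _ "Dom C q"] exI[of _ q] exI[of _ k]) (auto simp: Hom_def)
  qed
qed

end

lemma additive_subcategoryD:
  assumes "additive_subcategory C M"
  shows "A \<in> M \<Longrightarrow> A \<in> Ob C" "\<lbrakk>A \<in> M; isomorphic C A B\<rbrakk> \<Longrightarrow> B \<in> M" "zero_object C Z \<Longrightarrow> Z \<in> M"
    "\<lbrakk>A \<in> M; B \<in> M; biproduct C A B P i j p q\<rbrakk> \<Longrightarrow> P \<in> M"
  using assms unfolding additive_subcategory_def by blast+

context exact_category
begin

lemma iso_conflation:
  assumes r: "is_iso C r" and Z: "zero_object C Z"
  shows "(Zero C Z (Dom C r), r) \<in> S" "(r, Zero C (Cod C r) Z) \<in> S"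
proof -
  interpret O: exact_category "opc C" "S\<inverse>" by (rule exact_category_opc)
  have T [simp]: "r \<in> Ar C" using r unfolding is_iso_def by simp
  have 1: "(Zero C Z (Dom C r), Id C (Dom C r)) \<in> S" using O.conflation_Id_zero[of Z "Dom C r"] Z by simp
  show "(Zero C Z (Dom C r), r) \<in> S"
    by (rule conflation_iso[OF 1, of "Id C Z" "Id C (Dom C r)" r]) (use Z r in \<open>auto simp: Hom_def\<close>)
  have 2: "(Id C (Cod C r), Zero C (Cod C r) Z) \<in> S" using conflation_Id_zero[of Z "Cod C r"] Z by simp
  obtain g where g: "g \<in> Hom C (Cod C r) (Dom C r)" "g \<cdot> r = Id C (Dom C r)" "r \<cdot> g = Id C (Cod C r)"
    "is_iso C g"
    using is_isoE[OF r] by blast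
  note [simp] = HomD[OF g(1)]
  show "(r, Zero C (Cod C r) Z) \<in> S"
    by (rule conflation_iso[OF 2, of g "Id C (Cod C r)" "Id C Z"]) (use Z g in \<open>auto simp: Hom_def\<close>)
qed

text \<open>Local exactness is applied to the universal cycle \<open>i (k - 1)\<close>. It shows
  that \<open>r\<close> composed with some arrow is a deflation, which does not yet make
  \<open>r\<close> a deflation.\<close>

lemma locally_exact_factor:
  assumes X: "locally_exact C S X" and a: "acyclic_data C S X Z i p {..<k}"
  obtains r where "r \<in> Hom C (Obj X k) (Z (k - 1))" "Diff X k = i (k - 1) \<cdot> r"
    "\<exists>Q q g. deflation S q \<and> q \<in> Hom C Q (Z (k - 1)) \<and> g \<in> Hom C Q (Obj X k) \<and> r \<cdot> g = q"
proof -
  note Xc = locally_exact_is_complex[OF X]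
  note [simp] = is_complexD(1-4)[OF Xc]
  have D: "k - 1 \<in> {..<k}" "k - 2 \<in> {..<k}" by auto
  have "Diff X (k - 1) \<cdot> Diff X k = Zero C (Obj X k) (Obj X (k - 1 - 1))"
    using is_complexD(5)[OF Xc, of k "k - 1"] by simp
  then obtain r where r: "r \<in> Hom C (Obj X k) (Z (k - 1))" "i (k - 1) \<cdot> r = Diff X k"
    using acyclic_cycle_lift[OF a D(1), of "Diff X k" "Obj X k"] by (auto simp: Hom_def)
  note A1 = acyclic_dataD[OF a D(1)] and A2 = acyclic_dataD[OF a D(2)]
  have [simp]: "k - 1 - 1 = k - 2" by simp
  have "Diff X (k - 1) \<cdot> i (k - 1) = Zero C (Z (k - 1)) (Obj X (k - 1 - 1))"
    using A1 A2 by simp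
  then obtain Q q g where q: "deflation S q" "q \<in> Hom C Q (Z (k - 1))" and g: "g \<in> Hom C Q (Obj X k)"
    "Diff X k \<cdot> g = i (k - 1) \<cdot> q"
    using locally_exactE[OF X, of "i (k - 1)" "Z (k - 1)" "k - 1" k] A1 by (auto simp: Hom_def)
  note [simp] = HomD[OF r(1)] HomD[OF q(2)] HomD[OF g(1)]
  have "i (k - 1) \<cdot> (r \<cdot> g) = i (k - 1) \<cdot> q" using g(2) r(2)[symmetric] A1 by simp
  then have "r \<cdot> g = q" using inflation_mono[OF A1(12), of "r \<cdot> g" Q q] A1 by (simp add: Hom_def)
  then show thesis using that[OF r(1) r(2)[symmetric]] q g(1) by blast
qed

text \<open>If the kernels of \<open>X\<close> exist below degree \<open>k\<close>, adding a contractible complex in degrees \<open>k + 1\<close>, \<open>k\<close>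
  makes the differential onto the cycles in degree \<open>k - 1\<close> a deflation.\<close>

lemma acyclic_step:
  assumes X: "locally_exact C S X" and a: "acyclic_data C S X Z i p {..<k}"
    and M: "additive_subcategory C M" "generating C S M"
  obtains X' F G Z' i' p' where "deformation_retract C X X' F G" "locally_exact C S X'"
    "acyclic_data C S X' Z' i' p' {..<k + 1}"
      "\<And>n. n \<noteq> k \<Longrightarrow> n \<noteq> k + 1 \<Longrightarrow> Obj X' n = Obj X n \<and> F n = Id C (Obj X n)"
    "\<And>n. Obj X n \<in> M \<Longrightarrow> Obj X' n \<in> M"
proof -
  interpret O: exact_category "opc C" "S\<inverse>" by (rule exact_category_opc)
  note Xc = locally_exact_is_complex[OF X]
  note [simp] = is_complexD[OF Xc]
  obtain r Q q0 g0 where r: "r \<in> Hom C (Obj X k) (Z (k - 1))" "Diff X k = i (k - 1) \<cdot> r"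
    and q0: "deflation S q0" "q0 \<in> Hom C Q (Z (k - 1))" "g0 \<in> Hom C Q (Obj X k)" "r \<cdot> g0 = q0"
    using locally_exact_factor[OF X a] by metis
  \<comment> \<open>The contractible summand will be built on \<open>B\<close>; choosing
    \<open>B\<close> in \<open>M\<close> keeps terms of \<open>M\<close> in
    \<open>M\<close>.\<close>
  obtain B b0 where B: "B \<in> M" and b0: "b0 \<in> Hom C B Q" "deflation S b0"
    using M(2) HomD(4)[OF q0(2)] unfolding generating_def by blast
  note [simp] = HomD[OF r(1)] HomD[OF q0(2)] HomD[OF q0(3)] HomD[OF b0(1)]
  have [simp]: "B \<in> Ob C" using additive_subcategoryD(1)[OF M(1) B] .
  let ?g = "g0 \<cdot> b0"
  have defl: "deflation S (r \<cdot> ?g)"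
    using deflation_Comp[OF b0(2) q0(1)] q0(4) Comp_cong_left[OF q0(4), of b0] by simp
  obtain P a1 b c e where bk: "biproduct C (Obj X k) B P a1 b c e" using ex_biproduct[of "Obj X k" B]
    by auto
  obtain P' a1' b' c' e' where bk1: "biproduct C (Obj X (k + 1)) B P' a1' b' c' e'"
    using ex_biproduct[of "Obj X (k + 1)" B] by auto
  note [simp] = biproduct_simps[OF bk] biproduct_simps[OF bk1]
  \<comment> \<open>Dual form of the shear: since \<open>r \<cdot> ?g\<close> is a deflation, so is
    (r, 0) on the sum of \<open>Obj X k\<close> and \<open>B\<close>.\<close>
  have "deflation S (r \<cdot> c)"
    using O.inflation_biproduct_zero[of "Obj X k" B P c e a1 b r "Z (k - 1)" ?g] bk defl
    by (simp add: biproduct_opc Hom_def)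
  then obtain \<iota> where \<iota>: "(\<iota>, r \<cdot> c) \<in> S" unfolding deflation_def by auto
  note [simp] = conflationD[OF \<iota>]
  let ?D = "(Diff X)(k := Diff X k \<cdot> c, k + 1 := a1 \<cdot> (Diff X (k + 1) \<cdot> c') \<oplus> b \<cdot> e', k + 2 := a1' \<cdot> Diff
    X (k + 2))"
  let ?X = "\<lparr>Obj = (Obj X)(k := P, k + 1 := P'), Diff = ?D\<rparr>"
  let ?F = "(\<lambda>n. Id C (Obj X n))(k := a1, k + 1 := a1')"
    and ?G = "(\<lambda>n. Id C (Obj X n))(k := c, k + 1 := c')"
  have [simp]: "Cod C (Diff X (k + 2)) = Obj X (k + 1)" "1 + k = k + 1" "2 + k = k + 2" "3 + k = k + 3"
    "k + 2 - 1 = k + 1" "k + 3 - 1 = k + 2"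
    using is_complexD(4)[OF Xc, of "k + 2"] by (auto simp: add.commute)
  have cases: "n = k \<or> n = k + 1 \<or> n = k + 2 \<or> n = k - 1 \<or> (n \<noteq> k \<and> n - 1 \<noteq> k \<and> n - 2 \<noteq> k \<and>
    n + 1 \<noteq> k)" for n
    by linarith
  have X'c: "is_complex C ?X"
  proof (rule is_complexI)
    fix n
    show "Obj ?X n \<in> Ob C" by simp
    show "Diff ?X n \<in> Hom C (Obj ?X n) (Obj ?X (n - 1))" using cases[of n]
      by (elim disjE) (auto simp: Hom_def)
    show "Diff ?X n \<cdot> Diff ?X (n + 1) = Zero C (Obj ?X (n + 1)) (Obj ?X (n - 1))"
      using cases[of n] by (elim disjE) (auto simp: Hom_def)
  qed
  have F: "chain_map C X ?X ?F" unfolding chain_map_def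
  proof (intro conjI allI)
    fix n
    show "?F n \<in> Hom C (Obj X n) (Obj ?X n)" by (simp add: Hom_def)
    show "Diff ?X n \<cdot> ?F n = ?F (n - 1) \<cdot> Diff X n" using cases[of n] by (elim disjE) auto
  qed
  have G: "chain_map C ?X X ?G" unfolding chain_map_def
  proof (intro conjI allI)
    fix n
    show "?G n \<in> Hom C (Obj ?X n) (Obj X n)" by (simp add: Hom_def)
    show "Diff X n \<cdot> ?G n = ?G (n - 1) \<cdot> Diff ?X n" using cases[of n] by (elim disjE) auto
  qed
  \<comment> \<open>This contracts the added summand. The minus sign matches the convention that
    \<open>?F n \<cdot> ?G n\<close> equals the identity plus the homotopy terms.\<close>
  let ?s = "\<lambda>n. if n = k then Neg C (b' \<cdot> e) else Zero C (Obj ?X n) (Obj ?X (n + 1))"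
  have e1: "a1 \<cdot> c = Id C P \<ominus> b \<cdot> e" and e2: "a1' \<cdot> c' = Id C P' \<ominus> b' \<cdot> e'"
    using biproductD(20)[OF bk] biproductD(20)[OF bk1] by (auto simp: Minus_eq_iff)
  have "?F n \<cdot> ?G n = Id C (Obj ?X n) \<oplus> (Diff ?X (n + 1) \<cdot> ?s n \<oplus> ?s (n - 1) \<cdot> Diff ?X n)" for n
    using cases[of n] is_complexD(1-4)[OF X'c] by (elim disjE) (auto simp: e1 e2 hom_algebra)
  then have FG: "chain_homotopic C ?X ?X (\<lambda>n. ?F n \<cdot> ?G n) (\<lambda>n. Id C (Obj ?X n))"
    unfolding chain_homotopic_def by (intro exI[of _ ?s]) (auto simp: Hom_def)
  have dr: "deformation_retract C X ?X ?F ?G" unfolding deformation_retract_def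
    using Xc X'c F G FG by auto
  have lx: "locally_exact C S ?X" by (rule locally_exact_homotopy[OF X X'c G F FG])
  let ?Z = "Z(k := Dom C \<iota>)" and ?i = "i(k := \<iota>)" and ?p = "p(k := r \<cdot> c)"
  have "acyclic_data C S ?X ?Z ?i ?p {..<k + 1}"
    unfolding acyclic_data_def
  proof
    fix n assume n: "n \<in> {..<k + 1}"
    show "(?i n, ?p n) \<in> S \<and> ?i n \<in> Hom C (?Z n) (Obj ?X n) \<and> ?p n \<in> Hom C (Obj ?X n) (?Z (n - 1)) \<and>
      Diff ?X n = ?i (n - 1) \<cdot> ?p n"
    proof (cases "n = k")
      case True
      have "k - 1 \<in> {..<k}" by simp
      note [simp] = acyclic_dataD(3-)[OF a this]
      show ?thesis using True \<iota> r(2) by (simp add: Hom_def)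
    next
      case False
      then have "n \<in> {..<k}" using n by auto
      then show ?thesis using acyclic_dataD[OF a] False by (simp add: Hom_def)
    qed
  qed
  moreover have "Obj X n \<in> M \<Longrightarrow> Obj ?X n \<in> M" for n
    using additive_subcategoryD(4)[OF M(1) _ B bk] additive_subcategoryD(4)[OF M(1) _ B bk1] by auto
  ultimately show thesis using that[OF dr lx] by simp
qed

text \<open>Each step adds a contractible summand in degrees \<open>k\<close> and
  \<open>k + 1\<close>, which stays within the degrees \<open>a\<close> to \<open>b\<close> as long
  as \<open>k < b\<close>. In degree \<open>b\<close> no summand is added: the arrow onto the cycles
  is a monomorphism because the next term is zero, and a deflation factors through it, which makes
  it invertible.\<close>

lemma locally_exact_acyclic:
  assumes X: "locally_exact C S X" and fin: "finite_complex C a b X" and ab: "a < b"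
    and M: "additive_subcategory C M" "generating C S M"
  obtains Y F G where "acyclic_complex C S Y" "finite_complex C a b Y" "deformation_retract C X Y F G"
    "Obj Y a = Obj X a" "F a = Id C (Obj X a)" "\<And>n. Obj X n \<in> M \<Longrightarrow> Obj Y n \<in> M"
proof -
  note Xc = locally_exact_is_complex[OF X]
  obtain Z0 where Z0: "zero_object C Z0" using ex_zero_object by auto
  have zero: "n < a \<or> b < n \<Longrightarrow> zero_object C (Obj X n)" for n using fin unfolding finite_complex_def
    by auto
  have "\<exists>Y F G Z i p. deformation_retract C X Y F G \<and> locally_exact C S Y \<and>
    acyclic_data C S Y Z i p {..<a + 1 + int m} \<and>
    (\<forall>n. n \<le> a \<or> a + 1 + int m < n \<longrightarrow> Obj Y n = Obj X n \<and> F n = Id C (Obj X n)) \<and> (\<forall>n. Obj X n \<in> M \<longrightarrow>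
      Obj Y n \<in> M)" for m
  proof (induction m)
    case 0
    \<comment> \<open>Below degree \<open>a\<close> all terms are zero, so every term up to degree
      \<open>a\<close> is its own object of cycles.\<close>
    let ?i = "\<lambda>n. Id C (Obj X n)" and ?p = "\<lambda>n. Zero C (Obj X n) (Obj X (n - 1))"
    have "acyclic_data C S X (Obj X) ?i ?p {..<a + 1}"
      unfolding acyclic_data_def
    proof
      fix n assume "n \<in> {..<a + 1}"
      then have z: "zero_object C (Obj X (n - 1))" using zero by auto
      have "Diff X n = Zero C (Obj X n) (Obj X (n - 1))"
        using zero_object_eq(1)[OF z, of "Diff X n"] is_complexD[OF Xc] by simp
      then show "(?i n, ?p n) \<in> S \<and> ?i n \<in> Hom C (Obj X n) (Obj X n) \<and>
        ?p n \<in> Hom C (Obj X n) (Obj X (n - 1)) \<and>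
        Diff X n = ?i (n - 1) \<cdot> ?p n"
        using conflation_Id_zero[OF z] is_complexD(1)[OF Xc] by (simp add: Hom_def)
    qed
    then show ?case using deformation_retract_refl[OF Xc] X
      by (intro exI[of _ X] exI[of _ "\<lambda>n. Id C (Obj X n)"] exI[of _ "Obj X"] exI[of _ ?i] exI[of _ ?p])
        simp
  next
    case (Suc m)
    then obtain Y F G Z i p where Y: "deformation_retract C X Y F G" "locally_exact C S Y"
      "acyclic_data C S Y Z i p {..<a + 1 + int m}"
      "\<And>n. n \<le> a \<or> a + 1 + int m < n \<Longrightarrow> Obj Y n = Obj X n \<and> F n = Id C (Obj X n)"
      "\<And>n. Obj X n \<in> M \<Longrightarrow> Obj Y n \<in> M" by blast
    obtain Y' F' G' Z' i' p' where Y': "deformation_retract C Y Y' F' G'" "locally_exact C S Y'"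
      "acyclic_data C S Y' Z' i' p' {..<a + 1 + int m + 1}"
      "\<And>n. n \<noteq> a + 1 + int m \<Longrightarrow> n \<noteq> a + 1 + int m + 1 \<Longrightarrow> Obj Y' n = Obj Y n \<and> F' n = Id C (Obj Y n)"
      "\<And>n. Obj Y n \<in> M \<Longrightarrow> Obj Y' n \<in> M"
      using acyclic_step[OF Y(2,3) M] by blast
    have 1: "Obj Y' n = Obj X n \<and> F' n \<cdot> F n = Id C (Obj X n)" if "n \<le> a \<or> a + 1 + int (Suc m) < n" for n
      using Y(4)[of n] Y'(4)[of n] that is_complexD(1)[OF Xc] by auto
    have "a + 1 + int m + 1 = a + 1 + int (Suc m)" by simp
    then have 2: "acyclic_data C S Y' Z' i' p' {..<a + 1 + int (Suc m)}" using Y'(3) by metis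
    have 3: "Obj X n \<in> M \<longrightarrow> Obj Y' n \<in> M" for n using Y(5) Y'(5) by blast
    from deformation_retract_trans[OF Y(1) Y'(1)] Y'(2) 1 2 3 show ?case by blast
  qed
  \<comment> \<open>These \<open>b - a - 1\<close> steps treat the degrees \<open>a + 1\<close> to
    \<open>b - 1\<close>; the last one enlarges the terms in degrees \<open>b - 1\<close> and
    \<open>b\<close>, and degree \<open>a\<close> is never touched.\<close>
  note ex = this[of "nat (b - a - 1)"]
  have "a + 1 + int (nat (b - a - 1)) = b" using ab by simp
  from ex[unfolded this] obtain Y F G Z i p where Y: "deformation_retract C X Y F G" "locally_exact C S Y"
    "acyclic_data C S Y Z i p {..<b}"
    "\<And>n. n \<le> a \<or> b < n \<Longrightarrow> Obj Y n = Obj X n \<and> F n = Id C (Obj X n)"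
    "\<And>n. Obj X n \<in> M \<Longrightarrow> Obj Y n \<in> M" by blast
  note Yc = locally_exact_is_complex[OF Y(2)]
  note [simp] = is_complexD(1-4)[OF Yc]
  have zeroY: "n < a \<or> b < n \<Longrightarrow> zero_object C (Obj Y n)" for n using zero Y(4)[of n] by auto
  obtain r Q q g where r: "r \<in> Hom C (Obj Y b) (Z (b - 1))" "Diff Y b = i (b - 1) \<cdot> r"
    and q: "deflation S q" "q \<in> Hom C Q (Z (b - 1))" "g \<in> Hom C Q (Obj Y b)" "r \<cdot> g = q"
    using locally_exact_factor[OF Y(2,3)] by metis
  note [simp] = HomD[OF r(1)] HomD[OF q(2)] HomD[OF q(3)]
  have "b - 1 \<in> {..<b}" by simp
  note A = acyclic_dataD[OF Y(3) this]
  \<comment> \<open>If \<open>r\<close> kills \<open>u\<close>, then \<open>u\<close> is a cycle in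
    degree \<open>b\<close>, locally a boundary from the zero object in degree \<open>b + 1\<close>;
    a deflation detects that it vanishes.\<close>
  have mono: "u = Zero C U (Obj Y b)" if u: "u \<in> Hom C U (Obj Y b)" "r \<cdot> u = Zero C U (Z (b - 1))" for u U
  proof -
    note [simp] = HomD[OF u(1)]
    have "Diff Y b \<cdot> u = Zero C U (Obj Y (b - 1))" unfolding r(2) using u(2) A by simp
    then obtain V v w where v: "deflation S v" "v \<in> Hom C V U" "w \<in> Hom C V (Obj Y (b + 1))"
      "Diff Y (b + 1) \<cdot> w = u \<cdot> v"
      by (rule locally_exactE[OF Y(2) u(1) _ refl])
    note [simp] = HomD[OF v(2)] HomD[OF v(3)]
    have "w = Zero C V (Obj Y (b + 1))" using zero_object_eq(1)[OF zeroY, of "b + 1" w] by simp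
    then have "u \<cdot> v = Zero C U (Obj Y b) \<cdot> v" using v(4)[symmetric] by simp
    then show ?thesis using deflation_epi[OF v(1), of u "Obj Y b" "Zero C U (Obj Y b)"]
      by (simp add: Hom_def)
  qed
  obtain \<kappa> where \<kappa>: "(\<kappa>, q) \<in> S" using q(1) unfolding deflation_def by auto
  note [simp] = conflationD(1-3)[OF \<kappa>]
  \<comment> \<open>As \<open>r\<close> is a monomorphism, \<open>g\<close> kills the kernel of
    \<open>q\<close> and descends to a section of \<open>r\<close>, which is then an
    inverse.\<close>
  have "r \<cdot> (g \<cdot> \<kappa>) = Zero C (Dom C \<kappa>) (Z (b - 1))"
    using conflationD(4)[OF \<kappa>] Comp_cong_left[OF q(4), of \<kappa>] by simp
  then have "g \<cdot> \<kappa> = Zero C (Dom C \<kappa>) (Obj Y b)"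
    by (rule mono[rotated]) (simp add: Hom_def)
  then obtain g' where g': "g' \<in> Hom C (Z (b - 1)) (Obj Y b)" "g' \<cdot> q = g"
    using conflation_colift[OF \<kappa>, of g "Obj Y b"] by (auto simp: Hom_def)
  note [simp] = HomD[OF g'(1)]
  have "(r \<cdot> g') \<cdot> q = Id C (Z (b - 1)) \<cdot> q" using g'(2) q(4) by simp
  then have rg: "r \<cdot> g' = Id C (Z (b - 1))"
    using deflation_epi[OF q(1), of "r \<cdot> g'" "Z (b - 1)" "Id C (Z (b - 1))"] by (simp add: Hom_def)
  have "r \<cdot> (g' \<cdot> r \<ominus> Id C (Obj Y b)) = Zero C (Obj Y b) (Z (b - 1))"
    using Comp_cong_left[OF rg, of r] by simp
  from mono[OF _ this] have "g' \<cdot> r = Id C (Obj Y b)" by (simp add: Hom_def Minus_eq_Zero_iff)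
  then have iso: "is_iso C r" using is_isoI[OF r(1) g'(1) _ rg] by simp
  let ?Z = "\<lambda>n. if n < b then Z n else Z0" and ?i = "\<lambda>n. if n < b then i n else Zero C Z0 (Obj Y n)"
    and ?p = "\<lambda>n. if n < b then p n else if n = b then r else Zero C (Obj Y n) Z0"
  have "acyclic_data C S Y ?Z ?i ?p UNIV"
    unfolding acyclic_data_def
  proof
    fix n
    consider "n < b" | "n = b" | "n > b" by linarith
    then show "(?i n, ?p n) \<in> S \<and> ?i n \<in> Hom C (?Z n) (Obj Y n) \<and> ?p n \<in> Hom C (Obj Y n) (?Z (n - 1)) \<and>
      Diff Y n = ?i (n - 1) \<cdot> ?p n"
    proof cases
      case 1
      then show ?thesis using acyclic_dataD[OF Y(3), of n] by (simp add: Hom_def)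
    next
      case 2
      then show ?thesis using iso_conflation(1)[OF iso Z0] Z0 r by (simp add: Hom_def)
    next
      case 3
      have z: "zero_object C (Obj Y n)" using zeroY 3 by simp
      have "is_iso C (Zero C (Obj Y n) Z0)" using zero_object_iso[OF z Z0] Z0 by (simp add: Hom_def)
      then have "(Zero C Z0 (Obj Y n), Zero C (Obj Y n) Z0) \<in> S"
        using iso_conflation(1)[OF _ Z0, of "Zero C (Obj Y n) Z0"] Z0 by simp
      moreover have "Diff Y n = Zero C (Obj Y n) (Obj Y (n - 1))"
        using zero_object_eq(2)[OF z, of "Diff Y n"] by simp
      ultimately show ?thesis using 3 Z0 by (simp add: Hom_def)
    qed
  qed
  then have "acyclic_complex C S Y" using acyclic_complex_iff by blast
  moreover have "finite_complex C a b Y" unfolding finite_complex_def using Yc zeroY by blast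
  ultimately show thesis using that Y(1,5) Y(4)[of a] by blast
qed

end

section \<open>Truncated mapping cones\<close>

text \<open>A relation and not a function, so that it also covers \<open>segment\<close>, formed in
  the full subcategory and read in the ambient category. The degree shift \<open>c\<close> carries
  no sign.\<close>

definition truncation ::
  "('o, 'm) precat \<Rightarrow> ('o, 'm) cpx \<Rightarrow> int \<Rightarrow> int \<Rightarrow> int \<Rightarrow> ('o, 'm) cpx \<Rightarrow> bool" where
  "truncation C X c l m X' \<longleftrightarrow> is_complex C X' \<and>
    (\<forall>k. if l \<le> k \<and> k \<le> m then Obj X' k = Obj X (k + c) else zero_object C (Obj X' k)) \<and>
    (\<forall>k. l < k \<and> k \<le> m \<longrightarrow> Diff X' k = Diff X (k + c))"

context additive_category
begin

lemma truncationD: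
  assumes "truncation C X c l m X'"
  shows "is_complex C X'" "l \<le> k \<Longrightarrow> k \<le> m \<Longrightarrow> Obj X' k = Obj X (k + c)"
    "\<not> (l \<le> k \<and> k \<le> m) \<Longrightarrow> zero_object C (Obj X' k)" "l < k \<Longrightarrow> k \<le> m \<Longrightarrow> Diff X' k = Diff X (k + c)"
  using assms unfolding truncation_def by (auto split: if_splits)

lemma ex_mapping_cone:
  assumes X: "is_complex C X" and Y: "is_complex C Y" and h: "chain_map C X Y h"
  obtains K where "mapping_cone C X Y h K"
proof -
  note [simp] = is_complexD[OF X] is_complexD[OF Y] chain_mapD(1-3)[OF h]
  have "\<forall>n. \<exists>P i j p q. biproduct C (Obj X (n - 1)) (Obj Y n) P i j p q" using ex_biproduct by simp
  then obtain P i j p q where b: "\<And>n. biproduct C (Obj X (n - 1)) (Obj Y n) (P n) (i n) (j n) (p n) (q n)"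
    by metis
  note [simp] = biproduct_simps[OF b]
  let ?D = "\<lambda>n. i (n - 1) \<cdot> (Neg C (Diff X (n - 1)) \<cdot> p n) \<oplus> j (n - 1) \<cdot> (h (n - 1) \<cdot> p n \<oplus> Diff Y n \<cdot> q
    n)"
  let ?K = "\<lparr>Obj = P, Diff = ?D\<rparr>"
  have K: "is_complex C ?K"
  proof (rule is_complexI)
    fix n
    have c: "Diff Y n \<cdot> (h n \<cdot> p (n + 1)) = h (n - 1) \<cdot> (Diff X n \<cdot> p (n + 1))"
      using chain_map_Comp[OF Y h _ _ X, of "p (n + 1)" n] by simp
    show "Obj ?K n \<in> Ob C" by simp
    show "Diff ?K n \<in> Hom C (Obj ?K n) (Obj ?K (n - 1))" by (simp add: Hom_def)
    show "Diff ?K n \<cdot> Diff ?K (n + 1) = Zero C (Obj ?K (n + 1)) (Obj ?K (n - 1))"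
      using c by simp
  qed
  have "mapping_cone C X Y h ?K"
    unfolding mapping_cone_def
    by (intro conjI K exI[of _ i] exI[of _ j] exI[of _ p] exI[of _ q] allI) (use b in simp_all)
  then show thesis using that by blast
qed

text \<open>The definition of the cone gives the matrix entries of its differential; this form
  applies the matrix to a generalised element \<open>f\<close> with coordinates
  \<open>p n \<cdot> f\<close> and \<open>q n \<cdot> f\<close>.\<close>

lemma mapping_cone_sum:
  assumes "mapping_cone C X Y h K"
  obtains i j p q where "\<And>n. biproduct C (Obj X (n - 1)) (Obj Y n) (Obj K n) (i n) (j n) (p n) (q n)"
    "\<And>n f. \<lbrakk>is_complex C X; is_complex C Y; chain_map C X Y h; f \<in> Ar C; Cod C f = Obj K n\<rbrakk> \<Longrightarrow>
      p (n - 1) \<cdot> (Diff K n \<cdot> f) = Neg C (Diff X (n - 1) \<cdot> (p n \<cdot> f))"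
    "\<And>n f. \<lbrakk>is_complex C X; is_complex C Y; chain_map C X Y h; f \<in> Ar C; Cod C f = Obj K n\<rbrakk> \<Longrightarrow>
      q (n - 1) \<cdot> (Diff K n \<cdot> f) = h (n - 1) \<cdot> (p n \<cdot> f) \<oplus> Diff Y n \<cdot> (q n \<cdot> f)"
proof -
  obtain i j p q where b: "\<And>n. biproduct C (Obj X (n - 1)) (Obj Y n) (Obj K n) (i n) (j n) (p n) (q n)"
    and D: "\<And>n. p (n - 1) \<cdot> Diff K n \<cdot> i n = Neg C (Diff X (n - 1))"
    "\<And>n. p (n - 1) \<cdot> Diff K n \<cdot> j n = Zero C (Obj Y n) (Obj X (n - 2))"
    "\<And>n. q (n - 1) \<cdot> Diff K n \<cdot> i n = h (n - 1)"
    "\<And>n. q (n - 1) \<cdot> Diff K n \<cdot> j n = Diff Y n" and K: "is_complex C K"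
    using assms unfolding mapping_cone_def by blast
  note [simp] = biproductD[OF b] is_complexD(1-4)[OF K]
  show thesis
  proof (rule that[OF b])
    fix n f assume X: "is_complex C X" and Y: "is_complex C Y" and h: "chain_map C X Y h"
      and f: "f \<in> Ar C" "Cod C f = Obj K n"
    note [simp] = is_complexD(1-4)[OF X] is_complexD(1-4)[OF Y] chain_mapD(1-3)[OF h] f
    have e: "u \<cdot> (Diff K n \<cdot> f) = (u \<cdot> Diff K n \<cdot> i n) \<cdot> (p n \<cdot> f) \<oplus> (u \<cdot> Diff K n \<cdot> j n) \<cdot> (q n \<cdot> f)"
      if u [simp]: "u \<in> Ar C" "Dom C u = Obj K (n - 1)" for u
    proof -
      have "u \<cdot> (Diff K n \<cdot> f) = u \<cdot> (Diff K n \<cdot> (i n \<cdot> (p n \<cdot> f) \<oplus> j n \<cdot> (q n \<cdot> f)))"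
        using biproduct_decomp(1)[OF b[of n], of f] by (metis f)
      then show ?thesis by simp
    qed
    have [simp]: "n - 1 - 1 = n - 2" by simp
    show "p (n - 1) \<cdot> (Diff K n \<cdot> f) = Neg C (Diff X (n - 1) \<cdot> (p n \<cdot> f))"
      by (subst e) (simp_all add: D del: Comp_assoc')
    show "q (n - 1) \<cdot> (Diff K n \<cdot> f) = h (n - 1) \<cdot> (p n \<cdot> f) \<oplus> Diff Y n \<cdot> (q n \<cdot> f)"
      by (subst e) (simp_all add: D del: Comp_assoc')
  qed
qed

lemma iso_cancel:
  assumes "is_iso C h" "f \<in> Hom C A (Dom C h)" "g \<in> Hom C A (Dom C h)" "h \<cdot> f = h \<cdot> g"
  shows "f = g"
proof -
  obtain k where k: "k \<in> Hom C (Cod C h) (Dom C h)" "k \<cdot> h = Id C (Dom C h)"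
    using is_isoE[OF assms(1)] by blast
  have h: "h \<in> Ar C" using assms(1) unfolding is_iso_def by simp
  note [simp] = HomD[OF k(1)] HomD[OF assms(2)] HomD[OF assms(3)] h
  have "k \<cdot> (h \<cdot> f) = k \<cdot> (h \<cdot> g)" using assms(4) by simp
  then show ?thesis using Comp_cong_left[OF k(2)] by simp
qed

lemma iso_lift:
  assumes "is_iso C h" "f \<in> Hom C A (Cod C h)"
  obtains g where "g \<in> Hom C A (Dom C h)" "h \<cdot> g = f"
proof -
  obtain k where k: "k \<in> Hom C (Cod C h) (Dom C h)" "h \<cdot> k = Id C (Cod C h)"
    using is_isoE[OF assms(1)] by blast
  have h: "h \<in> Ar C" using assms(1) unfolding is_iso_def by simp
  note [simp] = HomD[OF k(1)] HomD[OF assms(2)] h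
  show thesis using that[of "k \<cdot> f"] Comp_cong_left[OF k(2), of f] by (simp add: Hom_def)
qed

lemma Add_eq_Zero_iff:
  assumes "f \<in> Ar C" "g \<in> Ar C" "Dom C f = Dom C g" "Cod C f = Cod C g" "A = Dom C g" "B = Cod C g"
  shows "f \<oplus> g = Zero C A B \<longleftrightarrow> f = Neg C g" "f \<oplus> g = Zero C A B \<longleftrightarrow> g = Neg C f"
  using assms by (auto simp: hom_algebra)

lemma Neg_eq_iff:
  assumes "f \<in> Ar C" "g \<in> Ar C" "Dom C f = Dom C g" "Cod C f = Cod C g"
  shows "Neg C f = Neg C g \<longleftrightarrow> f = g" "Neg C f = g \<longleftrightarrow> f = Neg C g"
  using assms by (metis Neg_Neg)+

end

context exact_category
begin

text \<open>Where \<open>h\<close> is invertible, the terms of the mapping cone of \<open>h\<close> may be discarded without affecting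
  exactness: a cycle of the truncated cone extends to a cycle of the full cone, and conversely for
  boundaries.\<close>

lemma truncated_cone_locally_exact:
  assumes X: "locally_exact C S X" and Y: "locally_exact C S Y" and h: "chain_map C X Y h"
    and iso: "\<And>k. \<not> (l \<le> k \<and> k \<le> m) \<Longrightarrow> is_iso C (h (k + c))"
    and X': "truncation C X c l m X'" and Y': "truncation C Y c l m Y'" and h': "chain_map C X' Y' h'"
    and hh': "\<And>k. l \<le> k \<Longrightarrow> k \<le> m \<Longrightarrow> h' k = h (k + c)" and K: "mapping_cone C X' Y' h' K"
  shows "locally_exact C S K"
proof -
  have Kc: "is_complex C K" using K unfolding mapping_cone_def by simp
  note Xc = locally_exact_is_complex[OF X] and Yc = locally_exact_is_complex[OF Y]
  note X'c = truncationD(1)[OF X'] and Y'c = truncationD(1)[OF Y']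
  note [simp] = is_complexD[OF Xc] is_complexD[OF Yc] is_complexD[OF X'c] is_complexD[OF Y'c]
    is_complexD[OF Kc]
    chain_mapD(1-3)[OF h] chain_mapD(1-3)[OF h']
  obtain i j p q where b: "\<And>n. biproduct C (Obj X' (n - 1)) (Obj Y' n) (Obj K n) (i n) (j n) (p n) (q n)"
    and Dp: "\<And>n f. \<lbrakk>f \<in> Ar C; Cod C f = Obj K n\<rbrakk> \<Longrightarrow>
      p (n - 1) \<cdot> (Diff K n \<cdot> f) = Neg C (Diff X' (n - 1) \<cdot> (p n \<cdot> f))"
    and Dq: "\<And>n f. \<lbrakk>f \<in> Ar C; Cod C f = Obj K n\<rbrakk> \<Longrightarrow>
      q (n - 1) \<cdot> (Diff K n \<cdot> f) = h' (n - 1) \<cdot> (p n \<cdot> f) \<oplus> Diff Y' n \<cdot> (q n \<cdot> f)"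
    using mapping_cone_sum[OF K] X'c Y'c h' by metis
  note [simp] = biproduct_simps[OF b]
  show ?thesis
  proof (rule locally_exactI[OF Kc])
    fix n A f assume f: "f \<in> Hom C A (Obj K n)" and z: "Diff K n \<cdot> f = Zero C A (Obj K (n - 1))"
    note [simp] = HomD[OF f]
    \<comment> \<open>The coordinates of the given cycle of the truncated cone; \<open>N\<close> is
      the degree of the untruncated complexes that corresponds to \<open>n\<close>.\<close>
    define x y N where "x = p n \<cdot> f" and "y = q n \<cdot> f" and "N = n + c"
    have xy [simp]: "x \<in> Ar C" "Dom C x = A" "Cod C x = Obj X' (n - 1)" "y \<in> Ar C" "Dom C y = A"
      "Cod C y = Obj Y' n"
      unfolding x_def y_def by auto
    have hc: "Diff Y k \<cdot> (h k \<cdot> w) = h (k - 1) \<cdot> (Diff X k \<cdot> w)" if "w \<in> Ar C" "Cod C w = Obj X k" for k w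
      using chain_map_Comp[OF Yc h that Xc] .
    have Dx: "Diff X' (n - 1) \<cdot> x = Zero C A (Obj X' (n - 2))"
    proof -
      have "Neg C (Diff X' (n - 1) \<cdot> x) = Zero C A (Obj X' (n - 2))"
        using Dp[of f n] z unfolding x_def by simp
      then show ?thesis by (subst (asm) Neg_eq_iff) auto
    qed
    have Dxy: "h' (n - 1) \<cdot> x \<oplus> Diff Y' n \<cdot> y = Zero C A (Obj Y' (n - 1))"
      using Dq[of f n] z unfolding x_def y_def by simp
    have isoN: "is_iso C (h (N - 1))" if "\<not> (l \<le> n - 1 \<and> n - 1 \<le> m)" using iso[OF that]
      by (simp add: N_def algebra_simps)
    have isoN0: "is_iso C (h N)" if "\<not> (l \<le> n \<and> n \<le> m)" using iso[OF that]
      by (simp add: N_def algebra_simps)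
    have isoN1: "is_iso C (h (N + 1))" if "\<not> (l \<le> n + 1 \<and> n + 1 \<le> m)" using iso[OF that]
      by (simp add: N_def algebra_simps)
    have isoN2: "is_iso C (h (N - 2))" if "\<not> (l \<le> n - 2 \<and> n - 2 \<le> m)" using iso[OF that]
      by (simp add: N_def algebra_simps)
    have obX: "Obj X' (n - 1) = Obj X (N - 1)" "h' (n - 1) = h (N - 1)"
      "Obj Y' (n - 1) = Obj Y (N - 1)" if "l \<le> n - 1" "n - 1 \<le> m"
      using truncationD(2)[OF X' that] truncationD(2)[OF Y' that] hh'[OF that]
        by (simp_all add: N_def algebra_simps)
    have obY: "Obj Y' n = Obj Y N" "Obj X' n = Obj X N" "h' n = h N" if "l \<le> n" "n \<le> m"
      using truncationD(2)[OF Y' that] truncationD(2)[OF X' that] hh'[OF that]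
        by (simp_all add: N_def algebra_simps)
    have obY1: "Obj Y' (n + 1) = Obj Y (N + 1)" if "l \<le> n + 1" "n + 1 \<le> m"
      using truncationD(2)[OF Y' that] by (simp_all add: N_def algebra_simps)
    have dY: "Diff Y' n = Diff Y N" "Diff X' n = Diff X N" if "l < n" "n \<le> m"
      using truncationD(4)[OF Y' that] truncationD(4)[OF X' that] by (simp_all add: N_def algebra_simps)
    have dX: "Diff X' (n - 1) = Diff X (N - 1)" if "l < n - 1" "n - 1 \<le> m"
      using truncationD(4)[OF X' that] by (simp_all add: N_def algebra_simps)
    have dY1: "Diff Y' (n + 1) = Diff Y (N + 1)" if "l < n + 1" "n + 1 \<le> m"
      using truncationD(4)[OF Y' that] by (simp_all add: N_def algebra_simps)
    have zX: "zero_object C (Obj X' (n - 1))" "zero_object C (Obj Y' (n - 1))"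
      if "\<not> (l \<le> n - 1 \<and> n - 1 \<le> m)"
      using truncationD(3)[OF X' that] truncationD(3)[OF Y' that] by auto
    have zY: "zero_object C (Obj Y' n)" "zero_object C (Obj X' n)" if "\<not> (l \<le> n \<and> n \<le> m)"
      using truncationD(3)[OF X' that] truncationD(3)[OF Y' that] by auto
    have zY1: "zero_object C (Obj Y' (n + 1))" if "\<not> (l \<le> n + 1 \<and> n + 1 \<le> m)"
      using truncationD(3)[OF Y' that] by auto
    define goal where "goal \<longleftrightarrow> (\<exists>Q q g. deflation S q \<and> q \<in> Hom C Q A \<and> g \<in> Hom C Q (Obj K (n + 1)) \<and>
      Diff K (n + 1) \<cdot> g = f \<cdot> q)"
    have goalI: goal if "deflation S t" "t \<in> Hom C R A" "x' \<in> Hom C R (Obj X' n)"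
      "y' \<in> Hom C R (Obj Y' (n + 1))"
      "Neg C (Diff X' n \<cdot> x') = x \<cdot> t" "h' n \<cdot> x' \<oplus> Diff Y' (n + 1) \<cdot> y' = y \<cdot> t" for t R x' y'
    proof -
      note [simp] = HomD[OF that(2)] HomD[OF that(3)] HomD[OF that(4)]
      let ?g = "i (n + 1) \<cdot> x' \<oplus> j (n + 1) \<cdot> y'"
      have T [simp]: "?g \<in> Ar C" "Dom C ?g = R" "Cod C ?g = Obj K (n + 1)" by auto
      have "p n \<cdot> (Diff K (n + 1) \<cdot> ?g) = p n \<cdot> (f \<cdot> t)" using Dp[of ?g "n + 1"] that(5)
        by (simp add: x_def)
      moreover have "q n \<cdot> (Diff K (n + 1) \<cdot> ?g) = q n \<cdot> (f \<cdot> t)" using Dq[of ?g "n + 1"] that(6)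
        by (simp add: y_def)
      ultimately have "Diff K (n + 1) \<cdot> ?g = f \<cdot> t"
        by (rule biproduct_eqI[OF b[of n], of _ R, rotated 2]) (auto simp: Hom_def simp del: Comp_Add')
      then show goal unfolding goal_def using that(1,2)
        by (intro exI[of _ R] exI[of _ t] exI[of _ ?g]) (simp add: Hom_def del: Comp_Add')
    qed
    have goal
    proof (cases "\<not> (l \<le> n - 1 \<and> n - 1 \<le> m) \<and> \<not> (l \<le> n \<and> n \<le> m)")
      case True
      have "x = Zero C A (Obj X' (n - 1))" "y = Zero C A (Obj Y' n)"
        using zero_object_eq(1)[OF zX(1), of x] zero_object_eq(1)[OF zY(1), of y] True by auto
      then show goal using deflation_Id
        by (intro goalI[of "Id C A" A "Zero C A (Obj X' n)"
          "Zero C A (Obj Y' (n + 1))"]) (auto simp: Hom_def)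
    next
      case False
      \<comment> \<open>Extension to a cycle of the full cone: a coordinate discarded on the side of
        \<open>Y\<close> is set to zero, and one discarded on the side of \<open>X\<close> is solved
        for through the inverse of \<open>h\<close>.\<close>
      have "\<exists>x1 y1. x1 \<in> Hom C A (Obj X (N - 1)) \<and> y1 \<in> Hom C A (Obj Y N) \<and>
        Diff X (N - 1) \<cdot> x1 = Zero C A (Obj X (N - 2)) \<and>
        h (N - 1) \<cdot> x1 \<oplus> Diff Y N \<cdot> y1 = Zero C A (Obj Y (N - 1)) \<and> (l \<le> n - 1 \<and> n - 1 \<le> m \<longrightarrow> x1 = x) \<and>
        (if l \<le> n \<and> n \<le> m then y1 = y else y1 = Zero C A (Obj Y N))"
      proof (cases "l \<le> n - 1 \<and> n - 1 \<le> m")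
        case in1: True
        then have x [simp]: "Obj X' (n - 1) = Obj X (N - 1)" using obX by simp
        define y1 where "y1 = (if l \<le> n \<and> n \<le> m then y else Zero C A (Obj Y N))"
        have y1 [simp]: "y1 \<in> Ar C" "Dom C y1 = A" "Cod C y1 = Obj Y N" unfolding y1_def using obY by auto
        have e: "h (N - 1) \<cdot> x \<oplus> Diff Y N \<cdot> y1 = Zero C A (Obj Y (N - 1))"
        proof (cases "l \<le> n \<and> n \<le> m")
          case True
          then show ?thesis using Dxy obX in1 dY unfolding y1_def by simp
        next
          case False
          then have "y = Zero C A (Obj Y' n)" using zero_object_eq(1)[OF zY(1), of y] by simp
          then show ?thesis using False Dxy obX in1 unfolding y1_def by simp
        qed
        have "Diff X (N - 1) \<cdot> x = Zero C A (Obj X (N - 2))"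
        proof (cases "l < n - 1")
          case True
          then have "n - 2 \<ge> l" by simp
          then have "Obj X' (n - 2) = Obj X (N - 2)" using truncationD(2)[OF X', of "n - 2"] in1
            by (simp add: N_def algebra_simps)
          then show ?thesis using Dx dX in1 True by simp
        next
          case False
          \<comment> \<open>Here \<open>n - 1 = l\<close>, and the truncated differential no longer
            shows that \<open>x\<close> is a cycle of \<open>X\<close>; this follows from the cone
            equation because \<open>h\<close> is invertible in the degree just below.\<close>
          then have iso2: "is_iso C (h (N - 2))" using isoN2 by simp
          have "h (N - 1) \<cdot> x = Neg C (Diff Y N \<cdot> y1)" using e by (subst (asm) Add_eq_Zero_iff(1)) auto
          then have "Diff Y (N - 1) \<cdot> (h (N - 1) \<cdot> x) = Zero C A (Obj Y (N - 2))" by simp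
          then have "h (N - 2) \<cdot> (Diff X (N - 1) \<cdot> x) = h (N - 2) \<cdot> Zero C A (Obj X (N - 2))"
            using hc[of x "N - 1"] by simp
          then show ?thesis by (rule iso_cancel[OF iso2, rotated 2]) (auto simp: Hom_def)
        qed
        moreover have "if l \<le> n \<and> n \<le> m then y1 = y else y1 = Zero C A (Obj Y N)" by (simp add: y1_def)
        ultimately show ?thesis using e
          by - (rule exI[of _ x], rule exI[of _ y1], simp add: Hom_def)
      next
        case out1: False
        then have in0: "l \<le> n" "n \<le> m" using False by auto
        then have y [simp]: "Obj Y' n = Obj Y N" using obY by simp
        have iso1: "is_iso C (h (N - 1))" and iso2: "is_iso C (h (N - 2))" using isoN isoN2 out1 in0
          by auto
        obtain x1 where x1: "x1 \<in> Hom C A (Obj X (N - 1))" "h (N - 1) \<cdot> x1 = Neg C (Diff Y N \<cdot> y)"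
          using iso_lift[OF iso1, of "Neg C (Diff Y N \<cdot> y)" A] by (auto simp: Hom_def)
        note [simp] = HomD[OF x1(1)]
        have "Diff Y (N - 1) \<cdot> (h (N - 1) \<cdot> x1) = Zero C A (Obj Y (N - 2))" unfolding x1(2) by simp
        then have "h (N - 2) \<cdot> (Diff X (N - 1) \<cdot> x1) = h (N - 2) \<cdot> Zero C A (Obj X (N - 2))"
          using hc[of x1 "N - 1"] by simp
        then have "Diff X (N - 1) \<cdot> x1 = Zero C A (Obj X (N - 2))"
          by (rule iso_cancel[OF iso2, rotated 2]) (auto simp: Hom_def)
        then show ?thesis using x1 out1 in0
          by - (rule exI[of _ x1], rule exI[of _ y], auto simp: Hom_def)
      qed
      then obtain x1 y1 where x1: "x1 \<in> Hom C A (Obj X (N - 1))" and y1: "y1 \<in> Hom C A (Obj Y N)"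
        and Dx1: "Diff X (N - 1) \<cdot> x1 = Zero C A (Obj X (N - 2))"
        and e: "h (N - 1) \<cdot> x1 \<oplus> Diff Y N \<cdot> y1 = Zero C A (Obj Y (N - 1))"
        and xx: "l \<le> n - 1 \<and> n - 1 \<le> m \<Longrightarrow> x1 = x"
        and yy: "l \<le> n \<and> n \<le> m \<Longrightarrow> y1 = y" "\<not> (l \<le> n \<and> n \<le> m) \<Longrightarrow> y1 = Zero C A (Obj Y N)"
          by (metis (full_types))
      note [simp] = HomD[OF x1] HomD[OF y1]
      \<comment> \<open>The usual two liftings for a cone: first \<open>- x1\<close> in
        \<open>X\<close>, then the remaining discrepancy in \<open>Y\<close>, each on a further
        cover.\<close>
      have "Diff X (N - 1) \<cdot> Neg C x1 = Zero C A (Obj X (N - 1 - 1))" using Dx1 by simp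
      then obtain Q q0 x2 where q0: "deflation S q0" "q0 \<in> Hom C Q A"
        and x2: "x2 \<in> Hom C Q (Obj X N)" "Diff X N \<cdot> x2 = Neg C x1 \<cdot> q0"
        by (rule locally_exactE[OF X, of "Neg C x1" A "N - 1" N, rotated]) (auto simp: Hom_def)
      note [simp] = HomD[OF q0(2)] HomD[OF x2(1)]
      have e': "h (N - 1) \<cdot> (x1 \<cdot> q0) \<oplus> Diff Y N \<cdot> (y1 \<cdot> q0) = Zero C Q (Obj Y (N - 1))"
      proof -
        have "(h (N - 1) \<cdot> x1 \<oplus> Diff Y N \<cdot> y1) \<cdot> q0 = Zero C Q (Obj Y (N - 1))" unfolding e by simp
        then show ?thesis by simp
      qed
      have "Diff Y N \<cdot> (y1 \<cdot> q0) = Neg C (h (N - 1) \<cdot> (x1 \<cdot> q0))"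
        using e' by (subst (asm) Add_eq_Zero_iff(2)) auto
      then have "Diff Y N \<cdot> (y1 \<cdot> q0 \<ominus> h N \<cdot> x2) = Zero C Q (Obj Y (N - 1))"
        using hc[of x2 N] x2(2) by simp
      then obtain R q1 y2 where q1: "deflation S q1" "q1 \<in> Hom C R Q"
        and y2: "y2 \<in> Hom C R (Obj Y (N + 1))"
        "Diff Y (N + 1) \<cdot> y2 = (y1 \<cdot> q0 \<ominus> h N \<cdot> x2) \<cdot> q1"
        by (rule locally_exactE[OF Y, of "y1 \<cdot> q0 \<ominus> h N \<cdot> x2" Q N "N + 1", rotated]) (auto simp: Hom_def)
      note [simp] = HomD[OF q1(2)] HomD[OF y2(1)]
      let ?t = "q0 \<cdot> q1" and ?x = "x2 \<cdot> q1"
      have t: "deflation S ?t" "?t \<in> Hom C R A" using deflation_Comp[OF q1(1) q0(1)]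
        by (auto simp: Hom_def)
      have x3: "Diff X N \<cdot> ?x = Neg C (x1 \<cdot> ?t)" using Comp_cong_left[OF x2(2), of q1] by simp
      have y3: "h N \<cdot> ?x \<oplus> Diff Y (N + 1) \<cdot> y2 = y1 \<cdot> ?t" unfolding y2(2) by (simp add: hom_algebra)
      show goal
      proof (cases "l \<le> n \<and> n \<le> m")
        case in0: True
        have xt: "Neg C (Diff X' n \<cdot> w) = x \<cdot> ?t"
          if w: "w \<in> Hom C R (Obj X N)" "Diff X N \<cdot> w = Neg C (x1 \<cdot> ?t)" for w
        proof (cases "l \<le> n - 1 \<and> n - 1 \<le> m")
          case True
          then show ?thesis using w in0 dY xx[OF True] by simp
        next
          case False
          show ?thesis
            by (rule zero_object_parallel(1)[OF zX(1)[OF False], of _ R]) (use w obY in0 HomD[OF w(1)] in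
              \<open>auto simp: Hom_def\<close>)
        qed
        show goal
        proof (cases "n + 1 \<le> m")
          case True
          show goal
            by (rule goalI[OF t, of ?x y2]) (use True in0 obY obY1 dY1 y3 yy xt[OF _ x3] in \<open>auto simp:
              Hom_def\<close>)
        next
          case False
          then have out1: "\<not> (l \<le> n + 1 \<and> n + 1 \<le> m)" by simp
          \<comment> \<open>The \<open>Y\<close> coordinate of the lift lies in the discarded degree
            \<open>n + 1\<close>. Through the inverse of \<open>h\<close> it becomes a boundary in
            \<open>X\<close> and is absorbed into the \<open>X\<close> coordinate.\<close>
          obtain w where w: "w \<in> Hom C R (Obj X (N + 1))" "h (N + 1) \<cdot> w = y2"
            using iso_lift[OF isoN1[OF out1], of y2 R] by (auto simp: Hom_def)
          note [simp] = HomD[OF w(1)]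
          let ?x' = "?x \<oplus> Diff X (N + 1) \<cdot> w"
          have w': "?x' \<in> Hom C R (Obj X N)" "Diff X N \<cdot> ?x' = Neg C (x1 \<cdot> ?t)" using x3
            by (auto simp: Hom_def)
          have "h N \<cdot> ?x' = y1 \<cdot> ?t" using y3 hc[of w "N + 1"] w(2) by simp
          then show goal
            by (intro goalI[OF t, of ?x' "Zero C R (Obj Y' (n + 1))"]) (use in0 obY yy xt[OF w'] w'(1)
              HomD[OF w'(1)] in \<open>auto simp: Hom_def\<close>)
        qed
      next
        case out0: False
        then have in1: "l \<le> n - 1 \<and> n - 1 \<le> m" and out1: "\<not> (l \<le> n + 1 \<and> n + 1 \<le> m)" using False by auto
        obtain w where w: "w \<in> Hom C R (Obj X (N + 1))" "h (N + 1) \<cdot> w = y2"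
          using iso_lift[OF isoN1[OF out1], of y2 R] by (auto simp: Hom_def)
        note [simp] = HomD[OF w(1)]
        \<comment> \<open>Now \<open>n - 1 = m\<close>, so no coordinate is left to lift with. The
          same correction, together with the invertibility of \<open>h\<close> in degree
          \<open>N\<close>, shows that \<open>x\<close> already vanishes on the cover.\<close>
        have "h N \<cdot> (?x \<oplus> Diff X (N + 1) \<cdot> w) = h N \<cdot> Zero C R (Obj X N)"
          using y3 hc[of w "N + 1"] w(2) yy(2)[OF out0] by simp
        then have "?x \<oplus> Diff X (N + 1) \<cdot> w = Zero C R (Obj X N)"
          by (rule iso_cancel[OF isoN0[OF out0], rotated 2]) (auto simp: Hom_def)
        then have "Diff X N \<cdot> (?x \<oplus> Diff X (N + 1) \<cdot> w) = Zero C R (Obj X (N - 1))" by simp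
        then have "Neg C (x1 \<cdot> ?t) = Zero C R (Obj X (N - 1))" using x3 by simp
        then have x4: "x1 \<cdot> ?t = Zero C R (Obj X (N - 1))" by (subst (asm) Neg_eq_iff) auto
        have "y \<cdot> ?t = Zero C R (Obj Y' n)"
          using zero_object_eq(1)[OF zY(1)[OF out0], of "y \<cdot> ?t"] by simp
        then show goal
          by (intro goalI[OF t, of "Zero C R (Obj X' n)" "Zero C R (Obj Y' (n + 1))"])
            (use x4 xx[OF in1] obX in1 in \<open>auto simp: Hom_def\<close>)
      qed
    qed
    then show "\<exists>Q q g. deflation S q \<and> q \<in> Hom C Q A \<and> g \<in> Hom C Q (Obj K (n + 1)) \<and>
      Diff K (n + 1) \<cdot> g = f \<cdot> q"
      unfolding goal_def .
  qed
qed

end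

section \<open>Approximation by the cluster tilting subcategory\<close>

locale cluster = exact_category C S for C :: "('o, 'm) precat" (structure) and S +
  fixes d :: nat and M :: "'o set"
  assumes d_pos: "1 \<le> d" and cluster_tilting: "cluster_tilting d C S M"

context exact_category
begin

text \<open>The new cycles in degree \<open>k - 1\<close> are the cokernel of
  \<open>\<alpha> \<cdot> i k\<close>, and the term in degree \<open>k - 1\<close> is pushed out
  along the induced arrow of cycles. The condition is placed on \<open>\<alpha> \<cdot> i k\<close>
  so that it holds for inflations \<open>\<alpha>\<close> and also for arbitrary
  \<open>\<alpha>\<close> in a top degree, where there are no cycles.\<close>

lemma acyclic_pushout_step:
  assumes a: "acyclic_data C S Y Z i p UNIV" and \<alpha>: "\<alpha> \<in> Hom C (Obj Y k) N" "inflation S (\<alpha> \<cdot> i k)"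
  obtains Y' h where "acyclic_complex C S Y'" "chain_map C Y Y' h" "Obj Y' k = N" "h k = \<alpha>"
    "\<And>n. n \<noteq> k \<Longrightarrow> n \<noteq> k - 1 \<Longrightarrow> Obj Y' n = Obj Y n \<and> h n = Id C (Obj Y n)"
    "is_pushout C \<alpha> (Diff Y k) (h (k - 1)) (Diff Y' k)"
proof -
  note Yc = acyclic_data_is_complex[OF a]
  note A = acyclic_dataD[OF a UNIV_I]
  note [simp] = A(3-) HomD[OF \<alpha>(1)]
  have k2 [simp]: "k - 1 - 1 = k - 2" "k + 1 - 1 = k" by auto
  have [simp]: "Cod C (p (k + 1)) = Z k" using A(8)[of "k + 1"] by simp
  obtain c where c: "(\<alpha> \<cdot> i k, c) \<in> S" using \<alpha>(2) unfolding inflation_def by auto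
  have cT [simp]: "c \<in> Ar C" "Dom C c = N" using conflationD[OF c] by auto
  have "c \<cdot> \<alpha> \<cdot> i k = Zero C (Z k) (Cod C c)" using conflationD(4)[OF c] by simp
  then obtain \<zeta> where \<zeta>: "\<zeta> \<in> Hom C (Z (k - 1)) (Cod C c)" "\<zeta> \<cdot> p k = c \<cdot> \<alpha>"
    using conflation_colift[OF A(1), of "c \<cdot> \<alpha>" k "Cod C c"] by (auto simp: Hom_def)
  note [simp] = HomD[OF \<zeta>(1)]
  obtain \<iota> b \<pi> where po: "is_pushout C (i (k - 1)) \<zeta> \<iota> b"
    and \<iota>: "(\<iota>, \<pi>) \<in> S" "\<pi> \<cdot> b = p (k - 1)" "Cod C \<pi> = Z (k - 2)"
    using pushout_conflation[OF A(1), of \<zeta> "k - 1"] by auto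
  have T [simp]: "\<iota> \<in> Ar C" "b \<in> Ar C" "Dom C \<iota> = Cod C c" "Dom C b = Obj Y (k - 1)" "Cod C b = Cod C \<iota>"
    "\<pi> \<in> Ar C" "Dom C \<pi> = Cod C \<iota>" and sq: "b \<cdot> i (k - 1) = \<iota> \<cdot> \<zeta>"
    using po conflationD[OF \<iota>(1)] unfolding is_pushout_def by auto
  note [simp] = \<iota>(3)
  let ?Z = "Z(k - 1 := Cod C c)" and ?i = "i(k := \<alpha> \<cdot> i k, k - 1 := \<iota>)" and ?p = "p(k := c, k - 1 := \<pi>)"
  let ?Y = "\<lparr>Obj = (Obj Y)(k := N, k - 1 := Cod C \<iota>), Diff = \<lambda>n. ?i (n - 1) \<cdot> ?p n\<rparr>"
  let ?h = "(\<lambda>n. Id C (Obj Y n))(k := \<alpha>, k - 1 := b)"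
  have cases: "n = k \<or> n = k + 1 \<or> n = k - 1 \<or> (n \<noteq> k \<and> n - 1 \<noteq> k \<and> n + 1 \<noteq> k)" for n by linarith
  have ad: "acyclic_data C S ?Y ?Z ?i ?p UNIV"
    unfolding acyclic_data_def
  proof
    fix n
    show "(?i n, ?p n) \<in> S \<and> ?i n \<in> Hom C (?Z n) (Obj ?Y n) \<and> ?p n \<in> Hom C (Obj ?Y n) (?Z (n - 1)) \<and>
      Diff ?Y n = ?i (n - 1) \<cdot> ?p n"
      using cases[of n] A(1)[of n] c \<iota> by (elim disjE) (auto simp: Hom_def)
  qed
  have b_D: "b \<cdot> (i (k - 1) \<cdot> p k) = \<iota> \<cdot> (c \<cdot> \<alpha>)"
    using Comp_cong_left[OF sq, of "p k"] \<zeta>(2) by simp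
  have cm: "chain_map C Y ?Y ?h"
    unfolding chain_map_def
  proof (intro conjI allI)
    fix n
    show "?h n \<in> Hom C (Obj Y n) (Obj ?Y n)" by (simp add: Hom_def)
    show "Diff ?Y n \<cdot> ?h n = ?h (n - 1) \<cdot> Diff Y n"
      using cases[of n] A(2)[of n] b_D \<iota>(2) by (elim disjE) auto
  qed
  \<comment> \<open>Pushing out along the arrow of cycles agrees with pushing out
    \<open>\<alpha>\<close> along the differential: a compatible arrow on \<open>N\<close> kills the
    cycles in degree \<open>k\<close>, hence factors through \<open>c\<close>.\<close>
  have "is_pushout C \<alpha> (Diff Y k) (?h (k - 1)) (Diff ?Y k)"
    unfolding is_pushout_def
  proof (intro conjI ballI impI)
    fix X u v assume X: "X \<in> Ob C" and u: "u \<in> Hom C (Cod C \<alpha>) X" and v: "v \<in> Hom C (Cod C (Diff Y k)) X"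
      and eq: "u \<cdot> \<alpha> = v \<cdot> Diff Y k"
    note [simp] = HomD[OF u]
    have v' [simp]: "v \<in> Ar C" "Dom C v = Obj Y (k - 1)" "Cod C v = X" using HomD[OF v] A(2)[of k] by auto
    have eq': "u \<cdot> \<alpha> = v \<cdot> (i (k - 1) \<cdot> p k)" using eq A(2)[of k] by simp
    have "u \<cdot> (\<alpha> \<cdot> i k) = Zero C (Z k) X" using Comp_cong_left[OF eq', of "i k"] by simp
    then obtain u' where u': "u' \<in> Hom C (Cod C c) X" "u' \<cdot> c = u"
      using conflation_colift[OF c, of u X] by (auto simp: Hom_def)
    note [simp] = HomD[OF u'(1)]
    have "(u' \<cdot> \<zeta>) \<cdot> p k = (v \<cdot> i (k - 1)) \<cdot> p k"
      using \<zeta>(2) Comp_cong_left[OF u'(2), of \<alpha>] eq' by simp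
    then have "v \<cdot> i (k - 1) = u' \<cdot> \<zeta>"
      using deflation_epi[OF A(13)[of k], of "u' \<cdot> \<zeta>" X "v \<cdot> i (k - 1)"] by (simp add: Hom_def)
    then have ex: "\<exists>!w. w \<in> Hom C (Cod C \<iota>) X \<and> w \<cdot> b = v \<and> w \<cdot> \<iota> = u'"
      using is_pushout_ex1[OF po, of v X u'] by (simp add: Hom_def)
    have "\<exists>!w. w \<in> Hom C (Cod C \<iota>) X \<and> w \<cdot> (\<iota> \<cdot> c) = u \<and> w \<cdot> b = v"
    proof -
      obtain w where w: "w \<in> Hom C (Cod C \<iota>) X" "w \<cdot> b = v" "w \<cdot> \<iota> = u'" using ex by blast
      note [simp] = HomD[OF w(1)]
      show ?thesis
      proof (intro ex1I[of _ w] conjI)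
        show "w \<cdot> (\<iota> \<cdot> c) = u" using Comp_cong_left[OF w(3), of c] u'(2) by simp
        fix w' assume w': "w' \<in> Hom C (Cod C \<iota>) X \<and> w' \<cdot> (\<iota> \<cdot> c) = u \<and> w' \<cdot> b = v"
        note [simp] = HomD[OF conjunct1[OF w']]
        have "(w' \<cdot> \<iota>) \<cdot> c = u' \<cdot> c" using w' u'(2) by simp
        moreover have "deflation S c" using c unfolding deflation_def by blast
        ultimately have "w' \<cdot> \<iota> = u'" using deflation_epi[of c "w' \<cdot> \<iota>" X u'] by (simp add: Hom_def)
        then show "w' = w" using ex w w' by blast
      qed (use w in auto)
    qed
    then show "\<exists>!w. w \<in> Hom C (Cod C (?h (k - 1))) X \<and> w \<cdot> Diff ?Y k = u \<and> w \<cdot> ?h (k - 1) = v" by simp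
  qed (use A(2)[of k] b_D in auto)
  moreover have "acyclic_complex C S ?Y" using ad acyclic_complex_iff by blast
  ultimately show thesis using that[of ?Y ?h] cm by simp
qed

end

context cluster
begin

lemma M_sub: "additive_subcategory C M" and M_gen: "generating C S M" and M_cogen: "cogenerating C S M"
  and M_cov: "covariantly_finite C M"
  using cluster_tilting unfolding cluster_tilting_def functorially_finite_def by auto

lemma M_eq:
  shows "M = {A \<in> Ob C. \<forall>n. 0 < n \<and> n < d \<longrightarrow> (\<forall>X \<in> M. Ext_vanishes C S n A X)}"
    "M = {A \<in> Ob C. \<forall>n. 0 < n \<and> n < d \<longrightarrow> (\<forall>X \<in> M. Ext_vanishes C S n X A)}"
  using cluster_tilting unfolding cluster_tilting_def by blast+

lemmas M_Ob = additive_subcategoryD(1)[OF M_sub]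
lemmas M_zero = additive_subcategoryD(3)[OF M_sub]
lemmas M_biproduct = additive_subcategoryD(4)[OF M_sub]

definition left_approx :: "'m \<Rightarrow> bool" where
  "left_approx a \<longleftrightarrow> (\<forall>B \<in> M. \<forall>g \<in> Hom C (Dom C a) B. \<exists>h \<in> Hom C (Cod C a) B. h \<cdot> a = g)"

text \<open>A left approximation remains one after adding a further component; a cogenerating
  inflation as second component makes it an inflation.\<close>

lemma left_approx_inflation:
  assumes V: "V \<in> Ob C"
  obtains N a where "N \<in> M" "a \<in> Hom C V N" "inflation S a" "left_approx a"
proof -
  obtain N1 f where N1: "N1 \<in> M" "f \<in> Hom C V N1"
    and f: "\<And>B g. B \<in> M \<Longrightarrow> g \<in> Hom C V B \<Longrightarrow> \<exists>h \<in> Hom C N1 B. h \<cdot> f = g"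
    using M_cov V unfolding covariantly_finite_def by metis
  obtain N2 \<iota> where N2: "N2 \<in> M" "\<iota> \<in> Hom C V N2" "inflation S \<iota>"
    using M_cogen V unfolding cogenerating_def by metis
  obtain P i j p q where b: "biproduct C N1 N2 P i j p q" using ex_biproduct M_Ob N1 N2 by metis
  note [simp] = biproduct_simps[OF b] HomD[OF N1(2)] HomD[OF N2(2)]
  let ?a = "i \<cdot> f \<oplus> j \<cdot> \<iota>"
  have "left_approx ?a"
    unfolding left_approx_def
  proof (intro ballI)
    fix B g assume B: "B \<in> M" "g \<in> Hom C (Dom C ?a) B"
    then obtain h where h: "h \<in> Hom C N1 B" "h \<cdot> f = g" using f[of B g] by auto
    then show "\<exists>h \<in> Hom C (Cod C ?a) B. h \<cdot> ?a = g"
      using HomD[OF h(1)] by (intro bexI[of _ "h \<cdot> p"]) (auto simp: Hom_def)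
  qed
  moreover have "?a \<in> Hom C V P" by (simp add: Hom_def)
  moreover have "inflation S ?a" by (rule inflation_biproduct[OF b N1(2) N2(2,3)])
  moreover have "P \<in> M" using M_biproduct[OF N1(1) N2(1) b] .
  ultimately show thesis using that by blast
qed

text \<open>The objects \<open>V m\<close>, ..., \<open>V l\<close> are iterated cokernels of left
  approximations, as in a coresolution of \<open>V m\<close> by \<open>M\<close>. A middle term
  \<open>Q\<close> arises as the sum of the original term in degree \<open>k - 1\<close> and an
  object of \<open>M\<close>, whence the conditional membership.\<close>

definition approx_chain :: "(int \<Rightarrow> 'o) \<Rightarrow> (int \<Rightarrow> 'o) \<Rightarrow> int \<Rightarrow> int \<Rightarrow> bool" where
  "approx_chain Y V l m \<longleftrightarrow> (\<forall>k. l < k \<and> k \<le> m \<longrightarrow> (\<exists>Q \<iota> \<pi>. (\<iota>, \<pi>) \<in> S \<and> \<iota> \<in> Hom C (V k) Q \<and>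
    \<pi> \<in> Hom C Q (V (k - 1)) \<and> left_approx \<iota> \<and> (Y (k - 1) \<in> M \<longrightarrow> Q \<in> M)))"

text \<open>Replacing, from the top down, the terms in degrees \<open>m, \<dots>, l + 1\<close> by objects of \<open>M\<close> and pushing out
  along left approximations. The objects \<open>V k\<close> are the successive pushouts.\<close>

lemma approximate_complex:
  assumes Y: "acyclic_complex C S Y" and lm: "l \<le> m"
  obtains Y' h V where "acyclic_complex C S Y'" "chain_map C Y Y' h"
    "\<And>n. \<not> (l \<le> n \<and> n \<le> m) \<Longrightarrow> Obj Y' n = Obj Y n \<and> h n = Id C (Obj Y n)"
    "\<And>n. l < n \<Longrightarrow> n \<le> m \<Longrightarrow> Obj Y' n \<in> M" "V m = Obj Y m" "V l = Obj Y' l" "approx_chain (Obj Y) V l m"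
    "\<And>W f. \<lbrakk>is_complex C W; chain_map C Y W f; \<And>n. l < n \<Longrightarrow> n \<le> m \<Longrightarrow> Obj W n \<in> M\<rbrakk> \<Longrightarrow>
      \<exists>f'. chain_map C Y' W f' \<and> (\<forall>n. \<not> (l \<le> n \<and> n \<le> m) \<longrightarrow> f' n = f n)"
proof -
  have Yc: "is_complex C Y" using Y unfolding acyclic_complex_def by simp
  note [simp] = is_complexD[OF Yc]
  \<comment> \<open>The induction invariant. Its last clause is a weak universal property: chain
    maps into complexes with terms of \<open>M\<close> in degrees \<open>l + 1\<close> to
    \<open>m\<close> factor through the replacement, without change outside the degrees
    \<open>l\<close> to \<open>m\<close>.\<close>
  define T where "T l Y' h V \<longleftrightarrow> acyclic_complex C S Y' \<and> chain_map C Y Y' h \<and>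
    (\<forall>n. \<not> (l \<le> n \<and> n \<le> m) \<longrightarrow> Obj Y' n = Obj Y n \<and> h n = Id C (Obj Y n)) \<and>
    (\<forall>n. l < n \<and> n \<le> m \<longrightarrow> Obj Y' n \<in> M) \<and> V m = Obj Y m \<and> V l = Obj Y' l \<and> approx_chain (Obj Y) V l m \<and>
    (\<forall>W f. is_complex C W \<and> chain_map C Y W f \<and> (\<forall>n. l < n \<and> n \<le> m \<longrightarrow> Obj W n \<in> M) \<longrightarrow>
      (\<exists>f'. chain_map C Y' W f' \<and> (\<forall>n. \<not> (l \<le> n \<and> n \<le> m) \<longrightarrow> f' n = f n)))" for l Y' h V
  have "\<exists>Y' h V. T (m - int t) Y' h V" for t
  proof (induction t)
    case 0
    have "T (m - int 0) Y (\<lambda>n. Id C (Obj Y n)) (\<lambda>_. Obj Y m)"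
      unfolding T_def using Y chain_map_Id[OF Yc] by (auto simp: approx_chain_def)
    then show ?case by blast
  next
    case (Suc t)
    define l where "l = m - int (Suc t)"
    have l: "m - int t = l + 1" "l < m" unfolding l_def by auto
    obtain Y1 h1 V where T1: "T (l + 1) Y1 h1 V" using Suc l by auto
    then have Y1: "acyclic_complex C S Y1" "chain_map C Y Y1 h1"
      "\<And>n. \<not> (l + 1 \<le> n \<and> n \<le> m) \<Longrightarrow> Obj Y1 n = Obj Y n \<and> h1 n = Id C (Obj Y n)"
      "\<And>n. l + 1 < n \<and> n \<le> m \<Longrightarrow> Obj Y1 n \<in> M" "V m = Obj Y m" "V (l + 1) = Obj Y1 (l + 1)"
      "approx_chain (Obj Y) V (l + 1) m"
      and univ1: "\<And>W f. is_complex C W \<Longrightarrow> chain_map C Y W f \<Longrightarrow> (\<And>n. l + 1 < n \<and> n \<le> m \<Longrightarrow> Obj W n \<in> M) \<Longrightarrow>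
      \<exists>f'. chain_map C Y1 W f' \<and> (\<forall>n. \<not> (l + 1 \<le> n \<and> n \<le> m) \<longrightarrow> f' n = f n)"
      unfolding T_def by (blast, blast, blast, blast, blast, blast, blast, blast)
    obtain Z i p where a: "acyclic_data C S Y1 Z i p UNIV" using Y1(1) acyclic_complex_iff by auto
    have Y1c: "is_complex C Y1" using acyclic_data_is_complex[OF a] .
    note [simp] = is_complexD[OF Y1c]
    obtain N \<alpha> where N: "N \<in> M" and \<alpha>: "\<alpha> \<in> Hom C (Obj Y1 (l + 1)) N" "inflation S \<alpha>" "left_approx \<alpha>"
      using left_approx_inflation[of "Obj Y1 (l + 1)"] by auto
    note [simp] = HomD[OF \<alpha>(1)]
    have l1: "l + 1 - 1 = l" and [simp]: "1 + l = l + 1" by simp_all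
    have "inflation S (\<alpha> \<cdot> i (l + 1))"
      using inflation_Comp[OF _ \<alpha>(2)] acyclic_dataD(3,4,5,12)[OF a UNIV_I, of "l + 1"] by simp
    then obtain Y2 h2 where Y2: "acyclic_complex C S Y2" "chain_map C Y1 Y2 h2" "Obj Y2 (l + 1) = N"
      "h2 (l + 1) = \<alpha>"
      "\<And>n. n \<noteq> l + 1 \<Longrightarrow> n \<noteq> l \<Longrightarrow> Obj Y2 n = Obj Y1 n \<and> h2 n = Id C (Obj Y1 n)"
      "is_pushout C \<alpha> (Diff Y1 (l + 1)) (h2 l) (Diff Y2 (l + 1))"
      by (rule acyclic_pushout_step[OF a \<alpha>(1), unfolded l1]) (rule that)
    have Y2c: "is_complex C Y2" using Y2(1) unfolding acyclic_complex_def by simp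
    note [simp] = is_complexD[OF Y2c] chain_mapD(1-3)[OF Y1(2)] chain_mapD(1-3)[OF Y2(2)]
    have D2: "Diff Y2 n = h2 (n - 1) \<cdot> Diff Y1 n" if "n \<noteq> l + 1" "n \<noteq> l" for n
      using chain_mapD(4)[OF Y2(2), of n] Y2(5)[OF that] by simp
    let ?V = "V(l := Obj Y2 l)"
    have "T l Y2 (\<lambda>n. h2 n \<cdot> h1 n) ?V"
      unfolding T_def
    proof (intro conjI allI impI)
      show "acyclic_complex C S Y2" by (rule Y2(1))
      show "chain_map C Y Y2 (\<lambda>n. h2 n \<cdot> h1 n)" by (rule chain_map_compose[OF Yc Y1c Y2c Y1(2) Y2(2)])
      show "?V m = Obj Y m" "?V l = Obj Y2 l" using Y1(5) l by auto
    next
      fix n assume n: "\<not> (l \<le> n \<and> n \<le> m)"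
      then have "\<not> (l + 1 \<le> n \<and> n \<le> m)" "n \<noteq> l + 1" "n \<noteq> l" using l(2) by auto
      then show "Obj Y2 n = Obj Y n" "h2 n \<cdot> h1 n = Id C (Obj Y n)" using Y1(3)[of n] Y2(5)[of n] by auto
    next
      fix n assume "l < n \<and> n \<le> m"
      then show "Obj Y2 n \<in> M" using Y2(3,5) Y1(4)[of n] N by (cases "n = l + 1") auto
    next
      show "approx_chain (Obj Y) ?V l m"
        unfolding approx_chain_def
      proof (intro allI impI)
        fix k assume k: "l < k \<and> k \<le> m"
        show "\<exists>Q \<iota> \<pi>. (\<iota>, \<pi>) \<in> S \<and> \<iota> \<in> Hom C (?V k) Q \<and> \<pi> \<in> Hom C Q (?V (k - 1)) \<and> left_approx \<iota> \<and>
          (Obj Y (k - 1) \<in> M \<longrightarrow> Q \<in> M)"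
        proof (cases "k = l + 1")
          case False
          then have "l + 1 < k \<and> k \<le> m" "k \<noteq> l" "k - 1 \<noteq> l" using k by auto
          then show ?thesis using Y1(7) unfolding approx_chain_def by simp
        next
          case True
          \<comment> \<open>The pushout square that defines \<open>Y2\<close> in degree
            \<open>l\<close> is read as a conflation from \<open>V (l + 1)\<close> through the sum
            \<open>Q\<close> of \<open>Obj Y1 l\<close> and \<open>N\<close> to the new
            \<open>V l\<close>. Its inflation is an approximation because its second component
            \<open>\<alpha>\<close> is one.\<close>
          obtain Q i' j' p' q' where b: "biproduct C (Obj Y1 l) N Q i' j' p' q'"
            using ex_biproduct[of "Obj Y1 l" N] M_Ob[OF N] by auto
          note [simp] = biproduct_simps[OF b]
          have cod [simp]: "Cod C (Diff Y1 (l + 1)) = Obj Y1 l" "Cod C (Diff Y2 (l + 1)) = Obj Y2 l"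
            by auto
          let ?\<iota> = "i' \<cdot> Diff Y1 (l + 1) \<oplus> j' \<cdot> \<alpha>" and ?\<pi> = "h2 l \<cdot> p' \<ominus> Diff Y2 (l + 1) \<cdot> q'"
          have "(?\<iota>, ?\<pi>) \<in> S" using pushout_biproduct_conflation[OF \<alpha>(2) Y2(6)] b by simp
          moreover have "?\<iota> \<in> Hom C (?V k) Q" "?\<pi> \<in> Hom C Q (?V (k - 1))" using True Y1(6) Y2(3)
            by (auto simp: Hom_def)
          moreover have "left_approx ?\<iota>"
            unfolding left_approx_def
          proof (intro ballI)
            fix B g assume B: "B \<in> M" "g \<in> Hom C (Dom C ?\<iota>) B"
            then obtain h where h: "h \<in> Hom C N B" "h \<cdot> \<alpha> = g" using \<alpha>(3) unfolding left_approx_def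
              by auto
            note [simp] = HomD[OF h(1)]
            show "\<exists>h \<in> Hom C (Cod C ?\<iota>) B. h \<cdot> ?\<iota> = g"
              using h(2) by (intro bexI[of _ "h \<cdot> q'"]) (auto simp: Hom_def)
          qed
          moreover have "Obj Y (k - 1) \<in> M \<longrightarrow> Q \<in> M" using True Y1(3)[of l] M_biproduct[OF _ N b] by simp
          ultimately show ?thesis by blast
        qed
      qed
    next
      fix W f assume A: "is_complex C W \<and> chain_map C Y W f \<and> (\<forall>n. l < n \<and> n \<le> m \<longrightarrow> Obj W n \<in> M)"
      then have Wc: "is_complex C W" and f: "chain_map C Y W f"
        and WM: "\<And>n. l < n \<and> n \<le> m \<Longrightarrow> Obj W n \<in> M" by auto
      obtain f1 where f1: "chain_map C Y1 W f1" "\<And>n. \<not> (l + 1 \<le> n \<and> n \<le> m) \<Longrightarrow> f1 n = f n"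
        using univ1[OF Wc f] WM by force
      note [simp] = is_complexD[OF Wc] chain_mapD(1-3)[OF f1(1)]
      have "Obj W (l + 1) \<in> M" "f1 (l + 1) \<in> Hom C (Dom C \<alpha>) (Obj W (l + 1))"
        using WM[of "l + 1"] l(2) by (auto simp: Hom_def)
      \<comment> \<open>In degree \<open>l + 1\<close> the map extends along the approximation, as
        \<open>W\<close> has a term of \<open>M\<close> there; the pushout then determines the
        component in degree \<open>l\<close>.\<close>
      then obtain u where u: "u \<in> Hom C N (Obj W (l + 1))" "u \<cdot> \<alpha> = f1 (l + 1)"
        using \<alpha>(3) unfolding left_approx_def by auto
      note [simp] = HomD[OF u(1)]
      have cod [simp]: "Cod C (Diff Y1 (l + 1)) = Obj Y1 l" "Cod C (Diff Y2 (l + 1)) = Obj Y2 l"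
        "Dom C (Diff Y2 (l + 1)) = N"
        "Cod C (Diff W (l + 1)) = Obj W l" using Y2(3) by auto
      have "Diff W (l + 1) \<cdot> u \<cdot> \<alpha> = f1 l \<cdot> Diff Y1 (l + 1)"
        using u(2) chain_mapD(4)[OF f1(1), of "l + 1"] by simp
      then have "\<exists>!w. w \<in> Hom C (Obj Y2 l) (Obj W l) \<and> w \<cdot> Diff Y2 (l + 1) = Diff W (l + 1) \<cdot> u \<and>
        w \<cdot> h2 l = f1 l"
        using is_pushout_ex1[OF Y2(6), of "Diff W (l + 1) \<cdot> u" "Obj W l" "f1 l"] by (simp add: Hom_def)
      then obtain w where w: "w \<in> Hom C (Obj Y2 l) (Obj W l)" "w \<cdot> Diff Y2 (l + 1) = Diff W (l + 1) \<cdot> u"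
        "w \<cdot> h2 l = f1 l"
        by blast
      note [simp] = HomD[OF w(1)]
      let ?f = "f1(l + 1 := u, l := w)"
      have "chain_map C Y2 W ?f"
        unfolding chain_map_def
      proof (intro conjI allI)
        fix n
        show "?f n \<in> Hom C (Obj Y2 n) (Obj W n)" using Y2(3) Y2(5)[of n] by (auto simp: Hom_def)
        consider "n = l + 2" | "n = l + 1" | "n = l" | "n \<noteq> l + 2" "n \<noteq> l + 1" "n \<noteq> l" by blast
        then show "Diff W n \<cdot> ?f n = ?f (n - 1) \<cdot> Diff Y2 n"
        proof cases
          case 1
          have "Diff Y2 n = \<alpha> \<cdot> Diff Y1 n" using D2[of n] Y2(4) 1 by simp
          moreover have "u \<cdot> (\<alpha> \<cdot> Diff Y1 n) = f1 (l + 1) \<cdot> Diff Y1 n"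
            using Comp_cong_left[OF u(2), of "Diff Y1 n"] 1 by simp
          ultimately show ?thesis using chain_mapD(4)[OF f1(1), of n] 1 by simp
        next
          case 2
          then show ?thesis using w(2) by simp
        next
          case 3
          \<comment> \<open>Commutation below the pushout is tested on the pushout: both composites
            agree after \<open>h2 l\<close> and vanish after the differential from degree
            \<open>l + 1\<close>.\<close>
          let ?a = "Diff W l \<cdot> w" and ?b = "f1 (l - 1) \<cdot> Diff Y2 l"
          have o: "Obj Y2 (l - 1) = Obj Y1 (l - 1)" "h2 (l - 1) = Id C (Obj Y1 (l - 1))"
            using Y2(5)[of "l - 1"] by auto
          have T: "?a \<in> Hom C (Obj Y2 l) (Obj W (l - 1))" "?b \<in> Hom C (Obj Y2 l) (Obj W (l - 1))"
            using o by (auto simp: Hom_def)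
          have 1: "?b \<cdot> h2 l = f1 (l - 1) \<cdot> Diff Y1 l"
            using chain_mapD(4)[OF Y2(2), of l] o by simp
          have 2: "?a \<cdot> h2 l = f1 (l - 1) \<cdot> Diff Y1 l"
            using chain_mapD(4)[OF f1(1), of l] w(3) by simp
          have 3: "?a \<cdot> Diff Y2 (l + 1) = Zero C N (Obj W (l - 1))" using w(2) by simp
          have 4: "?b \<cdot> Diff Y2 (l + 1) = Zero C N (Obj W (l - 1))" using o Y2(3) by simp
          have "\<exists>!w. w \<in> Hom C (Obj Y2 l) (Obj W (l - 1)) \<and>
            w \<cdot> Diff Y2 (l + 1) = Zero C N (Obj W (l - 1)) \<and> w \<cdot> h2 l = f1 (l - 1) \<cdot> Diff Y1 l"
            using is_pushout_ex1[OF Y2(6), of "Zero C N (Obj W (l - 1))" "Obj W (l - 1)"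
              "f1 (l - 1) \<cdot> Diff Y1 l"] M_Ob[OF N] by (simp add: Hom_def)
          then have "?a = ?b" by (rule Ex1_unique) (use T 1 2 3 4 in auto)
          then show ?thesis using \<open>n = l\<close> by simp
        next
          case 4
          then have n: "n - 1 \<noteq> l + 1" "n - 1 \<noteq> l" by auto
          show ?thesis using D2[of n] Y2(5)[OF n] chain_mapD(4)[OF f1(1), of n] 4 n by simp
        qed
      qed
      moreover have "\<forall>n. \<not> (l \<le> n \<and> n \<le> m) \<longrightarrow> ?f n = f n" using f1(2) l(2) by auto
      ultimately show "\<exists>f'. chain_map C Y2 W f' \<and> (\<forall>n. \<not> (l \<le> n \<and> n \<le> m) \<longrightarrow> f' n = f n)" by blast
    qed
    then show ?case unfolding l_def by blast
  qed
  from this[of "nat (m - l)"] obtain Y' h V where "T l Y' h V" using lm by auto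
  then show thesis using that[of Y' h V] unfolding T_def by blast
qed

end

section \<open>Yoneda extensions\<close>

lemma Ext_vanishesD:
  assumes "Ext_vanishes C S n A B" "X \<in> extensions C S n A B" "Y \<in> extensions C S n A B"
  shows "(X, Y) \<in> (extension_morphism C S n A B \<union> (extension_morphism C S n A B)\<inverse>)\<^sup>*"
proof -
  let ?r = "(extension_morphism C S n A B \<union> (extension_morphism C S n A B)\<inverse>)\<^sup>*"
  obtain c where c: "extensions C S n A B // ?r = {c}"
    using assms(1) unfolding Ext_vanishes_def yoneda_Ext_def is_singleton_def by blast
  have "?r `` {X} = ?r `` {Y}"
    using quotientI[OF assms(2), of ?r] quotientI[OF assms(3), of ?r] unfolding c by simp
  then show ?thesis by auto
qed

lemma Ext_vanishesI:
  assumes "X \<in> extensions C S n A B"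
    and "\<And>Y. Y \<in> extensions C S n A B \<Longrightarrow>
      (X, Y) \<in> (extension_morphism C S n A B \<union> (extension_morphism C S n A B)\<inverse>)\<^sup>*"
  shows "Ext_vanishes C S n A B"
proof -
  let ?r = "(extension_morphism C S n A B \<union> (extension_morphism C S n A B)\<inverse>)\<^sup>*"
  have "sym ?r" by (intro sym_rtrancl) (auto simp: sym_def)
  then have "?r `` {X} = ?r `` {Y}" if "Y \<in> extensions C S n A B" for Y
    using assms(2)[OF that] by (auto dest: symD intro: rtrancl_trans)
  then have "extensions C S n A B // ?r = {?r `` {X}}"
    using assms(1) unfolding quotient_def by blast
  then show ?thesis unfolding Ext_vanishes_def yoneda_Ext_def is_singleton_def by blast
qed

lemma extension_invariant:
  assumes "(X, Y) \<in> (extension_morphism C S n A B \<union> (extension_morphism C S n A B)\<inverse>)\<^sup>*" "P X"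
    and "\<And>U V. (U, V) \<in> extension_morphism C S n A B \<Longrightarrow> P U \<longleftrightarrow> P V"
  shows "P Y"
  using assms(1)
proof (induction rule: rtrancl_induct)
  case (step V W)
  then show ?case using assms(3)[of V W] assms(3)[of W V] by auto
qed (rule assms(2))

context additive_category
begin

lemma ex_truncation:
  assumes X: "is_complex C X"
  obtains X' where "truncation C X c l m X'"
proof -
  obtain Z where Z: "zero_object C Z" using ex_zero_object by auto
  note [simp] = is_complexD[OF X]
  let ?O = "\<lambda>k. if l \<le> k \<and> k \<le> m then Obj X (k + c) else Z"
  let ?X = "\<lparr>Obj = ?O, Diff = \<lambda>k. if l < k \<and> k \<le> m then Diff X (k + c) else Zero C (?O k) (?O (k - 1))\<rparr>"
  have [simp]: "k + c - 1 = k - 1 + c" "k + 1 + c = (k + c) + 1" for k by auto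
  have "is_complex C ?X"
  proof (rule is_complexI)
    fix n
    show "Obj ?X n \<in> Ob C" using Z by simp
    show "Diff ?X n \<in> Hom C (Obj ?X n) (Obj ?X (n - 1))" using Z by (auto simp: Hom_def)
    show "Diff ?X n \<cdot> Diff ?X (n + 1) = Zero C (Obj ?X (n + 1)) (Obj ?X (n - 1))"
      using Z by (auto simp: Hom_def)
  qed
  then have "truncation C X c l m ?X" unfolding truncation_def using Z by auto
  then show thesis using that by blast
qed

lemma ex_truncation_chain_map:
  assumes X: "is_complex C X" and Y: "is_complex C Y" and h: "chain_map C X Y h"
    and X': "truncation C X c l m X'" and Y': "truncation C Y c l m Y'"
  obtains h' where "chain_map C X' Y' h'" "\<And>k. l \<le> k \<Longrightarrow> k \<le> m \<Longrightarrow> h' k = h (k + c)"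
proof -
  note X'c = truncationD(1)[OF X'] and Y'c = truncationD(1)[OF Y']
  note [simp] = is_complexD(1-4)[OF X] is_complexD(1-4)[OF Y] is_complexD(1-4)[OF X'c]
    is_complexD(1-4)[OF Y'c] chain_mapD(1-3)[OF h]
  define g where "g k = (if l \<le> k \<and> k \<le> m then h (k + c) else Zero C (Obj X' k) (Obj Y' k))" for k
  have h': "g k \<in> Hom C (Obj X' k) (Obj Y' k)" for k
    using truncationD(2)[OF X'] truncationD(2)[OF Y'] by (auto simp: Hom_def g_def)
  have [simp]: "g k \<in> Ar C" "Dom C (g k) = Obj X' k" "Cod C (g k) = Obj Y' k" for k
    using HomD[OF h'[of k]] by auto
  have "chain_map C X' Y' g"
    unfolding chain_map_def
  proof (intro conjI allI h')
    fix k
    consider "l < k \<and> k \<le> m" | "\<not> (l \<le> k - 1 \<and> k - 1 \<le> m)" | "\<not> (l \<le> k \<and> k \<le> m)" by linarith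
    then show "Diff Y' k \<cdot> g k = g (k - 1) \<cdot> Diff X' k"
    proof cases
      case 1
      have e: "k - 1 + c = k + c - 1" by simp
      show ?thesis using 1 truncationD(4)[OF X'] truncationD(4)[OF Y'] chain_mapD(4)[OF h, of "k + c"]
        by (simp add: e g_def)
    next
      case 2
      show ?thesis
        by (rule zero_object_parallel(1)[OF truncationD(3)[OF Y' 2], of _ "Obj X' k"]) (simp_all add:
          Hom_def)
    next
      case 3
      show ?thesis
        by (rule zero_object_parallel(2)[OF truncationD(3)[OF X' 3], of _ "Obj Y' (k - 1)"]) (simp_all
          add: Hom_def)
    qed
  qed
  then show thesis using that by (simp add: g_def)
qed

end

context exact_category
begin

lemma extensionsD:
  assumes "X \<in> extensions C S n A B"
  shows "acyclic_complex C S X" "locally_exact C S X" "is_complex C X" "Obj X 0 = A"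
    "Obj X (int n + 1) = B"
    "finite_complex C 0 (int n + 1) X" "k < 0 \<or> int n + 1 < k \<Longrightarrow> zero_object C (Obj X k)"
  using assms acyclic_locally_exact unfolding extensions_def finite_complex_def by auto

lemma extension_morphismI:
  assumes "X \<in> extensions C S n A B" "Y \<in> extensions C S n A B" "chain_map C X Y h" "h 0 = Id C A"
    "h (int n + 1) = Id C B"
  shows "(X, Y) \<in> extension_morphism C S n A B"
  using assms unfolding extension_morphism_def by auto

lemma extension_morphism_trans:
  assumes "(X, Y) \<in> extension_morphism C S n A B" "(Y, W) \<in> extension_morphism C S n A B"
  shows "(X, W) \<in> extension_morphism C S n A B"
proof -
  have E: "X \<in> extensions C S n A B" "Y \<in> extensions C S n A B" "W \<in> extensions C S n A B"
    using assms unfolding extension_morphism_def by auto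
  obtain h g where h: "chain_map C X Y h" "h 0 = Id C A" "h (int n + 1) = Id C B"
    and g: "chain_map C Y W g" "g 0 = Id C A" "g (int n + 1) = Id C B"
    using assms unfolding extension_morphism_def by auto
  have "A \<in> Ob C" "B \<in> Ob C" using extensionsD(3-5)[OF E(1)] is_complexD(1) by metis+
  then show ?thesis
    using extension_morphismI[OF E(1,3) chain_map_compose[OF extensionsD(3)[OF E(1)] extensionsD(3)[OF
      E(2)] extensionsD(3)[OF E(3)] h(1) g(1)]] h g
    by simp
qed

lemma extension_morphism_refl:
  assumes "X \<in> extensions C S n A B"
  shows "(X, X) \<in> extension_morphism C S n A B"
  using extension_morphismI[OF assms assms chain_map_Id] extensionsD[OF assms] by simp

text \<open>The complex with cycle objects \<open>A\<close> in degree 0 and \<open>B\<close> in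
  degree \<open>n\<close> whose terms are biproducts of neighbouring cycles; this also covers
  \<open>n = 1\<close>. The biproducts at the two ends are chosen to be literally \<open>A\<close>
  and \<open>B\<close>, as \<open>extensions\<close> demands equality.\<close>

lemma split_extension:
  assumes A: "A \<in> Ob C" and B: "B \<in> Ob C" and n: "1 \<le> n"
  obtains X s where "X \<in> extensions C S n A B" "s \<in> Hom C A (Obj X 1)" "Diff X 1 \<cdot> s = Id C A"
proof -
  obtain Z0 where Z0: "zero_object C Z0" using ex_zero_object by auto
  let ?Z = "\<lambda>k::int. if k = 0 then A else if k = int n then B else Z0"
  have "\<forall>k. \<exists>P i j p q. biproduct C (?Z k) (?Z (k - 1)) P i j p q \<and> (k = 0 \<longrightarrow> P = A \<and> i = Id C A) \<and>
    (k = int n + 1 \<longrightarrow> P = B)"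
  proof
    fix k
    consider "k = 0" | "k = int n + 1" | "k \<noteq> 0" "k \<noteq> int n + 1" by blast
    then show "\<exists>P i j p q. biproduct C (?Z k) (?Z (k - 1)) P i j p q \<and> (k = 0 \<longrightarrow> P = A \<and> i = Id C A) \<and>
      (k = int n + 1 \<longrightarrow> P = B)"
    proof cases
      case 1
      have "biproduct C (?Z k) (?Z (k - 1)) A (Id C A) (Zero C Z0 A) (Id C A) (Zero C A Z0)"
        using biproduct_zero[OF A Z0] 1 n by simp
      moreover have "k \<noteq> int n + 1" using 1 by simp
      ultimately show ?thesis by blast
    next
      case 2
      have "biproduct C (?Z k) (?Z (k - 1)) B (Zero C Z0 B) (Id C B) (Zero C B Z0) (Id C B)"
        using biproduct_commute[OF biproduct_zero[OF B Z0]] 2 n by simp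
      moreover have "k \<noteq> 0" using 2 by simp
      ultimately show ?thesis by blast
    next
      case 3
      have "?Z k \<in> Ob C" "?Z (k - 1) \<in> Ob C" using A B Z0 by auto
      then show ?thesis using ex_biproduct[of "?Z k" "?Z (k - 1)"] 3 by blast
    qed
  qed
  then obtain P i j p q where b: "\<And>k. biproduct C (?Z k) (?Z (k - 1)) (P k) (i k) (j k) (p k) (q k)"
    and P: "P 0 = A" "i 0 = Id C A" "P (int n + 1) = B" by metis
  let ?X = "\<lparr>Obj = P, Diff = \<lambda>k. i (k - 1) \<cdot> q k\<rparr>"
  have ad: "acyclic_data C S ?X ?Z i q UNIV"
    unfolding acyclic_data_def
  proof
    fix k
    show "(i k, q k) \<in> S \<and> i k \<in> Hom C (?Z k) (Obj ?X k) \<and> q k \<in> Hom C (Obj ?X k) (?Z (k - 1)) \<and>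
      Diff ?X k = i (k - 1) \<cdot> q k"
      using conflation_biproduct[OF b[of k]] b[of k] unfolding biproduct_def by simp
  qed
  have zero: "zero_object C (P k)" if "k < 0 \<or> int n + 1 < k" for k
    using biproduct_zero_object[OF b[of k]] that Z0 by auto
  have X: "?X \<in> extensions C S n A B"
    unfolding extensions_def finite_complex_def using ad acyclic_complex_iff acyclic_data_is_complex[OF
      ad] P zero by auto
  have "j 1 \<in> Hom C A (Obj ?X 1)" "Diff ?X 1 \<cdot> j 1 = Id C A"
    using biproductD[OF b[of 1]] P A by (auto simp: Hom_def)
  then show thesis using that X by blast
qed

lemma acyclic_top_zero:
  assumes a: "acyclic_data C S Y Z i p UNIV" and z: "zero_object C (Obj Y (n + 1))"
  shows "zero_object C (Z n)"
proof -
  note D = acyclic_dataD[OF a UNIV_I]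
  note [simp] = D(3-)
  have c [simp]: "Cod C (p (n + 1)) = Z n" using D(8)[of "n + 1"] by simp
  have p0: "p (n + 1) = Zero C (Obj Y (n + 1)) (Z n)" using zero_object_eq(2)[OF z, of "p (n + 1)"]
    by simp
  have "Id C (Z n) \<cdot> p (n + 1) = Zero C (Z n) (Z n) \<cdot> p (n + 1)" unfolding p0 by simp
  then have "Id C (Z n) = Zero C (Z n) (Z n)"
    using deflation_epi[OF D(13)[of "n + 1"], of "Id C (Z n)" "Z n"] by (simp add: Hom_def)
  then show ?thesis by (simp add: zero_object_iff)
qed

lemma acyclic_top_lift:
  assumes a: "acyclic_data C S Y Z i p UNIV" and z: "zero_object C (Obj Y (n + 2))"
    and f: "f \<in> Hom C A (Obj Y n)" "Diff Y n \<cdot> f = Zero C A (Obj Y (n - 1))"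
  obtains g where "g \<in> Hom C A (Obj Y (n + 1))" "Diff Y (n + 1) \<cdot> g = f"
proof -
  note D = acyclic_dataD[OF a UNIV_I]
  note [simp] = D(3-)
  have c: "Cod C (p (n + 1)) = Z n" using D(8)[of "n + 1"] by simp
  have "zero_object C (Z (n + 1))" by (rule acyclic_top_zero[OF a]) (use z in \<open>simp add: add.commute\<close>)
  then have iso: "is_iso C (p (n + 1))" using conflation_zero_iso[OF D(1)[of "n + 1"]] by simp
  obtain t where t: "t \<in> Hom C A (Z n)" "i n \<cdot> t = f" using acyclic_cycle_lift[OF a _ _ f] by auto
  obtain g where g: "g \<in> Hom C A (Obj Y (n + 1))" "p (n + 1) \<cdot> g = t"
    using iso_lift[OF iso, of t A] t(1) c by auto
  note [simp] = HomD[OF t(1)] HomD[OF g(1)]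
  show thesis using that[OF g(1)] D(2)[of "n + 1"] g(2) t(2) c by simp
qed

end

section \<open>Lifting cycles by the vanishing of Ext\<close>

context cluster
begin

text \<open>For \<open>i\<close> at least 1 and \<open>X\<close> acyclic, lifting is governed by
  Ext^1(A, K) with K the kernel of the deflation onto the cycles in degree \<open>n\<close>.
  Dimension shifting along the terms from degree \<open>n + 2\<close> on, which lie in
  \<open>M\<close>, relates it to Ext^i(A, -) of the top term. Local exactness in place of
  acyclicity makes the statement applicable to mapping cones.\<close>

definition cycle_lifting :: "nat \<Rightarrow> 'o \<Rightarrow> bool" where
  "cycle_lifting i A \<longleftrightarrow> (\<forall>X a n f. locally_exact C S X \<and> finite_complex C a (n + int i + 1) X \<and>
    (\<forall>k. n + 2 \<le> k \<longrightarrow> Obj X k \<in> M) \<and> f \<in> Hom C A (Obj X n) \<and> Diff X n \<cdot> f = Zero C A (Obj X (n - 1)) \<longrightarrow>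
    (\<exists>g \<in> Hom C A (Obj X (n + 1)). Diff X (n + 1) \<cdot> g = f))"

lemma cycle_liftingD:
  "\<lbrakk>cycle_lifting i A; locally_exact C S X; finite_complex C a (n + int i + 1) X; \<And>k. n + 2 \<le> k \<Longrightarrow>
    Obj X k \<in> M;
      f \<in> Hom C A (Obj X n); Diff X n \<cdot> f = Zero C A (Obj X (n - 1))\<rbrakk>
      \<Longrightarrow> \<exists>g \<in> Hom C A (Obj X (n + 1)). Diff X (n + 1) \<cdot> g = f"
  unfolding cycle_lifting_def by blast

text \<open>With the common ends \<open>A\<close> and \<open>B\<close> cut off, the mapping cone of
  the morphism is locally exact and ends in degree \<open>i + 2\<close>. The section
  \<open>s\<close> is a cycle of this cone in degree 1, so the induction hypothesis lifts it, and
  the \<open>X\<close> component of the lift is the section sought.\<close>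

lemma M_type_section_backward:
  assumes IH: "cycle_lifting i A"
    and XY: "(X, Y) \<in> extension_morphism C S (Suc i) A B"
    and XM: "\<And>k. 2 \<le> k \<Longrightarrow> k \<le> int (Suc i) \<Longrightarrow> Obj X k \<in> M"
      and YM: "\<And>k. 2 \<le> k \<Longrightarrow> k \<le> int (Suc i) \<Longrightarrow> Obj Y k \<in> M"
    and s: "s \<in> Hom C A (Obj Y 1)" "Diff Y 1 \<cdot> s = Id C A"
  shows "\<exists>s \<in> Hom C A (Obj X 1). Diff X 1 \<cdot> s = Id C A"
proof -
  have E: "X \<in> extensions C S (Suc i) A B" "Y \<in> extensions C S (Suc i) A B" using XY
    unfolding extension_morphism_def by auto
  obtain h where h: "chain_map C X Y h" "h 0 = Id C A" "h (int (Suc i) + 1) = Id C B"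
    using XY unfolding extension_morphism_def by auto
  note X = extensionsD[OF E(1)] and Y = extensionsD[OF E(2)]
  note [simp] = is_complexD[OF X(3)] is_complexD[OF Y(3)] chain_mapD(1-3)[OF h(1)] HomD[OF s(1)]
  have AB [simp]: "A \<in> Ob C" "B \<in> Ob C" using X is_complexD(1)[OF X(3)] by metis+
  let ?m = "int (Suc i)"
  obtain X' where X': "truncation C X 0 1 ?m X'" using ex_truncation[OF X(3)] .
  obtain Y' where Y': "truncation C Y 0 1 ?m Y'" using ex_truncation[OF Y(3)] .
  obtain h' where h': "chain_map C X' Y' h'" "\<And>k. 1 \<le> k \<Longrightarrow> k \<le> ?m \<Longrightarrow> h' k = h (k + 0)"
    by (rule ex_truncation_chain_map[OF X(3) Y(3) h(1) X' Y']) (rule that)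
  note X'c = truncationD(1)[OF X'] and Y'c = truncationD(1)[OF Y']
  note [simp] = is_complexD[OF X'c] is_complexD[OF Y'c] chain_mapD(1-3)[OF h'(1)]
  obtain K where K: "mapping_cone C X' Y' h' K" using ex_mapping_cone[OF X'c Y'c h'(1)] .
  have Kc: "is_complex C K" using K unfolding mapping_cone_def by simp
  note [simp] = is_complexD[OF Kc]
  have iso: "is_iso C (h (k + 0))" if "\<not> (1 \<le> k \<and> k \<le> ?m)" for k
  proof -
    have "k = 0 \<or> k = ?m + 1 \<or> (k < 0 \<or> ?m + 1 < k)" using that by arith
    then consider "k = 0" | "k = ?m + 1" | "k < 0 \<or> ?m + 1 < k" by blast
    then show ?thesis
    proof cases
      case 3
      show ?thesis using zero_object_iso[OF X(7)[OF 3] Y(7)[OF 3], of "h k"] by (simp add: Hom_def)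
    qed (use h AB in auto)
  qed
  have lK: "locally_exact C S K"
    by (rule truncated_cone_locally_exact[OF X(2) Y(2) h(1) iso X' Y' h' K])
  obtain ii j p q where b: "\<And>n. biproduct C (Obj X' (n - 1)) (Obj Y' n) (Obj K n) (ii n) (j n) (p n) (q
    n)"
    and Dq: "\<And>n f. \<lbrakk>is_complex C X'; is_complex C Y'; chain_map C X' Y' h'; f \<in> Ar C; Cod C f = Obj K n\<rbrakk> \<Longrightarrow>
      q (n - 1) \<cdot> (Diff K n \<cdot> f) = h' (n - 1) \<cdot> (p n \<cdot> f) \<oplus> Diff Y' n \<cdot> (q n \<cdot> f)"
    using mapping_cone_sum[OF K] by metis
  note [simp] = biproduct_simps[OF b]
  have zero: "zero_object C (Obj K k)" if "k < 1 \<or> ?m + 1 < k" for k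
    using biproduct_zero_object[OF b[of k]] truncationD(3)[OF X', of "k - 1"] truncationD(3)[OF Y', of k]
      that by auto
  have fin: "finite_complex C 1 (1 + int i + 1) K" unfolding finite_complex_def using Kc zero by auto
  have KM: "Obj K k \<in> M" if "1 + 2 \<le> k" for k
  proof -
    have "Obj X' (k - 1) \<in> M"
      using that truncationD(2)[OF X', of "k - 1"] truncationD(3)[OF X', of "k - 1"] XM[of "k - 1"] M_zero
      by (cases "k - 1 \<le> ?m") auto
    moreover have "Obj Y' k \<in> M"
      using that truncationD(2)[OF Y', of k] truncationD(3)[OF Y', of k] YM[of k] M_zero
      by (cases "k \<le> ?m") auto
    ultimately show ?thesis using M_biproduct[OF _ _ b[of k]] by blast
  qed
  have Y1 [simp]: "Obj Y' 1 = Obj Y 1" "Obj X' 1 = Obj X 1" "h' 1 = h 1"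
    using truncationD(2)[OF Y', of 1] truncationD(2)[OF X', of 1] h'(2)[of 1] by auto
  let ?f = "j 1 \<cdot> s"
  have f: "?f \<in> Hom C A (Obj K 1)" by (simp add: Hom_def)
  have "Diff K 1 \<cdot> ?f = Zero C A (Obj K (1 - 1))"
    using zero_object_eq(1)[OF zero[of 0], of "Diff K 1 \<cdot> ?f"] by simp
  from cycle_liftingD[OF IH lK fin KM f this] obtain g where g: "g \<in> Hom C A (Obj K 2)"
    "Diff K 2 \<cdot> g = ?f" by auto
  note [simp] = HomD[OF g(1)]
  have [simp]: "Cod C (p 2) = Obj X 1" "Cod C (Diff Y' 2) = Obj Y 1" "Cod C (Diff K 2) = Obj K 1"
    using biproductD(12)[OF b[of 2]] by auto
  let ?x = "p 2 \<cdot> g" and ?y = "q 2 \<cdot> g"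
  \<comment> \<open>So \<open>s\<close> is \<open>h 1 \<cdot> ?x\<close> plus a boundary. Applying
    \<open>Diff Y 1\<close> removes the boundary, and \<open>h 0\<close> is the identity.\<close>
  have e: "h 1 \<cdot> ?x \<oplus> Diff Y' 2 \<cdot> ?y = s"
    using Dq[OF X'c Y'c h'(1), of g 2] g(2) by simp
  have "Diff Y 1 \<cdot> (Diff Y' 2 \<cdot> ?y) = Zero C A (Obj Y 0)"
  proof (cases "2 \<le> ?m")
    case True
    then have "Diff Y' 2 = Diff Y 2" "Obj Y' 2 = Obj Y 2" using truncationD(2,4)[OF Y', of 2] by auto
    then show ?thesis by simp
  next
    case False
    have "?y = Zero C A (Obj Y' 2)" using zero_object_eq(1)[OF truncationD(3)[OF Y', of 2], of ?y] False
      by simp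
    then show ?thesis by simp
  qed
  moreover have "Diff Y 1 \<cdot> (h 1 \<cdot> ?x) = Diff X 1 \<cdot> ?x"
    using chain_map_Comp[OF Y(3) h(1) _ _ X(3), of ?x 1] h(2) X(4) by simp
  moreover have "Diff Y 1 \<cdot> (h 1 \<cdot> ?x \<oplus> Diff Y' 2 \<cdot> ?y) = Id C A" unfolding e by (rule s(2))
  ultimately have "Diff X 1 \<cdot> ?x = Id C A" using X(4) Y(4) by simp
  moreover have "?x \<in> Hom C A (Obj X 1)" by (simp add: Hom_def)
  ultimately show ?thesis by blast
qed

text \<open>The replacement is weakly initial among the extensions that receive a morphism from
  \<open>X\<close> and have terms of \<open>M\<close> in degrees 2 to \<open>n\<close>; the term in
  degree 1 is the last pushout and is not controlled here.\<close>

lemma extension_approximation: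
  assumes X: "X \<in> extensions C S n A B" and n: "1 \<le> n"
  obtains X' where "(X, X') \<in> extension_morphism C S n A B" "\<And>k. 2 \<le> k \<Longrightarrow> k \<le> int n \<Longrightarrow> Obj X' k \<in> M"
    "\<And>W. (X, W) \<in> extension_morphism C S n A B \<Longrightarrow> (\<And>k. 2 \<le> k \<Longrightarrow> k \<le> int n \<Longrightarrow> Obj W k \<in> M) \<Longrightarrow>
      (X', W) \<in> extension_morphism C S n A B"
proof -
  obtain X' h V where X': "acyclic_complex C S X'" "chain_map C X X' h"
    "\<And>k. \<not> (1 \<le> k \<and> k \<le> int n) \<Longrightarrow> Obj X' k = Obj X k \<and> h k = Id C (Obj X k)"
    "\<And>k. 1 < k \<Longrightarrow> k \<le> int n \<Longrightarrow> Obj X' k \<in> M"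
    "\<And>W f. \<lbrakk>is_complex C W; chain_map C X W f; \<And>k. 1 < k \<Longrightarrow> k \<le> int n \<Longrightarrow> Obj W k \<in> M\<rbrakk> \<Longrightarrow>
      \<exists>f'. chain_map C X' W f' \<and> (\<forall>k. \<not> (1 \<le> k \<and> k \<le> int n) \<longrightarrow> f' k = f k)"
    by (rule approximate_complex[OF extensionsD(1)[OF X], of 1 "int n"]) (use n that in auto)
  have E: "X' \<in> extensions C S n A B"
    using X' extensionsD(4-7)[OF X] acyclic_locally_exact[OF X'(1)] locally_exact_is_complex
    unfolding extensions_def finite_complex_def by simp
  show thesis
  proof (rule that)
    show "(X, X') \<in> extension_morphism C S n A B"
      using extension_morphismI[OF X E X'(2)] X'(3)[of 0] X'(3)[of "int n + 1"] extensionsD(4,5)[OF X]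
        by simp
    show "Obj X' k \<in> M" if "2 \<le> k" "k \<le> int n" for k using X'(4)[of k] that by simp
    fix W assume XW: "(X, W) \<in> extension_morphism C S n A B" and W: "\<And>k. 2 \<le> k \<Longrightarrow> k \<le> int n \<Longrightarrow> Obj W k \<in> M"
    obtain f where f: "chain_map C X W f" "f 0 = Id C A" "f (int n + 1) = Id C B"
      and WE: "W \<in> extensions C S n A B"
      using XW unfolding extension_morphism_def by auto
    obtain f' where "chain_map C X' W f'" "\<forall>k. \<not> (1 \<le> k \<and> k \<le> int n) \<longrightarrow> f' k = f k"
      using X'(5)[OF extensionsD(3)[OF WE] f(1)] W by force
    then show "(X', W) \<in> extension_morphism C S n A B" using extension_morphismI[OF E WE] f by simp
  qed
qed

text \<open>Sections push forward along every morphism but are known to pull back only between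
  extensions with terms of \<open>M\<close> in degrees 2 to \<open>i + 1\<close>. Hence the
  invariant \<open>splits U\<close> asks for sections of all extensions of this kind under
  \<open>U\<close>. It holds for the split extension and is preserved along zigzags, and vanishing
  of Ext provides a zigzag to \<open>X\<close>.\<close>

lemma extension_section:
  assumes IH: "cycle_lifting i A"
    and i: "Suc i < d" and A: "A \<in> M" and B: "B \<in> M" and X: "X \<in> extensions C S (Suc i) A B"
    and XM: "\<And>k. 2 \<le> k \<Longrightarrow> k \<le> int (Suc i) \<Longrightarrow> Obj X k \<in> M"
  shows "\<exists>s \<in> Hom C A (Obj X 1). Diff X 1 \<cdot> s = Id C A"
proof -
  let ?R = "extension_morphism C S (Suc i) A B"
  define P where "P W \<longleftrightarrow> (\<forall>k. 2 \<le> k \<and> k \<le> int (Suc i) \<longrightarrow> Obj W k \<in> M)" for W :: "('o, 'm) cpx"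
  define spl where "spl W \<longleftrightarrow> (\<exists>s \<in> Hom C A (Obj W 1). Diff W 1 \<cdot> s = Id C A)" for W :: "('o, 'm) cpx"
  define splits where "splits U \<longleftrightarrow> (\<forall>W. (U, W) \<in> ?R \<longrightarrow> P W \<longrightarrow> spl W)" for U
  have bwd: "spl U" if "(U, W) \<in> ?R" "P U" "P W" "spl W" for U W
    using that M_type_section_backward[OF IH that(1)] unfolding P_def spl_def by blast
  have fwd: "spl W" if UW: "(U, W) \<in> ?R" and U: "spl U" for U W
  proof -
    obtain s where s: "s \<in> Hom C A (Obj U 1)" "Diff U 1 \<cdot> s = Id C A" using U unfolding spl_def by auto
    obtain h where h: "chain_map C U W h" "h 0 = Id C A"
      and E: "U \<in> extensions C S (Suc i) A B" "W \<in> extensions C S (Suc i) A B"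
      using UW unfolding extension_morphism_def by auto
    note [simp] = HomD[OF s(1)] chain_mapD(1-3)[OF h(1)]
    have "Diff W 1 \<cdot> (h 1 \<cdot> s) = Id C A"
      using chain_map_Comp[OF extensionsD(3)[OF E(2)] h(1) _ _ extensionsD(3)[OF E(1)], of s 1] s(2) h(2)
        by simp
    then show ?thesis unfolding spl_def by (intro bexI[of _ "h 1 \<cdot> s"]) (auto simp: Hom_def)
  qed
  have inv: "splits U \<longleftrightarrow> splits V" if UV: "(U, V) \<in> ?R" for U V
  proof
    assume "splits U"
    then show "splits V" using extension_morphism_trans[OF UV] unfolding splits_def by blast
  next
    assume V: "splits V"
    have E: "U \<in> extensions C S (Suc i) A B" "V \<in> extensions C S (Suc i) A B"
      using UV unfolding extension_morphism_def by auto
    obtain U' where U': "(U, U') \<in> ?R" "P U'" "\<And>W. (U, W) \<in> ?R \<Longrightarrow> P W \<Longrightarrow> (U', W) \<in> ?R"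
      by (rule extension_approximation[OF E(1)]) (use that in \<open>auto simp: P_def\<close>)
    obtain V' where V': "(V, V') \<in> ?R" "P V'"
      by (rule extension_approximation[OF E(2)]) (use that in \<open>auto simp: P_def\<close>)
    \<comment> \<open>By weak initiality \<open>U'\<close> maps to \<open>V'\<close>, so the section
      of \<open>V'\<close> pulls back to \<open>U'\<close>; from there it pushes forward to every
      extension of the required kind under \<open>U\<close>.\<close>
    have "spl V'" using V V' unfolding splits_def by blast
    then have "spl U'" using bwd[OF U'(3)[OF extension_morphism_trans[OF UV V'(1)] V'(2)] U'(2) V'(2)]
      by blast
    then show "splits U" using fwd[OF U'(3)] unfolding splits_def by blast
  qed
  obtain T s where T: "T \<in> extensions C S (Suc i) A B" "s \<in> Hom C A (Obj T 1)" "Diff T 1 \<cdot> s = Id C A"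
    using split_extension[OF M_Ob[OF A] M_Ob[OF B], of "Suc i"] by auto
  have "spl T" using T(2,3) unfolding spl_def by blast
  then have "splits T" using fwd unfolding splits_def by blast
  moreover have "Ext_vanishes C S (Suc i) A B" using A B i M_eq(1) by auto
  ultimately have "splits X" using extension_invariant[OF Ext_vanishesD[OF _ T(1) X], where P = splits]
    inv by blast
  then show ?thesis using extension_morphism_refl[OF X] XM unfolding splits_def P_def spl_def by blast
qed

text \<open>Acyclic complexes suffice: \<open>X\<close> is a deformation retract of an acyclic
  complex of the same kind, and a lift there is moved back by the retraction
  \<open>G\<close>.\<close>

lemma cycle_liftingI:
  assumes *: "\<And>Y Z \<iota> p n f. \<lbrakk>acyclic_data C S Y Z \<iota> p UNIV; \<And>k. n + int i + 1 < k \<Longrightarrow>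
    zero_object C (Obj Y k);
      \<And>k. n + 2 \<le> k \<Longrightarrow> Obj Y k \<in> M; f \<in> Hom C A (Obj Y n); Diff Y n \<cdot> f = Zero C A (Obj Y (n - 1))\<rbrakk>
      \<Longrightarrow> \<exists>g \<in> Hom C A (Obj Y (n + 1)). Diff Y (n + 1) \<cdot> g = f"
  shows "cycle_lifting i A"
  unfolding cycle_lifting_def
proof (intro allI impI)
  fix X a n f
  let ?b = "n + int i + 1"
  assume "locally_exact C S X \<and> finite_complex C a ?b X \<and> (\<forall>k. n + 2 \<le> k \<longrightarrow> Obj X k \<in> M) \<and>
    f \<in> Hom C A (Obj X n) \<and> Diff X n \<cdot> f = Zero C A (Obj X (n - 1))"
  then have X: "locally_exact C S X" "finite_complex C a ?b X" "\<And>k. n + 2 \<le> k \<Longrightarrow> Obj X k \<in> M"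
    and f: "f \<in> Hom C A (Obj X n)" "Diff X n \<cdot> f = Zero C A (Obj X (n - 1))" by auto
  \<comment> \<open>The lower bound is decreased if necessary, as
    \<open>locally_exact_acyclic\<close> needs two different bounds.\<close>
  have fin: "finite_complex C (min a (?b - 1)) ?b X" and lt: "min a (?b - 1) < ?b" using X(2)
    unfolding finite_complex_def by auto
  obtain Y F G where Y: "acyclic_complex C S Y" "finite_complex C (min a (?b - 1)) ?b Y"
    "deformation_retract C X Y F G"
    "\<And>n. Obj X n \<in> M \<Longrightarrow> Obj Y n \<in> M"
    by (rule locally_exact_acyclic[OF X(1) fin lt M_sub M_gen]) (rule that)
  have Xc: "is_complex C X" and Yc: "is_complex C Y" and F: "chain_map C X Y F" and G: "chain_map C Y X G"
    and GF: "\<And>n. G n \<cdot> F n = Id C (Obj X n)" using Y(3) unfolding deformation_retract_def by auto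
  obtain Z \<iota> p where ad: "acyclic_data C S Y Z \<iota> p UNIV" using Y(1) acyclic_complex_iff by auto
  note [simp] = is_complexD(1-4)[OF Xc] is_complexD(1-4)[OF Yc] chain_mapD(1-3)[OF F] chain_mapD(1-3)[OF
    G] HomD[OF f(1)]
  have "Diff Y n \<cdot> (F n \<cdot> f) = Zero C A (Obj Y (n - 1))" using chain_map_Comp[OF Yc F, of f n] Xc f(2)
    by simp
  then obtain g where g: "g \<in> Hom C A (Obj Y (n + 1))" "Diff Y (n + 1) \<cdot> g = F n \<cdot> f"
    using *[OF ad, of n "F n \<cdot> f"] X(3) Y(2,4) unfolding finite_complex_def by (auto simp: Hom_def)
  note [simp] = HomD[OF g(1)]
  have "Diff X (n + 1) \<cdot> (G (n + 1) \<cdot> g) = G n \<cdot> (F n \<cdot> f)"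
    using chain_map_Comp[OF Xc G, of g "n + 1"] Yc g(2) by simp
  also have "\<dots> = f" using Comp_cong_left[OF GF[of n], of f] by simp
  finally show "\<exists>g \<in> Hom C A (Obj X (n + 1)). Diff X (n + 1) \<cdot> g = f"
    by (intro bexI[of _ "G (n + 1) \<cdot> g"]) (auto simp: Hom_def)
qed

text \<open>Pulling back the deflation onto the cycles in degree \<open>n\<close> along
  \<open>A\<close> turns the part of the complex above degree \<open>n\<close> into an extension of
  \<open>A\<close> by the top term. A section of it composed with the projection of the pullback is
  the lift.\<close>

lemma cycle_lifting_M:
  assumes "i < d" and A: "A \<in> M"
  shows "cycle_lifting i A"
  using assms(1)
proof (induction i)
  case 0
  show ?case
  proof (rule cycle_liftingI)
    fix Y Z \<iota> p n f
    assume a: "acyclic_data C S Y Z \<iota> p UNIV" and zero: "\<And>k. n + int 0 + 1 < k \<Longrightarrow> zero_object C (Obj Y k)"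
      and f: "f \<in> Hom C A (Obj Y n)" "Diff Y n \<cdot> f = Zero C A (Obj Y (n - 1))"
    have "zero_object C (Obj Y (n + 2))" using zero by simp
    from acyclic_top_lift[OF a this f] show "\<exists>g \<in> Hom C A (Obj Y (n + 1)). Diff Y (n + 1) \<cdot> g = f"
      by blast
  qed
next
  case (Suc i)
  then have IH: "cycle_lifting i A" by simp
  interpret O: exact_category "opc C" "S\<inverse>" by (rule exact_category_opc)
  show ?case
  proof (rule cycle_liftingI)
    fix Y Z \<iota> p n f
    assume a: "acyclic_data C S Y Z \<iota> p UNIV" and zero: "\<And>k. n + int (Suc i) + 1 < k \<Longrightarrow>
      zero_object C (Obj Y k)"
      and YM: "\<And>k. n + 2 \<le> k \<Longrightarrow> Obj Y k \<in> M" and f: "f \<in> Hom C A (Obj Y n)"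
        "Diff Y n \<cdot> f = Zero C A (Obj Y (n - 1))"
    note D = acyclic_dataD[OF a UNIV_I]
    note [simp] = D(3-) HomD[OF f(1)]
    obtain Z0 where Z0: "zero_object C Z0" using ex_zero_object by auto
    have e2: "n + 2 - 1 = n + 1" by simp
    have c [simp]: "Cod C (p (n + 2)) = Z (n + 1)" "Cod C (p (n + 1)) = Z n"
      using D(8)[of "n + 2"] D(8)[of "n + 1"] by (auto simp: e2)
    obtain t where t: "t \<in> Hom C A (Z n)" "\<iota> n \<cdot> t = f" using acyclic_cycle_lift[OF a _ _ f] by auto
    note [simp] = HomD[OF t(1)]
    obtain \<pi> k \<kappa> where "is_pushout (opc C) (p (n + 1)) t \<pi> k" "(\<pi>, \<kappa>) \<in> S\<inverse>" "\<kappa> \<cdot>\<^bsub>opc C\<^esub> k = \<iota> (n + 1)"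
      "Cod (opc C) \<kappa> = Cod (opc C) (\<iota> (n + 1))"
      by (rule O.pushout_conflation[of "p (n + 1)" "\<iota> (n + 1)" t]) (use D(1) in auto)
    then have pb: "is_pullback C (p (n + 1)) t \<pi> k" and \<kappa>: "(\<kappa>, \<pi>) \<in> S" "k \<cdot> \<kappa> = \<iota> (n + 1)"
      "Dom C \<kappa> = Z (n + 1)" by auto
    have T [simp]: "\<pi> \<in> Ar C" "k \<in> Ar C" "Cod C \<pi> = A" "Cod C k = Obj Y (n + 1)" "Dom C \<pi> = Dom C k"
      "\<kappa> \<in> Ar C" "Cod C \<kappa> = Dom C k"
      and sq: "p (n + 1) \<cdot> k = t \<cdot> \<pi>"
      using pb conflationD[OF \<kappa>(1)] unfolding is_pullback_def by auto
    \<comment> \<open>The extension: \<open>A\<close> in degree 0, the pullback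
      \<open>Dom C k\<close> in degree 1, and the terms \<open>Obj Y (n + j)\<close> in the degrees
      \<open>j\<close> from 2 on.\<close>
    define Z' where "Z' j = (if j < 0 then Z0 else if j = 0 then A else Z (n + j))" for j
    define i' where "i' j = (if j < 0 then Id C Z0 else if j = 0 then Id C A else
      if j = 1 then \<kappa> else \<iota> (n + j))" for j
    define p' where "p' j = (if j < 0 then Zero C Z0 Z0 else if j = 0 then Zero C A Z0 else
      if j = 1 then \<pi> else p (n + j))" for j
    define O' where "O' j = (if j < 0 then Z0 else if j = 0 then A else
      if j = 1 then Dom C k else Obj Y (n + j))" for j
    let ?X = "\<lparr>Obj = O', Diff = \<lambda>j. i' (j - 1) \<cdot> p' j\<rparr>"
    have ad: "acyclic_data C S ?X Z' i' p' UNIV"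
      unfolding acyclic_data_def
    proof
      fix j :: int
      consider "j < 0" | "j = 0" | "j = 1" | "j \<ge> 2" by linarith
      then show "(i' j, p' j) \<in> S \<and> i' j \<in> Hom C (Z' j) (Obj ?X j) \<and>
        p' j \<in> Hom C (Obj ?X j) (Z' (j - 1)) \<and> Diff ?X j = i' (j - 1) \<cdot> p' j"
      proof cases
        case 1
        then show ?thesis using conflation_Id_zero[OF Z0, of Z0] Z0
          by (simp add: Z'_def i'_def p'_def O'_def Hom_def)
      next
        case 2
        then show ?thesis using conflation_Id_zero[OF Z0, of A] Z0
          by (simp add: Z'_def i'_def p'_def O'_def Hom_def)
      next
        case 3
        then show ?thesis using \<kappa> by (simp add: Z'_def i'_def p'_def O'_def Hom_def)
      next
        case 4
        have e: "n + (j - 1) = n + j - 1" by simp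
        show ?thesis using 4 D(1)[of "n + j"] by (simp add: Z'_def i'_def p'_def O'_def Hom_def e)
      qed
    qed
    let ?B = "Obj Y (n + int (Suc i) + 1)"
    have B: "?B \<in> M" using YM by simp
    have z: "zero_object C (O' j)" if "j < 0 \<or> int (Suc i) + 1 < j" for j
      using that Z0 zero[of "n + j"] unfolding O'_def by auto
    have o: "O' 0 = A" "O' (int (Suc i) + 1) = ?B" unfolding O'_def by (auto simp: add.assoc)
    have "acyclic_complex C S ?X" using ad acyclic_complex_iff by blast
    then have E: "?X \<in> extensions C S (Suc i) A ?B"
      unfolding extensions_def finite_complex_def using acyclic_data_is_complex[OF ad] z o by simp
    have XM: "Obj ?X j \<in> M" if "2 \<le> j" for j using that YM unfolding O'_def by simp
    obtain s where s: "s \<in> Hom C A (Obj ?X 1)" "Diff ?X 1 \<cdot> s = Id C A"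
      using extension_section[OF IH Suc.prems A B E] XM by blast
    have s1 [simp]: "s \<in> Ar C" "Dom C s = A" "Cod C s = Dom C k" using HomD[OF s(1)] unfolding O'_def
      by auto
    have ps: "\<pi> \<cdot> s = Id C A" using s(2) M_Ob[OF A] unfolding i'_def p'_def by simp
    have "Diff Y (n + 1) \<cdot> (k \<cdot> s) = \<iota> n \<cdot> ((p (n + 1) \<cdot> k) \<cdot> s)" unfolding D(2)[of "n + 1"] by simp
    also have "\<dots> = \<iota> n \<cdot> (t \<cdot> (\<pi> \<cdot> s))" unfolding sq by simp
    also have "\<dots> = f" unfolding ps using t(2) by simp
    finally show "\<exists>g \<in> Hom C A (Obj Y (n + 1)). Diff Y (n + 1) \<cdot> g = f"
      by (intro bexI[of _ "k \<cdot> s"]) (auto simp: Hom_def)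
  qed
qed

end

section \<open>Iterated cokernels of left approximations\<close>

context cluster
begin

text \<open>Write V_j for \<open>V (l + j)\<close>. Classically the conflations from V_j through Q_j
  to V_(j-1), with Q_j in \<open>M\<close>, shift Ext^n(V_0, B) to Ext^1(V_(n-1), B), and this
  vanishes as every arrow from V_n to \<open>B\<close> extends over Q_n. So V_0 satisfies the Ext
  condition that characterises \<open>M\<close>. The shift is carried out by an explicit chain map
  from one fixed extension.\<close>

lemma approx_chain_M:
  assumes W: "V l \<in> Ob C" and ch: "approx_chain Yo V l (l + int d - 1)"
    and YM: "\<And>k. l \<le> k \<Longrightarrow> k < l + int d - 1 \<Longrightarrow> Yo k \<in> M"
  shows "V l \<in> M"
proof -
  define V' where "V' j = V (l + j)" for j
  have "\<forall>j. \<exists>Q \<iota> \<pi>. 1 \<le> j \<and> j \<le> int d - 1 \<longrightarrow> (\<iota>, \<pi>) \<in> S \<and> \<iota> \<in> Hom C (V' j) Q \<and>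
    \<pi> \<in> Hom C Q (V' (j - 1)) \<and> left_approx \<iota> \<and> Q \<in> M"
  proof
    fix j
    show "\<exists>Q \<iota> \<pi>. 1 \<le> j \<and> j \<le> int d - 1 \<longrightarrow> (\<iota>, \<pi>) \<in> S \<and> \<iota> \<in> Hom C (V' j) Q \<and>
      \<pi> \<in> Hom C Q (V' (j - 1)) \<and> left_approx \<iota> \<and> Q \<in> M"
    proof (cases "1 \<le> j \<and> j \<le> int d - 1")
      case True
      then have j: "l < l + j \<and> l + j \<le> l + int d - 1" and y: "Yo (l + j - 1) \<in> M"
        using YM[of "l + j - 1"] by auto
      have e: "V' (j - 1) = V (l + j - 1)" by (simp add: V'_def add_diff_eq)
      show ?thesis using ch[unfolded approx_chain_def, rule_format, OF j] y unfolding e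
        unfolding V'_def by blast
    qed blast
  qed
  then obtain Q \<iota> \<pi> where Q: "\<And>j. 1 \<le> j \<Longrightarrow> j \<le> int d - 1 \<Longrightarrow> (\<iota> j, \<pi> j) \<in> S \<and> \<iota> j \<in> Hom C (V' j) (Q j) \<and>
    \<pi> j \<in> Hom C (Q j) (V' (j - 1)) \<and> left_approx (\<iota> j) \<and> Q j \<in> M" by metis
  have T: "\<iota> j \<in> Ar C" "Dom C (\<iota> j) = V' j" "Cod C (\<iota> j) = Q j" "\<pi> j \<in> Ar C" "Dom C (\<pi> j) = Q j"
    "Cod C (\<pi> j) = V' (j - 1)"
    "Q j \<in> Ob C" if "1 \<le> j" "j \<le> int d - 1" for j
    using Q[OF that] M_Ob by (auto simp: Hom_def)
  have V'Ob: "V' j \<in> Ob C" if "0 \<le> j" "j \<le> int d - 1" for j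
    using W T(1,2)[of j] that Dom_Ob[of "\<iota> j"] by (cases "j = 0") (auto simp: V'_def)
  have "Ext_vanishes C S n (V l) B" if n: "0 < n" "n < d" and B: "B \<in> M" for n B
  proof -
    let ?n = "int n"
    obtain Z0 where Z0: "zero_object C Z0" using ex_zero_object by auto
    have BO [simp]: "B \<in> Ob C" using M_Ob[OF B] .
    have V0 [simp]: "V' 0 = V l" "V l \<in> Ob C" using W by (auto simp: V'_def)
    obtain P iB jV pB qV where b: "biproduct C B (V' (?n - 1)) P iB jV pB qV"
      using ex_biproduct[of B "V' (?n - 1)"] V'Ob[of "?n - 1"] n by auto
    note [simp] = biproduct_simps[OF b]
    \<comment> \<open>An extension representing zero: the given conflations for 0 < k < n, spliced
      with the split conflation from \<open>B\<close> through \<open>P\<close> to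
      \<open>V' (?n - 1)\<close>.\<close>
    define Z' where "Z' k = (if k < 0 then Z0 else if k < ?n then V' k else
      if k = ?n then B else Z0)" for k
    define O' where "O' k = (if k < 0 then Z0 else if k = 0 then V l else if k < ?n then Q k else
      if k = ?n then P else if k = ?n + 1 then B else Z0)" for k
    define i' where "i' k = (if k < 0 then Id C Z0 else if k = 0 then Id C (V l) else
      if k < ?n then \<iota> k else if k = ?n then iB
      else if k = ?n + 1 then Zero C Z0 B else Id C Z0)" for k
    define p' where "p' k = (if k < 0 then Zero C Z0 Z0 else if k = 0 then Zero C (V l) Z0 else
      if k < ?n then \<pi> k else if k = ?n then qV
      else if k = ?n + 1 then Id C B else Zero C Z0 Z0)" for k
    note defs = Z'_def O'_def i'_def p'_def
    let ?X = "\<lparr>Obj = O', Diff = \<lambda>k. i' (k - 1) \<cdot> p' k\<rparr>"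
    have cases: "k < 0 \<or> k = 0 \<or> (0 < k \<and> k < ?n) \<or> k = ?n \<or> k = ?n + 1 \<or> ?n + 1 < k" for k by linarith
    have ad: "acyclic_data C S ?X Z' i' p' UNIV"
      unfolding acyclic_data_def
    proof
      fix k
      have "(i' k, p' k) \<in> S \<and> i' k \<in> Hom C (Z' k) (O' k) \<and> p' k \<in> Hom C (O' k) (Z' (k - 1))"
        using cases[of k]
      proof (elim disjE)
        assume "k < 0"
        then show ?thesis using conflation_Id_zero[OF Z0, of Z0] Z0 by (simp add: defs Hom_def)
      next
        assume "k = 0"
        then show ?thesis using conflation_Id_zero[OF Z0 V0(2)] Z0 n by (simp add: defs Hom_def)
      next
        assume "0 < k \<and> k < ?n"
        then show ?thesis using Q[of k] n by (simp add: defs)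
      next
        assume "k = ?n"
        then show ?thesis using conflation_biproduct[OF b] n by (simp add: defs Hom_def)
      next
        assume "k = ?n + 1"
        then show ?thesis using iso_conflation(1)[OF is_iso_Id[OF BO] Z0] n Z0 by (simp add: defs Hom_def)
      next
        assume "?n + 1 < k"
        then show ?thesis using conflation_Id_zero[OF Z0, of Z0] Z0 by (simp add: defs Hom_def)
      qed
      then show "(i' k, p' k) \<in> S \<and> i' k \<in> Hom C (Z' k) (Obj ?X k) \<and>
        p' k \<in> Hom C (Obj ?X k) (Z' (k - 1)) \<and> Diff ?X k = i' (k - 1) \<cdot> p' k"
        by simp
    qed
    have zero: "zero_object C (O' k)" if "k < 0 \<or> ?n + 1 < k" for k
      using that Z0 unfolding O'_def by auto
    have o: "O' 0 = V l" "O' (?n + 1) = B" unfolding O'_def by auto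
    have "acyclic_complex C S ?X" using ad acyclic_complex_iff by blast
    then have E: "?X \<in> extensions C S n (V l) B"
      unfolding extensions_def finite_complex_def using acyclic_data_is_complex[OF ad] zero o by simp
    have "(?X, U) \<in> (extension_morphism C S n (V l) B \<union> (extension_morphism C S n (V l) B)\<inverse>)\<^sup>*"
      if U: "U \<in> extensions C S n (V l) B" for U
    proof -
      \<comment> \<open>A zigzag of length two suffices: \<open>U\<close> maps to a replacement
        \<open>Y\<close> with terms of \<open>M\<close> from degree 2 on, and \<open>?X\<close> will
        be mapped to \<open>Y\<close>.\<close>
      obtain Y where UY: "(U, Y) \<in> extension_morphism C S n (V l) B"
        and Ymid: "\<And>k. 2 \<le> k \<Longrightarrow> k \<le> ?n \<Longrightarrow> Obj Y k \<in> M"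
        by (rule extension_approximation[OF U]) (use n that in auto)
      have YE: "Y \<in> extensions C S n (V l) B" using UY unfolding extension_morphism_def by auto
      note YD = extensionsD[OF YE]
      note [simp] = is_complexD[OF YD(3)]
      have YMk: "Obj Y k \<in> M" if "2 \<le> k" for k
      proof -
        consider "k \<le> ?n" | "k = ?n + 1" | "?n + 1 < k" by linarith
        then show ?thesis using Ymid[of k] that YD(5) B M_zero[OF YD(7)[of k]] by cases auto
      qed
      \<comment> \<open>The arrow \<open>\<nu> k\<close> is to be the component on
        \<open>Q k\<close> of a chain map into \<open>Y\<close>, and \<open>\<mu> \<nu> k\<close>
        its restriction to the cycles \<open>V' k\<close>; \<open>good\<close> says that consecutive
        components fit together.\<close>
      define \<mu> where "\<mu> \<nu> k = (if k = 0 then Id C (V l) else \<nu> k \<cdot> \<iota> k)" for \<nu> :: "int \<Rightarrow> 'm" and k :: int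
      define good where "good \<nu> k \<longleftrightarrow> \<nu> k \<in> Hom C (Q k) (Obj Y k) \<and>
        Diff Y k \<cdot> \<nu> k = \<mu> \<nu> (k - 1) \<cdot> \<pi> k" for \<nu> k
      have \<mu>: "\<mu> \<nu> k \<in> Hom C (V' k) (Obj Y k) \<and> Diff Y k \<cdot> \<mu> \<nu> k = Zero C (V' k) (Obj Y (k - 1))"
        if k: "0 \<le> k" "k \<le> ?n" and g: "\<And>j. 1 \<le> j \<Longrightarrow> j \<le> k \<Longrightarrow> good \<nu> j" for \<nu> k
        using k g
      proof (induction "nat k" arbitrary: k)
        case 0
        then have "k = 0" by simp
        moreover have "Diff Y 0 \<cdot> Id C (V l) = Zero C (V l) (Obj Y (- 1))"
          using zero_object_eq(1)[OF YD(7)[of "- 1"], of "Diff Y 0"] YD(4) by simp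
        ultimately show ?case using YD(4) by (simp add: \<mu>_def Hom_def)
      next
        case (Suc t)
        then have k: "1 \<le> k" "t = nat (k - 1)" "0 \<le> k - 1" "k \<le> int d - 1" using n by auto
        have IH: "\<mu> \<nu> (k - 1) \<in> Hom C (V' (k - 1)) (Obj Y (k - 1))"
          using Suc.hyps(1)[OF k(2,3)] Suc.prems by simp
        have gk: "good \<nu> k" using Suc.prems(3)[of k] k by simp
        then have \<nu>k: "\<nu> k \<in> Hom C (Q k) (Obj Y k)" and D: "Diff Y k \<cdot> \<nu> k = \<mu> \<nu> (k - 1) \<cdot> \<pi> k"
          unfolding good_def by auto
        note [simp] = T[OF k(1,4)] HomD[OF IH] HomD[OF \<nu>k]
        have pi: "\<pi> k \<cdot> \<iota> k = Zero C (V' k) (V' (k - 1))"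
          using Q[OF k(1,4)] conflationD(4)[of "\<iota> k" "\<pi> k"] by simp
        have "Diff Y k \<cdot> (\<nu> k \<cdot> \<iota> k) = Zero C (V' k) (Obj Y (k - 1))"
          using Comp_cong_left[OF D, of "\<iota> k"] pi V'Ob[of k] k by simp
        then show ?case using k by (simp add: \<mu>_def Hom_def)
      qed
      have "\<exists>\<nu>. \<forall>k. 1 \<le> k \<and> k \<le> int m \<longrightarrow> good \<nu> k" if "m \<le> n" for m
        using that
      proof (induction m)
        case 0
        then show ?case by auto
      next
        case (Suc m)
        then obtain \<nu> where \<nu>: "\<And>k. 1 \<le> k \<Longrightarrow> k \<le> int m \<Longrightarrow> good \<nu> k" by auto
        let ?m = "int m"
        have m: "1 \<le> ?m + 1" "?m + 1 \<le> int d - 1" using Suc.prems n by auto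
        have \<mu>m: "\<mu> \<nu> ?m \<in> Hom C (V' ?m) (Obj Y ?m)"
          "Diff Y ?m \<cdot> \<mu> \<nu> ?m = Zero C (V' ?m) (Obj Y (?m - 1))"
          using \<mu>[of ?m \<nu>] \<nu> Suc.prems by auto
        note [simp] = T[OF m] HomD[OF \<mu>m(1)]
        \<comment> \<open>\<open>Y\<close> ends in degree \<open>n + 1\<close>, so lifting at degree
          \<open>m\<close> has index \<open>n - m\<close>, which is less than
          \<open>d\<close>.\<close>
        have "finite_complex C 0 (?m + int (n - m) + 1) Y" using YD(6) Suc.prems by simp
        moreover have "\<mu> \<nu> ?m \<cdot> \<pi> (?m + 1) \<in> Hom C (Q (?m + 1)) (Obj Y ?m)" by (simp add: Hom_def)
        moreover have "Diff Y ?m \<cdot> (\<mu> \<nu> ?m \<cdot> \<pi> (?m + 1)) = Zero C (Q (?m + 1)) (Obj Y (?m - 1))"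
          using Comp_cong_left[OF \<mu>m(2), of "\<pi> (?m + 1)"] by simp
        moreover have "cycle_lifting (n - m) (Q (?m + 1))" using cycle_lifting_M n Q[OF m] by simp
        ultimately obtain g where g: "g \<in> Hom C (Q (?m + 1)) (Obj Y (?m + 1))"
          "Diff Y (?m + 1) \<cdot> g = \<mu> \<nu> ?m \<cdot> \<pi> (?m + 1)"
          using cycle_liftingD[OF _ YD(2), of "n - m" "Q (?m + 1)" 0 ?m "\<mu> \<nu> ?m \<cdot> \<pi> (?m + 1)"] YMk by auto
        let ?\<nu> = "\<nu>(?m + 1 := g)"
        have "good ?\<nu> k" if k: "1 \<le> k" "k \<le> int (Suc m)" for k
        proof (cases "k = ?m + 1")
          case True
          have "\<mu> ?\<nu> ?m = \<mu> \<nu> ?m" unfolding \<mu>_def by simp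
          then show ?thesis using True g unfolding good_def by simp
        next
          case False
          then have k': "k \<le> ?m" using k by simp
          have "\<mu> ?\<nu> (k - 1) = \<mu> \<nu> (k - 1)" using k' unfolding \<mu>_def by simp
          then show ?thesis using \<nu>[OF k(1) k'] False unfolding good_def by simp
        qed
        then show ?case by blast
      qed
      from this[of n] obtain \<nu> where \<nu>: "\<And>k. 1 \<le> k \<Longrightarrow> k \<le> ?n \<Longrightarrow> good \<nu> k" by auto
      have \<mu>': "\<mu> \<nu> k \<in> Hom C (V' k) (Obj Y k)" "Diff Y k \<cdot> \<mu> \<nu> k = Zero C (V' k) (Obj Y (k - 1))"
        if "0 \<le> k" "k \<le> ?n" for k
        using \<mu>[OF that, of \<nu>] \<nu> that by auto
      have n1: "1 \<le> ?n" "?n \<le> int d - 1" using n by auto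
      note [simp] = T[OF n1]
      have \<nu>n: "\<nu> ?n \<in> Hom C (Q ?n) (Obj Y ?n)" "Diff Y ?n \<cdot> \<nu> ?n = \<mu> \<nu> (?n - 1) \<cdot> \<pi> ?n"
        using \<nu>[of ?n] n1 unfolding good_def by auto
      have \<mu>n: "\<mu> \<nu> ?n = \<nu> ?n \<cdot> \<iota> ?n" unfolding \<mu>_def using n1 by simp
      obtain ZY iY pY where aY: "acyclic_data C S Y ZY iY pY UNIV" using YD(1) acyclic_complex_iff by auto
      obtain \<phi> where \<phi>: "\<phi> \<in> Hom C (V' ?n) (Obj Y (?n + 1))" "Diff Y (?n + 1) \<cdot> \<phi> = \<mu> \<nu> ?n"
        using acyclic_top_lift[OF aY YD(7)[of "?n + 2"] \<mu>'[of ?n]] by auto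
      \<comment> \<open>On \<open>V' ?n\<close> the arrow \<open>\<nu> ?n\<close> comes from
        \<open>\<phi>\<close> into the top term \<open>B\<close>. Extending \<open>\<phi>\<close>
        over \<open>Q ?n\<close> and subtracting its boundary makes \<open>\<nu> ?n\<close> vanish
        on \<open>V' ?n\<close>, so it descends to \<open>\<sigma>\<close> on the summand
        \<open>V' (?n - 1)\<close> of \<open>P\<close>.\<close>
      have "left_approx (\<iota> ?n)" using Q[OF n1] by simp
      then obtain \<psi> where \<psi>: "\<psi> \<in> Hom C (Q ?n) B" "\<psi> \<cdot> \<iota> ?n = \<phi>"
        unfolding left_approx_def using \<phi>(1) B YD(5) by auto
      have m1: "\<mu> \<nu> (?n - 1) \<in> Hom C (V' (?n - 1)) (Obj Y (?n - 1))" using \<mu>'(1)[of "?n - 1"] n1 by simp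
      note [simp] = HomD[OF \<nu>n(1)] HomD[OF \<psi>(1)] HomD[OF m1] YD(5)
      let ?\<nu> = "\<nu> ?n \<ominus> Diff Y (?n + 1) \<cdot> \<psi>"
      have "?\<nu> \<cdot> \<iota> ?n = Zero C (V' ?n) (Obj Y ?n)" using \<phi>(2) \<psi>(2) \<mu>n V'Ob[of ?n] n1 by simp
      moreover have St: "(\<iota> ?n, \<pi> ?n) \<in> S" using Q[OF n1] by simp
      ultimately obtain \<sigma> where \<sigma>: "\<sigma> \<in> Hom C (V' (?n - 1)) (Obj Y ?n)" "\<sigma> \<cdot> \<pi> ?n = ?\<nu>"
        using conflation_colift[OF St, of ?\<nu> "Obj Y ?n"] by (auto simp: Hom_def)
      note [simp] = HomD[OF \<sigma>(1)]
      have "(Diff Y ?n \<cdot> \<sigma>) \<cdot> \<pi> ?n = \<mu> \<nu> (?n - 1) \<cdot> \<pi> ?n" using \<sigma>(2) \<nu>n(2) by simp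
      then have D\<sigma>: "Diff Y ?n \<cdot> \<sigma> = \<mu> \<nu> (?n - 1)"
        using deflation_epi[of "\<pi> ?n" "Diff Y ?n \<cdot> \<sigma>" "Obj Y (?n - 1)" "\<mu> \<nu> (?n - 1)"] St
          unfolding deflation_def
        by (auto simp: Hom_def)
      define H where "H k = (if k = 0 then Id C (V l) else if 0 < k \<and> k < ?n then \<nu> k
        else if k = ?n then Diff Y (?n + 1) \<cdot> pB \<oplus> \<sigma> \<cdot> qV else
          if k = ?n + 1 then Id C B else Zero C (O' k) (Obj Y k))" for k
      have O'Ob: "O' k \<in> Ob C" for k using is_complexD(1)[OF acyclic_data_is_complex[OF ad], of k] by simp
      have Hi: "H k \<cdot> i' k = \<mu> \<nu> k" if "0 \<le> k" "k < ?n" for k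
        using that by (auto simp: H_def i'_def \<mu>_def)
      have HH: "H k \<in> Hom C (O' k) (Obj Y k)" for k
        using cases[of k] \<nu>[of k] YD(4) O'Ob[of k] n1 by (elim disjE) (auto simp: H_def O'_def good_def
          Hom_def)
      have XT: "i' k \<in> Ar C" "Dom C (i' k) = Z' k" "Cod C (i' k) = O' k" "p' k \<in> Ar C"
        "Dom C (p' k) = O' k" "Cod C (p' k) = Z' (k - 1)" for k
        using acyclic_dataD(3-8)[OF ad UNIV_I, of k] by auto
      have "chain_map C ?X Y H"
        unfolding chain_map_def
      proof (intro conjI allI)
        fix k
        show "H k \<in> Hom C (Obj ?X k) (Obj Y k)" using HH by simp
        note [simp] = HomD[OF HH] XT
        have [simp]: "Cod C (H (k - 1)) = Obj Y (k - 1)" by simp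
        have parts: "Diff Y k \<cdot> H k \<in> Hom C (O' k) (Obj Y (k - 1))"
          "H (k - 1) \<cdot> (i' (k - 1) \<cdot> p' k) \<in> Hom C (O' k) (Obj Y (k - 1))"
          by (auto simp: Hom_def)
        show "Diff Y k \<cdot> H k = H (k - 1) \<cdot> Diff ?X k"
        proof (cases "k \<le> 0 \<or> ?n + 1 < k")
          case True
          then have "zero_object C (O' k) \<or> zero_object C (Obj Y (k - 1))"
            using zero YD(7)[of "k - 1"] by auto
          then show ?thesis using zero_object_parallel parts by fastforce
        next
          case False
          then consider "0 < k" "k < ?n" | "k = ?n" | "k = ?n + 1" by linarith
          then show ?thesis
          proof cases
            case 1
            then have "Diff Y k \<cdot> H k = \<mu> \<nu> (k - 1) \<cdot> \<pi> k" using \<nu>[of k] unfolding good_def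
              by (simp add: H_def)
            also have "\<pi> k = p' k" using 1 by (simp add: p'_def)
            also have "\<mu> \<nu> (k - 1) \<cdot> p' k = H (k - 1) \<cdot> (i' (k - 1) \<cdot> p' k)"
              using Comp_cong_left[OF Hi[of "k - 1"], of "p' k"] 1 by simp
            finally show ?thesis by simp
          next
            case 2
            then have "Diff Y k \<cdot> H k = \<mu> \<nu> (k - 1) \<cdot> qV" using n1 Comp_cong_left[OF D\<sigma>, of qV]
              by (simp add: H_def)
            also have "qV = p' k" using 2 n1 by (simp add: p'_def)
            also have "\<mu> \<nu> (k - 1) \<cdot> p' k = H (k - 1) \<cdot> (i' (k - 1) \<cdot> p' k)"
              using Comp_cong_left[OF Hi[of "k - 1"], of "p' k"] 2 n1 by simp
            finally show ?thesis by simp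
          next
            case 3
            then show ?thesis using n1 by (simp add: H_def i'_def p'_def)
          qed
        qed
      qed
      moreover have "H 0 = Id C (V l)" "H (?n + 1) = Id C B" unfolding H_def by auto
      ultimately have XY: "(?X, Y) \<in> extension_morphism C S n (V l) B"
        using extension_morphismI[OF E YE] by simp
      then show ?thesis using UY by (meson Un_iff converse_iff converse_rtrancl_into_rtrancl
        r_into_rtrancl)
    qed
    then show ?thesis using Ext_vanishesI[OF E] by blast
  qed
  then show ?thesis using M_eq(1) W by blast
qed

text \<open>Replacing \<open>d\<close> degrees produces \<open>d - 1\<close> approximation
  conflations, just enough to control Ext^1, ..., Ext^(d-1) of the last pushout. The terms in
  degrees \<open>l\<close> to \<open>l + d - 2\<close> enter the middle terms of these conflations
  and must lie in \<open>M\<close>; the one in degree \<open>l + d - 1\<close> may be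
  arbitrary.\<close>

lemma approximate_complex_M:
  assumes Y: "acyclic_complex C S Y" and YM: "\<And>k. l \<le> k \<Longrightarrow> k < l + int d - 1 \<Longrightarrow> Obj Y k \<in> M"
  obtains Y' h where "acyclic_complex C S Y'" "chain_map C Y Y' h"
    "\<And>n. \<not> (l \<le> n \<and> n < l + int d) \<Longrightarrow> Obj Y' n = Obj Y n \<and> h n = Id C (Obj Y n)"
    "\<And>n. l \<le> n \<Longrightarrow> n < l + int d \<Longrightarrow> Obj Y' n \<in> M"
proof -
  let ?m = "l + int d - 1"
  have lm: "l \<le> ?m" using d_pos by simp
  obtain Y' h V where Y': "acyclic_complex C S Y'" "chain_map C Y Y' h"
    "\<And>n. \<not> (l \<le> n \<and> n \<le> ?m) \<Longrightarrow> Obj Y' n = Obj Y n \<and> h n = Id C (Obj Y n)"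
    "\<And>n. l < n \<Longrightarrow> n \<le> ?m \<Longrightarrow> Obj Y' n \<in> M" "V l = Obj Y' l" "approx_chain (Obj Y) V l ?m"
    by (rule approximate_complex[OF Y lm]) (rule that)
  have "is_complex C Y'" using Y'(1) unfolding acyclic_complex_def by simp
  then have "V l \<in> M" using approx_chain_M[of V l "Obj Y"] Y'(5,6) YM is_complexD(1) by metis
  then have "Obj Y' n \<in> M" if "l \<le> n" "n < l + int d" for n
    using Y'(4)[of n] Y'(5) that by (cases "n = l") auto
  then show thesis using that Y'(1-3) by auto
qed

end

section \<open>The opposite category\<close>

text \<open>The complex \<open>X\<close> in the opposite category, re-indexed by \<open>n \<mapsto> c - n\<close>.\<close>

definition opx :: "int \<Rightarrow> ('o, 'm) cpx \<Rightarrow> ('o, 'm) cpx" where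
  "opx c X = \<lparr>Obj = \<lambda>n. Obj X (c - n), Diff = \<lambda>n. Diff X (c + 1 - n)\<rparr>"

lemma opx_sel [simp]: "Obj (opx c X) n = Obj X (c - n)" "Diff (opx c X) n = Diff X (c + 1 - n)"
  by (simp_all add: opx_def)

lemma opx_opx [simp]: "opx c (opx c X) = X"
  by (simp add: opx_def)

lemma is_complex_opx:
  assumes "is_complex C X"
  shows "is_complex (opc C) (opx c X)"
proof -
  have *: "Obj X n \<in> Ob C" "Diff X n \<in> Hom C (Obj X n) (Obj X (n - 1))"
    "Diff X (n - 1) \<cdot>\<^bsub>C\<^esub> Diff X n = Zero C (Obj X n) (Obj X (n - 2))" for n
    using assms unfolding is_complex_def by auto
  have e: "c + 1 - n - 1 = c - n" "c + 1 - (n - 1) - 1 = c + 1 - n"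
    "c + 1 - (n - 1) = c - (n - 1) + 1 - 0"
    "c - (n - 1) = c + 1 - n" "c - (n - 2) - 2 = c - n" "c - (n - 2) - 1 = c - (n - 1)"
      "c + 2 - n = c - (n - 2)" for n :: int
    by auto
  show ?thesis
    unfolding is_complex_def
  proof (intro conjI allI)
    fix n
    show "Obj (opx c X) n \<in> Ob (opc C)" using * by simp
    show "Diff (opx c X) n \<in> Hom (opc C) (Obj (opx c X) n) (Obj (opx c X) (n - 1))"
      using *(2)[of "c + 1 - n"] by (simp add: e)
    show "Diff (opx c X) (n - 1) \<cdot>\<^bsub>opc C\<^esub> Diff (opx c X) n = Zero (opc C) (Obj (opx c X) n) (Obj (opx c
      X) (n - 2))"
      using *(3)[of "c + 2 - n"] by (simp add: algebra_simps)
  qed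
qed

lemma finite_complex_opx:
  assumes "finite_complex C a b X" "a = c - b'" "b = c - a'"
  shows "finite_complex (opc C) a' b' (opx c X)"
  using assms is_complex_opx unfolding finite_complex_def by auto

lemma chain_map_opx:
  assumes "chain_map C X Y h"
  shows "chain_map (opc C) (opx c Y) (opx c X) (\<lambda>n. h (c - n))"
proof -
  have *: "h n \<in> Hom C (Obj X n) (Obj Y n)" "Diff Y n \<cdot>\<^bsub>C\<^esub> h n = h (n - 1) \<cdot>\<^bsub>C\<^esub> Diff X n" for n
    using assms unfolding chain_map_def by auto
  show ?thesis unfolding chain_map_def
  proof (intro conjI allI)
    fix n
    show "h (c - n) \<in> Hom (opc C) (Obj (opx c Y) n) (Obj (opx c X) n)" using * by simp
    show "Diff (opx c X) n \<cdot>\<^bsub>opc C\<^esub> h (c - n) = h (c - (n - 1)) \<cdot>\<^bsub>opc C\<^esub> Diff (opx c Y) n"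
      using *(2)[of "c + 1 - n"] by (simp add: algebra_simps)
  qed
qed

lemma (in additive_category) chain_homotopic_opx:
  assumes X: "is_complex C X" and "chain_homotopic C X X f g"
  shows "chain_homotopic (opc C) (opx c X) (opx c X) (\<lambda>n. f (c - n)) (\<lambda>n. g (c - n))"
proof -
  obtain s where s: "\<And>n. s n \<in> Hom C (Obj X n) (Obj X (n + 1))"
    "\<And>n. f n = g n \<oplus> (Diff X (n + 1) \<cdot> s n \<oplus> s (n - 1) \<cdot> Diff X n)"
    using assms unfolding chain_homotopic_def by auto
  note [simp] = is_complexD(1-4)[OF X] HomD[OF s(1)]
  have e: "c - n - 1 + 1 = c - n" "c - (n + 1) = c - n - 1" "c + 1 - (n + 1) = c - n"
    "c - (n - 1) - 1 = c - n" "c + 1 - n = c - n + 1" for n :: int by auto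
  show ?thesis unfolding chain_homotopic_def
  proof (intro exI[of _ "\<lambda>n. s (c - n - 1)"] conjI allI)
    fix n
    show "s (c - n - 1) \<in> Hom (opc C) (Obj (opx c X) n) (Obj (opx c X) (n + 1))"
      using s(1)[of "c - n - 1"] by (simp add: e)
    have "Diff X (c - n + 1) \<cdot> s (c - n) \<oplus> s (c - n - 1) \<cdot> Diff X (c - n) =
      s (c - n - 1) \<cdot> Diff X (c - n) \<oplus> Diff X (c - n + 1) \<cdot> s (c - n)"
      by (rule Add_commute) auto
    then show "f (c - n) = g (c - n) \<oplus>\<^bsub>opc C\<^esub> (Diff (opx c X) (n + 1) \<cdot>\<^bsub>opc C\<^esub> s (c - n - 1) \<oplus>\<^bsub>opc C\<^esub>
      s (c - (n - 1) - 1) \<cdot>\<^bsub>opc C\<^esub> Diff (opx c X) n)"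
      using s(2)[of "c - n"] by (simp add: e)
  qed
qed

lemma (in additive_category) homotopy_equivalent_opx:
  assumes "homotopy_equivalent C X Y"
  shows "homotopy_equivalent (opc C) (opx c X) (opx c Y)"
proof -
  obtain f g where X: "is_complex C X" and Y: "is_complex C Y"
    and fg: "chain_map C X Y f" "chain_map C Y X g"
    "chain_homotopic C X X (\<lambda>n. g n \<cdot> f n) (\<lambda>n. Id C (Obj X n))"
    "chain_homotopic C Y Y (\<lambda>n. f n \<cdot> g n) (\<lambda>n. Id C (Obj Y n))"
    using assms unfolding homotopy_equivalent_def by blast
  show ?thesis unfolding homotopy_equivalent_def
    using is_complex_opx[OF X] is_complex_opx[OF Y] chain_map_opx[OF fg(1)] chain_map_opx[OF fg(2)]
      chain_homotopic_opx[OF X fg(3), of c] chain_homotopic_opx[OF Y fg(4), of c]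
    by (intro conjI exI[of _ "\<lambda>n. g (c - n)"] exI[of _ "\<lambda>n. f (c - n)"]) simp_all
qed

lemma acyclic_complex_opx:
  assumes "acyclic_complex C S X"
  shows "acyclic_complex (opc C) (S\<inverse>) (opx c X)"
proof -
  obtain Z i p where *: "\<And>n. (i n, p n) \<in> S" "\<And>n. i n \<in> Hom C (Z n) (Obj X n)"
    "\<And>n. p n \<in> Hom C (Obj X n) (Z (n - 1))"
    "\<And>n. Diff X n = i (n - 1) \<cdot>\<^bsub>C\<^esub> p n" and X: "is_complex C X"
    using assms unfolding acyclic_complex_def by blast
  have e: "c - (n - 1) - 1 = c - n" "c - (n - 1) = c - n + 1" "c + 1 - n = c - n + 1" for n :: int by auto
  have "(p (c - n), i (c - n)) \<in> S\<inverse> \<and> p (c - n) \<in> Hom (opc C) (Z (c - n - 1)) (Obj (opx c X) n) \<and>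
    i (c - n) \<in> Hom (opc C) (Obj (opx c X) n) (Z (c - (n - 1) - 1)) \<and>
      Diff (opx c X) n = p (c - (n - 1)) \<cdot>\<^bsub>opc C\<^esub> i (c - n)" for n
    using *(1-3)[of "c - n"] *(4)[of "c - n + 1"] by (simp add: e)
  then show ?thesis unfolding acyclic_complex_def using is_complex_opx[OF X]
    by (intro conjI exI[of _ "\<lambda>n. Z (c - n - 1)"] exI[of _ "\<lambda>n. p (c - n)"] exI[of _ "\<lambda>n. i (c - n)"])
      auto
qed

lemma extensions_opx:
  assumes "X \<in> extensions C S n B A"
  shows "opx (int n + 1) X \<in> extensions (opc C) (S\<inverse>) n A B"
  using assms acyclic_complex_opx[of C S X] finite_complex_opx[of C 0 "int n + 1" X "int n + 1"
    "int n + 1" 0]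
  unfolding extensions_def by auto

lemma extension_morphism_opx:
  assumes "(X, Y) \<in> extension_morphism C S n B A"
  shows "(opx (int n + 1) Y, opx (int n + 1) X) \<in> extension_morphism (opc C) (S\<inverse>) n A B"
proof -
  obtain h where h: "chain_map C X Y h" "h 0 = Id C B" "h (int n + 1) = Id C A"
    and E: "X \<in> extensions C S n B A" "Y \<in> extensions C S n B A"
    using assms unfolding extension_morphism_def by auto
  show ?thesis unfolding extension_morphism_def
    using extensions_opx[OF E(1)] extensions_opx[OF E(2)] chain_map_opx[OF h(1), of "int n + 1"] h(2,3)
    by (auto intro!: exI[of _ "\<lambda>k. h (int n + 1 - k)"])
qed

text \<open>A zigzag is transported step by step. Each morphism changes direction, which the
  symmetric closure absorbs.\<close>

lemma Ext_vanishes_opc_imp: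
  assumes E: "Ext_vanishes C S n B A"
  shows "Ext_vanishes (opc C) (S\<inverse>) n A B"
proof -
  let ?c = "int n + 1"
  have "extensions C S n B A \<noteq> {}"
    using E unfolding Ext_vanishes_def yoneda_Ext_def is_singleton_def quotient_def by auto
  then obtain X where X: "X \<in> extensions C S n B A" by blast
  show ?thesis
  proof (rule Ext_vanishesI[OF extensions_opx[OF X]])
    let ?R = "extension_morphism (opc C) (S\<inverse>) n A B"
    fix Y assume "Y \<in> extensions (opc C) (S\<inverse>) n A B"
    from extensions_opx[OF this] have Y: "opx ?c Y \<in> extensions C S n B A" by simp
    from Ext_vanishesD[OF E X Y] have "(opx ?c X, opx ?c (opx ?c Y)) \<in> (?R \<union> ?R\<inverse>)\<^sup>*"
    proof (induction rule: rtrancl_induct)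
      case (step U V)
      from step.hyps(2) have "(opx ?c U, opx ?c V) \<in> ?R \<union> ?R\<inverse>"
        using extension_morphism_opx[of U V] extension_morphism_opx[of V U] by auto
      then show ?case using step.IH by (rule rtrancl_into_rtrancl[rotated])
    qed simp
    then show "(opx ?c X, Y) \<in> (?R \<union> ?R\<inverse>)\<^sup>*" by simp
  qed
qed

lemma Ext_vanishes_opc: "Ext_vanishes (opc C) (S\<inverse>) n A B \<longleftrightarrow> Ext_vanishes C S n B A"
  using Ext_vanishes_opc_imp[of "opc C" "S\<inverse>" n A B] Ext_vanishes_opc_imp[of C S n B A] by auto

lemma (in category) isomorphic_opc_iff: "isomorphic (opc C) A B \<longleftrightarrow> isomorphic C A B"
  using isomorphic_opc[of C A B] isomorphic_opc[of "opc C" A B] by auto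

lemma (in cluster) cluster_opc: "cluster (opc C) (S\<inverse>) d M"
proof (intro cluster.intro cluster_axioms.intro exact_category_opc d_pos)
  have "additive_subcategory (opc C) M"
    unfolding additive_subcategory_def
  proof (intro conjI allI impI)
    fix A B P i j p q assume "A \<in> M" "B \<in> M" "biproduct (opc C) A B P i j p q"
    then show "P \<in> M" unfolding biproduct_opc by (rule M_biproduct)
  next
    fix A B assume "A \<in> M" "isomorphic (opc C) A B"
    then show "B \<in> M" using additive_subcategoryD(2)[OF M_sub] isomorphic_opc_iff by blast
  qed (use M_Ob M_zero in auto)
  moreover have "generating (opc C) (S\<inverse>) M" using M_cogen unfolding generating_def cogenerating_def
    by simp
  moreover have "cogenerating (opc C) (S\<inverse>) M" using M_gen unfolding generating_def cogenerating_def
    by simp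
  moreover have "functorially_finite (opc C) M"
    using cluster_tilting unfolding cluster_tilting_def functorially_finite_def
      contravariantly_finite_def covariantly_finite_def
    by simp
  moreover have "M = {A \<in> Ob (opc C). \<forall>n. 0 < n \<and> n < d \<longrightarrow> (\<forall>X \<in> M. Ext_vanishes (opc C) (S\<inverse>) n A X)}"
    "M = {A \<in> Ob (opc C). \<forall>n. 0 < n \<and> n < d \<longrightarrow> (\<forall>X \<in> M. Ext_vanishes (opc C) (S\<inverse>) n X A)}"
    unfolding Ext_vanishes_opc opc_sel using M_eq by blast+
  ultimately show "cluster_tilting d (opc C) (S\<inverse>) M" unfolding cluster_tilting_def by blast
qed

section \<open>Full subcategories\<close>

lemma full_sub_sel [simp]:
  "Ob (full_sub C M) = M" "Ar (full_sub C M) = {f \<in> Ar C. Dom C f \<in> M \<and> Cod C f \<in> M}"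
  "Dom (full_sub C M) = Dom C" "Cod (full_sub C M) = Cod C" "Id (full_sub C M) = Id C"
  "Comp (full_sub C M) = Comp C" "Add (full_sub C M) = Add C" "Zero (full_sub C M) = Zero C"
  by (simp_all add: full_sub_def)

lemma full_sub_opc: "full_sub (opc C) M = opc (full_sub C M)"
  by (auto simp: full_sub_def opc_def)

lemma Hom_full_sub: "Hom (full_sub C M) A B = (if A \<in> M \<and> B \<in> M then Hom C A B else {})"
  by (auto simp: Hom_def)

lemma hom_group_full_sub: "A \<in> M \<Longrightarrow> B \<in> M \<Longrightarrow> hom_group (full_sub C M) A B = hom_group C A B"
  by (simp add: hom_group_def Hom_full_sub)

lemma Neg_full_sub: "Dom C f \<in> M \<Longrightarrow> Cod C f \<in> M \<Longrightarrow> Neg (full_sub C M) f = Neg C f"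
  by (simp add: Neg_def hom_group_full_sub)

lemma is_complex_full_sub:
  assumes "M \<subseteq> Ob C"
  shows "is_complex (full_sub C M) X \<longleftrightarrow> is_complex C X \<and> (\<forall>n. Obj X n \<in> M)"
  using assms unfolding is_complex_def by (auto simp: Hom_full_sub)

lemma chain_map_full_sub:
  assumes "\<And>n. Obj X n \<in> M" "\<And>n. Obj Y n \<in> M"
  shows "chain_map (full_sub C M) X Y h \<longleftrightarrow> chain_map C X Y h"
  using assms unfolding chain_map_def by (auto simp: Hom_full_sub)

lemma biproduct_full_sub:
  assumes "M \<subseteq> Ob C" "A \<in> M" "B \<in> M"
  shows "biproduct (full_sub C M) A B P i j p q \<longleftrightarrow> P \<in> M \<and> biproduct C A B P i j p q"
  using assms unfolding biproduct_def by (auto simp: Hom_full_sub)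

lemma (in additive_category) additive_category_full_sub:
  assumes M: "additive_subcategory C M"
  shows "additive_category (full_sub C M)"
proof (intro additive_category.intro additive_category_axioms.intro category.intro)
  have Ob: "A \<in> M \<Longrightarrow> A \<in> Ob C" for A using additive_subcategoryD(1)[OF M] .
  obtain Z where Z: "zero_object C Z" using ex_zero_object by auto
  have ZM: "Z \<in> M" using additive_subcategoryD(3)[OF M Z] .
  have "zero_object (full_sub C M) Z" unfolding zero_object_def
    using Z ZM Ob unfolding zero_object_def by (auto simp: Hom_full_sub)
  then show "\<exists>Z. zero_object (full_sub C M) Z" by blast
  fix A B assume AB: "A \<in> Ob (full_sub C M)" "B \<in> Ob (full_sub C M)"
  then show "comm_group (hom_group (full_sub C M) A B)"
    using hom_comm_group Ob by (simp add: hom_group_full_sub)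
  obtain P i j p q where b: "biproduct C A B P i j p q" using ex_biproduct[of A B] AB Ob by auto
  then have "biproduct (full_sub C M) A B P i j p q"
    using biproduct_full_sub[of M C A B P i j p q] additive_subcategoryD(4)[OF M _ _ b] AB Ob by auto
  then show "\<exists>P i j p q. biproduct (full_sub C M) A B P i j p q" by blast
qed (auto simp: Hom_full_sub Hom_def additive_subcategoryD(1)[OF M] split: if_splits)

section \<open>Admissible complexes in the full subcategory\<close>

context cluster
begin

lemma additive_category_M: "additive_category (full_sub C M)"
  by (rule additive_category_full_sub[OF M_sub])

lemma M_subset: "M \<subseteq> Ob C"
  using M_Ob by blast

lemma zero_object_M: "zero_object (full_sub C M) Z \<longleftrightarrow> zero_object C Z"
proof -
  interpret F: additive_category "full_sub C M" by (rule additive_category_M)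
  show ?thesis using M_zero[of Z] M_Ob[of Z] unfolding F.zero_object_iff zero_object_iff by auto
qed

lemma finite_complex_M:
  "finite_complex (full_sub C M) a b X \<longleftrightarrow> finite_complex C a b X \<and> (\<forall>n. Obj X n \<in> M)"
  unfolding finite_complex_def is_complex_full_sub[OF M_subset] zero_object_M by auto

lemma is_iso_M: "is_iso (full_sub C M) f \<longleftrightarrow> is_iso C f \<and> Dom C f \<in> M \<and> Cod C f \<in> M"
  unfolding is_iso_def by (auto simp: Hom_full_sub)

lemma mapping_cone_M:
  assumes "\<And>n. Obj X n \<in> M" "\<And>n. Obj Y n \<in> M" "is_complex C X"
  shows "mapping_cone (full_sub C M) X Y h K \<longleftrightarrow> mapping_cone C X Y h K \<and> (\<forall>n. Obj K n \<in> M)"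
proof -
  have n: "Neg (full_sub C M) (Diff X n) = Neg C (Diff X n)" for n
    by (rule Neg_full_sub) (use assms is_complexD[OF assms(3)] in auto)
  show ?thesis
    unfolding mapping_cone_def is_complex_full_sub[OF M_subset] n
    using assms by (auto simp: biproduct_full_sub[OF M_subset]) metis+
qed

definition admissible :: "('o, 'm) cpx set" where
  "admissible = {X. finite_complex (full_sub C M) 0 (int d + 1) X \<and>
    (\<exists>Y. acyclic_complex C S Y \<and> homotopy_equivalent C X Y)}"

text \<open>The acyclic complex \<open>Y\<close> in the definition is arbitrary, possibly unbounded
  and with terms outside \<open>M\<close>; local exactness passes from it to \<open>X\<close>.
  Conversely a finite locally exact complex is a deformation retract of an acyclic one.\<close>

lemma admissible_iff:
  "X \<in> admissible \<longleftrightarrow> finite_complex C 0 (int d + 1) X \<and> (\<forall>n. Obj X n \<in> M) \<and> locally_exact C S X"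
proof
  assume "X \<in> admissible"
  then obtain Y where X: "finite_complex C 0 (int d + 1) X" "\<And>n. Obj X n \<in> M"
    and Y: "acyclic_complex C S Y" "homotopy_equivalent C X Y"
    unfolding admissible_def finite_complex_M by auto
  then show "finite_complex C 0 (int d + 1) X \<and> (\<forall>n. Obj X n \<in> M) \<and> locally_exact C S X"
    using locally_exact_homotopy[OF acyclic_locally_exact[OF Y(1)]] unfolding homotopy_equivalent_def
      by blast
next
  assume X: "finite_complex C 0 (int d + 1) X \<and> (\<forall>n. Obj X n \<in> M) \<and> locally_exact C S X"
  obtain Y F G where "acyclic_complex C S Y" "deformation_retract C X Y F G"
    by (rule locally_exact_acyclic[of X 0 "int d + 1" M]) (use X M_sub M_gen that in auto)
  then show "X \<in> admissible" unfolding admissible_def finite_complex_M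
    using X deformation_retract_homotopy_equivalent by blast
qed

lemma admissibleD:
  assumes "X \<in> admissible"
  shows "finite_complex C 0 (int d + 1) X" "Obj X n \<in> M" "locally_exact C S X" "is_complex C X"
    "n < 0 \<or> int d + 1 < n \<Longrightarrow> zero_object C (Obj X n)"
  using assms unfolding admissible_iff finite_complex_def by auto

lemma admissible_left_d_exact:
  assumes X: "X \<in> admissible"
  shows "left_d_exact d (full_sub C M) X"
  unfolding left_d_exact_def
proof (intro conjI ballI allI impI)
  note D = admissibleD[OF X]
  note [simp] = is_complexD[OF D(4)]
  show "finite_complex (full_sub C M) 0 (int d + 1) X" using D unfolding finite_complex_M by auto
  fix A n assume A: "A \<in> Ob (full_sub C M)" and n: "1 \<le> n \<and> n \<le> int d + 1"
  have AM: "A \<in> M" and AO: "A \<in> Ob C" using A M_Ob by auto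
  \<comment> \<open>For \<open>n \<le> d\<close> this makes \<open>n + ?i + 1\<close> the top degree
    \<open>d + 1\<close>. For \<open>n = d + 1\<close> subtraction on the natural numbers gives 0,
    and \<open>X\<close> is regarded as ending in degree \<open>d + 2\<close>.\<close>
  let ?i = "d - nat n"
  have i: "?i < d" using n d_pos by auto
  have "finite_complex C 0 (n + int ?i + 1) X"
    using D(1) n unfolding finite_complex_def by auto
  then have lift: "\<exists>g \<in> Hom C A (Obj X (n + 1)). Diff X (n + 1) \<cdot> g = f"
    if "f \<in> Hom C A (Obj X n)" "Diff X n \<cdot> f = Zero C A (Obj X (n - 1))" for f
    using cycle_liftingD[OF cycle_lifting_M[OF i AM] D(3)] D(2) that by blast
  have "Diff X n \<cdot> (Diff X (n + 1) \<cdot> g) = Zero C A (Obj X (n - 1))"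
    "Diff X (n + 1) \<cdot> g \<in> Hom C A (Obj X n)"
    if "g \<in> Hom C A (Obj X (n + 1))" for g
    using HomD[OF that] by (auto simp: Hom_def)
  then show "(\<lambda>g. Diff X (n + 1) \<cdot>\<^bsub>full_sub C M\<^esub> g) ` Hom (full_sub C M) A (Obj X (n + 1)) =
      kernel (hom_group (full_sub C M) A (Obj X n)) (hom_group (full_sub C M) A (Obj X (n - 1))) (\<lambda>f.
        Diff X n \<cdot>\<^bsub>full_sub C M\<^esub> f)"
    using AM D(2) unfolding kernel_def by (auto simp: Hom_full_sub hom_group_def dest!: lift)
qed

lemma admissible_opx:
  assumes "X \<in> admissible"
  shows "opx (int d + 1) X \<in> cluster.admissible (opc C) (S\<inverse>) d M"
proof -
  interpret O: cluster "opc C" "S\<inverse>" d M by (rule cluster_opc)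
  obtain Y where X: "finite_complex C 0 (int d + 1) X" "\<And>n. Obj X n \<in> M"
    and Y: "acyclic_complex C S Y" "homotopy_equivalent C X Y"
    using assms unfolding admissible_def finite_complex_M by auto
  show ?thesis unfolding O.admissible_def O.finite_complex_M
    using finite_complex_opx[OF X(1), of "int d + 1"
      "int d + 1" 0] X(2) acyclic_complex_opx[OF Y(1), of "int d + 1"]
      homotopy_equivalent_opx[OF Y(2), of "int d + 1"] by auto
qed

end

lemma Comp_opc_fun: "Comp (opc C) g = (\<lambda>f. f \<cdot>\<^bsub>C\<^esub> g)"
  by (simp add: opc_def)

lemma right_d_exact_opx:
  assumes "left_d_exact d (opc C) (opx (int d + 1) X)"
  shows "right_d_exact d C X"
  unfolding right_d_exact_def
proof (intro conjI ballI allI impI)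
  have f: "finite_complex (opc C) 0 (int d + 1) (opx (int d + 1) X)" using assms
    unfolding left_d_exact_def by simp
  show "finite_complex C 0 (int d + 1) X" using finite_complex_opx[OF f, of "int d + 1" "int d + 1" 0]
    by simp
  fix A n assume A: "A \<in> Ob C" and n: "0 \<le> n \<and> n \<le> int d"
  have e: "int d + 1 - (int d + 1 - n + 1) = n - 1" "int d + 1 + 1 - (int d + 1 - n + 1) = n"
    "int d + 1 - (int d + 1 - n) = n"
    "int d + 1 - (int d + 1 - n - 1) = n + 1" "int d + 1 + 1 - (int d + 1 - n) = n + 1" by auto
  show "(\<lambda>g. g \<cdot>\<^bsub>C\<^esub> Diff X n) ` Hom C (Obj X (n - 1)) A =
      kernel (hom_group C (Obj X n) A) (hom_group C (Obj X (n + 1)) A) (\<lambda>f. f \<cdot>\<^bsub>C\<^esub> Diff X (n + 1))"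
    using assms A n unfolding left_d_exact_def
    by (elim conjE, elim ballE[of _ _ A], elim allE[of _ "int d + 1 - n"]) (simp_all only: e Comp_opc_fun
      opc_sel opx_sel Hom_opc hom_group_opc, auto)
qed

lemma left_d_exact_opx:
  assumes "right_d_exact d C X"
  shows "left_d_exact d (opc C) (opx (int d + 1) X)"
  unfolding left_d_exact_def
proof (intro conjI ballI allI impI)
  have f: "finite_complex C 0 (int d + 1) X" using assms unfolding right_d_exact_def by simp
  show "finite_complex (opc C) 0 (int d + 1) (opx (int d + 1) X)"
    using finite_complex_opx[OF f, of "int d + 1" "int d + 1" 0] by simp
  fix A n assume A: "A \<in> Ob (opc C)" and n: "1 \<le> n \<and> n \<le> int d + 1"
  have e: "int d + 1 - (n + 1) = int d + 1 - n - 1" "int d + 1 + 1 - (n + 1) = int d + 1 - n" 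
    "int d + 1 - (n - 1) = int d + 1 - n + 1" "int d + 1 + 1 - n = int d + 1 - n + 1" by auto
  show "(\<lambda>g. Diff (opx (int d + 1) X) (n + 1) \<cdot>\<^bsub>opc C\<^esub> g) ` Hom (opc C) A (Obj (opx (int d + 1) X) (n +
    1)) =
      kernel (hom_group (opc C) A (Obj (opx (int d + 1) X) n)) (hom_group (opc C) A (Obj (opx (int d + 1)
        X) (n - 1)))
        (\<lambda>f. Diff (opx (int d + 1) X) n \<cdot>\<^bsub>opc C\<^esub> f)"
    using assms A n unfolding right_d_exact_def
    by (elim conjE, elim ballE[of _ _ A], elim allE[of _ "int d + 1 - n"]) (simp_all only: e Comp_opc_fun
      opc_sel opx_sel Hom_opc hom_group_opc, auto)
qed

lemma d_exact_opx:
  assumes "d_exact d C X"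
  shows "d_exact d (opc C) (opx (int d + 1) X)"
  using assms left_d_exact_opx[of d C X] right_d_exact_opx[of d "opc C" "opx (int d + 1) X"]
    unfolding d_exact_def by simp

lemma (in cluster) admissible_exact:
  assumes X: "X \<in> admissible"
  shows "d_exact d (full_sub C M) X"
proof -
  interpret O: cluster "opc C" "S\<inverse>" d M by (rule cluster_opc)
  have "left_d_exact d (opc (full_sub C M)) (opx (int d + 1) X)"
    using O.admissible_left_d_exact[OF admissible_opx[OF X]] by (simp add: full_sub_opc)
  then show ?thesis using right_d_exact_opx admissible_left_d_exact[OF X] unfolding d_exact_def by blast
qed

section \<open>Uniqueness of \<open>d\<close>-exact sequences\<close>

context additive_category
begin

lemma right_d_exact_lift:
  assumes X: "right_d_exact d C X" and n: "0 \<le> n" "n \<le> int d"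
    and u: "u \<in> Hom C (Obj X n) A" "u \<cdot> Diff X (n + 1) = Zero C (Obj X (n + 1)) A"
  obtains g where "g \<in> Hom C (Obj X (n - 1)) A" "g \<cdot> Diff X n = u"
proof -
  have "(\<lambda>g. g \<cdot> Diff X n) ` Hom C (Obj X (n - 1)) A =
      kernel (hom_group C (Obj X n) A) (hom_group C (Obj X (n + 1)) A) (\<lambda>f. f \<cdot> Diff X (n + 1))"
    using X n HomD(5)[OF u(1)] unfolding right_d_exact_def by blast
  moreover have "u \<in> kernel (hom_group C (Obj X n) A) (hom_group C (Obj X (n + 1)) A) (\<lambda>f. f \<cdot> Diff X (n
    + 1))"
    using u unfolding kernel_def hom_group_def by simp
  ultimately have "u \<in> (\<lambda>g. g \<cdot> Diff X n) ` Hom C (Obj X (n - 1)) A" by simp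
  then show thesis using that by blast
qed

lemma right_d_exactD:
  assumes "right_d_exact d C X"
  shows "is_complex C X" "n < 0 \<or> int d + 1 < n \<Longrightarrow> zero_object C (Obj X n)"
  using assms unfolding right_d_exact_def finite_complex_def by auto

text \<open>\<open>Diff Y k \<cdot> F k\<close> kills the incoming differential of \<open>X\<close>,
  hence factors through the outgoing one by right exactness; the factor is the next
  component.\<close>

lemma extend_chain_map_down:
  assumes X: "right_d_exact d C X" and Y: "finite_complex C 0 (int d + 1) Y" and n: "0 \<le> n" "n \<le> int d"
    and f: "f0 \<in> Hom C (Obj X n) (Obj Y n)" "f1 \<in> Hom C (Obj X (n + 1)) (Obj Y (n + 1))"
    and comm: "Diff Y (n + 1) \<cdot> f1 = f0 \<cdot> Diff X (n + 1)"
  obtains F where "F n = f0" "F (n + 1) = f1" "\<And>k. k \<le> n + 1 \<Longrightarrow> F k \<in> Hom C (Obj X k) (Obj Y k)"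
    "\<And>k. k \<le> n + 1 \<Longrightarrow> Diff Y k \<cdot> F k = F (k - 1) \<cdot> Diff X k"
proof -
  note Xc = right_d_exactD(1)[OF X]
  have Yc: "is_complex C Y" and Y0: "\<And>k. k < 0 \<Longrightarrow> zero_object C (Obj Y k)" using Y
    unfolding finite_complex_def by auto
  note [simp] = is_complexD[OF Xc] is_complexD[OF Yc]
  have "\<exists>F. F n = f0 \<and> F (n + 1) = f1 \<and> (\<forall>k. n - int t \<le> k \<and> k \<le> n + 1 \<longrightarrow>
    F k \<in> Hom C (Obj X k) (Obj Y k)) \<and>
    (\<forall>k. n - int t < k \<and> k \<le> n + 1 \<longrightarrow> Diff Y k \<cdot> F k = F (k - 1) \<cdot> Diff X k)" if "int t \<le> n" for t
    using that
  proof (induction t)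
    case 0
    have *: "k = n \<or> k = n + 1" if "n \<le> k \<and> k \<le> n + 1" for k using that by auto
    then have "(\<forall>k. n \<le> k \<and> k \<le> n + 1 \<longrightarrow> ((\<lambda>_. f0)(n + 1 := f1)) k \<in> Hom C (Obj X k) (Obj Y k))"
      using f by fastforce
    moreover have "(\<forall>k. n < k \<and> k \<le> n + 1 \<longrightarrow> Diff Y k \<cdot> ((\<lambda>_. f0)(n + 1 := f1)) k = ((\<lambda>_. f0)(n + 1 :=
      f1)) (k - 1) \<cdot> Diff X k)"
    proof (intro allI impI)
      fix k assume "n < k \<and> k \<le> n + 1"
      then have "k = n + 1" by simp
      then show "Diff Y k \<cdot> ((\<lambda>_. f0)(n + 1 := f1)) k = ((\<lambda>_. f0)(n + 1 := f1)) (k - 1) \<cdot> Diff X k"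
        using comm by simp
    qed
    ultimately show ?case by (intro exI[of _ "(\<lambda>_. f0)(n + 1 := f1)"]) simp
  next
    case (Suc t)
    then obtain F where F: "F n = f0" "F (n + 1) = f1"
      "\<And>k. n - int t \<le> k \<Longrightarrow> k \<le> n + 1 \<Longrightarrow> F k \<in> Hom C (Obj X k) (Obj Y k)"
      "\<And>k. n - int t < k \<Longrightarrow> k \<le> n + 1 \<Longrightarrow> Diff Y k \<cdot> F k = F (k - 1) \<cdot> Diff X k" by auto
    let ?k = "n - int t"
    have Fk: "F ?k \<in> Hom C (Obj X ?k) (Obj Y ?k)" and Fk1: "F (?k + 1) \<in> Hom C (Obj X (?k + 1)) (Obj Y
      (?k + 1))" using F(3) by auto
    note [simp] = HomD[OF Fk] HomD[OF Fk1]
    have cm: "Diff Y (?k + 1) \<cdot> F (?k + 1) = F ?k \<cdot> Diff X (?k + 1)" using F(4)[of "?k + 1"] by simp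
    have "(Diff Y ?k \<cdot> F ?k) \<cdot> Diff X (?k + 1) = Diff Y ?k \<cdot> (Diff Y (?k + 1) \<cdot> F (?k + 1))"
      unfolding cm by simp
    also have "\<dots> = Zero C (Obj X (?k + 1)) (Obj Y (?k - 1))" by simp
    finally obtain g where g: "g \<in> Hom C (Obj X (?k - 1)) (Obj Y (?k - 1))"
      "g \<cdot> Diff X ?k = Diff Y ?k \<cdot> F ?k"
      using right_d_exact_lift[OF X, of ?k "Diff Y ?k \<cdot> F ?k" "Obj Y (?k - 1)"] Suc.prems n
        by (auto simp: Hom_def)
    let ?F = "F(?k - 1 := g)"
    have "?F k \<in> Hom C (Obj X k) (Obj Y k)" if "n - int (Suc t) \<le> k \<and> k \<le> n + 1" for k
      using that F(3)[of k] g(1) by (cases "k = ?k - 1") auto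
    moreover have "Diff Y k \<cdot> ?F k = ?F (k - 1) \<cdot> Diff X k" if "n - int (Suc t) < k \<and> k \<le> n + 1" for k
    proof (cases "k = ?k")
      case True
      show ?thesis using g(2) unfolding True by simp
    next
      case False
      then show ?thesis using that F(4)[of k] by simp
    qed
    moreover have "?F n = f0" "?F (n + 1) = f1" using F(1,2) by auto
    ultimately show ?case by blast
  qed
  from this[of "nat n"] obtain F where F: "F n = f0" "F (n + 1) = f1"
    "\<And>k. 0 \<le> k \<Longrightarrow> k \<le> n + 1 \<Longrightarrow> F k \<in> Hom C (Obj X k) (Obj Y k)"
    "\<And>k. 0 < k \<Longrightarrow> k \<le> n + 1 \<Longrightarrow> Diff Y k \<cdot> F k = F (k - 1) \<cdot> Diff X k" using n by auto
  \<comment> \<open>Below degree 0 the terms of \<open>Y\<close> vanish, so zero is the only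
    possible component there.\<close>
  define G where "G k = (if 0 \<le> k then F k else Zero C (Obj X k) (Obj Y k))" for k
  have GT: "G k \<in> Hom C (Obj X k) (Obj Y k)" if "k \<le> n + 1" for k using F(3)[of k] that
    unfolding G_def by (simp add: Hom_def)
  show thesis
  proof (rule that[of G])
    show "G n = f0" "G (n + 1) = f1" using F n unfolding G_def by auto
    fix k assume k: "k \<le> n + 1"
    show "G k \<in> Hom C (Obj X k) (Obj Y k)" by (rule GT[OF k])
    note [simp] = HomD[OF GT[OF k]]
    have [simp]: "G (k - 1) \<in> Ar C" "Dom C (G (k - 1)) = Obj X (k - 1)"
      "Cod C (G (k - 1)) = Obj Y (k - 1)" using HomD[OF GT[of "k - 1"]] k by auto
    show "Diff Y k \<cdot> G k = G (k - 1) \<cdot> Diff X k"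
    proof (cases "0 < k")
      case True
      then show ?thesis using F(4)[OF _ k] unfolding G_def by simp
    next
      case False
      show ?thesis by (rule zero_object_parallel(1)[OF Y0[of "k - 1"], of _ "Obj X k"]) (use False in
        \<open>auto simp: Hom_def\<close>)
    qed
  qed
qed

text \<open>The dual construction. Under \<open>opx (int d + 1)\<close> the degrees
  \<open>n + 1\<close> and \<open>n\<close> become \<open>d - n\<close> and
  \<open>d - n + 1\<close>, so the two given components exchange roles.\<close>

lemma extend_chain_map_up:
  assumes Y: "left_d_exact d C Y" and X: "finite_complex C 0 (int d + 1) X" and n: "0 \<le> n" "n \<le> int d"
    and f: "f0 \<in> Hom C (Obj X n) (Obj Y n)" "f1 \<in> Hom C (Obj X (n + 1)) (Obj Y (n + 1))"
    and comm: "Diff Y (n + 1) \<cdot> f1 = f0 \<cdot> Diff X (n + 1)"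
  obtains F where "F n = f0" "F (n + 1) = f1" "\<And>k. n \<le> k \<Longrightarrow> F k \<in> Hom C (Obj X k) (Obj Y k)"
    "\<And>k. n < k \<Longrightarrow> Diff Y k \<cdot> F k = F (k - 1) \<cdot> Diff X k"
proof -
  interpret O: additive_category "opc C" by (rule additive_category_opc)
  let ?c = "int d + 1"
  have Y': "right_d_exact d (opc C) (opx ?c Y)" using right_d_exact_opx[of d "opc C" "opx ?c Y"] Y by simp
  have X': "finite_complex (opc C) 0 (int d + 1) (opx ?c X)"
    using finite_complex_opx[OF X, of ?c ?c 0] by simp
  have e: "?c - (int d - n) = n + 1" "?c - (int d - n + 1) = n" "?c + 1 - (int d - n + 1) = n + 1" by auto
  have f': "f1 \<in> Hom (opc C) (Obj (opx ?c Y) (int d - n)) (Obj (opx ?c X) (int d - n))"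
    "f0 \<in> Hom (opc C) (Obj (opx ?c Y) (int d - n + 1)) (Obj (opx ?c X) (int d - n + 1))"
    "Diff (opx ?c X) (int d - n + 1) \<cdot>\<^bsub>opc C\<^esub> f0 = f1 \<cdot>\<^bsub>opc C\<^esub> Diff (opx ?c Y) (int d - n + 1)"
    unfolding opx_sel Hom_opc opc_sel e using f comm by auto
  obtain F where F: "F (int d - n) = f1" "F (int d - n + 1) = f0"
    "\<And>k. k \<le> int d - n + 1 \<Longrightarrow> F k \<in> Hom (opc C) (Obj (opx ?c Y) k) (Obj (opx ?c X) k)"
    "\<And>k. k \<le> int d - n + 1 \<Longrightarrow> Diff (opx ?c X) k \<cdot>\<^bsub>opc C\<^esub> F k = F (k - 1) \<cdot>\<^bsub>opc C\<^esub> Diff (opx ?c Y) k"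
    by (rule O.extend_chain_map_down[OF Y' X' _ _ f']) (use n that in auto)
  show thesis
  proof (rule that[of "\<lambda>k. F (?c - k)"])
    have e2: "?c - n = int d - n + 1" "?c - (n + 1) = int d - n" by auto
    show "F (?c - n) = f0" "F (?c - (n + 1)) = f1" unfolding e2 by (rule F(2), rule F(1))
    fix k
    show "n \<le> k \<Longrightarrow> F (?c - k) \<in> Hom C (Obj X k) (Obj Y k)" using F(3)[of "?c - k"] by simp
    have e: "?c - (k - 1) = ?c - k + 1" "?c + 1 - (?c - k + 1) = k" "?c - k + 1 - 1 = ?c - k" by auto
    show "n < k \<Longrightarrow> Diff Y k \<cdot> F (?c - k) = F (?c - (k - 1)) \<cdot> Diff X k"
      using F(4)[of "?c - k + 1"] unfolding e opx_sel opc_sel by simp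
  qed
qed

lemma extend_chain_map:
  assumes X: "right_d_exact d C X" and Y: "left_d_exact d C Y" and n: "0 \<le> n" "n \<le> int d"
    and f: "f0 \<in> Hom C (Obj X n) (Obj Y n)" "f1 \<in> Hom C (Obj X (n + 1)) (Obj Y (n + 1))"
    and comm: "Diff Y (n + 1) \<cdot> f1 = f0 \<cdot> Diff X (n + 1)"
  obtains F where "chain_map C X Y F" "F n = f0" "F (n + 1) = f1"
proof -
  have fin: "finite_complex C 0 (int d + 1) X" "finite_complex C 0 (int d + 1) Y"
    using X Y unfolding right_d_exact_def left_d_exact_def by auto
  obtain F where F: "F n = f0" "F (n + 1) = f1" "\<And>k. k \<le> n + 1 \<Longrightarrow> F k \<in> Hom C (Obj X k) (Obj Y k)"
    "\<And>k. k \<le> n + 1 \<Longrightarrow> Diff Y k \<cdot> F k = F (k - 1) \<cdot> Diff X k"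
    by (rule extend_chain_map_down[OF X fin(2) n f comm]) (rule that)
  obtain G where G: "G n = f0" "G (n + 1) = f1" "\<And>k. n \<le> k \<Longrightarrow> G k \<in> Hom C (Obj X k) (Obj Y k)"
    "\<And>k. n < k \<Longrightarrow> Diff Y k \<cdot> G k = G (k - 1) \<cdot> Diff X k"
    by (rule extend_chain_map_up[OF Y fin(1) n f comm]) (rule that)
  let ?H = "\<lambda>k. if k \<le> n then F k else G k"
  have "chain_map C X Y ?H"
    unfolding chain_map_def
  proof (intro conjI allI)
    fix k
    show "?H k \<in> Hom C (Obj X k) (Obj Y k)" using F(3)[of k] G(3)[of k] by simp
    consider "k \<le> n" | "k = n + 1" | "n + 1 < k" by linarith
    then show "Diff Y k \<cdot> ?H k = ?H (k - 1) \<cdot> Diff X k"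
      using F(4)[of k] G(4)[of k] F(1) G(1) by cases auto
  qed
  then show thesis using that[of ?H] F(1) G(2) by simp
qed

text \<open>Once the homotopy equation holds in degree \<open>k + 1\<close>, the difference
  \<open>f k \<ominus> Diff Y (k + 1) \<cdot> s k\<close> kills the incoming differential of
  \<open>X\<close> and factors through the outgoing one. That \<open>s\<close> is zero from degree
  \<open>n - 1\<close> on allows gluing with the dual homotopy above.\<close>

lemma null_homotopic_down:
  assumes X: "right_d_exact d C X" and Y: "is_complex C Y" and f: "chain_map C X Y f"
    and n: "n \<le> int d + 1" and fn: "f n = Zero C (Obj X n) (Obj Y n)"
  obtains s where "\<And>k. s k \<in> Hom C (Obj X k) (Obj Y (k + 1))"
    "\<And>k. n - 1 \<le> k \<Longrightarrow> s k = Zero C (Obj X k) (Obj Y (k + 1))"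
    "\<And>k. k \<le> n \<Longrightarrow> f k = Diff Y (k + 1) \<cdot> s k \<oplus> s (k - 1) \<cdot> Diff X k"
proof -
  note Xc = right_d_exactD(1)[OF X]
  note [simp] = is_complexD[OF Xc] is_complexD[OF Y] chain_mapD(1-3)[OF f]
  have "\<exists>s. (\<forall>k. s k \<in> Hom C (Obj X k) (Obj Y (k + 1))) \<and> (\<forall>k. n - 1 \<le> k \<longrightarrow>
    s k = Zero C (Obj X k) (Obj Y (k + 1))) \<and>
    (\<forall>k. n - int t \<le> k \<and> k \<le> n \<longrightarrow> f k = Diff Y (k + 1) \<cdot> s k \<oplus> s (k - 1) \<cdot> Diff X k)" if "int t \<le> n" for t
    using that
  proof (induction t)
    case 0
    show ?case using fn by (intro exI[of _ "\<lambda>k. Zero C (Obj X k) (Obj Y (k + 1))"]) (auto simp: Hom_def)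
  next
    case (Suc t)
    then obtain s where s: "\<And>k. s k \<in> Hom C (Obj X k) (Obj Y (k + 1))"
      "\<And>k. n - 1 \<le> k \<Longrightarrow> s k = Zero C (Obj X k) (Obj Y (k + 1))"
      "\<And>k. n - int t \<le> k \<Longrightarrow> k \<le> n \<Longrightarrow> f k = Diff Y (k + 1) \<cdot> s k \<oplus> s (k - 1) \<cdot> Diff X k" by auto
    define k where "k = n - int t - 1"
    note [simp] = HomD[OF s(1)]
    have [simp]: "1 + k = k + 1" "2 + k = k + 2" "k + 2 - 1 = k + 1" by auto
    have r: "f (k + 1) = Diff Y (k + 2) \<cdot> s (k + 1) \<oplus> s k \<cdot> Diff X (k + 1)"
      using s(3)[of "k + 1"] unfolding k_def by (simp add: add.commute)
    have cf: "f k \<cdot> Diff X (k + 1) = Diff Y (k + 1) \<cdot> f (k + 1)" using chain_mapD(4)[OF f, of "k + 1"]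
      by simp
    have "Diff Y (k + 1) \<cdot> f (k + 1) = Diff Y (k + 1) \<cdot> (s k \<cdot> Diff X (k + 1))" unfolding r by simp
    then have "(f k \<ominus> Diff Y (k + 1) \<cdot> s k) \<cdot> Diff X (k + 1) = Zero C (Obj X (k + 1)) (Obj Y k)"
      using cf by simp
    then obtain g where g: "g \<in> Hom C (Obj X (k - 1)) (Obj Y k)"
      "g \<cdot> Diff X k = f k \<ominus> Diff Y (k + 1) \<cdot> s k"
      using right_d_exact_lift[OF X, of k "f k \<ominus> Diff Y (k + 1) \<cdot> s k" "Obj Y k"] Suc.prems n k_def
      by (auto simp: Hom_def)
    note [simp] = HomD[OF g(1)]
    let ?s = "s(k - 1 := g)"
    have "?s j \<in> Hom C (Obj X j) (Obj Y (j + 1))" for j using s(1)[of j] g(1) by auto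
    moreover have "?s j = Zero C (Obj X j) (Obj Y (j + 1))" if "n - 1 \<le> j" for j
      using s(2)[OF that] that unfolding k_def by auto
    moreover have "f j = Diff Y (j + 1) \<cdot> ?s j \<oplus> ?s (j - 1) \<cdot> Diff X j"
      if "n - int (Suc t) \<le> j \<and> j \<le> n" for j
    proof (cases "j = k")
      case True
      show ?thesis unfolding True using g(2) by (simp add: hom_algebra)
    next
      case False
      then have "n - int t \<le> j" using that unfolding k_def by simp
      then show ?thesis using s(3)[of j] that False unfolding k_def by auto
    qed
    ultimately show ?case by blast
  qed
  note ex = this
  show thesis
  proof (cases "0 \<le> n")
    case True
    then obtain s where s: "\<And>k. s k \<in> Hom C (Obj X k) (Obj Y (k + 1))"
      "\<And>k. n - 1 \<le> k \<Longrightarrow> s k = Zero C (Obj X k) (Obj Y (k + 1))"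
      "\<And>k. 0 \<le> k \<Longrightarrow> k \<le> n \<Longrightarrow> f k = Diff Y (k + 1) \<cdot> s k \<oplus> s (k - 1) \<cdot> Diff X k"
      using ex[of "nat n"] by auto
    have "f k = Diff Y (k + 1) \<cdot> s k \<oplus> s (k - 1) \<cdot> Diff X k" if "k < 0" for k
    proof (rule zero_object_parallel(2)[OF right_d_exactD(2)[OF X, of k], of _ "Obj Y k"])
      have "s (k - 1) \<in> Hom C (Obj X (k - 1)) (Obj Y k)" using s(1)[of "k - 1"] by simp
      note [simp] = HomD[OF this] HomD[OF s(1)]
      show "f k \<in> Hom C (Obj X k) (Obj Y k)"
        "Diff Y (k + 1) \<cdot> s k \<oplus> s (k - 1) \<cdot> Diff X k \<in> Hom C (Obj X k) (Obj Y k)"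
        by (auto simp: Hom_def)
    qed (use that in auto)
    then show thesis using that[OF s(1,2)] s(3) by (meson not_le)
  next
    case False
    let ?s = "\<lambda>k. Zero C (Obj X k) (Obj Y (k + 1))"
    have "f k = Diff Y (k + 1) \<cdot> ?s k \<oplus> ?s (k - 1) \<cdot> Diff X k" if "k \<le> n" for k
      by (rule zero_object_parallel(2)[OF right_d_exactD(2)[OF X, of k], of _ "Obj Y k"])
        (use that False in \<open>auto simp: Hom_def\<close>)
    then show thesis using that[of ?s] by (auto simp: Hom_def)
  qed
qed

lemma null_homotopic:
  assumes X: "d_exact d C X" and Y: "d_exact d C Y" and f: "chain_map C X Y f"
    and n: "0 \<le> n" "n \<le> int d + 1" and fn: "f n = Zero C (Obj X n) (Obj Y n)"
  obtains s where "\<And>k. s k \<in> Hom C (Obj X k) (Obj Y (k + 1))"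
    "\<And>k. f k = Diff Y (k + 1) \<cdot> s k \<oplus> s (k - 1) \<cdot> Diff X k"
proof -
  interpret O: additive_category "opc C" by (rule additive_category_opc)
  let ?c = "int d + 1"
  have Xr: "right_d_exact d C X" and Yr: "right_d_exact d C Y" using X Y unfolding d_exact_def by auto
  note Xc = right_d_exactD(1)[OF Xr] and Yc = right_d_exactD(1)[OF Yr]
  note [simp] = is_complexD(1-4)[OF Xc] is_complexD(1-4)[OF Yc]
  obtain s where s: "\<And>k. s k \<in> Hom C (Obj X k) (Obj Y (k + 1))"
    "\<And>k. n - 1 \<le> k \<Longrightarrow> s k = Zero C (Obj X k) (Obj Y (k + 1))"
    "\<And>k. k \<le> n \<Longrightarrow> f k = Diff Y (k + 1) \<cdot> s k \<oplus> s (k - 1) \<cdot> Diff X k"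
    by (rule null_homotopic_down[OF Xr Yc f n(2) fn]) (rule that)
  have Y': "right_d_exact d (opc C) (opx ?c Y)" using d_exact_opx[OF Y] unfolding d_exact_def by simp
  obtain t where t: "\<And>k. t k \<in> Hom (opc C) (Obj (opx ?c Y) k) (Obj (opx ?c X) (k + 1))"
    "\<And>k. ?c - n - 1 \<le> k \<Longrightarrow> t k = Zero (opc C) (Obj (opx ?c Y) k) (Obj (opx ?c X) (k + 1))"
    "\<And>k. k \<le> ?c - n \<Longrightarrow> f (?c - k) = Diff (opx ?c X) (k + 1) \<cdot>\<^bsub>opc C\<^esub> t k \<oplus>\<^bsub>opc C\<^esub> t (k - 1) \<cdot>\<^bsub>opc C\<^esub> Diff
      (opx ?c Y) k"
    by (rule O.null_homotopic_down[OF Y' is_complex_opx[OF Xc, of ?c] chain_map_opx[OF f, of ?c], of "?c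
      - n"]) (use n fn that in auto)
  define u where "u k = t (?c - k - 1)" for k
  have u: "u k \<in> Hom C (Obj X k) (Obj Y (k + 1))" "k \<le> n \<Longrightarrow> u k = Zero C (Obj X k) (Obj Y (k + 1))"
    "n \<le> k \<Longrightarrow> f k = Diff Y (k + 1) \<cdot> u k \<oplus> u (k - 1) \<cdot> Diff X k" for k
  proof -
    have e: "?c - (?c - k - 1) = k + 1" "?c - (?c - k - 1 + 1) = k" "?c - (?c - k) = k"
      "?c + 1 - (?c - k + 1) = k" "?c + 1 - (?c - k) = k + 1"
      "?c - (k - 1) - 1 = ?c - k" "?c - (?c - k + 1) = k - 1" by auto
    show uT: "u k \<in> Hom C (Obj X k) (Obj Y (k + 1))" for k
      using t(1)[of "?c - k - 1"] unfolding u_def opx_sel Hom_opc by (simp add: algebra_simps)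
    show "k \<le> n \<Longrightarrow> u k = Zero C (Obj X k) (Obj Y (k + 1))" using t(2)[of "?c - k - 1"]
      unfolding u_def opx_sel opc_sel e by simp
    have uT': "u (k - 1) \<in> Hom C (Obj X (k - 1)) (Obj Y k)" using uT[of "k - 1"] by simp
    note [simp] = HomD[OF uT] HomD[OF uT']
    have "f k = u (k - 1) \<cdot> Diff X k \<oplus> Diff Y (k + 1) \<cdot> u k" if "n \<le> k"
      using t(3)[of "?c - k"] that unfolding u_def opx_sel opc_sel e by simp
    then show "n \<le> k \<Longrightarrow> f k = Diff Y (k + 1) \<cdot> u k \<oplus> u (k - 1) \<cdot> Diff X k"
      using Add_commute[of "u (k - 1) \<cdot> Diff X k" "Diff Y (k + 1) \<cdot> u k"] by simp
  qed
  \<comment> \<open>The halves can be glued: \<open>s\<close> vanishes from degree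
    \<open>n - 1\<close> on and \<open>u\<close> up to degree \<open>n\<close>, so both are zero in
    degree \<open>n - 1\<close>, where the homotopy equation in degree \<open>n\<close> needs them
    to agree.\<close>
  let ?w = "\<lambda>k. if k < n then s k else u k"
  show thesis
  proof (rule that[of ?w])
    fix k
    show "?w k \<in> Hom C (Obj X k) (Obj Y (k + 1))" using s(1) u(1) by simp
    consider "k < n" | "k = n" | "n < k" by linarith
    then show "f k = Diff Y (k + 1) \<cdot> ?w k \<oplus> ?w (k - 1) \<cdot> Diff X k"
    proof cases
      case 2
      then have "?w k = u k" "?w (k - 1) = u (k - 1)" using s(2)[of "k - 1"] u(2)[of "k - 1"] by auto
      then show ?thesis using u(3)[of k] 2 by simp
    qed (use s(3) u(3) in auto)
  qed
qed

text \<open>The inverses in degrees \<open>n\<close> and \<open>n + 1\<close> extend to a chain map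
  \<open>G\<close>. Both composites are the identity in degree \<open>n\<close>, so their
  differences from the identity are null-homotopic.\<close>

lemma d_exact_homotopy_equivalent:
  assumes X: "d_exact d C X" and Y: "d_exact d C Y" and h: "chain_map C X Y h"
    and n: "0 \<le> n" "n \<le> int d" and iso: "is_iso C (h n)" "is_iso C (h (n + 1))"
  shows "homotopy_equivalent C X Y"
proof -
  have Xr: "right_d_exact d C X" "left_d_exact d C X" and Yr: "right_d_exact d C Y" "left_d_exact d C Y"
    using X Y unfolding d_exact_def by auto
  note Xc = right_d_exactD(1)[OF Xr(1)] and Yc = right_d_exactD(1)[OF Yr(1)]
  note [simp] = is_complexD(1-4)[OF Xc] is_complexD(1-4)[OF Yc] chain_mapD(1-3)[OF h]
  have n1 [simp]: "n + 1 - 1 = n" by simp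
  obtain g0 where g0: "g0 \<in> Hom C (Obj Y n) (Obj X n)" "g0 \<cdot> h n = Id C (Obj X n)"
    "h n \<cdot> g0 = Id C (Obj Y n)"
    using is_isoE[OF iso(1)] by auto
  obtain g1 where g1: "g1 \<in> Hom C (Obj Y (n + 1)) (Obj X (n + 1))" "h (n + 1) \<cdot> g1 = Id C (Obj Y (n + 1))"
    using is_isoE[OF iso(2)] by auto
  note [simp] = HomD[OF g0(1)] HomD[OF g1(1)]
  have "Diff X (n + 1) \<cdot> g1 = (g0 \<cdot> h n) \<cdot> (Diff X (n + 1) \<cdot> g1)" using g0(2) by simp
  also have "\<dots> = g0 \<cdot> ((h n \<cdot> Diff X (n + 1)) \<cdot> g1)" by simp
  also have "h n \<cdot> Diff X (n + 1) = Diff Y (n + 1) \<cdot> h (n + 1)" using chain_mapD(4)[OF h, of "n + 1"]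
    by simp
  also have "g0 \<cdot> ((Diff Y (n + 1) \<cdot> h (n + 1)) \<cdot> g1) = g0 \<cdot> Diff Y (n + 1)" using g1(2) by simp
  finally have comm: "Diff X (n + 1) \<cdot> g1 = g0 \<cdot> Diff Y (n + 1)" .
  obtain G where G: "chain_map C Y X G" "G n = g0" "G (n + 1) = g1"
    by (rule extend_chain_map[OF Yr(1) Xr(2) n g0(1) g1(1) comm])
  note [simp] = chain_mapD(1-3)[OF G(1)]
  have null: "chain_homotopic C W W k (\<lambda>n. Id C (Obj W n))"
    if W: "d_exact d C W" and k: "chain_map C W W k" and kn: "k n = Id C (Obj W n)" for W k
  proof -
    have Wc: "is_complex C W" using W right_d_exactD(1) unfolding d_exact_def by blast
    note [simp] = is_complexD(1-4)[OF Wc] chain_mapD(1-3)[OF k]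
    have "chain_map C W W (\<lambda>n. k n \<ominus> Id C (Obj W n))"
      using chain_mapD(4)[OF k] unfolding chain_map_def by (simp add: Hom_def)
    then obtain s where s: "\<And>n. s n \<in> Hom C (Obj W n) (Obj W (n + 1))"
      "\<And>n. k n \<ominus> Id C (Obj W n) = Diff W (n + 1) \<cdot> s n \<oplus> s (n - 1) \<cdot> Diff W n"
      by (rule null_homotopic[OF W W, of "\<lambda>n. k n \<ominus> Id C (Obj W n)" n]) (use n kn in auto)
    have "k n = Id C (Obj W n) \<oplus> (Diff W (n + 1) \<cdot> s n \<oplus> s (n - 1) \<cdot> Diff W n)" for n
    proof -
      have "s (n - 1) \<in> Hom C (Obj W (n - 1)) (Obj W n)" using s(1)[of "n - 1"] by simp
      note [simp] = HomD[OF this] HomD[OF s(1)]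
      have "k n = (Diff W (n + 1) \<cdot> s n \<oplus> s (n - 1) \<cdot> Diff W n) \<oplus> Id C (Obj W n)"
        using s(2)[of n] by (subst (asm) Minus_eq_iff(1)) auto
      then show ?thesis by (simp add: Add_ac)
    qed
    then show ?thesis unfolding chain_homotopic_def using s(1) by blast
  qed
  show ?thesis unfolding homotopy_equivalent_def
    using Xc Yc h G(1) null[OF X chain_map_compose[OF Xc Yc Xc h G(1)]] null[OF Y chain_map_compose[OF Yc
      Xc Yc G(1) h]] G(2) g0(2,3)
    by blast
qed

end

section \<open>Admissible monomorphisms\<close>

text \<open>The degree \<open>c\<close> is that of the middle term; with \<open>c = d\<close> the
  inflation sits where a complex with \<open>d + 2\<close> terms has its first morphism.\<close>

lemma (in exact_category) conflation_complex:
  assumes S: "(\<iota>, \<pi>) \<in> S"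
  obtains Y where "acyclic_complex C S Y" "Obj Y (c + 1) = Dom C \<iota>" "Obj Y c = Cod C \<iota>"
    "Diff Y (c + 1) = \<iota>" "\<And>n. n < c - 1 \<or> c + 1 < n \<Longrightarrow> zero_object C (Obj Y n)"
proof -
  obtain Z0 where Z0: "zero_object C Z0" using ex_zero_object by auto
  note [simp] = conflationD(1-3)[OF S]
  define Z where "Z n = (if n = c then Dom C \<iota> else if n = c - 1 then Cod C \<pi> else Z0)" for n
  define O' where "O' n = (if n = c + 1 then Dom C \<iota> else if n = c then Cod C \<iota> else
    if n = c - 1 then Cod C \<pi> else Z0)" for n
  define i where "i n = (if n = c + 1 then Zero C Z0 (Dom C \<iota>) else if n = c then \<iota> else
    if n = c - 1 then Id C (Cod C \<pi>) else Id C Z0)" for n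
  define p where "p n = (if n = c + 1 then Id C (Dom C \<iota>) else if n = c then \<pi> else
    if n = c - 1 then Zero C (Cod C \<pi>) Z0 else Zero C Z0 Z0)" for n
  let ?Y = "\<lparr>Obj = O', Diff = \<lambda>n. i (n - 1) \<cdot> p n\<rparr>"
  have ad: "acyclic_data C S ?Y Z i p UNIV"
    unfolding acyclic_data_def
  proof
    fix n
    consider "n = c + 1" | "n = c" | "n = c - 1" | "n \<noteq> c + 1" "n \<noteq> c" "n - 1 \<noteq> c" "n \<noteq> c - 1" by linarith
    then show "(i n, p n) \<in> S \<and> i n \<in> Hom C (Z n) (Obj ?Y n) \<and> p n \<in> Hom C (Obj ?Y n) (Z (n - 1)) \<and>
      Diff ?Y n = i (n - 1) \<cdot> p n"
    proof cases
      case 1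
      then show ?thesis using iso_conflation(1)[OF is_iso_Id[of "Dom C \<iota>"] Z0] Z0
        by (simp add: Z_def O'_def i_def p_def Hom_def)
    next
      case 2
      then show ?thesis using S by (simp add: Z_def O'_def i_def p_def Hom_def)
    next
      case 3
      then show ?thesis using conflation_Id_zero[OF Z0, of "Cod C \<pi>"] Z0
        by (simp add: Z_def O'_def i_def p_def Hom_def)
    next
      case 4
      then have "n - 1 \<noteq> c - 1" by simp
      then show ?thesis using 4 conflation_Id_zero[OF Z0, of Z0] Z0
        by (simp add: Z_def O'_def i_def p_def Hom_def)
    qed
  qed
  then have "acyclic_complex C S ?Y" using acyclic_complex_iff by blast
  then show thesis
    by (rule that) (use Z0 in \<open>auto simp: O'_def i_def p_def\<close>)
qed

context cluster
begin

text \<open>For \<open>d\<close> at least 2 the auxiliary summand that makes \<open>f\<close> an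
  inflation can later be moved to a lower degree, so \<open>f\<close> itself need not be one. For
  \<open>d = 1\<close> there is no room for this, whence the last clause.\<close>

definition M_inflation :: "'m \<Rightarrow> bool" where
  "M_inflation f \<longleftrightarrow> f \<in> Ar C \<and> Dom C f \<in> M \<and> Cod C f \<in> M \<and>
    (\<exists>\<alpha> \<in> Ar C. Dom C \<alpha> = Cod C f \<and> inflation S (\<alpha> \<cdot> f)) \<and> (d = 1 \<longrightarrow> inflation S f)"

text \<open>The conflation, seen as a complex in degrees \<open>d + 1\<close>, \<open>d\<close> and
  \<open>d - 1\<close>, has its terms in degrees 0 to \<open>d - 1\<close> replaced by objects of
  \<open>M\<close>. Before the replacement all of these are zero except the cokernel in degree
  \<open>d - 1\<close>, the degree where an arbitrary object is allowed.\<close>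

lemma inflation_resolution:
  assumes \<iota>: "inflation S \<iota>" "Dom C \<iota> \<in> M" "Cod C \<iota> \<in> M"
  obtains Y where "Y \<in> admissible" "Diff Y (int d + 1) = \<iota>"
proof -
  obtain \<pi> where S: "(\<iota>, \<pi>) \<in> S" using \<iota>(1) unfolding inflation_def by auto
  note [simp] = conflationD(1-3)[OF S]
  obtain Y0 where Y0: "acyclic_complex C S Y0" "Obj Y0 (int d + 1) = Dom C \<iota>" "Obj Y0 (int d) = Cod C \<iota>"
    "Diff Y0 (int d + 1) = \<iota>" "\<And>n. n < int d - 1 \<or> int d + 1 < n \<Longrightarrow> zero_object C (Obj Y0 n)"
    by (rule conflation_complex[OF S, of "int d"]) (rule that)
  have M0: "Obj Y0 k \<in> M" if "0 \<le> k" "k < 0 + int d - 1" for k using M_zero[OF Y0(5)[of k]] that by simp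
  obtain Y h where Y: "acyclic_complex C S Y" "chain_map C Y0 Y h"
    "\<And>n. \<not> (0 \<le> n \<and> n < 0 + int d) \<Longrightarrow> Obj Y n = Obj Y0 n \<and> h n = Id C (Obj Y0 n)"
    "\<And>n. 0 \<le> n \<Longrightarrow> n < 0 + int d \<Longrightarrow> Obj Y n \<in> M"
    by (rule approximate_complex_M[OF Y0(1) M0]) (use that in auto)
  have Yc: "is_complex C Y" using Y(1) unfolding acyclic_complex_def by simp
  note [simp] = is_complexD(1-4)[OF Yc]
  have zero: "zero_object C (Obj Y n)" if "n < 0 \<or> int d + 1 < n" for n
    using Y(3)[of n] Y0(5)[of n] that d_pos by auto
  have "Obj Y n \<in> M" for n
  proof -
    have "n = int d \<or> n = int d + 1 \<or> (n < 0 \<or> int d + 1 < n) \<or> (0 \<le> n \<and> n < 0 + int d)" by arith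
    then show ?thesis using Y(4)[of n] Y(3)[of n] Y0(2,3) \<iota>(2,3) M_zero[OF zero[of n]] by auto
  qed
  moreover have "finite_complex C 0 (int d + 1) Y" unfolding finite_complex_def using Yc zero by blast
  ultimately have "Y \<in> admissible" using acyclic_locally_exact[OF Y(1)] unfolding admissible_iff by blast
  moreover have "Diff Y (int d + 1) = \<iota>"
  proof -
    have "Diff Y (int d + 1) \<cdot> Id C (Dom C \<iota>) = Id C (Cod C \<iota>) \<cdot> \<iota>"
      using chain_mapD(4)[OF Y(2), of "int d + 1"] Y(3)[of "int d"] Y(3)[of "int d + 1"] Y0(2-4) by simp
    then show ?thesis using Y(3)[of "int d + 1"] Y0(2) by simp
  qed
  ultimately show thesis using that by blast
qed

lemma admissible_colift:
  assumes X: "X \<in> admissible" and n: "0 \<le> n" "n \<le> int d" and A: "A \<in> M"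
    and u: "u \<in> Hom C (Obj X n) A" "u \<cdot> Diff X (n + 1) = Zero C (Obj X (n + 1)) A"
  obtains g where "g \<in> Hom C (Obj X (n - 1)) A" "g \<cdot> Diff X n = u"
proof -
  interpret F: additive_category "full_sub C M" by (rule additive_category_M)
  have r: "right_d_exact d (full_sub C M) X" using admissible_exact[OF X] unfolding d_exact_def by simp
  note D = admissibleD(2)[OF X]
  show thesis
    by (rule F.right_d_exact_lift[OF r n, of u A]) (use u A D that in \<open>auto simp: Hom_full_sub\<close>)
qed

text \<open>A morphism \<open>f : A \<rightarrow> B\<close> such that \<open>\<alpha> \<cdot> f : A \<rightarrow> A'\<close> is an inflation need not have a cokernel. For
  \<open>d \<ge> 2\<close> one resolves the inflation \<open>(f, 0) : A \<rightarrow> B \<oplus> A'\<close> and then moves the summand \<open>A'\<close> from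
  degree \<open>d\<close> to degree \<open>d - 2\<close>.\<close>

lemma M_inflation_resolution:
  assumes f: "M_inflation f"
  obtains X where "X \<in> admissible" "Diff X (int d + 1) = f"
proof (cases "d = 1")
  case True
  then show thesis using inflation_resolution[of f] f that unfolding M_inflation_def by blast
next
  case False
  then have d2: "2 \<le> d" using d_pos by simp
  let ?e = "int d"
  define A where "A = Dom C f"
  define B where "B = Cod C f"
  have fA [simp]: "f \<in> Ar C" "Dom C f = A" "Cod C f = B" and AB: "A \<in> M" "B \<in> M"
    using f unfolding M_inflation_def A_def B_def by auto
  obtain \<alpha>0 where \<alpha>0: "\<alpha>0 \<in> Ar C" "Dom C \<alpha>0 = B" "inflation S (\<alpha>0 \<cdot> f)" using f
    unfolding M_inflation_def B_def by auto
  \<comment> \<open>Composing with an inflation into \<open>M\<close> places the auxiliary summand,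
    and with it \<open>P\<close>, in \<open>M\<close>.\<close>
  obtain A' \<beta> where A': "A' \<in> M" and \<beta>: "\<beta> \<in> Hom C (Cod C \<alpha>0) A'" "inflation S \<beta>"
    using M_cogen[unfolded cogenerating_def, rule_format, of "Cod C \<alpha>0"] \<alpha>0(1) by auto
  note [simp] = \<alpha>0(1,2) HomD[OF \<beta>(1)]
  have \<alpha>: "\<beta> \<cdot> \<alpha>0 \<in> Hom C B A'" "inflation S ((\<beta> \<cdot> \<alpha>0) \<cdot> f)"
    using inflation_Comp[OF \<alpha>0(3) \<beta>(2)] by (auto simp: Hom_def)
  obtain P i j p q where b: "biproduct C B A' P i j p q" using ex_biproduct M_Ob AB A' by metis
  note [simp] = biproduct_simps[OF b]
  have PM: "P \<in> M" by (rule M_biproduct[OF AB(2) A' b])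
  have "inflation S (i \<cdot> f)" by (rule inflation_biproduct_zero[OF b _ \<alpha>]) (simp add: Hom_def)
  then obtain Y where Y: "Y \<in> admissible" "Diff Y (?e + 1) = i \<cdot> f"
    by (rule inflation_resolution) (use AB PM in auto)
  note YD = admissibleD[OF Y(1)]
  note [simp] = is_complexD[OF YD(4)]
  have Ob [simp]: "Obj Y (?e + 1) = A" "Obj Y ?e = P"
    using is_complexD(3,4)[OF YD(4), of "?e + 1"] Y(2) by auto
  have e [simp]: "1 + ?e = ?e + 1" "?e - 1 - 1 = ?e - 2" "?e - 2 - 1 = ?e - 3" "?e - 2 + 1 = ?e - 1"
    "?e - 3 + 1 = ?e - 2" "?e + 1 + 1 = ?e + 2" "2 + ?e = ?e + 2" by auto
  \<comment> \<open>\<open>q\<close> kills the first differential \<open>i \<cdot> f\<close> of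
    \<open>Y\<close>, so it factors through the next one; this uses right exactness with respect to
    the object \<open>A'\<close> of \<open>M\<close>.\<close>
  obtain r where r: "r \<in> Hom C (Obj Y (?e - 1)) A'" "r \<cdot> Diff Y ?e = q"
    by (rule admissible_colift[OF Y(1), of ?e A' q]) (use A' Y(2) AB M_Ob that in \<open>auto simp: Hom_def\<close>)
  note [simp] = HomD[OF r(1)]
  have rD: "r \<cdot> (Diff Y ?e \<cdot> x) = q \<cdot> x" if "x \<in> Ar C" "Cod C x = P" for x
    using Comp_cong_left[OF r(2), of x] that by simp
  obtain P2 i2 j2 p2 q2 where b2: "biproduct C (Obj Y (?e - 2)) A' P2 i2 j2 p2 q2"
    using ex_biproduct[of "Obj Y (?e - 2)" A'] M_Ob A' YD(2) by blast
  note [simp] = biproduct_simps[OF b2]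
  have P2M: "P2 \<in> M" by (rule M_biproduct[OF YD(2) A' b2])
  have Ob2 [simp]: "A \<in> Ob C" "B \<in> Ob C" "A' \<in> Ob C" using AB A' M_Ob by auto
  \<comment> \<open>Removing \<open>A'\<close> in degree \<open>?e\<close> shrinks the boundaries in
    degree \<open>?e - 1\<close> to those on which \<open>r\<close> vanishes; recording
    \<open>r\<close> in a new summand \<open>A'\<close> of degree \<open>?e - 2\<close> restricts
    the cycles accordingly. As \<open>2 \<le> d\<close>, this degree is not negative.\<close>
  let ?D = "(Diff Y)(?e + 1 := f, ?e := Diff Y ?e \<cdot> i, ?e - 1 := i2 \<cdot> Diff Y (?e - 1) \<oplus> j2 \<cdot> r, ?e - 2 :=
    Diff Y (?e - 2) \<cdot> p2)"
  let ?X = "\<lparr>Obj = (Obj Y)(?e := B, ?e - 2 := P2), Diff = ?D\<rparr>"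
  have D0: "Diff Y ?e \<cdot> (i \<cdot> f) = Zero C A (Obj Y (?e - 1))"
    using is_complexD(5)[OF YD(4), of "?e + 1" ?e] Y(2) by simp
  have cases: "n = ?e + 1 \<or> n = ?e \<or> n = ?e - 1 \<or> n = ?e - 2 \<or> n = ?e - 3 \<or>
    (n \<noteq> ?e + 1 \<and> n \<noteq> ?e \<and> n \<noteq> ?e - 1 \<and> n \<noteq> ?e - 2 \<and> n + 1 \<noteq> ?e - 2 \<and> n \<noteq> ?e - 3 \<and> n - 1 \<noteq> ?e \<and>
      n - 1 \<noteq> ?e - 2 \<and> n + 1 \<noteq> ?e \<and>
      n + 1 \<noteq> ?e + 1 \<and> n + 1 \<noteq> ?e - 1)" for n by linarith
  have Xc: "is_complex C ?X"
  proof (rule is_complexI)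
    fix n
    show "Obj ?X n \<in> Ob C" by simp
    show "Diff ?X n \<in> Hom C (Obj ?X n) (Obj ?X (n - 1))" using cases[of n]
      by (elim disjE) (auto simp: Hom_def)
    show "Diff ?X n \<cdot> Diff ?X (n + 1) = Zero C (Obj ?X (n + 1)) (Obj ?X (n - 1))"
      using cases[of n]
    proof (elim disjE)
      assume "n = ?e + 1"
      moreover have "i \<cdot> (f \<cdot> Diff Y (?e + 2)) = Zero C (Obj Y (?e + 2)) P"
        using is_complexD(5)[OF YD(4), of "?e + 2" "?e + 1"] Y(2) by simp
      then have "p \<cdot> (i \<cdot> (f \<cdot> Diff Y (?e + 2))) = Zero C (Obj Y (?e + 2)) B" by simp
      then have "f \<cdot> Diff Y (?e + 2) = Zero C (Obj Y (?e + 2)) B" by simp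
      ultimately show ?thesis by simp
    qed (use D0 rD[of i] in auto)
  qed
  have "locally_exact C S ?X"
  proof (rule locally_exactI[OF Xc])
    fix n T x assume x: "x \<in> Hom C T (Obj ?X n)" and z: "Diff ?X n \<cdot> x = Zero C T (Obj ?X (n - 1))"
    have goalI: "\<exists>Q t g. deflation S t \<and> t \<in> Hom C Q T \<and> g \<in> Hom C Q (Obj ?X (n + 1)) \<and>
      Diff ?X (n + 1) \<cdot> g = x \<cdot> t"
      if "deflation S t" "t \<in> Hom C Q T" "g \<in> Hom C Q (Obj ?X (n + 1))"
        "Diff ?X (n + 1) \<cdot> g = x \<cdot> t" for t Q g
      using that by blast
    note [simp] = HomD(1,2,4)[OF x]
    show "\<exists>Q t g. deflation S t \<and> t \<in> Hom C Q T \<and> g \<in> Hom C Q (Obj ?X (n + 1)) \<and>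
      Diff ?X (n + 1) \<cdot> g = x \<cdot> t"
      using cases[of n]
    proof (elim disjE)
      assume n: "n = ?e + 1"
      then have [simp]: "Cod C x = A" using HomD(3)[OF x] by simp
      have "Diff Y (?e + 1) \<cdot> x = Zero C T (Obj Y (?e + 1 - 1))" using z n Y(2) by simp
      then obtain Q t g where "deflation S t" "t \<in> Hom C Q T" "g \<in> Hom C Q (Obj Y (?e + 2))"
        "Diff Y (?e + 2) \<cdot> g = x \<cdot> t"
        by (rule locally_exactE[OF YD(3), of x T "?e + 1" "?e + 2", rotated]) (auto simp: Hom_def)
      then show ?thesis using n by (intro goalI[of t Q g]) auto
    next
      assume n: "n = ?e"
      then have [simp]: "Cod C x = B" using HomD(3)[OF x] by simp
      have "Diff Y ?e \<cdot> (i \<cdot> x) = Zero C T (Obj Y (?e - 1))" using z n by simp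
      then obtain Q t g where t: "deflation S t" "t \<in> Hom C Q T"
        and g: "g \<in> Hom C Q (Obj Y (?e + 1))" "Diff Y (?e + 1) \<cdot> g = (i \<cdot> x) \<cdot> t"
        by (rule locally_exactE[OF YD(3), of "i \<cdot> x" T ?e "?e + 1", rotated]) (auto simp: Hom_def)
      note [simp] = HomD[OF t(2)] HomD[OF g(1)]
      have "p \<cdot> ((i \<cdot> f) \<cdot> g) = p \<cdot> ((i \<cdot> x) \<cdot> t)" using g(2) Y(2) by simp
      then have "f \<cdot> g = x \<cdot> t" by simp
      then show ?thesis using n t g(1) by (intro goalI[of t Q g]) auto
    next
      assume n: "n = ?e - 1"
      then have [simp]: "Cod C x = Obj Y (?e - 1)" using HomD(3)[OF x] by simp
      have z': "i2 \<cdot> (Diff Y (?e - 1) \<cdot> x) \<oplus> j2 \<cdot> (r \<cdot> x) = Zero C T P2" using z n by simp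
      have "p2 \<cdot> (i2 \<cdot> (Diff Y (?e - 1) \<cdot> x) \<oplus> j2 \<cdot> (r \<cdot> x)) = Zero C T (Obj Y (?e - 2))"
        "q2 \<cdot> (i2 \<cdot> (Diff Y (?e - 1) \<cdot> x) \<oplus> j2 \<cdot> (r \<cdot> x)) = Zero C T A'" unfolding z' by auto
      then have Dx: "Diff Y (?e - 1) \<cdot> x = Zero C T (Obj Y (?e - 1 - 1))"
        and rx: "r \<cdot> x = Zero C T A'" by auto
      obtain Q t g where t: "deflation S t" "t \<in> Hom C Q T"
        and g: "g \<in> Hom C Q (Obj Y ?e)" "Diff Y ?e \<cdot> g = x \<cdot> t"
        by (rule locally_exactE[OF YD(3) _ Dx, of ?e]) (auto simp: Hom_def)
      note [simp] = HomD[OF t(2)] HomD[OF g(1)]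
      \<comment> \<open>As \<open>q\<close> is \<open>r\<close> after the differential and
        \<open>r\<close> vanishes on the cycle, the lift \<open>g\<close> lies in the remaining
        summand \<open>B\<close>.\<close>
      have "q \<cdot> g = Zero C Q A'" using rD[of g] g(2) Comp_cong_left[OF rx, of t] by simp
      then have "i \<cdot> (p \<cdot> g) \<oplus> j \<cdot> (q \<cdot> g) = i \<cdot> (p \<cdot> g)" by simp
      then have "i \<cdot> (p \<cdot> g) = g" using biproduct_decomp(1)[OF b, of g] by simp
      then have "Diff Y ?e \<cdot> (i \<cdot> (p \<cdot> g)) = x \<cdot> t" using g(2) by simp
      then show ?thesis using n t by (intro goalI[of t Q "p \<cdot> g"]) (auto simp: Hom_def)
    next
      assume n: "n = ?e - 2"
      then have [simp]: "Cod C x = P2" using HomD(3)[OF x] by simp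
      have "Diff Y (?e - 2) \<cdot> (p2 \<cdot> x) = Zero C T (Obj Y (?e - 2 - 1))" using z n by simp
      then obtain Q t g where t: "deflation S t" "t \<in> Hom C Q T"
        and g: "g \<in> Hom C Q (Obj Y (?e - 1))" "Diff Y (?e - 1) \<cdot> g = (p2 \<cdot> x) \<cdot> t"
        by (rule locally_exactE[OF YD(3), of "p2 \<cdot> x" T "?e - 2" "?e - 1", rotated]) (auto simp: Hom_def)
      note [simp] = HomD[OF t(2)] HomD[OF g(1)]
      \<comment> \<open>\<open>g\<close> already has the right image under the differential of
        \<open>Y\<close>. Adding the boundary of \<open>j \<cdot> ?y\<close> leaves this unchanged
        and corrects the value of \<open>r\<close>, since
        \<open>r \<cdot> (Diff Y ?e \<cdot> j)\<close> is the identity of \<open>A'\<close>.\<close>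
      let ?y = "q2 \<cdot> (x \<cdot> t) \<ominus> r \<cdot> g"
      let ?g = "g \<oplus> Diff Y ?e \<cdot> (j \<cdot> ?y)"
      have y [simp]: "?y \<in> Ar C" "Dom C ?y = Q" "Cod C ?y = A'" by auto
      have "Diff Y (?e - 1) \<cdot> ?g = p2 \<cdot> (x \<cdot> t)" using g(2) by simp
      moreover have "r \<cdot> ?g = q2 \<cdot> (x \<cdot> t)" using rD[of "j \<cdot> ?y"] by (simp add: hom_algebra)
      ultimately have "i2 \<cdot> (Diff Y (?e - 1) \<cdot> ?g) \<oplus> j2 \<cdot> (r \<cdot> ?g) = x \<cdot> t"
        using biproduct_decomp(1)[OF b2, of "x \<cdot> t"] by simp
      moreover have "(i2 \<cdot> Diff Y (?e - 1) \<oplus> j2 \<cdot> r) \<cdot> ?g = i2 \<cdot> (Diff Y (?e - 1) \<cdot> ?g) \<oplus> j2 \<cdot> (r \<cdot> ?g)"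
        by (subst Add_Comp') (auto simp del: Comp_Add' Comp_Minus)
      ultimately have "(i2 \<cdot> Diff Y (?e - 1) \<oplus> j2 \<cdot> r) \<cdot> ?g = x \<cdot> t"
        by (simp del: Comp_Add' Add_Comp' Comp_Minus)
      then show ?thesis using n t by (intro goalI[of t Q ?g]) (auto simp: Hom_def simp del: Comp_Add'
        Add_Comp' Comp_Minus)
    next
      assume n: "n = ?e - 3"
      then have [simp]: "Cod C x = Obj Y (?e - 3)" using HomD(3)[OF x] by simp
      have "Diff Y (?e - 3) \<cdot> x = Zero C T (Obj Y (?e - 3 - 1))" using z n by simp
      then obtain Q t g where t: "deflation S t" "t \<in> Hom C Q T"
        and g: "g \<in> Hom C Q (Obj Y (?e - 2))" "Diff Y (?e - 2) \<cdot> g = x \<cdot> t"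
        by (rule locally_exactE[OF YD(3), of x T "?e - 3" "?e - 2", rotated]) (auto simp: Hom_def)
      note [simp] = HomD[OF t(2)] HomD[OF g(1)]
      show ?thesis using n t g by (intro goalI[of t Q "i2 \<cdot> g"]) (auto simp: Hom_def)
    next
      assume n: "n \<noteq> ?e + 1 \<and> n \<noteq> ?e \<and> n \<noteq> ?e - 1 \<and> n \<noteq> ?e - 2 \<and> n + 1 \<noteq> ?e - 2 \<and> n \<noteq> ?e - 3 \<and>
        n - 1 \<noteq> ?e \<and> n - 1 \<noteq> ?e - 2 \<and> n + 1 \<noteq> ?e \<and>
        n + 1 \<noteq> ?e + 1 \<and> n + 1 \<noteq> ?e - 1"
      then have x': "x \<in> Hom C T (Obj Y n)" "Diff Y n \<cdot> x = Zero C T (Obj Y (n - 1))" using x z by auto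
      obtain Q t g where "deflation S t" "t \<in> Hom C Q T" "g \<in> Hom C Q (Obj Y (n + 1))"
        "Diff Y (n + 1) \<cdot> g = x \<cdot> t"
        by (rule locally_exactE[OF YD(3) x' refl])
      then show ?thesis using n by (intro goalI[of t Q g]) auto
    qed
  qed
  moreover have "finite_complex C 0 (?e + 1) ?X"
    unfolding finite_complex_def using Xc YD(5) d2 by auto
  moreover have "Obj ?X n \<in> M" for n using YD(2) AB P2M by simp
  ultimately have "?X \<in> admissible" unfolding admissible_iff by blast
  then show thesis using that[of ?X] by simp
qed

text \<open>For \<open>d = 1\<close> the Ext conditions are empty, so \<open>M\<close> is all of
  \<open>Ob C\<close>. Right exactness then makes the last morphism a cokernel of the first, and the
  obscure axiom applies. For larger \<open>d\<close> the arrow \<open>\<alpha>\<close> is itself the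
  witness.\<close>

lemma M_inflationI:
  assumes X: "d_exact d (full_sub C M) X" and \<alpha>: "\<alpha> \<in> Ar C" "Dom C \<alpha> = Obj X (int d)"
    "inflation S (\<alpha> \<cdot> Diff X (int d + 1))"
  shows "M_inflation (Diff X (int d + 1))"
proof -
  interpret F: additive_category "full_sub C M" by (rule additive_category_M)
  have r: "right_d_exact d (full_sub C M) X" using X unfolding d_exact_def by simp
  have Xc: "is_complex C X" and XM: "\<And>n. Obj X n \<in> M" and X0: "\<And>n. n < 0 \<Longrightarrow> zero_object C (Obj X n)"
    using F.right_d_exactD[OF r] unfolding is_complex_full_sub[OF M_subset] zero_object_M by auto
  note [simp] = is_complexD[OF Xc] \<alpha>(1,2)
  have "inflation S (Diff X (int d + 1))" if d1: "d = 1"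
  proof -
    have MC: "M = Ob C" using M_eq(1) d1 by auto
    have "is_cokernel C (Diff X 1) (Diff X 2)"
      unfolding is_cokernel_def
    proof (intro conjI ballI impI)
      fix A u assume A: "A \<in> Ob C" and u: "u \<in> Hom C (Cod C (Diff X 2)) A"
        "u \<cdot> Diff X 2 = Zero C (Dom C (Diff X 2)) A"
      have u': "u \<in> Hom (full_sub C M) (Obj X 1) A"
        "u \<cdot>\<^bsub>full_sub C M\<^esub> Diff X (1 + 1) = Zero (full_sub C M) (Obj X (1 + 1)) A"
        using u A XM MC by (auto simp: Hom_full_sub)
      obtain g where g: "g \<in> Hom C (Obj X 0) A" "g \<cdot> Diff X 1 = u"
        by (rule F.right_d_exact_lift[OF r _ _ u']) (use d1 XM A MC that in \<open>auto simp: Hom_full_sub\<close>)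
      show "\<exists>!g. g \<in> Hom C (Cod C (Diff X 1)) A \<and> g \<cdot> Diff X 1 = u"
      proof (intro ex1I[of _ g])
        fix k assume k: "k \<in> Hom C (Cod C (Diff X 1)) A \<and> k \<cdot> Diff X 1 = u"
        note [simp] = HomD[OF g(1)]
        have kT [simp]: "k \<in> Ar C" "Dom C k = Obj X 0" "Cod C k = A" using HomD[OF conjunct1[OF k]]
          by auto
        have v: "k \<ominus> g \<in> Hom (full_sub C M) (Obj X 0) A"
          "(k \<ominus> g) \<cdot>\<^bsub>full_sub C M\<^esub> Diff X (0 + 1) = Zero (full_sub C M) (Obj X (0 + 1)) A"
          using k g(2) A XM MC by (auto simp: Hom_full_sub Hom_def Minus_eq_Zero_iff)
        obtain w where "w \<in> Hom C (Obj X (0 - 1)) A" and w2: "w \<cdot> Diff X 0 = k \<ominus> g"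
          by (rule F.right_d_exact_lift[OF r _ _ v]) (use XM A MC that in \<open>auto simp: Hom_full_sub\<close>)
        note [simp] = HomD[OF this(1)]
        have "Diff X 0 = Zero C (Obj X 0) (Obj X (- 1))"
          using zero_object_eq(1)[OF X0[of "- 1"], of "Diff X 0"] by simp
        then have "k \<ominus> g = Zero C (Obj X 0) A" using w2 A by simp
        then show "k = g" by (simp add: Minus_eq_Zero_iff)
      qed (use g in auto)
    qed auto
    then show ?thesis using obscure_axiom[of "Diff X 2" "Obj X 2" "Obj X 1" \<alpha> "Cod C \<alpha>" "Diff X 1"] \<alpha> d1
      unfolding inflation_def[of S "Diff X (int d + 1)"] by (auto simp: Hom_def)
  qed
  then show ?thesis unfolding M_inflation_def using XM \<alpha> by (auto intro!: bexI[of _ \<alpha>])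
qed

text \<open>In the opposite complex the identity of \<open>Obj X (int d + 1)\<close> is a cycle,
  because the term beyond it is zero. Local exactness there yields an inflation out of this object
  that factors through the first morphism of \<open>X\<close>.\<close>

lemma admissible_M_inflation:
  assumes X: "X \<in> admissible"
  shows "M_inflation (Diff X (int d + 1))"
proof -
  interpret O: cluster "opc C" "S\<inverse>" d M by (rule cluster_opc)
  let ?c = "int d + 1"
  note D = admissibleD[OF X]
  note [simp] = is_complexD[OF D(4)]
  have [simp]: "1 + int d = int d + 1" by simp
  have l: "locally_exact (opc C) (S\<inverse>) (opx ?c X)" using admissible_opx[OF X] O.admissible_iff by blast
  have "Diff X (?c + 1) = Zero C (Obj X (?c + 1)) (Obj X ?c)"
    using zero_object_eq(2)[OF D(5)[of "?c + 1"], of "Diff X (?c + 1)"] by simp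
  then have z: "Diff (opx ?c X) 0 \<cdot>\<^bsub>opc C\<^esub> Id C (Obj X ?c) = Zero (opc C) (Obj X ?c) (Obj (opx ?c X) (0 -
    1))" by simp
  obtain Q q g where "deflation (S\<inverse>) q" "q \<in> Hom (opc C) Q (Obj X ?c)"
    "g \<in> Hom (opc C) Q (Obj (opx ?c X) 1)"
    "Diff (opx ?c X) 1 \<cdot>\<^bsub>opc C\<^esub> g = Id C (Obj X ?c) \<cdot>\<^bsub>opc C\<^esub> q"
    by (rule O.locally_exactE[OF l _ z, of 1]) (auto simp: Hom_def)
  then have g: "inflation S q" "q \<in> Hom C (Obj X ?c) Q" "g \<in> Hom C (Obj X (int d)) Q"
    "g \<cdot> Diff X ?c = q" by (auto simp: Hom_def)
  then show ?thesis using M_inflationI[OF admissible_exact[OF X], of g] HomD[OF g(3)] by auto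
qed

text \<open>Pushing the inflation \<open>\<beta> \<cdot> g\<close> out along \<open>\<alpha>\<close>
  gives an inflation \<open>i'\<close>, and the composite of \<open>\<alpha> \<cdot> f\<close> with
  \<open>i'\<close> factors through \<open>g \<cdot> f\<close>.\<close>

lemma M_inflation_Comp:
  assumes f: "M_inflation f" and g: "M_inflation g" and fg: "Cod C f = Dom C g"
  shows "M_inflation (g \<cdot> f)"
proof -
  obtain \<alpha> \<beta> where \<alpha>: "\<alpha> \<in> Ar C" "Dom C \<alpha> = Cod C f" "inflation S (\<alpha> \<cdot> f)"
    and \<beta>: "\<beta> \<in> Ar C" "Dom C \<beta> = Cod C g" "inflation S (\<beta> \<cdot> g)" using f g unfolding M_inflation_def
      by auto
  have [simp]: "f \<in> Ar C" "g \<in> Ar C" using f g unfolding M_inflation_def by auto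
  note [simp] = \<alpha>(1,2) \<beta>(1,2) fg
  obtain i' f' where po: "is_pushout C (\<beta> \<cdot> g) \<alpha> i' f'" and I: "inflation S i'"
    using inflation_pushout[OF \<beta>(3), of \<alpha>] by auto
  have T [simp]: "i' \<in> Ar C" "f' \<in> Ar C" "Dom C f' = Cod C \<beta>" "Dom C i' = Cod C \<alpha>"
    and e: "f' \<cdot> (\<beta> \<cdot> g) = i' \<cdot> \<alpha>"
    using po unfolding is_pushout_def by auto
  have "(f' \<cdot> \<beta>) \<cdot> (g \<cdot> f) = i' \<cdot> (\<alpha> \<cdot> f)" using Comp_cong_left[OF e, of f] by simp
  then have "inflation S ((f' \<cdot> \<beta>) \<cdot> (g \<cdot> f))" using inflation_Comp[OF \<alpha>(3) I] by simp
  moreover have "d = 1 \<longrightarrow> inflation S (g \<cdot> f)" using inflation_Comp f g fg unfolding M_inflation_def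
    by blast
  ultimately show ?thesis using f g unfolding M_inflation_def by (auto intro!: bexI[of _ "f' \<cdot> \<beta>"])
qed

lemma admissible_mono_iff: "admissible_mono d admissible f \<longleftrightarrow> M_inflation f"
  unfolding admissible_mono_def using admissible_M_inflation M_inflation_resolution by metis

section \<open>Closure under weak isomorphisms\<close>

lemma homotopy_equivalent_M:
  assumes "homotopy_equivalent (full_sub C M) X Y"
  shows "homotopy_equivalent C X Y"
proof -
  have XY: "is_complex C X" "is_complex C Y" "\<And>n. Obj X n \<in> M" "\<And>n. Obj Y n \<in> M"
    using assms unfolding homotopy_equivalent_def is_complex_full_sub[OF M_subset] by auto
  have "chain_homotopic (full_sub C M) W W f g \<Longrightarrow> chain_homotopic C W W f g" if "\<And>n. Obj W n \<in> M" for W f g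
    using that unfolding chain_homotopic_def by (simp add: Hom_full_sub)
  then show ?thesis using assms XY unfolding homotopy_equivalent_def
    by (simp add: chain_map_full_sub) blast
qed

lemma homotopy_equivalent_admissible:
  assumes eq: "homotopy_equivalent C X Y" and Y: "Y \<in> admissible"
    and X: "finite_complex (full_sub C M) 0 (int d + 1) X"
  shows "X \<in> admissible"
proof -
  have "locally_exact C S X"
    using eq locally_exact_homotopy[OF admissibleD(3)[OF Y]] unfolding homotopy_equivalent_def by blast
  then show ?thesis using X unfolding admissible_iff finite_complex_M by blast
qed

lemma homotopy_equivalent_sym: "homotopy_equivalent C X Y \<Longrightarrow> homotopy_equivalent C Y X"
  unfolding homotopy_equivalent_def by blast

text \<open>A d-exact sequence is determined up to homotopy equivalence by its first morphism: the
  identities in degrees \<open>d + 1\<close> and \<open>d\<close> extend to a chain map from an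
  admissible resolution of that morphism.\<close>

lemma admissible_of_M_inflation:
  assumes X: "d_exact d (full_sub C M) X" and f: "M_inflation (Diff X (int d + 1))"
  shows "X \<in> admissible"
proof -
  interpret F: additive_category "full_sub C M" by (rule additive_category_M)
  obtain Z where Z: "Z \<in> admissible" "Diff Z (int d + 1) = Diff X (int d + 1)"
    using M_inflation_resolution[OF f] .
  note Zd = admissible_exact[OF Z(1)]
  have Xc: "finite_complex (full_sub C M) 0 (int d + 1) X" and Xr: "left_d_exact d (full_sub C M) X"
    using X unfolding d_exact_def left_d_exact_def by auto
  have Zr: "right_d_exact d (full_sub C M) Z" using Zd unfolding d_exact_def by auto
  have XD: "is_complex C X" "\<And>n. Obj X n \<in> M" using Xc
    unfolding finite_complex_def is_complex_full_sub[OF M_subset] by auto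
  note ZD = admissibleD[OF Z(1)]
  have o: "Obj Z (int d + 1) = Obj X (int d + 1)" "Obj Z (int d) = Obj X (int d)"
    using is_complexD(3,4)[OF XD(1), of "int d + 1"] is_complexD(3,4)[OF ZD(4), of "int d + 1"] Z(2)
      by auto
  have Ob: "Obj X n \<in> Ob C" for n using is_complexD(1)[OF XD(1)] .
  obtain h where h: "chain_map (full_sub C M) Z X h" "h (int d) = Id C (Obj X (int d))"
    "h (int d + 1) = Id C (Obj X (int d + 1))"
    by (rule F.extend_chain_map[OF Zr Xr, of "int d" "Id C (Obj X (int d))" "Id C (Obj X (int d + 1))"])
      (use o Z(2) XD Ob is_complexD(1-4)[OF XD(1), of "int d + 1"] that in \<open>auto simp: Hom_full_sub
        Hom_def\<close>)
  have "homotopy_equivalent (full_sub C M) Z X"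
    by (rule F.d_exact_homotopy_equivalent[OF Zd X h(1), of "int d"]) (use h XD Ob in \<open>auto simp:
      is_iso_M\<close>)
  then show ?thesis
    using homotopy_equivalent_admissible[OF homotopy_equivalent_sym[OF homotopy_equivalent_M] Z(1) Xc]
      by blast
qed

text \<open>A witness \<open>\<alpha>\<close> for the first morphism of \<open>Y\<close>, composed
  with \<open>h (int d)\<close>, is a witness for that of \<open>X\<close>, because
  \<open>h (int d + 1)\<close> is invertible.\<close>

lemma admissible_of_end_isos:
  assumes X: "d_exact d (full_sub C M) X" and Y: "Y \<in> admissible" and h: "chain_map (full_sub C M) X Y h"
    and iso: "is_iso (full_sub C M) (h (int d + 1))"
  shows "X \<in> admissible"
proof -
  note YD = admissibleD[OF Y]
  have XD: "is_complex C X" "\<And>n. Obj X n \<in> M"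
    using X unfolding d_exact_def left_d_exact_def finite_complex_def is_complex_full_sub[OF M_subset]
      by auto
  have h: "chain_map C X Y h" using h chain_map_full_sub[of X M Y C h] XD(2) YD(2) by simp
  have iso: "is_iso C (h (int d + 1))" using iso is_iso_M by simp
  note [simp] = is_complexD(1-4)[OF XD(1)] is_complexD(1-4)[OF YD(4)] chain_mapD(1-3)[OF h]
  obtain \<alpha> where \<alpha>: "\<alpha> \<in> Ar C" "Dom C \<alpha> = Obj Y (int d)" "inflation S (\<alpha> \<cdot> Diff Y (int d + 1))"
    using admissible_M_inflation[OF Y] unfolding M_inflation_def by auto
  note [simp] = \<alpha>(1,2)
  obtain Z0 where Z0: "zero_object C Z0" using ex_zero_object by auto
  have "inflation S (h (int d + 1))" using iso_conflation(2)[OF iso Z0] unfolding inflation_def by blast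
  from inflation_Comp[OF this \<alpha>(3)] have "inflation S ((\<alpha> \<cdot> h (int d)) \<cdot> Diff X (int d + 1))"
    using chain_mapD(4)[OF h, of "int d + 1"] by simp
  then have "M_inflation (Diff X (int d + 1))" by (intro M_inflationI[OF X, of "\<alpha> \<cdot> h (int d)"]) auto
  then show ?thesis by (rule admissible_of_M_inflation[OF X])
qed

lemma weak_isomorphism_admissible:
  assumes w: "weak_isomorphism d (full_sub C M) X Y h"
  shows "X \<in> admissible \<longleftrightarrow> Y \<in> admissible"
proof -
  interpret F: additive_category "full_sub C M" by (rule additive_category_M)
  interpret O: cluster "opc C" "S\<inverse>" d M by (rule cluster_opc)
  let ?c = "int d + 1"
  have X: "d_exact d (full_sub C M) X" and Y: "d_exact d (full_sub C M) Y"
    and h: "chain_map (full_sub C M) X Y h"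
    using w unfolding weak_isomorphism_def by auto
  have fin: "finite_complex (full_sub C M) 0 ?c X" "finite_complex (full_sub C M) 0 ?c Y"
    using X Y unfolding d_exact_def left_d_exact_def by auto
  from w consider n where "0 \<le> n" "n \<le> int d" "is_iso (full_sub C M) (h n)"
    "is_iso (full_sub C M) (h (n + 1))"
    | "is_iso (full_sub C M) (h ?c)" "is_iso (full_sub C M) (h 0)" unfolding weak_isomorphism_def by blast
  then show ?thesis
  proof cases
    case 1
    have "homotopy_equivalent C X Y" by (rule homotopy_equivalent_M[OF F.d_exact_homotopy_equivalent[OF X
      Y h 1]])
    then show ?thesis using homotopy_equivalent_admissible fin homotopy_equivalent_sym by blast
  next
    case 2
    have "X \<in> admissible" if "Y \<in> admissible" by (rule admissible_of_end_isos[OF X that h 2(1)])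
    moreover have "Y \<in> admissible" if XA: "X \<in> admissible"
    proof -
      \<comment> \<open>The isomorphism in degree 0 becomes one in degree \<open>d + 1\<close> of
        the opposite complexes, and the chain map changes direction, so the same argument transfers
        admissibility to \<open>Y\<close>.\<close>
      have "d_exact d (full_sub (opc C) M) (opx ?c Y)" using d_exact_opx[OF Y] by (simp add: full_sub_opc)
      moreover have "chain_map (full_sub (opc C) M) (opx ?c Y) (opx ?c X) (\<lambda>n. h (?c - n))"
        using chain_map_opx[OF h, of ?c] by (simp add: full_sub_opc)
      moreover have "is_iso (full_sub (opc C) M) (h (?c - ?c))" using 2 by (simp add: full_sub_opc)
      ultimately have "opx ?c Y \<in> O.admissible" using O.admissible_of_end_isos admissible_opx[OF XA]
        by blast
      then show ?thesis using O.admissible_opx[of "opx ?c Y"] by simp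
    qed
    ultimately show ?thesis by blast
  qed
qed

end

section \<open>The \<open>d\<close>-exact structure\<close>

lemma (in additive_category) truncation_segment:
  assumes X: "is_complex C X"
  shows "truncation C X a 0 n (segment C X a n)"
proof -
  define Z where "Z = (SOME Z. zero_object C Z)"
  have Z: "zero_object C Z" unfolding Z_def using ex_zero_object by (rule someI_ex)
  note [simp] = is_complexD[OF X]
  let ?O = "\<lambda>k. if 0 \<le> k \<and> k \<le> n then Obj X (a + k) else Z"
  have seg: "segment C X a n = \<lparr>Obj = ?O, Diff = \<lambda>k. if 0 < k \<and>
    k \<le> n then Diff X (a + k) else Zero C (?O k) (?O (k - 1))\<rparr>"
    unfolding segment_def Let_def Z_def ..
  have [simp]: "a + k - 1 = a + (k - 1)" "a + (k + 1) = (a + k) + 1" for k by auto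
  have "is_complex C (segment C X a n)"
    unfolding seg
  proof (rule is_complexI)
    fix k
    let ?S = "\<lparr>Obj = ?O, Diff = \<lambda>k. if 0 < k \<and> k \<le> n then Diff X (a + k) else Zero C (?O k) (?O (k - 1))\<rparr>"
    show "Obj ?S k \<in> Ob C" using Z by simp
    show "Diff ?S k \<in> Hom C (Obj ?S k) (Obj ?S (k - 1))" using Z by (auto simp: Hom_def)
    show "Diff ?S k \<cdot> Diff ?S (k + 1) = Zero C (Obj ?S (k + 1)) (Obj ?S (k - 1))"
      using Z by (auto simp: Hom_def)
  qed
  then show ?thesis unfolding truncation_def using Z by (auto simp: seg add.commute)
qed

context cluster
begin

text \<open>\<open>X\<close> is first made acyclic without touching degree 0, then pushed out in the
  top degree, and finally the degrees 1 to \<open>d\<close> are replaced by objects of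
  \<open>M\<close>. Every stage is the identity in degree 0.\<close>

lemma admissible_pushforward:
  assumes X: "X \<in> admissible" and f: "f \<in> Hom C (Obj X (int d + 1)) N" and N: "N \<in> M"
  obtains Z h where "Z \<in> admissible" "chain_map C X Z h" "h (int d + 1) = f" "is_iso C (h 0)"
    "Obj Z (int d + 1) = N"
proof -
  let ?c = "int d + 1"
  note XD = admissibleD[OF X]
  note Xc = XD(4)
  have lt: "(0::int) < ?c" by simp
  obtain Y F G where Y: "acyclic_complex C S Y" "finite_complex C 0 ?c Y" "deformation_retract C X Y F G"
    "Obj Y 0 = Obj X 0" "F 0 = Id C (Obj X 0)" "\<And>n. Obj X n \<in> M \<Longrightarrow> Obj Y n \<in> M"
    by (rule locally_exact_acyclic[OF XD(3,1) lt M_sub M_gen]) (rule that)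
  have Yc: "is_complex C Y" and F: "chain_map C X Y F" and G: "chain_map C Y X G"
    and GF: "G ?c \<cdot> F ?c = Id C (Obj X ?c)" using Y(3) unfolding deformation_retract_def by auto
  have YM: "Obj Y n \<in> M" and Y0: "n < 0 \<or> ?c < n \<Longrightarrow> zero_object C (Obj Y n)" for n
    using Y(2,6) XD(2) unfolding finite_complex_def by auto
  note [simp] = is_complexD(1-4)[OF Xc] is_complexD(1-4)[OF Yc] chain_mapD(1-3)[OF F] chain_mapD(1-3)[OF
    G] HomD[OF f]
  obtain Z i p where a: "acyclic_data C S Y Z i p UNIV" using Y(1) acyclic_complex_iff by auto
  let ?g = "f \<cdot> G ?c"
  have g: "?g \<in> Hom C (Obj Y ?c) N" by (simp add: Hom_def)
  \<comment> \<open>There are no cycles in the top degree, so \<open>acyclic_pushout_step\<close>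
    accepts any arrow out of \<open>Obj Y ?c\<close>.\<close>
  have z: "zero_object C (Z ?c)" by (rule acyclic_top_zero[OF a]) (use Y0 in simp)
  have iT: "i ?c \<in> Ar C" "Dom C (i ?c) = Z ?c" "Cod C (i ?c) = Obj Y ?c"
    using acyclic_dataD(3-5)[OF a UNIV_I] by auto
  have "?g \<cdot> i ?c = Zero C (Z ?c) N" using zero_object_eq(2)[OF z, of "?g \<cdot> i ?c"] iT by simp
  then have infl: "inflation S (?g \<cdot> i ?c)"
    using iso_conflation(1)[OF is_iso_Id[OF M_Ob[OF N]] z] M_Ob[OF N] unfolding inflation_def by auto
  have c1: "?c - 1 = int d" by simp
  obtain Y1 h1 where Y1: "acyclic_complex C S Y1" "chain_map C Y Y1 h1" "Obj Y1 ?c = N" "h1 ?c = ?g"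
    "\<And>n. n \<noteq> ?c \<Longrightarrow> n \<noteq> int d \<Longrightarrow> Obj Y1 n = Obj Y n \<and> h1 n = Id C (Obj Y n)"
    by (rule acyclic_pushout_step[OF a g infl, unfolded c1]) (rule that)
  have Y1c: "is_complex C Y1" using Y1(1) unfolding acyclic_complex_def by simp
  \<comment> \<open>The pushout can leave \<open>M\<close> only in degree \<open>d\<close>, which is
    the top of the \<open>d\<close> degrees 1 to \<open>d\<close> replaced next and may be
    arbitrary.\<close>
  have Y1M: "Obj Y1 k \<in> M" if "1 \<le> k" "k < 1 + int d - 1" for k using Y1(5)[of k] YM that by simp
  obtain W h2 where W: "acyclic_complex C S W" "chain_map C Y1 W h2"
    "\<And>n. \<not> (1 \<le> n \<and> n < 1 + int d) \<Longrightarrow> Obj W n = Obj Y1 n \<and> h2 n = Id C (Obj Y1 n)"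
    "\<And>n. 1 \<le> n \<Longrightarrow> n < 1 + int d \<Longrightarrow> Obj W n \<in> M"
    by (rule approximate_complex_M[OF Y1(1) Y1M]) (use that in auto)
  have Wc: "is_complex C W" using W(1) unfolding acyclic_complex_def by simp
  have same: "Obj W n = Obj Y n" "h2 n = Id C (Obj Y n)" "h1 n = Id C (Obj Y n)" if "n \<le> 0 \<or> ?c < n" for n
    using W(3)[of n] Y1(5)[of n] that d_pos by auto
  have W1: "Obj W ?c = N" "h2 ?c = Id C N" using W(3)[of ?c] Y1(3) by auto
  have "Obj W n \<in> M" for n
    using W(4)[of n] same(1)[of n] YM[of n] W1 N by (cases "n = ?c"; cases "1 \<le> n \<and> n < 1 + int d") auto
  moreover have "finite_complex C 0 ?c W" unfolding finite_complex_def using Wc same(1) Y0 by auto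
  ultimately have WA: "W \<in> admissible" using acyclic_locally_exact[OF W(1)] unfolding admissible_iff
    by blast
  let ?h = "\<lambda>n. h2 n \<cdot> (h1 n \<cdot> F n)"
  have cm: "chain_map C X W ?h"
    by (rule chain_map_compose[OF Xc Y1c Wc chain_map_compose[OF Xc Yc Y1c F Y1(2)] W(2)])
  have "?g \<cdot> F ?c = f" using GF by simp
  then have "?h ?c = f" using W1(2) Y1(4) by simp
  moreover have "is_iso C (?h 0)" using same[of 0] Y(4,5) is_iso_Id[of "Obj X 0"] by simp
  ultimately show thesis using that[OF WA cm] W1(1) by simp
qed

text \<open>The segment cuts off one degree of the sequences, 0 for \<open>a = 1\<close> and
  \<open>d + 1\<close> for \<open>a = 0\<close>, where \<open>h\<close> is assumed invertible. The
  cone of the truncated map has terms of \<open>M\<close> in degrees 0 to \<open>d + 1\<close>, so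
  it is admissible itself and hence d-exact.\<close>

lemma truncated_cone_admissible:
  assumes X: "X \<in> admissible" and Y: "Y \<in> admissible" and h: "chain_map C X Y h"
    and iso: "\<And>k. \<not> (0 \<le> k \<and> k \<le> int d) \<Longrightarrow> is_iso C (h (k + a))"
  obtains h' K where "finite_complex (full_sub C M) 0 (int d) (segment (full_sub C M) X a (int d))"
    "finite_complex (full_sub C M) 0 (int d) (segment (full_sub C M) Y a (int d))"
    "chain_map (full_sub C M) (segment (full_sub C M) X a (int d)) (segment (full_sub C M) Y a (int d))
      h'"
    "\<And>k. 0 \<le> k \<Longrightarrow> k \<le> int d \<Longrightarrow> h' k = h (k + a)"
    "mapping_cone (full_sub C M) (segment (full_sub C M) X a (int d)) (segment (full_sub C M) Y a (int
      d)) h' K"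
    "d_exact d (full_sub C M) K"
proof -
  interpret F: additive_category "full_sub C M" by (rule additive_category_M)
  let ?F = "full_sub C M"
  have tr: "truncation C W a 0 (int d) (segment ?F W a (int d))" "\<And>n. Obj (segment ?F W a (int d)) n \<in> M"
    "finite_complex ?F 0 (int d) (segment ?F W a (int d))" if W: "W \<in> admissible" for W
  proof -
    have "is_complex ?F W" unfolding is_complex_full_sub[OF M_subset] using admissibleD[OF W] by blast
    then have t: "truncation ?F W a 0 (int d) (segment ?F W a (int d))" by (rule F.truncation_segment)
    note T = F.truncationD(1)[OF t]
    show "truncation C W a 0 (int d) (segment ?F W a (int d))"
      using t unfolding truncation_def is_complex_full_sub[OF M_subset] zero_object_M by blast
    show "Obj (segment ?F W a (int d)) n \<in> M" for n using T unfolding is_complex_full_sub[OF M_subset]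
      by blast
    show "finite_complex ?F 0 (int d) (segment ?F W a (int d))"
      unfolding finite_complex_def using T F.truncationD(3)[OF t] by auto
  qed
  let ?X = "segment ?F X a (int d)" and ?Y = "segment ?F Y a (int d)"
  note XD = admissibleD[OF X] and YD = admissibleD[OF Y]
  note tX = tr[OF X] and tY = tr[OF Y]
  have Xc: "is_complex C ?X" and Yc: "is_complex C ?Y" using truncationD(1) tX(1) tY(1) by auto
  obtain h' where h': "chain_map C ?X ?Y h'" "\<And>k. 0 \<le> k \<Longrightarrow> k \<le> int d \<Longrightarrow> h' k = h (k + a)"
    by (rule ex_truncation_chain_map[OF XD(4) YD(4) h tX(1) tY(1)]) (rule that)
  obtain K where K: "mapping_cone C ?X ?Y h' K" using ex_mapping_cone[OF Xc Yc h'(1)] .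
  have Kc: "is_complex C K" using K unfolding mapping_cone_def by simp
  have lK: "locally_exact C S K"
    by (rule truncated_cone_locally_exact[OF XD(3) YD(3) h iso tX(1) tY(1) h' K])
  obtain ii j p q where b: "\<And>n. biproduct C (Obj ?X (n - 1)) (Obj ?Y n) (Obj K n) (ii n) (j n) (p n) (q
    n)"
    using mapping_cone_sum[OF K] by metis
  have KM: "Obj K n \<in> M" for n by (rule M_biproduct[OF tX(2) tY(2) b])
  have "zero_object C (Obj K n)" if "n < 0 \<or> int d + 1 < n" for n
    by (rule biproduct_zero_object[OF b[of n]]) (use that truncationD(3)[OF tX(1), of "n - 1"]
      truncationD(3)[OF tY(1), of n] in auto)
  then have "finite_complex C 0 (int d + 1) K" unfolding finite_complex_def using Kc by blast
  then have "K \<in> admissible" using KM lK unfolding admissible_iff by blast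
  then have "d_exact d ?F K" by (rule admissible_exact)
  moreover have "mapping_cone ?F ?X ?Y h' K" using mapping_cone_M[OF tX(2) tY(2) Xc] K KM by blast
  moreover have "chain_map ?F ?X ?Y h'" using chain_map_full_sub[of ?X M ?Y C h'] tX(2) tY(2) h'(1)
    by blast
  ultimately show thesis using that tX(3) tY(3) h'(2) by blast
qed

lemma admissible_zero_iso:
  assumes X: "X \<in> admissible" and Y: "Y \<in> admissible" and h: "chain_map C X Y h"
    and k: "k < 0 \<or> int d + 1 < k"
  shows "is_iso C (h k)"
  using zero_object_iso[OF admissibleD(5)[OF X k] admissibleD(5)[OF Y k], of "h k"] h
    unfolding chain_map_def by blast

text \<open>The chain map obtained by pushing forward is invertible in degree 0. Dropping this
  degree from the cone turns a map of sequences with \<open>d + 2\<close> terms into a d-pushout of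
  their upper parts.\<close>

lemma admissible_pushout:
  assumes Y: "Y \<in> admissible" and f: "f \<in> Ar (full_sub C M)" "Dom (full_sub C M) f = Obj Y (int d + 1)"
  shows "\<exists>Z h. d_pushout d (full_sub C M) (segment (full_sub C M) Y 1 (int d)) f Z h \<and>
    admissible_mono d admissible (Diff Z (int d))"
proof -
  have fH: "f \<in> Hom C (Obj Y (int d + 1)) (Cod C f)" and N: "Cod C f \<in> M" using f by (auto simp: Hom_def)
  obtain Z h where Z: "Z \<in> admissible" "chain_map C Y Z h" "h (int d + 1) = f" "is_iso C (h 0)"
    using admissible_pushforward[OF Y fH N] by metis
  have iso: "is_iso C (h (k + 1))" if "\<not> (0 \<le> k \<and> k \<le> int d)" for k
    using admissible_zero_iso[OF Y Z(1,2), of "k + 1"] Z(4) that by (cases "k = - 1") auto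
  let ?Y = "segment (full_sub C M) Y 1 (int d)" and ?Z = "segment (full_sub C M) Z 1 (int d)"
  obtain h' K where K: "finite_complex (full_sub C M) 0 (int d) ?Y"
    "finite_complex (full_sub C M) 0 (int d) ?Z"
    "chain_map (full_sub C M) ?Y ?Z h'" "\<And>k. 0 \<le> k \<Longrightarrow> k \<le> int d \<Longrightarrow> h' k = h (k + 1)"
    "mapping_cone (full_sub C M) ?Y ?Z h' K" "d_exact d (full_sub C M) K"
    by (rule truncated_cone_admissible[OF Y Z(1,2) iso], assumption) (rule that)
  have "d_pushout d (full_sub C M) ?Y f ?Z h'"
    unfolding d_pushout_def using K(1-3,5,6) K(4)[of "int d"] Z(3) unfolding d_exact_def by auto
  \<comment> \<open>As \<open>1 \<le> d\<close>, the segment contains the differential out of its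
    top term, which in the shifted numbering is the first morphism of \<open>Z\<close>.\<close>
  moreover have "Diff ?Z (int d) = Diff Z (int d + 1)" using d_pos
    by (simp add: segment_def Let_def add.commute)
  then have "admissible_mono d admissible (Diff ?Z (int d))" unfolding admissible_mono_def using Z(1)
    by metis
  ultimately show ?thesis by blast
qed

text \<open>The pushforward along \<open>g\<close> in the opposite category, read backwards, is a
  chain map \<open>k\<close> with \<open>k 0 = g\<close> that is invertible in degree
  \<open>d + 1\<close>, the degree dropped here.\<close>

lemma admissible_pullback:
  assumes Y: "Y \<in> admissible" and g: "g \<in> Ar (full_sub C M)" "Cod (full_sub C M) g = Obj Y 0"
  shows "\<exists>X h. d_pullback d (full_sub C M) (segment (full_sub C M) Y 0 (int d)) g X h \<and>
    admissible_epi admissible (Diff X 1)"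
proof -
  interpret O: cluster "opc C" "S\<inverse>" d M by (rule cluster_opc)
  let ?c = "int d + 1"
  have gH: "g \<in> Hom (opc C) (Obj (opx ?c Y) ?c) (Dom C g)" and N: "Dom C g \<in> M" using g
    by (auto simp: Hom_def)
  obtain Z h where Z: "Z \<in> O.admissible" "chain_map (opc C) (opx ?c Y) Z h" "h ?c = g"
    "is_iso (opc C) (h 0)"
    using O.admissible_pushforward[OF admissible_opx[OF Y] gH N] by metis
  define X where "X = opx ?c Z"
  define k where "k n = h (?c - n)" for n
  have X: "X \<in> admissible" using O.admissible_opx[OF Z(1)] unfolding X_def by simp
  have k: "chain_map C X Y k" using chain_map_opx[OF Z(2), of ?c] unfolding X_def k_def by simp
  have k0: "k 0 = g" "is_iso C (k ?c)" using Z(3,4) unfolding k_def by auto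
  have iso: "is_iso C (k (n + 0))" if "\<not> (0 \<le> n \<and> n \<le> int d)" for n
    using admissible_zero_iso[OF X Y k, of n] k0(2) that by (cases "n = ?c") auto
  let ?Y = "segment (full_sub C M) Y 0 (int d)" and ?X = "segment (full_sub C M) X 0 (int d)"
  obtain h' K where K: "finite_complex (full_sub C M) 0 (int d) ?X"
    "finite_complex (full_sub C M) 0 (int d) ?Y"
    "chain_map (full_sub C M) ?X ?Y h'" "\<And>n. 0 \<le> n \<Longrightarrow> n \<le> int d \<Longrightarrow> h' n = k (n + 0)"
    "mapping_cone (full_sub C M) ?X ?Y h' K" "d_exact d (full_sub C M) K"
    by (rule truncated_cone_admissible[OF X Y k iso], assumption) (rule that)
  have "d_pullback d (full_sub C M) ?Y g ?X h'"
    unfolding d_pullback_def using K(1-3,5,6) K(4)[of 0] k0(1) unfolding d_exact_def by auto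
  moreover have "Diff ?X 1 = Diff X 1" using d_pos by (simp add: segment_def Let_def)
  then have "admissible_epi admissible (Diff ?X 1)" unfolding admissible_epi_def using X by metis
  ultimately show ?thesis by blast
qed

lemma admissible_epi_iff: "admissible_epi admissible f \<longleftrightarrow> admissible_mono d (cluster.admissible (opc C)
  (S\<inverse>) d M) f"
proof -
  interpret O: cluster "opc C" "S\<inverse>" d M by (rule cluster_opc)
  have e: "int d + 1 + 1 - (int d + 1) = 1" "int d + 1 + 1 - 1 = int d + 1" by auto
  show ?thesis
  proof
    assume "admissible_epi admissible f"
    then obtain X where "X \<in> admissible" "f = Diff X 1" unfolding admissible_epi_def by auto
    then show "admissible_mono d O.admissible f" unfolding admissible_mono_def
      by (intro bexI[of _ "opx (int d + 1) X"] admissible_opx) (simp_all only: opx_sel e)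
  next
    assume "admissible_mono d O.admissible f"
    then obtain X where X: "X \<in> O.admissible" "f = Diff X (int d + 1)" unfolding admissible_mono_def
      by auto
    have "opx (int d + 1) X \<in> admissible" using O.admissible_opx[OF X(1)] by simp
    then show "admissible_epi admissible f" unfolding admissible_epi_def
      by (rule bexI[rotated]) (simp only: opx_sel e X(2))
  qed
qed

lemma zero_complex_admissible:
  assumes X: "is_complex (full_sub C M) X" and zero: "\<And>n. zero_object (full_sub C M) (Obj X n)"
  shows "X \<in> admissible"
proof -
  have Xc: "is_complex C X" and XM: "\<And>n. Obj X n \<in> M" using X
    unfolding is_complex_full_sub[OF M_subset] by auto
  have z: "zero_object C (Obj X n)" for n using zero zero_object_M by blast
  note [simp] = is_complexD(1-4)[OF Xc]
  have "locally_exact C S X"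
  proof (rule locally_exactI[OF Xc])
    fix n A f assume f: "f \<in> Hom C A (Obj X n)"
    note [simp] = HomD[OF f]
    have "Diff X (n + 1) \<cdot> Zero C A (Obj X (n + 1)) = f \<cdot> Id C A"
      by (rule zero_object_parallel(1)[OF z[of n], of _ A]) (auto simp: Hom_def)
    then show "\<exists>Q q g. deflation S q \<and> q \<in> Hom C Q A \<and> g \<in> Hom C Q (Obj X (n + 1)) \<and>
      Diff X (n + 1) \<cdot> g = f \<cdot> q"
      using deflation_Id[of A] Id_Hom[of A] Zero_Hom[of A "Obj X (n + 1)"]
        by (metis HomD(4)[OF f] is_complexD(1)[OF Xc])
  qed
  then show ?thesis unfolding admissible_iff finite_complex_def using Xc XM z by blast
qed

lemma admissible_d_exact_category: "d_exact_category d (full_sub C M) admissible"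
proof -
  interpret O: cluster "opc C" "S\<inverse>" d M by (rule cluster_opc)
  show ?thesis
  proof (intro d_exact_category.intro d_exact_category_axioms.intro additive_category_M)
    show "admissible_mono d admissible (g \<cdot>\<^bsub>full_sub C M\<^esub> f)"
      if "admissible_mono d admissible f" "admissible_mono d admissible g"
        "Cod (full_sub C M) f = Dom (full_sub C M) g" for f g
      using that M_inflation_Comp unfolding admissible_mono_iff by simp
    show "admissible_epi admissible (g \<cdot>\<^bsub>full_sub C M\<^esub> f)"
      if "admissible_epi admissible f" "admissible_epi admissible g"
        "Cod (full_sub C M) f = Dom (full_sub C M) g" for f g
      using that O.M_inflation_Comp[of g f] unfolding admissible_epi_iff O.admissible_mono_iff by simp
  qed (fact admissible_exact weak_isomorphism_admissible zero_complex_admissible admissible_pushout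
    admissible_pullback)+
qed

end

theorem theorem8p1:
  fixes E :: "('o, 'm) precat" and S :: "('m \<times> 'm) set" and M :: "'o set" and d :: nat
  assumes "1 \<le> d"
    and "exact_category E S"
    and "cluster_tilting d E S M"
  shows "d_exact_category d (full_sub E M)
    {X. finite_complex (full_sub E M) 0 (int d + 1) X \<and>
        (\<exists>Y. acyclic_complex E S Y \<and> homotopy_equivalent E X Y)}"
proof -
  interpret cluster E S d M
    using assms by (intro cluster.intro cluster_axioms.intro)
  show ?thesis using admissible_d_exact_category unfolding admissible_def .
qed

end
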